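(* Let $G$ be a Lie group, $\mathfrak{g}$ its Lie algebra, $M$ a homogeneous $G$-space (a smooth manifold with a smooth transitive action of $G$) and $\omega$ a symplectic form on $M$. Then the following two properties are mutually exclusive (they cannot both hold): (i) there exists a $G$-equivariant smooth complex line bundle $L\to M$ with non-trivial Chern class, i.e. $c_1(L)\neq 0$ in the de Rham cohomology of $M$; (ii) there exists a deformation quantization of $(M,\omega)$ induced by a twist based on $U(\mathfrak{g})[[h]]$.
   Context: Conventions. Algebras are unital and associative, over $\mathbb{C}$ or over $\mathbb{C}[[h]]$. $C^\infty(M)$ denotes the complex-valued smooth functions on $M$. For a complex vector space $V$, $V[[h]]$ is the $\mathbb{C}[[h]]$-module of formal power series in $h$ with coefficients in $V$. $U(\mathfrak{g})$ is the universal enveloping algebra of $\mathfrak{g}$ with complex coefficients (i.e. of $\mathfrak{g}\otimes_{\mathbb{R}}\mathbb{C}$), with its standard coproduct $\Delta$ and counit $\varepsilon$ extended $\mathbb{C}[[h]]$-linearly to $U(\mathfrak{g})[[h]]$; tensor products over $\mathbb{C}[[h]]$ are completed in the $h$-adic topology, so that $U(\mathfrak{g})[[h]]\,\hat\otimes\, U(\mathfrak{g})[[h]]=(U(\mathfrak{g})\otimes U(\mathfrak{g}))[[h]]$. Equivariant line bundle. A complex line bundle $\pi:L\to M$ is $G$-equivariant if $L$ and $M$ are $G$-spaces (with smooth actions, that on $M$ being the given one), the action of $G$ commutes with $\pi$, and $G$ acts linearly on fibers. Star product. A star product on a Poisson manifold $M$ is a $\mathbb{C}[[h]]$-bilinear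 associative binary operation $\ast$ on $C^\infty(M)[[h]]$ of the form $f\ast g=\sum_{k=0}^\infty h^kB_k(f,g)$ for $f,g\in C^\infty(M)$, where each $B_k$ is a bi-differential operator, $B_0(f,g)=fg$, $B_1(f,g)-B_1(g,f)=\mathrm{i}\{f,g\}$ is ($\mathrm{i}$ times) the Poisson bracket, and $f\ast 1=1\ast f=f$. The algebra $(C^\infty(M)[[h]],\ast)$ is called a deformation quantization of $M$. For a symplectic manifold $(M,\omega)$ the Poisson bracket is the one determined by $\omega$. Twist. A (formal cocycle) twist based on $U(\mathfrak{g})[[h]]$ is an invertible element $F\in (U(\mathfrak{g})\otimes U(\mathfrak{g}))[[h]]$ such that $(F\otimes 1)(\Delta\otimes\mathrm{Id})(F)=(1\otimes F)(\mathrm{Id}\otimes\Delta)(F)$, $(\varepsilon\otimes\mathrm{Id})(F)=(\mathrm{Id}\otimes\varepsilon)(F)=1$, and $F=1\otimes 1 \bmod h$. Deformation quantization induced by a twist. $G$ acts on $C^\infty(M)$ by $(\alpha_gf)(x)=f(g^{-1}x)$; differentiating gives an action $\triangleright$ of $U(\mathfrak{g})[[h]]$ on $C^\infty(M)[[h]]$. The deformation quantization of $(M,\omega)$ given by a star product $\ast$ is induced by the twist $F$ if $f\ast g=m\big(F^{-1}(\triangleright\otimes\triangleright)(f\otimes g)\big)$ for all $f,g\in C^\infty(M)[[h]]$, where $m$ is the pointwise multiplication of $C^\infty(M)[[h]]$. *)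

theory Defs
  imports
    "HOL-Analysis.Analysis"
    "HOL-Algebra.Group_Action"
    "HOL-Library.Function_Algebras"
    "HOL-Library.Poly_Mapping"
    "HOL-Computational_Algebra.Formal_Power_Series"
begin

section \<open>Smooth manifolds\<close>

fun Ck_on :: "nat \<Rightarrow> 'a::real_normed_vector set \<Rightarrow> ('a \<Rightarrow> 'b::real_normed_vector) \<Rightarrow> bool" where
  "Ck_on 0 S f \<longleftrightarrow> continuous_on S f"
| "Ck_on (Suc k) S f \<longleftrightarrow> (\<forall>x\<in>S. f differentiable (at x)) \<and>
     (\<forall>v. Ck_on k S (\<lambda>x. frechet_derivative f (at x) v))"

text \<open>Only used for open \<open>S\<close> in a finite-dimensional space.\<close>
definition smooth_on :: "'a::real_normed_vector set \<Rightarrow> ('a \<Rightarrow> 'b::real_normed_vector) \<Rightarrow> bool" where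
  "smooth_on S f \<longleftrightarrow> (\<forall>k. Ck_on k S f)"

type_synonym ('m, 'e) atlas = "('m set \<times> ('m \<Rightarrow> 'e)) set"

text \<open>The model space is a finite-dimensional inner product space; unlike the class
  \<open>euclidean_space\<close> this includes dimension zero. The underlying set is the whole type.\<close>
definition smooth_manifold ::
  "('m::{t2_space,second_countable_topology}, 'e::real_inner) atlas \<Rightarrow> bool" where
  "smooth_manifold A \<longleftrightarrow>
     (\<exists>B::'e set. finite B \<and> span B = UNIV) \<and>
     (\<Union>(U, \<phi>)\<in>A. U) = UNIV \<and>
     (\<forall>(U, \<phi>)\<in>A. open U \<and> open (\<phi> ` U) \<and> homeomorphism U (\<phi> ` U) \<phi> (inv_into U \<phi>)) \<and>
     (\<forall>(U, \<phi>)\<in>A. \<forall>(V, \<psi>)\<in>A. smooth_on (\<phi> ` (U \<inter> V)) (\<psi> \<circ> inv_into U \<phi>))"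

definition model_atlas :: "('e, 'e) atlas" where
  "model_atlas = {(UNIV, \<lambda>x. x)}"

definition prod_atlas :: "('m, 'e) atlas \<Rightarrow> ('n, 'f) atlas \<Rightarrow> ('m \<times> 'n, 'e \<times> 'f) atlas" where
  "prod_atlas A B = {(U \<times> V, map_prod \<phi> \<psi>) | U \<phi> V \<psi>. (U, \<phi>) \<in> A \<and> (V, \<psi>) \<in> B}"

text \<open>Smoothness on an open subset \<open>W\<close> of the source.\<close>
definition smooth_map_on ::
  "('m::topological_space, 'e::real_normed_vector) atlas \<Rightarrow>
   ('n::topological_space, 'f::real_normed_vector) atlas \<Rightarrow> 'm set \<Rightarrow> ('m \<Rightarrow> 'n) \<Rightarrow> bool" where
  "smooth_map_on A B W f \<longleftrightarrow> continuous_on W f \<and>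
     (\<forall>(U, \<phi>)\<in>A. \<forall>(V, \<psi>)\<in>B. smooth_on (\<phi> ` (U \<inter> W \<inter> f -` V)) (\<psi> \<circ> f \<circ> inv_into U \<phi>))"

abbreviation smooth_map ::
  "('m::topological_space, 'e::real_normed_vector) atlas \<Rightarrow>
   ('n::topological_space, 'f::real_normed_vector) atlas \<Rightarrow> ('m \<Rightarrow> 'n) \<Rightarrow> bool" where
  "smooth_map A B f \<equiv> smooth_map_on A B UNIV f"

abbreviation smooth_fun ::
  "('m::topological_space, 'e::real_normed_vector) atlas \<Rightarrow> ('m \<Rightarrow> 'b::real_normed_vector) \<Rightarrow> bool" where
  "smooth_fun A f \<equiv> smooth_map A model_atlas f"

definition diffeo_on ::
  "('m::topological_space, 'e::real_normed_vector) atlas \<Rightarrow>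
   ('n::topological_space, 'f::real_normed_vector) atlas \<Rightarrow> 'm set \<Rightarrow> 'n set \<Rightarrow> ('m \<Rightarrow> 'n) \<Rightarrow> bool" where
  "diffeo_on A B W W' f \<longleftrightarrow> bij_betw f W W' \<and>
     smooth_map_on A B W f \<and> smooth_map_on B A W' (inv_into W f)"


section \<open>Tangent vectors, vector fields and differential forms\<close>

type_synonym 'm tvec = "('m \<Rightarrow> real) \<Rightarrow> real"
type_synonym 'm vfield = "'m \<Rightarrow> 'm tvec"

text \<open>Real derivations at \<open>p\<close>, made canonical by requiring the value 0 on non-smooth functions.
  Sums, differences and zero of tangent vectors, vector fields and forms are the pointwise ones
  on functions.\<close>
definition tangent_space ::
  "('m::topological_space, 'e::real_normed_vector) atlas \<Rightarrow> 'm \<Rightarrow> 'm tvec set" where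
  "tangent_space A p = {v.
     (\<forall>f g. smooth_fun A f \<longrightarrow> smooth_fun A g \<longrightarrow>
        v (\<lambda>x. f x + g x) = v f + v g \<and> v (\<lambda>x. f x * g x) = v f * g p + f p * v g) \<and>
     (\<forall>f c. smooth_fun A f \<longrightarrow> v (\<lambda>x. c * f x) = c * v f) \<and>
     (\<forall>f. \<not> smooth_fun A f \<longrightarrow> v f = 0)}"

definition cderiv :: "'m tvec \<Rightarrow> ('m \<Rightarrow> complex) \<Rightarrow> complex" where
  "cderiv v f = Complex (v (\<lambda>x. Re (f x))) (v (\<lambda>x. Im (f x)))"

definition vector_field ::
  "('m::topological_space, 'e::real_normed_vector) atlas \<Rightarrow> 'm vfield \<Rightarrow> bool" where
  "vector_field A X \<longleftrightarrow> (\<forall>p. X p \<in> tangent_space A p) \<and>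
     (\<forall>f. smooth_fun A f \<longrightarrow> smooth_fun A (\<lambda>p. X p f))"

definition lie_bracket :: "'m vfield \<Rightarrow> 'm vfield \<Rightarrow> 'm vfield" where
  "lie_bracket X Y = (\<lambda>p f. X p (\<lambda>q. Y q f) - Y p (\<lambda>q. X q f))"

text \<open>Complex-valued forms, i.e.\ sections of the exterior powers of the cotangent bundle
  tensored with the complex numbers. Values outside the tangent spaces are irrelevant.\<close>
type_synonym 'm form1 = "'m \<Rightarrow> 'm tvec \<Rightarrow> complex"
type_synonym 'm form2 = "'m \<Rightarrow> 'm tvec \<Rightarrow> 'm tvec \<Rightarrow> complex"

definition one_form ::
  "('m::topological_space, 'e::real_normed_vector) atlas \<Rightarrow> 'm form1 \<Rightarrow> bool" where
  "one_form A \<theta> \<longleftrightarrow>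
     (\<forall>p. \<forall>v\<in>tangent_space A p. \<forall>w\<in>tangent_space A p. \<theta> p (v + w) = \<theta> p v + \<theta> p w) \<and>
     (\<forall>p. \<forall>v\<in>tangent_space A p. \<forall>c. \<theta> p (\<lambda>f. c * v f) = of_real c * \<theta> p v) \<and>
     (\<forall>X. vector_field A X \<longrightarrow> smooth_fun A (\<lambda>p. \<theta> p (X p)))"

definition two_form ::
  "('m::topological_space, 'e::real_normed_vector) atlas \<Rightarrow> 'm form2 \<Rightarrow> bool" where
  "two_form A \<eta> \<longleftrightarrow>
     (\<forall>p. \<forall>u\<in>tangent_space A p. \<forall>v\<in>tangent_space A p. \<forall>w\<in>tangent_space A p.
        \<eta> p (u + v) w = \<eta> p u w + \<eta> p v w) \<and>
     (\<forall>p. \<forall>v\<in>tangent_space A p. \<forall>w\<in>tangent_space A p. \<forall>c.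
        \<eta> p (\<lambda>f. c * v f) w = of_real c * \<eta> p v w) \<and>
     (\<forall>p. \<forall>v\<in>tangent_space A p. \<forall>w\<in>tangent_space A p. \<eta> p v w = - \<eta> p w v) \<and>
     (\<forall>X Y. vector_field A X \<longrightarrow> vector_field A Y \<longrightarrow> smooth_fun A (\<lambda>p. \<eta> p (X p) (Y p)))"

definition ext_deriv1 :: "'m form1 \<Rightarrow> 'm vfield \<Rightarrow> 'm vfield \<Rightarrow> 'm \<Rightarrow> complex" where
  "ext_deriv1 \<theta> X Y p =
     cderiv (X p) (\<lambda>q. \<theta> q (Y q)) - cderiv (Y p) (\<lambda>q. \<theta> q (X q)) - \<theta> p (lie_bracket X Y p)"

definition ext_deriv2 :: "'m form2 \<Rightarrow> 'm vfield \<Rightarrow> 'm vfield \<Rightarrow> 'm vfield \<Rightarrow> 'm \<Rightarrow> complex" where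
  "ext_deriv2 \<eta> X Y Z p =
     cderiv (X p) (\<lambda>q. \<eta> q (Y q) (Z q)) + cderiv (Y p) (\<lambda>q. \<eta> q (Z q) (X q)) +
     cderiv (Z p) (\<lambda>q. \<eta> q (X q) (Y q)) -
     \<eta> p (lie_bracket X Y p) (Z p) - \<eta> p (lie_bracket Y Z p) (X p) - \<eta> p (lie_bracket Z X p) (Y p)"

definition closed_form2 ::
  "('m::topological_space, 'e::real_normed_vector) atlas \<Rightarrow> 'm form2 \<Rightarrow> bool" where
  "closed_form2 A \<eta> \<longleftrightarrow> two_form A \<eta> \<and>
     (\<forall>X Y Z p. vector_field A X \<longrightarrow> vector_field A Y \<longrightarrow> vector_field A Z \<longrightarrow>
        ext_deriv2 \<eta> X Y Z p = 0)"

definition exact_form2 ::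
  "('m::topological_space, 'e::real_normed_vector) atlas \<Rightarrow> 'm form2 \<Rightarrow> bool" where
  "exact_form2 A \<eta> \<longleftrightarrow> (\<exists>\<theta>. one_form A \<theta> \<and>
     (\<forall>X Y p. vector_field A X \<longrightarrow> vector_field A Y \<longrightarrow> \<eta> p (X p) (Y p) = ext_deriv1 \<theta> X Y p))"

text \<open>The class of a closed 2-form in the second de Rham cohomology with complex coefficients,
  as a coset of the exact forms. The zero class is the class of the form \<open>0\<close>.\<close>
definition deRham_class ::
  "('m::topological_space, 'e::real_normed_vector) atlas \<Rightarrow> 'm form2 \<Rightarrow> 'm form2 set" where
  "deRham_class A \<eta> = {\<eta>'. closed_form2 A \<eta>' \<and> exact_form2 A (\<eta>' - \<eta>)}"


section \<open>Symplectic forms and Poisson bracket\<close>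

definition symplectic_form ::
  "('m::topological_space, 'e::real_normed_vector) atlas \<Rightarrow>
   ('m \<Rightarrow> 'm tvec \<Rightarrow> 'm tvec \<Rightarrow> real) \<Rightarrow> bool" where
  "symplectic_form A \<omega> \<longleftrightarrow> closed_form2 A (\<lambda>p v w. complex_of_real (\<omega> p v w)) \<and>
     (\<forall>p. \<forall>v\<in>tangent_space A p. (\<forall>w\<in>tangent_space A p. \<omega> p v w = 0) \<longrightarrow> v = 0)"

text \<open>Sign convention: \<open>\<omega>(X\<^sub>f, -) = df\<close> and \<open>{f, g} = \<omega>(X\<^sub>f, X\<^sub>g) = X\<^sub>g f\<close>.\<close>
definition hamiltonian_vfield ::
  "('m::topological_space, 'e::real_normed_vector) atlas \<Rightarrow>
   ('m \<Rightarrow> 'm tvec \<Rightarrow> 'm tvec \<Rightarrow> real) \<Rightarrow> ('m \<Rightarrow> real) \<Rightarrow> 'm vfield" where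
  "hamiltonian_vfield A \<omega> f =
     (THE X. vector_field A X \<and> (\<forall>p. \<forall>w\<in>tangent_space A p. \<omega> p (X p) w = w f))"

text \<open>Complex bilinear extension to complex-valued functions.\<close>
definition poisson_bracket ::
  "('m::topological_space, 'e::real_normed_vector) atlas \<Rightarrow>
   ('m \<Rightarrow> 'm tvec \<Rightarrow> 'm tvec \<Rightarrow> real) \<Rightarrow> ('m \<Rightarrow> complex) \<Rightarrow> ('m \<Rightarrow> complex) \<Rightarrow> 'm \<Rightarrow> complex" where
  "poisson_bracket A \<omega> f g p =
     cderiv (hamiltonian_vfield A \<omega> (\<lambda>x. Re (g x)) p) f +
     \<i> * cderiv (hamiltonian_vfield A \<omega> (\<lambda>x. Im (g x)) p) f"


section \<open>Lie groups and homogeneous spaces\<close>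

definition lie_group ::
  "('g::{t2_space,second_countable_topology}, 'k::real_inner) atlas \<Rightarrow> 'g monoid \<Rightarrow> bool" where
  "lie_group A G \<longleftrightarrow> smooth_manifold A \<and> group G \<and> carrier G = UNIV \<and>
     smooth_map (prod_atlas A A) A (\<lambda>(x, y). x \<otimes>\<^bsub>G\<^esub> y) \<and> smooth_map A A (\<lambda>x. inv\<^bsub>G\<^esub> x)"

definition smooth_action ::
  "('g::topological_space, 'k::real_normed_vector) atlas \<Rightarrow> 'g monoid \<Rightarrow>
   ('m::topological_space, 'e::real_normed_vector) atlas \<Rightarrow> ('g \<Rightarrow> 'm \<Rightarrow> 'm) \<Rightarrow> bool" where
  "smooth_action AG G A act \<longleftrightarrow> group_action G UNIV act \<and>
     smooth_map (prod_atlas AG A) A (\<lambda>(g, x). act g x)"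

definition homogeneous_space ::
  "('g::topological_space, 'k::real_normed_vector) atlas \<Rightarrow> 'g monoid \<Rightarrow>
   ('m::{t2_space,second_countable_topology}, 'e::real_inner) atlas \<Rightarrow> ('g \<Rightarrow> 'm \<Rightarrow> 'm) \<Rightarrow> bool" where
  "homogeneous_space AG G A act \<longleftrightarrow>
     smooth_manifold A \<and> smooth_action AG G A act \<and> transitive_action G UNIV act"

text \<open>The real Lie algebra of left-invariant vector fields, with bracket \<open>lie_bracket\<close>.\<close>
definition lie_algebra ::
  "('g::topological_space, 'k::real_normed_vector) atlas \<Rightarrow> 'g monoid \<Rightarrow> 'g vfield set" where
  "lie_algebra AG G = {X. vector_field AG X \<and>
     (\<forall>g x f. smooth_fun AG f \<longrightarrow> X (g \<otimes>\<^bsub>G\<^esub> x) f = X x (\<lambda>y. f (g \<otimes>\<^bsub>G\<^esub> y)))}"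

text \<open>The derivative at the unit, in direction \<open>X\<close>, of \<open>g \<mapsto> \<alpha>\<^sub>g f\<close> with
  \<open>(\<alpha>\<^sub>g f)(x) = f(g\<inverse>x)\<close>.\<close>
definition inf_action ::
  "'g monoid \<Rightarrow> ('g \<Rightarrow> 'm \<Rightarrow> 'm) \<Rightarrow> 'g vfield \<Rightarrow> ('m \<Rightarrow> complex) \<Rightarrow> 'm \<Rightarrow> complex" where
  "inf_action G act X f x = cderiv (X \<one>\<^bsub>G\<^esub>) (\<lambda>g. f (act (inv\<^bsub>G\<^esub> g) x))"


section \<open>Complex line bundles and the first Chern class\<close>

record ('l, 'm, 'e) line_bundle =
  total_atlas :: "('l, 'e \<times> complex) atlas"
  proj :: "'l \<Rightarrow> 'm"
  fadd :: "'l \<Rightarrow> 'l \<Rightarrow> 'l"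
  fscale :: "complex \<Rightarrow> 'l \<Rightarrow> 'l"

text \<open>The vector space axioms for the fibres, and their being one-dimensional, follow from the
  fibrewise linear local trivialisations.\<close>
definition complex_line_bundle ::
  "('m::topological_space, 'e::real_inner) atlas \<Rightarrow>
   ('l::{t2_space,second_countable_topology}, 'm, 'e) line_bundle \<Rightarrow> bool" where
  "complex_line_bundle A L \<longleftrightarrow>
     smooth_manifold (total_atlas L) \<and> smooth_map (total_atlas L) A (proj L) \<and>
     (\<forall>a b. proj L a = proj L b \<longrightarrow> proj L (fadd L a b) = proj L a) \<and>
     (\<forall>c a. proj L (fscale L c a) = proj L a) \<and>
     (\<forall>p. \<exists>U \<tau>. open U \<and> p \<in> U \<and>
        diffeo_on (total_atlas L) (prod_atlas A (model_atlas :: (complex, complex) atlas))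
          (proj L -` U) (U \<times> UNIV) (\<lambda>a. (proj L a, \<tau> a)) \<and>
        (\<forall>a b. proj L a \<in> U \<longrightarrow> proj L a = proj L b \<longrightarrow> \<tau> (fadd L a b) = \<tau> a + \<tau> b) \<and>
        (\<forall>c a. proj L a \<in> U \<longrightarrow> \<tau> (fscale L c a) = c * \<tau> a))"

definition sections ::
  "('m::topological_space, 'e::real_normed_vector) atlas \<Rightarrow>
   ('l::topological_space, 'm, 'e) line_bundle \<Rightarrow> ('m \<Rightarrow> 'l) set" where
  "sections A L = {s. smooth_map A (total_atlas L) s \<and> (\<forall>p. proj L (s p) = p)}"

definition connection ::
  "('m::topological_space, 'e::real_normed_vector) atlas \<Rightarrow>
   ('l::topological_space, 'm, 'e) line_bundle \<Rightarrow> ('m vfield \<Rightarrow> ('m \<Rightarrow> 'l) \<Rightarrow> 'm \<Rightarrow> 'l) \<Rightarrow> bool" where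
  "connection A L D \<longleftrightarrow>
     (\<forall>X s. vector_field A X \<longrightarrow> s \<in> sections A L \<longrightarrow> D X s \<in> sections A L) \<and>
     (\<forall>X Y s p. vector_field A X \<longrightarrow> vector_field A Y \<longrightarrow> s \<in> sections A L \<longrightarrow>
        D (X + Y) s p = fadd L (D X s p) (D Y s p)) \<and>
     (\<forall>f X s p. smooth_fun A f \<longrightarrow> vector_field A X \<longrightarrow> s \<in> sections A L \<longrightarrow>
        D (\<lambda>q \<phi>. f q * X q \<phi>) s p = fscale L (of_real (f p)) (D X s p)) \<and>
     (\<forall>X s t p. vector_field A X \<longrightarrow> s \<in> sections A L \<longrightarrow> t \<in> sections A L \<longrightarrow>
        D X (\<lambda>q. fadd L (s q) (t q)) p = fadd L (D X s p) (D X t p)) \<and>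
     (\<forall>f X s p. smooth_fun A f \<longrightarrow> vector_field A X \<longrightarrow> s \<in> sections A L \<longrightarrow>
        D X (\<lambda>q. fscale L (f q) (s q)) p =
          fadd L (fscale L (f p) (D X s p)) (fscale L (cderiv (X p) f) (s p)))"

definition is_curvature ::
  "('m::topological_space, 'e::real_normed_vector) atlas \<Rightarrow>
   ('l::topological_space, 'm, 'e) line_bundle \<Rightarrow> ('m vfield \<Rightarrow> ('m \<Rightarrow> 'l) \<Rightarrow> 'm \<Rightarrow> 'l) \<Rightarrow>
   'm form2 \<Rightarrow> bool" where
  "is_curvature A L D \<kappa> \<longleftrightarrow> two_form A \<kappa> \<and>
     (\<forall>X Y s p. vector_field A X \<longrightarrow> vector_field A Y \<longrightarrow> s \<in> sections A L \<longrightarrow>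
        fscale L (\<kappa> p (X p) (Y p)) (s p) =
          fadd L (fadd L (D X (D Y s) p) (fscale L (-1) (D Y (D X s) p)))
            (fscale L (-1) (D (lie_bracket X Y) s p)))"

text \<open>Chern--Weil: the first Chern class is represented by \<open>\<i>/2\<pi>\<close> times the curvature form of a
  connection; the class does not depend on the choice of the connection.\<close>
definition chern_form ::
  "('m::topological_space, 'e::real_normed_vector) atlas \<Rightarrow>
   ('l::topological_space, 'm, 'e) line_bundle \<Rightarrow> 'm form2 \<Rightarrow> bool" where
  "chern_form A L \<eta> \<longleftrightarrow> (\<exists>D \<kappa>. connection A L D \<and> is_curvature A L D \<kappa> \<and>
     \<eta> = (\<lambda>p v w. \<i> / (2 * of_real pi) * \<kappa> p v w))"

definition chern_class ::
  "('m::topological_space, 'e::real_normed_vector) atlas \<Rightarrow>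
   ('l::topological_space, 'm, 'e) line_bundle \<Rightarrow> 'm form2 set" where
  "chern_class A L = deRham_class A (SOME \<eta>. chern_form A L \<eta>)"

definition equivariant_line_bundle ::
  "('g::topological_space, 'k::real_normed_vector) atlas \<Rightarrow> 'g monoid \<Rightarrow>
   ('m::topological_space, 'e::real_inner) atlas \<Rightarrow> ('g \<Rightarrow> 'm \<Rightarrow> 'm) \<Rightarrow>
   ('l::{t2_space,second_countable_topology}, 'm, 'e) line_bundle \<Rightarrow> ('g \<Rightarrow> 'l \<Rightarrow> 'l) \<Rightarrow> bool" where
  "equivariant_line_bundle AG G A act L actL \<longleftrightarrow>
     complex_line_bundle A L \<and> smooth_action AG G (total_atlas L) actL \<and>
     (\<forall>g a. proj L (actL g a) = act g (proj L a)) \<and>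
     (\<forall>g a b. proj L a = proj L b \<longrightarrow> actL g (fadd L a b) = fadd L (actL g a) (actL g b)) \<and>
     (\<forall>g c a. actL g (fscale L c a) = fscale L c (actL g a))"


section \<open>Star products\<close>

text \<open>Formal power series in \<open>h\<close> with coefficients in the smooth functions. The type
  \<open>('m \<Rightarrow> complex) fps\<close> carries the undeformed (pointwise) product.\<close>
definition smooth_series ::
  "('m::topological_space, 'e::real_normed_vector) atlas \<Rightarrow> ('m \<Rightarrow> complex) fps set" where
  "smooth_series A = {f. \<forall>n. smooth_fun A (fps_nth f n)}"

definition const_series :: "complex fps \<Rightarrow> ('m \<Rightarrow> complex) fps" where
  "const_series c = Abs_fps (\<lambda>n x. fps_nth c n)"

text \<open>Algebraic (Grothendieck) description of linear differential operators of order at most \<open>k\<close>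
  on smooth functions, by iterated commutators with multiplication operators.\<close>
fun diff_order_le ::
  "('m::topological_space, 'e::real_normed_vector) atlas \<Rightarrow> nat \<Rightarrow>
   (('m \<Rightarrow> complex) \<Rightarrow> 'm \<Rightarrow> complex) \<Rightarrow> bool" where
  "diff_order_le A 0 P \<longleftrightarrow>
     (\<forall>a f. smooth_fun A a \<longrightarrow> smooth_fun A f \<longrightarrow> P (a * f) = a * P f)"
| "diff_order_le A (Suc k) P \<longleftrightarrow>
     (\<forall>a. smooth_fun A a \<longrightarrow> diff_order_le A k (\<lambda>f. P (a * f) - a * P f))"

definition diff_operator ::
  "('m::topological_space, 'e::real_normed_vector) atlas \<Rightarrow> nat \<Rightarrow>
   (('m \<Rightarrow> complex) \<Rightarrow> 'm \<Rightarrow> complex) \<Rightarrow> bool" where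
  "diff_operator A k P \<longleftrightarrow>
     (\<forall>f. smooth_fun A f \<longrightarrow> smooth_fun A (P f)) \<and>
     (\<forall>f g. smooth_fun A f \<longrightarrow> smooth_fun A g \<longrightarrow> P (f + g) = P f + P g) \<and>
     (\<forall>c f. smooth_fun A f \<longrightarrow> P (\<lambda>x. c * f x) = (\<lambda>x. c * P f x)) \<and>
     diff_order_le A k P"

definition bidiff_operator ::
  "('m::topological_space, 'e::real_normed_vector) atlas \<Rightarrow>
   (('m \<Rightarrow> complex) \<Rightarrow> ('m \<Rightarrow> complex) \<Rightarrow> 'm \<Rightarrow> complex) \<Rightarrow> bool" where
  "bidiff_operator A B \<longleftrightarrow> (\<exists>k. \<forall>f. smooth_fun A f \<longrightarrow>
     diff_operator A k (\<lambda>g. B f g) \<and> diff_operator A k (\<lambda>g. B g f))"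

definition star_product ::
  "('m::topological_space, 'e::real_normed_vector) atlas \<Rightarrow>
   ('m \<Rightarrow> 'm tvec \<Rightarrow> 'm tvec \<Rightarrow> real) \<Rightarrow>
   (('m \<Rightarrow> complex) fps \<Rightarrow> ('m \<Rightarrow> complex) fps \<Rightarrow> ('m \<Rightarrow> complex) fps) \<Rightarrow> bool" where
  "star_product A \<omega> star \<longleftrightarrow>
     (\<forall>f\<in>smooth_series A. \<forall>g\<in>smooth_series A. star f g \<in> smooth_series A) \<and>
     (\<forall>f\<in>smooth_series A. \<forall>f'\<in>smooth_series A. \<forall>g\<in>smooth_series A.
        star (f + f') g = star f g + star f' g \<and> star g (f + f') = star g f + star g f') \<and>
     (\<forall>c. \<forall>f\<in>smooth_series A. \<forall>g\<in>smooth_series A.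
        star (const_series c * f) g = const_series c * star f g \<and>
        star f (const_series c * g) = const_series c * star f g) \<and>
     (\<forall>f\<in>smooth_series A. \<forall>g\<in>smooth_series A. \<forall>k\<in>smooth_series A.
        star (star f g) k = star f (star g k)) \<and>
     (\<exists>B. (\<forall>k. bidiff_operator A (B k)) \<and>
        (\<forall>f g. smooth_fun A f \<longrightarrow> smooth_fun A g \<longrightarrow>
           star (fps_const f) (fps_const g) = Abs_fps (\<lambda>k. B k f g) \<and>
           B 0 f g = f * g \<and>
           B 1 f g - B 1 g f = (\<lambda>p. \<i> * poisson_bracket A \<omega> f g p))) \<and>
     (\<forall>f. smooth_fun A f \<longrightarrow> star (fps_const f) 1 = fps_const f \<and> star 1 (fps_const f) = fps_const f)"


section \<open>The universal enveloping algebra\<close>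

text \<open>Words form the free monoid, so \<open>'x list \<Rightarrow>\<^sub>0 complex\<close> is the free complex algebra (tensor
  algebra) \<open>A\<close> on the set \<open>'x\<close>. Likewise the monoid algebras over pairs and triples of words are
  \<open>A \<otimes> A\<close> and \<open>A \<otimes> A \<otimes> A\<close>.\<close>
instantiation list :: (type) monoid_add
begin
definition zero_list :: "'a list" where "zero_list = []"
definition plus_list :: "'a list \<Rightarrow> 'a list \<Rightarrow> 'a list" where "plus_list u v = u @ v"
instance by standard (simp_all add: zero_list_def plus_list_def)
end

type_synonym 'x alg = "'x list \<Rightarrow>\<^sub>0 complex"
type_synonym 'x alg2 = "('x list \<times> 'x list) \<Rightarrow>\<^sub>0 complex"
type_synonym 'x alg3 = "('x list \<times> 'x list \<times> 'x list) \<Rightarrow>\<^sub>0 complex"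

definition alg_on :: "'x set \<Rightarrow> 'x alg set" where
  "alg_on S = {a. Poly_Mapping.keys a \<subseteq> lists S}"
definition alg2_on :: "'x set \<Rightarrow> 'x alg2 set" where
  "alg2_on S = {a. Poly_Mapping.keys a \<subseteq> lists S \<times> lists S}"
definition alg3_on :: "'x set \<Rightarrow> 'x alg3 set" where
  "alg3_on S = {a. Poly_Mapping.keys a \<subseteq> lists S \<times> lists S \<times> lists S}"

definition lin_ext :: "('k \<Rightarrow> 'j \<Rightarrow>\<^sub>0 complex) \<Rightarrow> ('k \<Rightarrow>\<^sub>0 complex) \<Rightarrow> ('j::monoid_add \<Rightarrow>\<^sub>0 complex)" where
  "lin_ext \<phi> a = (\<Sum>k\<in>Poly_Mapping.keys a.
     Poly_Mapping.single 0 (Poly_Mapping.lookup a k) * \<phi> k)"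

abbreviation basis_elt :: "'k \<Rightarrow> 'k \<Rightarrow>\<^sub>0 complex" where
  "basis_elt k \<equiv> Poly_Mapping.single k 1"

inductive_set two_sided_ideal :: "'r::ring_1 set \<Rightarrow> 'r set \<Rightarrow> 'r set" for R S where
  zero: "0 \<in> two_sided_ideal R S"
| generator: "a \<in> R \<Longrightarrow> s \<in> S \<Longrightarrow> b \<in> R \<Longrightarrow> a * s * b \<in> two_sided_ideal R S"
| sum: "x \<in> two_sided_ideal R S \<Longrightarrow> y \<in> two_sided_ideal R S \<Longrightarrow> x + y \<in> two_sided_ideal R S"

text \<open>Dividing \<open>alg_on \<gg>\<close> by these relations gives the universal enveloping algebra of the
  complexification of the real Lie algebra \<open>\<gg>\<close> of vector fields.\<close>
definition uea_relations :: "'g vfield set \<Rightarrow> 'g vfield alg set" where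
  "uea_relations \<gg> =
     {basis_elt [X + Y] - basis_elt [X] - basis_elt [Y] | X Y. X \<in> \<gg> \<and> Y \<in> \<gg>} \<union>
     {basis_elt [\<lambda>p f. c * X p f] - Poly_Mapping.single [X] (of_real c) | c X. X \<in> \<gg>} \<union>
     {basis_elt [X] * basis_elt [Y] - basis_elt [Y] * basis_elt [X] - basis_elt [lie_bracket X Y]
        | X Y. X \<in> \<gg> \<and> Y \<in> \<gg>}"

text \<open>Elements of \<open>U(\<gg>)\<close>, \<open>U(\<gg>) \<otimes> U(\<gg>)\<close> and \<open>U(\<gg>) \<otimes> U(\<gg>) \<otimes> U(\<gg>)\<close> are represented by elements of
  \<open>alg_on \<gg>\<close>, \<open>alg2_on \<gg>\<close> and \<open>alg3_on \<gg>\<close>, two of which represent the same element iff they differ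
  by an element of the ideal \<open>I\<close>, of \<open>I \<otimes> A + A \<otimes> I\<close>, or of
  \<open>I \<otimes> A \<otimes> A + A \<otimes> I \<otimes> A + A \<otimes> A \<otimes> I\<close>, respectively.\<close>
definition uea_ideal :: "'g vfield set \<Rightarrow> 'g vfield alg set" where
  "uea_ideal \<gg> = two_sided_ideal (alg_on \<gg>) (uea_relations \<gg>)"

definition uea_ideal2 :: "'g vfield set \<Rightarrow> 'g vfield alg2 set" where
  "uea_ideal2 \<gg> = two_sided_ideal (alg2_on \<gg>)
     (lin_ext (\<lambda>w. basis_elt (w, [])) ` uea_relations \<gg> \<union>
      lin_ext (\<lambda>w. basis_elt ([], w)) ` uea_relations \<gg>)"

definition uea_ideal3 :: "'g vfield set \<Rightarrow> 'g vfield alg3 set" where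
  "uea_ideal3 \<gg> = two_sided_ideal (alg3_on \<gg>)
     (lin_ext (\<lambda>w. basis_elt (w, [], [])) ` uea_relations \<gg> \<union>
      lin_ext (\<lambda>w. basis_elt ([], w, [])) ` uea_relations \<gg> \<union>
      lin_ext (\<lambda>w. basis_elt ([], [], w)) ` uea_relations \<gg>)"

text \<open>Coproduct and counit on words: the algebra morphisms with
  \<open>\<Delta>(X) = X \<otimes> 1 + 1 \<otimes> X\<close> and \<open>\<epsilon>(X) = 0\<close> on generators.\<close>
definition coprod_word :: "'x list \<Rightarrow> 'x alg2" where
  "coprod_word w = prod_list (map (\<lambda>X. basis_elt ([X], []) + basis_elt ([], [X])) w)"

definition counit_word :: "'x list \<Rightarrow> complex" where
  "counit_word w = (if w = [] then 1 else 0)"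

definition tensor_one :: "'x alg2 \<Rightarrow> 'x alg3" where
  "tensor_one = lin_ext (\<lambda>(u, v). basis_elt (u, v, []))"
definition one_tensor :: "'x alg2 \<Rightarrow> 'x alg3" where
  "one_tensor = lin_ext (\<lambda>(u, v). basis_elt ([], u, v))"
definition coprod_tensor_id :: "'x alg2 \<Rightarrow> 'x alg3" where
  "coprod_tensor_id = lin_ext (\<lambda>(u, v). lin_ext (\<lambda>(u1, u2). basis_elt (u1, u2, v)) (coprod_word u))"
definition id_tensor_coprod :: "'x alg2 \<Rightarrow> 'x alg3" where
  "id_tensor_coprod = lin_ext (\<lambda>(u, v). lin_ext (\<lambda>(v1, v2). basis_elt (u, v1, v2)) (coprod_word v))"
definition counit_tensor_id :: "'x alg2 \<Rightarrow> 'x alg" where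
  "counit_tensor_id = lin_ext (\<lambda>(u, v). Poly_Mapping.single v (counit_word u))"
definition id_tensor_counit :: "'x alg2 \<Rightarrow> 'x alg" where
  "id_tensor_counit = lin_ext (\<lambda>(u, v). Poly_Mapping.single u (counit_word v))"


section \<open>Twists\<close>

definition coeffwise :: "('a \<Rightarrow> 'b) \<Rightarrow> 'a fps \<Rightarrow> 'b fps" where
  "coeffwise \<phi> F = Abs_fps (\<lambda>n. \<phi> (fps_nth F n))"

definition series_cong :: "'r::ring_1 set \<Rightarrow> 'r fps \<Rightarrow> 'r fps \<Rightarrow> bool" where
  "series_cong I F H \<longleftrightarrow> (\<forall>n. fps_nth F n - fps_nth H n \<in> I)"

definition series2_on :: "'x set \<Rightarrow> 'x alg2 fps set" where
  "series2_on S = {F. \<forall>n. fps_nth F n \<in> alg2_on S}"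

text \<open>\<open>F\<close> and \<open>H\<close> represent mutually inverse elements of \<open>(U(\<gg>) \<otimes> U(\<gg>))[[h]]\<close>.\<close>
definition inverse_series2 :: "'g vfield set \<Rightarrow> 'g vfield alg2 fps \<Rightarrow> 'g vfield alg2 fps \<Rightarrow> bool" where
  "inverse_series2 \<gg> F H \<longleftrightarrow> F \<in> series2_on \<gg> \<and> H \<in> series2_on \<gg> \<and>
     series_cong (uea_ideal2 \<gg>) (F * H) 1 \<and> series_cong (uea_ideal2 \<gg>) (H * F) 1"

definition twist :: "'g vfield set \<Rightarrow> 'g vfield alg2 fps \<Rightarrow> bool" where
  "twist \<gg> F \<longleftrightarrow> F \<in> series2_on \<gg> \<and> (\<exists>H. inverse_series2 \<gg> F H) \<and>
     series_cong (uea_ideal3 \<gg>)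
       (coeffwise tensor_one F * coeffwise coprod_tensor_id F)
       (coeffwise one_tensor F * coeffwise id_tensor_coprod F) \<and>
     series_cong (uea_ideal \<gg>) (coeffwise counit_tensor_id F) 1 \<and>
     series_cong (uea_ideal \<gg>) (coeffwise id_tensor_counit F) 1 \<and>
     fps_nth F 0 - 1 \<in> uea_ideal2 \<gg>"

definition word_action ::
  "'g monoid \<Rightarrow> ('g \<Rightarrow> 'm \<Rightarrow> 'm) \<Rightarrow> 'g vfield list \<Rightarrow> ('m \<Rightarrow> complex) \<Rightarrow> 'm \<Rightarrow> complex" where
  "word_action G act w f = foldr (inf_action G act) w f"

text \<open>\<open>m(a (\<triangleright> \<otimes> \<triangleright>) (f \<otimes> g))\<close> for \<open>a \<in> U(\<gg>) \<otimes> U(\<gg>)\<close>; for smooth \<open>f\<close> and \<open>g\<close> it depends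
  only on the class of the representative \<open>a\<close>.\<close>
definition mult_action ::
  "'g monoid \<Rightarrow> ('g \<Rightarrow> 'm \<Rightarrow> 'm) \<Rightarrow> 'g vfield alg2 \<Rightarrow> ('m \<Rightarrow> complex) \<Rightarrow> ('m \<Rightarrow> complex) \<Rightarrow> 'm \<Rightarrow> complex" where
  "mult_action G act a f g x = (\<Sum>(u, v)\<in>Poly_Mapping.keys a.
     Poly_Mapping.lookup a (u, v) * word_action G act u f x * word_action G act v g x)"

definition mult_action_series ::
  "'g monoid \<Rightarrow> ('g \<Rightarrow> 'm \<Rightarrow> 'm) \<Rightarrow> 'g vfield alg2 fps \<Rightarrow>
   ('m \<Rightarrow> complex) fps \<Rightarrow> ('m \<Rightarrow> complex) fps \<Rightarrow> ('m \<Rightarrow> complex) fps" where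
  "mult_action_series G act H f g = Abs_fps (\<lambda>n. \<Sum>i\<le>n. \<Sum>j\<le>n - i.
     mult_action G act (fps_nth H i) (fps_nth f j) (fps_nth g (n - i - j)))"

definition induced_by_twist ::
  "('g::topological_space, 'k::real_normed_vector) atlas \<Rightarrow> 'g monoid \<Rightarrow>
   ('m::topological_space, 'e::real_normed_vector) atlas \<Rightarrow> ('g \<Rightarrow> 'm \<Rightarrow> 'm) \<Rightarrow>
   (('m \<Rightarrow> complex) fps \<Rightarrow> ('m \<Rightarrow> complex) fps \<Rightarrow> ('m \<Rightarrow> complex) fps) \<Rightarrow>
   'g vfield alg2 fps \<Rightarrow> bool" where
  "induced_by_twist AG G A act star F \<longleftrightarrow>
     (\<exists>H. inverse_series2 (lie_algebra AG G) F H \<and>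
        (\<forall>f\<in>smooth_series A. \<forall>g\<in>smooth_series A. star f g = mult_action_series G act H f g))"

end

theory Submission
  imports Defs "Jordan_Normal_Form.Determinant"
begin

text \<open>
  Why the two properties exclude each other: a twist makes every equivariant line bundle flat.

  Let \<open>H = 1 + h H\<^sub>1 + \<dots>\<close> be the inverse of the twist. The twist does not only deform the functions on
  \<open>M\<close>: by the cocycle identity, \<open>f * g = m(H(f \<otimes> g))\<close> is associative on the functions on any manifold
  with an action of \<open>G\<close>, hence also on the total space of an equivariant line bundle \<open>L\<close>. The first-order
  part of its commutator is a bracket that satisfies the product rule (first order of associativity) and
  the Jacobi identity (second order). On \<open>M\<close> it is \<open>\<i>\<close> times the Poisson bracket of \<open>\<omega>\<close>, the projection
  \<open>L \<rightarrow> M\<close> preserves the brackets, and bracketing with a function pulled back from \<open>M\<close> respects the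
  homogeneity of functions along the fibres, because \<open>G\<close> acts linearly on them.

  Let \<open>X\<^sub>f\<close> be the Hamiltonian field of a real function \<open>f\<close> on \<open>M\<close>. The derivation \<open>\<i> {f \<circ> \<pi>, -}\<close> of the
  functions on \<open>L\<close> is a lift of \<open>X\<^sub>f\<close>, and at each point it depends on \<open>f\<close> only through \<open>X\<^sub>f\<close>. Since \<open>\<omega>\<close> is
  non-degenerate, every tangent vector is a value of some \<open>X\<^sub>f\<close>, so that all vector fields get a lift.
  A section \<open>s\<close> of \<open>L\<close> is the same as the function \<open>a \<mapsto> s/a\<close> of degree \<open>-1\<close> on the non-zero vectors, on
  which the lifts act: this is a connection on \<open>L\<close>. Its curvature is tensorial and vanishes on Hamiltonian
  fields by the Jacobi identities on \<open>L\<close> and on \<open>M\<close> (\<open>curv_ham\<close>, \<open>curv_zero\<close>). Finally, two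
  connections differ by a one-form \<open>\<alpha>\<close> and their curvatures by \<open>d\<alpha>\<close> (\<open>curvature_difference\<close>), so that
  the Chern form of every connection is exact once a flat one exists
  (\<open>flat_connection_chern_class\<close>).

  The brackets are computed on the group. To a function \<open>f\<close> and a point \<open>x\<close> of a \<open>G\<close>-manifold belongs the
  function \<open>g \<mapsto> f(g\<inverse>x)\<close> on \<open>G\<close>, which turns the action of the Lie algebra into differentiation along
  left-invariant fields. Both identities of the bracket are therefore proved once, on \<open>G\<close>
  (\<open>star_coeff_assoc\<close>, \<open>group_bracket_mult\<close>, \<open>group_bracket_jacobi\<close>), and transported.

  The parts before that develop the analysis on manifolds whose tangent vectors are derivations of global
  functions: Hadamard's lemma makes every derivation a directional derivative
  (\<open>tangent_chart\<close>), which yields finite frames (\<open>coordinate_frame_exists\<close>), pointwise dependence of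
  tensorial expressions (\<open>tensorial\<close>), Hamiltonian vector fields
  (\<open>hamiltonian_vfield_exists\<close>), and smoothness of the infinitesimal action
  (\<open>partial_derivation_smooth\<close>).
\<close>

text \<open>Below, \<open>\<bullet>\<close> is the inner product of the model spaces.\<close>

no_notation Matrix.scalar_prod (infix "\<bullet>" 70)

section \<open>Smooth functions on open subsets of normed spaces\<close>

lemma Ck_on_SucD:
  assumes "Ck_on (Suc k) S f" "x \<in> S"
  shows "(f has_derivative frechet_derivative f (at x)) (at x)"
  using assms by (simp add: frechet_derivative_works[symmetric])

lemma Ck_on_Suc_imp: "Ck_on (Suc k) S f \<Longrightarrow> Ck_on k S f"
proof (induction k arbitrary: f)
  case 0
  then show ?case
    by (auto intro!: continuous_at_imp_continuous_on differentiable_imp_continuous_within)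
next
  case (Suc k)
  then show ?case by (metis Ck_on.simps(2))
qed

lemma Ck_on_subset: "Ck_on k S f \<Longrightarrow> T \<subseteq> S \<Longrightarrow> Ck_on k T f"
  by (induction k arbitrary: f) (auto intro: continuous_on_subset)

text \<open>The set has to be open, since the derivatives at a point involve a full neighbourhood of it.\<close>

lemma Ck_on_cong:
  assumes "open S" "\<And>x. x \<in> S \<Longrightarrow> f x = g x" "Ck_on k S f"
  shows "Ck_on k S g"
  using assms(2,3)
proof (induction k arbitrary: f g)
  case 0
  then show ?case using continuous_on_cong[of S S f g] by simp
next
  case (Suc k)
  have fd: "f differentiable (at x)" if "x \<in> S" for x using Suc.prems(2) that by simp
  have eq: "frechet_derivative f (at x) = frechet_derivative g (at x)" if "x \<in> S" for x
    using frechet_derivative_transform_within_open[OF fd[OF that] assms(1) that] Suc.prems(1) by blast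
  have gd: "g differentiable (at x)" if "x \<in> S" for x
    using fd[OF that] Suc.prems(1) assms(1) that unfolding differentiable_def
    by (meson has_derivative_transform_within_open)
  have "Ck_on k S (\<lambda>x. frechet_derivative g (at x) v)" for v
    by (rule Suc.IH[of "\<lambda>x. frechet_derivative f (at x) v"]) (use eq Suc.prems(2) in auto)
  with gd show ?case by simp
qed

lemma Ck_on_SucI:
  assumes "open S" "\<And>x. x \<in> S \<Longrightarrow> (f has_derivative f' x) (at x)"
    "\<And>v. Ck_on k S (\<lambda>x. f' x v)"
  shows "Ck_on (Suc k) S f"
proof -
  have "frechet_derivative f (at x) = f' x" if "x \<in> S" for x
    using frechet_derivative_at[OF assms(2)[OF that]] by simp
  then have "Ck_on k S (\<lambda>x. frechet_derivative f (at x) v)" for v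
    using Ck_on_cong[OF assms(1) _ assms(3)[of v], of "\<lambda>x. frechet_derivative f (at x) v"] by simp
  moreover have "f differentiable (at x)" if "x \<in> S" for x
    using assms(2)[OF that] by (auto simp: differentiable_def)
  ultimately show ?thesis by simp
qed

lemma Ck_on_local:
  assumes "\<And>x. x \<in> S \<Longrightarrow> \<exists>U. open U \<and> x \<in> U \<and> Ck_on k U f"
  shows "Ck_on k S f"
  using assms
proof (induction k arbitrary: f)
  case 0
  show ?case unfolding Ck_on.simps
    by (rule continuous_at_imp_continuous_on)
      (use 0 in \<open>metis Ck_on.simps(1) continuous_on_eq_continuous_at\<close>)
next
  case (Suc k)
  have "f differentiable (at x)" if "x \<in> S" for x using Suc.prems[OF that] by auto
  moreover have "Ck_on k S (\<lambda>x. frechet_derivative f (at x) v)" for v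
    by (rule Suc.IH) (use Suc.prems in fastforce)
  ultimately show ?case by simp
qed

lemma Ck_on_const: "Ck_on k S (\<lambda>x. c)"
  by (induction k arbitrary: c) (auto simp: frechet_derivative_const)

lemma Ck_on_add:
  assumes "open S" "Ck_on k S f" "Ck_on k S g"
  shows "Ck_on k S (\<lambda>x. f x + g x)"
  using assms(2,3)
proof (induction k arbitrary: f g)
  case 0 then show ?case by (auto intro: continuous_intros)
next
  case (Suc k)
  show ?case
    by (rule Ck_on_SucI[OF assms(1) has_derivative_add[OF Ck_on_SucD[OF Suc.prems(1)] Ck_on_SucD[OF Suc.prems(2)]]])
      (use Suc in auto)
qed

lemma Ck_on_bounded_linear:
  assumes "open S" "bounded_linear h" "Ck_on k S f"
  shows "Ck_on k S (\<lambda>x. h (f x))"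
  using assms(3)
proof (induction k arbitrary: f)
  case 0 then show ?case using bounded_linear.continuous_on[OF assms(2)] by auto
next
  case (Suc k)
  show ?case
    by (rule Ck_on_SucI[OF assms(1) bounded_linear.has_derivative[OF assms(2) Ck_on_SucD[OF Suc.prems(1)]]])
      (use Suc in auto)
qed

lemma Ck_on_bilinear:
  assumes "open S" "bounded_bilinear p" "Ck_on k S f" "Ck_on k S g"
  shows "Ck_on k S (\<lambda>x. p (f x) (g x))"
  using assms(3,4)
proof (induction k arbitrary: f g)
  case 0 then show ?case using bounded_bilinear.continuous_on[OF assms(2)] by auto
next
  case (Suc k)
  show ?case
    by (rule Ck_on_SucI[OF assms(1) bounded_bilinear.FDERIV[OF assms(2) Ck_on_SucD[OF Suc.prems(1)] Ck_on_SucD[OF Suc.prems(2)]]])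
      (use Suc Ck_on_Suc_imp[OF Suc.prems(1)] Ck_on_Suc_imp[OF Suc.prems(2)] in \<open>auto intro!: Ck_on_add[OF assms(1)]\<close>)
qed

lemma Ck_on_inverse:
  fixes f :: "'a::real_normed_vector \<Rightarrow> 'b::real_normed_div_algebra"
  assumes "open S" "\<And>x. x \<in> S \<Longrightarrow> f x \<noteq> 0" "Ck_on k S f"
  shows "Ck_on k S (\<lambda>x. inverse (f x))"
  using assms(3)
proof (induction k)
  case 0 then show ?case using assms(2) by (auto intro: continuous_intros)
next
  case (Suc k)
  note b = Ck_on_bilinear[OF assms(1) bounded_bilinear_mult]
  show ?case
    by (rule Ck_on_SucI[OF assms(1) Deriv.has_derivative_inverse[OF assms(2) Ck_on_SucD[OF Suc.prems(1)]]])
      (use Suc Ck_on_Suc_imp[OF Suc.prems(1)] in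
        \<open>auto intro!: b Ck_on_bounded_linear[OF assms(1) bounded_linear_minus[OF bounded_linear_ident]]\<close>)
qed

lemma Ck_on_sum:
  assumes "open S" "\<And>i. i \<in> I \<Longrightarrow> Ck_on k S (f i)"
  shows "Ck_on k S (\<lambda>x. \<Sum>i\<in>I. f i x)"
  using assms(2) by (induction I rule: infinite_finite_induct) (auto intro!: Ck_on_const Ck_on_add assms(1))

text \<open>The model spaces of manifolds are inner product spaces which are finite-dimensional by assumption
  and not by their type; an orthonormal basis makes that assumption usable.\<close>

definition orthonormal_basis :: "'a::real_inner set \<Rightarrow> bool" where
  "orthonormal_basis E \<longleftrightarrow> finite E \<and>
     (\<forall>e\<in>E. \<forall>e'\<in>E. e \<bullet> e' = (if e = e' then 1 else 0)) \<and> (\<forall>x. (\<Sum>e\<in>E. (x \<bullet> e) *\<^sub>R e) = x)"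

lemma orthonormal_basis_exists:
  fixes B :: "'a::real_inner set"
  assumes "finite B" "span B = UNIV"
  obtains E :: "'a set" where "orthonormal_basis E"
proof -
  obtain C where C: "finite C" "span C = span B" "pairwise Linear_Algebra.orthogonal C"
    using basis_orthogonal[OF assms(1)] by blast
  define E where "E = (\<lambda>x. x /\<^sub>R norm x) ` (C - {0})"
  have finE: "finite E" using C(1) by (simp add: E_def)
  have on: "e \<bullet> e' = (if e = e' then 1 else 0)" if "e \<in> E" "e' \<in> E" for e e'
  proof -
    obtain x where x: "x \<in> C" "x \<noteq> 0" "e = x /\<^sub>R norm x" using \<open>e \<in> E\<close> unfolding E_def by blast
    obtain y where y: "y \<in> C" "y \<noteq> 0" "e' = y /\<^sub>R norm y" using \<open>e' \<in> E\<close> unfolding E_def by blast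
    note xy = x y
    show ?thesis
    proof (cases "x = y")
      case True
      then show ?thesis using xy by (simp add: dot_square_norm power2_eq_square)
    next
      case False
      then have o: "x \<bullet> y = 0" using C(3) xy unfolding pairwise_def Linear_Algebra.orthogonal_def by blast
      then have "e \<bullet> e' = 0" using xy by simp
      moreover have "e \<noteq> e'"
      proof
        assume "e = e'"
        then have "e \<bullet> e = 0" using \<open>e \<bullet> e' = 0\<close> by simp
        then show False using xy by simp
      qed
      ultimately show ?thesis by simp
    qed
  qed
  have "C \<subseteq> span E"
  proof
    fix x assume "x \<in> C"
    show "x \<in> span E"
    proof (cases "x = 0")
      case True then show ?thesis by (simp add: span_zero)
    next
      case False
      then have "x /\<^sub>R norm x \<in> span E" using \<open>x \<in> C\<close> by (auto simp: E_def intro: span_base)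
      then have "norm x *\<^sub>R (x /\<^sub>R norm x) \<in> span E" by (rule span_scale)
      then show ?thesis using False by simp
    qed
  qed
  then have sp: "span E = UNIV" using C(2) assms(2) by (metis span_minimal subspace_span top.extremum_uniqueI)
  have "(\<Sum>e\<in>E. (x \<bullet> e) *\<^sub>R e) = x" for x
  proof -
    have "x \<in> span E" using sp by simp
    then obtain u where u: "x = (\<Sum>e\<in>E. u e *\<^sub>R e)" using span_finite[OF finE] by auto
    have "x \<bullet> e = u e" if "e \<in> E" for e
    proof -
      have "x \<bullet> e = (\<Sum>e'\<in>E. u e' * (e' \<bullet> e))" by (simp add: u inner_sum_left)
      also have "\<dots> = (\<Sum>e'\<in>E. if e' = e then u e' else 0)"
        by (rule sum.cong) (use on that in auto)
      finally show ?thesis using finE that by simp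
    qed
    then show ?thesis using u by simp
  qed
  then show ?thesis using that[of E] finE on by (auto simp: orthonormal_basis_def)
qed

lemma linear_orthonormal_basis:
  assumes "orthonormal_basis E" "linear l"
  shows "l w = (\<Sum>e\<in>E. (w \<bullet> e) *\<^sub>R l e)"
proof -
  have "l w = l (\<Sum>e\<in>E. (w \<bullet> e) *\<^sub>R e)" using assms(1) by (simp add: orthonormal_basis_def)
  then show ?thesis using assms(2) by (simp add: linear_sum linear_cmul)
qed

text \<open>The chain rule differentiates \<open>g\<close> in a direction that moves with the point. Expanded in a basis of the
  middle space it becomes a combination of derivatives in fixed directions, to which the induction
  hypothesis applies.\<close>

lemma Ck_on_compose:
  fixes f :: "'a::real_normed_vector \<Rightarrow> 'b::real_inner" and E :: "'b set"
  assumes "open S" "open T" "orthonormal_basis E" "f ` S \<subseteq> T" "Ck_on k S f" "Ck_on k T g"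
  shows "Ck_on k S (\<lambda>x. g (f x))"
  using assms(5,6)
proof (induction k arbitrary: g)
  case 0
  then show ?case using assms(4) by (auto intro: continuous_on_compose2)
next
  case (Suc k)
  have d: "((\<lambda>x. g (f x)) has_derivative
      (\<lambda>v. \<Sum>e\<in>E. (frechet_derivative f (at x) v \<bullet> e) *\<^sub>R frechet_derivative g (at (f x)) e)) (at x)"
    if "x \<in> S" for x
  proof -
    have g: "(g has_derivative frechet_derivative g (at (f x))) (at (f x))"
      using Ck_on_SucD[OF Suc.prems(2)] assms(4) that by blast
    have lin: "linear (frechet_derivative g (at (f x)))"
      using g has_derivative_linear by blast
    have "(\<lambda>v. \<Sum>e\<in>E. (frechet_derivative f (at x) v \<bullet> e) *\<^sub>R frechet_derivative g (at (f x)) e)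
      = (\<lambda>v. frechet_derivative g (at (f x)) (frechet_derivative f (at x) v))"
      by (rule ext) (rule linear_orthonormal_basis[OF assms(3) lin, symmetric])
    then show ?thesis
      using has_derivative_compose[OF Ck_on_SucD[OF Suc.prems(1) that] g] by simp
  qed
  show ?case
  proof (rule Ck_on_SucI[OF assms(1) d])
    fix v
    show "Ck_on k S (\<lambda>x. \<Sum>e\<in>E. (frechet_derivative f (at x) v \<bullet> e) *\<^sub>R frechet_derivative g (at (f x)) e)"
    proof (intro Ck_on_sum[OF assms(1)] Ck_on_bilinear[OF assms(1) bounded_bilinear_scaleR])
      fix e
      show "Ck_on k S (\<lambda>x. frechet_derivative f (at x) v \<bullet> e)"
        by (rule Ck_on_bounded_linear[OF assms(1) bounded_linear_inner_left]) (use Suc.prems(1) in simp)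
      show "Ck_on k S (\<lambda>x. frechet_derivative g (at (f x)) e)"
        using Suc.IH[OF Ck_on_Suc_imp[OF Suc.prems(1)]] Suc.prems(2) by auto
    qed
  qed
qed

lemma smooth_on_imp_continuous_on: "smooth_on S f \<Longrightarrow> continuous_on S f"
  unfolding smooth_on_def by (metis Ck_on.simps(1))

lemma smooth_on_has_derivative:
  assumes "smooth_on S f" "x \<in> S"
  shows "(f has_derivative frechet_derivative f (at x)) (at x)"
  using assms Ck_on_SucD unfolding smooth_on_def by blast

lemma smooth_on_directional: "smooth_on S f \<Longrightarrow> smooth_on S (\<lambda>x. frechet_derivative f (at x) v)"
  unfolding smooth_on_def by (metis Ck_on.simps(2))

lemma smooth_on_subset: "smooth_on S f \<Longrightarrow> T \<subseteq> S \<Longrightarrow> smooth_on T f"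
  unfolding smooth_on_def using Ck_on_subset by blast

lemma smooth_on_cong:
  assumes "open S" "\<And>x. x \<in> S \<Longrightarrow> f x = g x" "smooth_on S f"
  shows "smooth_on S g"
  using Ck_on_cong[OF assms(1), of f g] assms(2,3) unfolding smooth_on_def by blast

lemma smooth_on_local:
  assumes "\<And>x. x \<in> S \<Longrightarrow> \<exists>U. open U \<and> x \<in> U \<and> smooth_on U f"
  shows "smooth_on S f"
  unfolding smooth_on_def using Ck_on_local assms unfolding smooth_on_def by meson

lemma smooth_on_const [simp]: "smooth_on S (\<lambda>x. c)"
  by (simp add: smooth_on_def Ck_on_const)

lemma smooth_on_add: "open S \<Longrightarrow> smooth_on S f \<Longrightarrow> smooth_on S g \<Longrightarrow> smooth_on S (\<lambda>x. f x + g x)"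
  by (simp add: smooth_on_def Ck_on_add)

lemma smooth_on_sum: "open S \<Longrightarrow> (\<And>i. i \<in> I \<Longrightarrow> smooth_on S (f i)) \<Longrightarrow> smooth_on S (\<lambda>x. \<Sum>i\<in>I. f i x)"
  by (simp add: smooth_on_def Ck_on_sum)

lemma smooth_on_bounded_linear: "open S \<Longrightarrow> bounded_linear h \<Longrightarrow> smooth_on S f \<Longrightarrow> smooth_on S (\<lambda>x. h (f x))"
  by (simp add: smooth_on_def Ck_on_bounded_linear)

lemma smooth_on_bilinear:
  "open S \<Longrightarrow> bounded_bilinear p \<Longrightarrow> smooth_on S f \<Longrightarrow> smooth_on S g \<Longrightarrow> smooth_on S (\<lambda>x. p (f x) (g x))"
  by (simp add: smooth_on_def Ck_on_bilinear)

lemma smooth_on_inverse: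
  fixes f :: "'a::real_normed_vector \<Rightarrow> 'b::real_normed_div_algebra"
  shows "open S \<Longrightarrow> (\<And>x. x \<in> S \<Longrightarrow> f x \<noteq> 0) \<Longrightarrow> smooth_on S f \<Longrightarrow> smooth_on S (\<lambda>x. inverse (f x))"
  by (simp add: smooth_on_def Ck_on_inverse)

lemma smooth_on_compose:
  fixes f :: "'a::real_normed_vector \<Rightarrow> 'b::real_inner" and E :: "'b set"
  assumes "open S" "open T" "orthonormal_basis E" "f ` S \<subseteq> T" "smooth_on S f" "smooth_on T g"
  shows "smooth_on S (\<lambda>x. g (f x))"
  using Ck_on_compose[OF assms(1-4)] assms(5,6) unfolding smooth_on_def by blast

lemma smooth_on_linear: "open S \<Longrightarrow> bounded_linear h \<Longrightarrow> smooth_on S h"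
proof -
  assume S: "open S" and h: "bounded_linear h"
  have "Ck_on k S (\<lambda>x. x)" for k
  proof (cases k)
    case (Suc n)
    show ?thesis unfolding Suc
      by (rule Ck_on_SucI[OF S has_derivative_ident]) (rule Ck_on_const)
  qed (simp add: continuous_on_id)
  then show ?thesis using smooth_on_bounded_linear[OF S h, of "\<lambda>x. x"] by (simp add: smooth_on_def)
qed

text \<open>The span of these functions is closed under differentiation, which gives smoothness of all of
  them at once.\<close>

definition flat_fun :: "nat \<Rightarrow> real \<Rightarrow> real" where
  "flat_fun n t = (if 0 < t then exp (- (1 / t)) / t ^ n else 0)"

text \<open>The exponential series of \<open>1 / t\<close> dominates its term of degree \<open>n + 2\<close>.\<close>

lemma flat_fun_bound: "\<bar>flat_fun n t\<bar> \<le> fact (n + 2) * t\<^sup>2"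
proof (cases "0 < t")
  case True
  have "(1 / t) ^ (n + 2) / fact (n + 2) \<le> exp (1 / t)"
  proof -
    have s: "(\<lambda>k. (1 / t) ^ k /\<^sub>R fact k) sums exp (1 / t)" by (rule exp_converges)
    have "(\<Sum>k\<in>{n+2}. (1 / t) ^ k /\<^sub>R fact k) \<le> exp (1 / t)"
      using sum_le_suminf[OF sums_summable[OF s], of "{n+2}"] sums_unique[OF s] True by auto
    then show ?thesis by (simp add: divide_simps mult.commute)
  qed
  then have "(1 / t) ^ (n + 2) \<le> exp (1 / t) * fact (n + 2)"
    by (simp only: pos_divide_le_eq[OF fact_gt_zero])
  then have "exp (- (1 / t)) * (1 / t) ^ (n + 2) \<le> exp (- (1 / t)) * (exp (1 / t) * fact (n + 2))"
    by (intro mult_left_mono) auto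
  also have "\<dots> = fact (n + 2)" by (simp add: exp_minus)
  finally have "exp (- (1 / t)) * (1 / t) ^ (n + 2) * t\<^sup>2 \<le> fact (n + 2) * t\<^sup>2"
    by (intro mult_right_mono) auto
  moreover have "exp (- (1 / t)) * (1 / t) ^ (n + 2) * t\<^sup>2 = exp (- (1 / t)) / t ^ n"
    using True by (simp add: power_divide power_add power2_eq_square)
  ultimately show ?thesis using True by (simp add: flat_fun_def)
qed (simp add: flat_fun_def)

lemma flat_fun_deriv:
  "(flat_fun n has_real_derivative flat_fun (n + 2) t - real n * flat_fun (n + 1) t) (at t)"
proof -
  consider "t < 0" | "t = 0" | "0 < t" by linarith
  then show ?thesis
  proof cases
    case 1
    have "((\<lambda>t. 0) has_real_derivative 0) (at t)" by simp
    then have "(flat_fun n has_real_derivative 0) (at t)"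
      by (rule has_field_derivative_transform_within_open[where S="{..<0}"]) (use 1 in \<open>auto simp: flat_fun_def\<close>)
    then show ?thesis using 1 by (simp add: flat_fun_def)
  next
    case 2
    have "((\<lambda>h. flat_fun n h / h) \<longlongrightarrow> 0) (at 0)"
    proof (rule Lim_null_comparison)
      show "\<forall>\<^sub>F h in at 0. norm (flat_fun n h / h) \<le> fact (n + 2) * \<bar>h\<bar>"
      proof (intro always_eventually allI)
        fix h :: real
        have "\<bar>flat_fun n h\<bar> / \<bar>h\<bar> \<le> (fact (n + 2) * h\<^sup>2) / \<bar>h\<bar>"
          by (intro divide_right_mono flat_fun_bound) auto
        also have "\<dots> = fact (n + 2) * \<bar>h\<bar>"
          by (cases "0 \<le> h") (simp_all add: power2_eq_square)
        finally show "norm (flat_fun n h / h) \<le> fact (n + 2) * \<bar>h\<bar>"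
          by simp
      qed
      show "((\<lambda>h. fact (n + 2) * \<bar>h\<bar>) \<longlongrightarrow> 0) (at (0::real))" by (auto intro!: tendsto_eq_intros)
    qed
    then show ?thesis using 2 by (simp add: DERIV_def flat_fun_def)
  next
    case 3
    have "((\<lambda>t. exp (- (1 / t)) / t ^ n) has_real_derivative flat_fun (n + 2) t - real n * flat_fun (n + 1) t) (at t)"
    proof (rule DERIV_cong)
      show "((\<lambda>t. exp (- (1 / t)) / t ^ n) has_real_derivative
          (exp (- (1 / t)) * (1 / t\<^sup>2) * t ^ n - exp (- (1 / t)) * (real n * t ^ (n - 1))) / (t ^ n * t ^ n)) (at t)"
        using 3 by (auto intro!: derivative_eq_intros simp: power2_eq_square)
      show "(exp (- (1 / t)) * (1 / t\<^sup>2) * t ^ n - exp (- (1 / t)) * (real n * t ^ (n - 1))) / (t ^ n * t ^ n)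
          = flat_fun (n + 2) t - real n * flat_fun (n + 1) t"
        using 3 by (cases n) (simp_all add: flat_fun_def diff_divide_distrib power2_eq_square mult_ac)
    qed
    then show ?thesis
      by (rule has_field_derivative_transform_within_open[where S="{0<..}"]) (use 3 in \<open>auto simp: flat_fun_def\<close>)
  qed
qed

lemma smooth_flat_fun: "smooth_on UNIV (flat_fun n)"
proof -
  have "Ck_on k UNIV (flat_fun n)" for k
  proof (induction k arbitrary: n)
    case 0
    show ?case using flat_fun_deriv by (auto intro!: continuous_at_imp_continuous_on DERIV_isCont)
  next
    case (Suc k)
    have "Ck_on k UNIV (\<lambda>x. v * (flat_fun (n + 2) x + (- real n) * flat_fun (n + 1) x))" for v
      by (intro Ck_on_bilinear[OF _ bounded_bilinear_mult] Ck_on_add Ck_on_const Suc) auto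
    then show ?case
      by (intro Ck_on_SucI[where f'="\<lambda>x v. v * (flat_fun (n + 2) x + (- real n) * flat_fun (n + 1) x)"])
        (use flat_fun_deriv[of n] in \<open>auto simp: has_field_derivative_def mult.commute[of _ "_ - _"]
           intro: has_derivative_eq_rhs\<close>)
  qed
  then show ?thesis by (simp add: smooth_on_def)
qed

lemma orthonormal_basis_real: "orthonormal_basis {1::real}"
  by (simp add: orthonormal_basis_def)

text \<open>With \<open>u\<close> flat at \<open>b\<close> and \<open>v\<close> flat at \<open>a\<close>, the quotient \<open>u / (u + v)\<close> does it.\<close>

lemma smooth_cutoff:
  assumes "a < b"
  obtains \<rho> :: "real \<Rightarrow> real" where "smooth_on UNIV \<rho>" "\<And>t. t \<le> a \<Longrightarrow> \<rho> t = 1" "\<And>t. b \<le> t \<Longrightarrow> \<rho> t = 0"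
proof -
  define u where "u t = flat_fun 0 (b - t)" for t
  define v where "v t = flat_fun 0 (t - a)" for t
  have lin: "smooth_on UNIV (\<lambda>t::real. c + d * t)" for c d
    by (intro smooth_on_add smooth_on_const smooth_on_linear bounded_linear_mult_right) auto
  have u: "smooth_on UNIV u" unfolding u_def
    using smooth_on_compose[OF _ _ orthonormal_basis_real _ lin[of b "-1"] smooth_flat_fun[of 0]] by simp
  have v: "smooth_on UNIV v" unfolding v_def
    using smooth_on_compose[OF _ _ orthonormal_basis_real _ lin[of "-a" 1] smooth_flat_fun[of 0]] by simp
  have nz: "u t + v t \<noteq> 0" for t
  proof -
    have "0 \<le> u t" "0 \<le> v t" "0 < u t \<or> 0 < v t" using assms by (auto simp: u_def v_def flat_fun_def)
    then show ?thesis by linarith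
  qed
  show ?thesis
  proof (rule that[of "\<lambda>t. u t * inverse (u t + v t)"])
    show "smooth_on UNIV (\<lambda>t. u t * inverse (u t + v t))"
      by (intro smooth_on_bilinear[OF _ bounded_bilinear_mult] smooth_on_inverse smooth_on_add u v nz) auto
    show "u t * inverse (u t + v t) = 1" if "t \<le> a" for t
      using that nz[of t] by (simp add: v_def flat_fun_def)
    show "u t * inverse (u t + v t) = 0" if "b \<le> t" for t
      using that by (simp add: u_def flat_fun_def)
  qed
qed

section \<open>Smooth maps between manifolds\<close>

abbreviation smooth_fun_on ::
  "('m::t2_space, 'e::real_normed_vector) atlas \<Rightarrow> 'm set \<Rightarrow> ('m \<Rightarrow> 'b::real_normed_vector) \<Rightarrow> bool" where
  "smooth_fun_on A W f \<equiv> smooth_map_on A model_atlas W f"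

text \<open>What the composition of smooth maps asks of the atlases. Leaving out the compatibility of the charts
  makes the notion pass to product atlases at once.\<close>

definition charted :: "('m::t2_space, 'e::real_inner) atlas \<Rightarrow> bool" where
  "charted A \<longleftrightarrow> (\<exists>B::'e set. finite B \<and> span B = UNIV) \<and> (\<Union>(U, \<phi>)\<in>A. U) = UNIV \<and>
     (\<forall>(U, \<phi>)\<in>A. open U \<and> open (\<phi> ` U) \<and> homeomorphism U (\<phi> ` U) \<phi> (inv_into U \<phi>))"

lemma smooth_manifold_charted: "smooth_manifold A \<Longrightarrow> charted A"
  by (simp add: smooth_manifold_def charted_def)

lemma charted_basis:
  fixes A :: "('m::t2_space, 'e::real_inner) atlas"
  assumes "charted A"
  obtains E :: "'e set" where "orthonormal_basis E"
proof -
  obtain B :: "'e set" where "finite B" "span B = UNIV" using assms unfolding charted_def by blast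
  then show ?thesis using orthonormal_basis_exists that by blast
qed

lemma charted_cover:
  assumes "charted A"
  obtains U \<phi> where "(U, \<phi>) \<in> A" "x \<in> U"
proof -
  have "x \<in> (\<Union>(U, \<phi>)\<in>A. U)" using assms by (simp add: charted_def)
  then show ?thesis using that by blast
qed

context
  fixes A :: "('m::t2_space, 'e::real_inner) atlas" and U \<phi>
  assumes A: "charted A" and chart: "(U, \<phi>) \<in> A"
begin

lemma chart_homeomorphism: "homeomorphism U (\<phi> ` U) \<phi> (inv_into U \<phi>)"
  and chart_open: "open U" and chart_image_open: "open (\<phi> ` U)"
  using A chart unfolding charted_def by blast+

lemma chart_inv [simp]: "x \<in> U \<Longrightarrow> inv_into U \<phi> (\<phi> x) = x"
  using chart_homeomorphism by (simp add: homeomorphism_def)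

lemma chart_inj: "inj_on \<phi> U"
  by (metis chart_inv inj_on_inverseI)

lemma chart_open_map: 
  assumes "open O'" shows "open (\<phi> ` (U \<inter> O'))"
proof -
  have "\<phi> ` (U \<inter> O') = \<phi> ` U \<inter> inv_into U \<phi> -` (U \<inter> O')" 
    using chart_inv by force
  moreover have "continuous_on (\<phi> ` U) (inv_into U \<phi>)" using chart_homeomorphism by (simp add: homeomorphism_def)
  ultimately show ?thesis
    using continuous_open_preimage[of "\<phi> ` U" "inv_into U \<phi>" "U \<inter> O'"] chart_image_open chart_open assms by auto
qed

end

lemma open_vimage_Int:
  assumes "open W" "continuous_on W f" "open V"
  shows "open (W \<inter> f -` V)"
  using continuous_open_preimage assms by blast

lemma smooth_map_onI:
  assumes "continuous_on W f"
    "\<And>U \<phi> V \<psi>. (U, \<phi>) \<in> A \<Longrightarrow> (V, \<psi>) \<in> B \<Longrightarrow> smooth_on (\<phi> ` (U \<inter> W \<inter> f -` V)) (\<psi> \<circ> f \<circ> inv_into U \<phi>)"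
  shows "smooth_map_on A B W f"
  using assms unfolding smooth_map_on_def by blast

lemma smooth_map_onD:
  assumes "smooth_map_on A B W f"
  shows "continuous_on W f"
    "(U, \<phi>) \<in> A \<Longrightarrow> (V, \<psi>) \<in> B \<Longrightarrow> smooth_on (\<phi> ` (U \<inter> W \<inter> f -` V)) (\<psi> \<circ> f \<circ> inv_into U \<phi>)"
  using assms unfolding smooth_map_on_def by blast+

lemma open_chart_vimage:
  assumes "charted A" "(U, \<phi>) \<in> A" "open W" "continuous_on W f" "open V"
  shows "open (\<phi> ` (U \<inter> W \<inter> f -` V))"
  using chart_open_map[OF assms(1,2) open_vimage_Int[OF assms(3-5)]] by (simp add: Int_assoc)

lemma smooth_map_on_subset:
  assumes "smooth_map_on A B W f" "W' \<subseteq> W"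
  shows "smooth_map_on A B W' f"
proof (rule smooth_map_onI)
  show "continuous_on W' f" using smooth_map_onD(1)[OF assms(1)] assms(2) continuous_on_subset by blast
  fix U \<phi> V \<psi> assume "(U, \<phi>) \<in> A" "(V, \<psi>) \<in> B"
  from smooth_map_onD(2)[OF assms(1) this]
  show "smooth_on (\<phi> ` (U \<inter> W' \<inter> f -` V)) (\<psi> \<circ> f \<circ> inv_into U \<phi>)"
    by (rule smooth_on_subset) (use assms(2) in blast)
qed

lemma smooth_map_on_cong:
  assumes "charted A" "charted B" "open W" "smooth_map_on A B W f" "\<And>x. x \<in> W \<Longrightarrow> f x = g x"
  shows "smooth_map_on A B W g"
proof (rule smooth_map_onI)
  show "continuous_on W g"
    using smooth_map_onD(1)[OF assms(4)] assms(5) continuous_on_cong[of W W f g] by auto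
  fix U \<phi> V \<psi> assume c: "(U, \<phi>) \<in> A" "(V, \<psi>) \<in> B"
  have eq: "U \<inter> W \<inter> f -` V = U \<inter> W \<inter> g -` V" using assms(5) by auto
  show "smooth_on (\<phi> ` (U \<inter> W \<inter> g -` V)) (\<psi> \<circ> g \<circ> inv_into U \<phi>)"
  proof (rule smooth_on_cong)
    show "open (\<phi> ` (U \<inter> W \<inter> g -` V))"
      unfolding eq[symmetric]
      by (rule open_chart_vimage[OF assms(1) c(1) assms(3) smooth_map_onD(1)[OF assms(4)] chart_open[OF assms(2) c(2)]])
    show "smooth_on (\<phi> ` (U \<inter> W \<inter> g -` V)) (\<psi> \<circ> f \<circ> inv_into U \<phi>)"
      using smooth_map_onD(2)[OF assms(4) c] by (simp add: eq)
  qed (use assms(1,5) c(1) in auto)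
qed

lemma smooth_map_on_local:
  assumes "charted A" "charted B" "\<And>p. p \<in> W \<Longrightarrow> \<exists>W'. open W' \<and> p \<in> W' \<and> smooth_map_on A B W' f"
  shows "smooth_map_on A B W f"
proof (rule smooth_map_onI)
  show "continuous_on W f"
    by (intro continuous_at_imp_continuous_on ballI)
      (use assms(3) smooth_map_onD(1) continuous_on_eq_continuous_at in meson)
  fix U \<phi> V \<psi> assume c: "(U, \<phi>) \<in> A" "(V, \<psi>) \<in> B"
  show "smooth_on (\<phi> ` (U \<inter> W \<inter> f -` V)) (\<psi> \<circ> f \<circ> inv_into U \<phi>)"
  proof (rule smooth_on_local)
    fix y assume "y \<in> \<phi> ` (U \<inter> W \<inter> f -` V)"
    then obtain x where x: "y = \<phi> x" "x \<in> U" "x \<in> W" "f x \<in> V" by blast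
    obtain W' where W': "open W'" "x \<in> W'" "smooth_map_on A B W' f" using assms(3) x(3) by blast
    show "\<exists>S. open S \<and> y \<in> S \<and> smooth_on S (\<psi> \<circ> f \<circ> inv_into U \<phi>)"
      by (rule exI[of _ "\<phi> ` (U \<inter> W' \<inter> f -` V)"])
        (use open_chart_vimage[OF assms(1) c(1) W'(1) smooth_map_onD(1)[OF W'(3)] chart_open[OF assms(2) c(2)]]
          smooth_map_onD(2)[OF W'(3) c] x W' in blast)
  qed
qed

text \<open>Near a given point any one chart of the middle manifold serves to split the composition.\<close>

lemma smooth_map_on_compose:
  fixes B :: "('n::t2_space, 'f::real_inner) atlas"
  assumes "charted A" "charted B" "charted C" "open W" "open W'"
    "smooth_map_on A B W f" "smooth_map_on B C W' g" "f ` W \<subseteq> W'"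
  shows "smooth_map_on A C W (\<lambda>x. g (f x))"
proof (rule smooth_map_onI)
  note cf = smooth_map_onD(1)[OF assms(6)] and cg = smooth_map_onD(1)[OF assms(7)]
  show cgf: "continuous_on W (\<lambda>x. g (f x))"
    using continuous_on_compose2[OF cg cf assms(8)] .
  fix U \<phi> V \<psi> assume c: "(U, \<phi>) \<in> A" "(V, \<psi>) \<in> C"
  show "smooth_on (\<phi> ` (U \<inter> W \<inter> (\<lambda>x. g (f x)) -` V)) (\<psi> \<circ> (\<lambda>x. g (f x)) \<circ> inv_into U \<phi>)"
  proof (rule smooth_on_local)
    fix y assume "y \<in> \<phi> ` (U \<inter> W \<inter> (\<lambda>x. g (f x)) -` V)"
    then obtain x where x: "y = \<phi> x" "x \<in> U" "x \<in> W" "g (f x) \<in> V" by blast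
    obtain V' \<xi> where V': "(V', \<xi>) \<in> B" "f x \<in> V'" using charted_cover[OF assms(2)] by blast
    obtain E :: "'f set" where E: "orthonormal_basis E" using charted_basis[OF assms(2)] .
    define T where "T = \<xi> ` (V' \<inter> W' \<inter> g -` V)"
    define S where "S = \<phi> ` (U \<inter> (W \<inter> f -` V' \<inter> (W \<inter> (\<lambda>x. g (f x)) -` V)))"
    have opS: "open S" unfolding S_def
      by (intro chart_open_map[OF assms(1) c(1)] open_Int open_vimage_Int[OF assms(4) cf] open_vimage_Int[OF assms(4) cgf]
          chart_open[OF assms(2) V'(1)] chart_open[OF assms(3) c(2)])
    have opT: "open T" unfolding T_def
      by (rule open_chart_vimage[OF assms(2) V'(1) assms(5) cg chart_open[OF assms(3) c(2)]])
    have 1: "smooth_on S (\<xi> \<circ> f \<circ> inv_into U \<phi>)"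
      by (rule smooth_on_subset[OF smooth_map_onD(2)[OF assms(6) c(1) V'(1)]]) (auto simp: S_def)
    have 2: "smooth_on T (\<psi> \<circ> g \<circ> inv_into V' \<xi>)"
      unfolding T_def by (rule smooth_map_onD(2)[OF assms(7) V'(1) c(2)])
    have sub: "(\<xi> \<circ> f \<circ> inv_into U \<phi>) ` S \<subseteq> T"
      using assms(8) assms(1) c(1) by (auto simp: S_def T_def)
    have "smooth_on S (\<lambda>z. (\<psi> \<circ> g \<circ> inv_into V' \<xi>) ((\<xi> \<circ> f \<circ> inv_into U \<phi>) z))"
      by (rule smooth_on_compose[OF opS opT E sub 1 2])
    then have "smooth_on S (\<psi> \<circ> (\<lambda>x. g (f x)) \<circ> inv_into U \<phi>)"
      by (rule smooth_on_cong[OF opS, rotated]) (use assms(1,2) c(1) V'(1) in \<open>auto simp: S_def\<close>)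
    then show "\<exists>S. open S \<and> y \<in> S \<and> smooth_on S (\<psi> \<circ> (\<lambda>x. g (f x)) \<circ> inv_into U \<phi>)"
      using opS x V' by (auto simp: S_def intro!: exI[of _ S])
  qed
qed

lemma charted_model: "orthonormal_basis (E :: 'b::real_inner set) \<Longrightarrow> charted (model_atlas :: ('b, 'b) atlas)"
proof -
  assume E: "orthonormal_basis E"
  have "x \<in> span E" for x
  proof -
    have "(\<Sum>e\<in>E. (x \<bullet> e) *\<^sub>R e) \<in> span E" by (intro span_sum span_scale span_base)
    then show ?thesis using E by (simp add: orthonormal_basis_def)
  qed
  then have "span E = UNIV" by blast
  moreover have "homeomorphism UNIV UNIV (\<lambda>x. x) (inv_into UNIV (\<lambda>x::'b. x))"
    by (simp add: homeomorphism_def inv_into_def[abs_def] inj_imp_inv_eq)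
  moreover have "finite E" using E by (simp add: orthonormal_basis_def)
  ultimately show ?thesis by (auto simp: charted_def model_atlas_def)
qed

lemma orthonormal_basis_complex: "orthonormal_basis {1, \<i>}"
  by (auto simp: orthonormal_basis_def inner_complex_def complex_eq_iff)

lemma charted_model_complex [simp]: "charted (model_atlas :: (complex, complex) atlas)"
  by (rule charted_model[OF orthonormal_basis_complex])

subsection \<open>Scalar functions\<close>

text \<open>For functions into a normed space continuity need not be asked separately; it can be read off in the
  charts of the source.\<close>

lemma smooth_fun_on_iff:
  assumes "charted A" "open W"
  shows "smooth_fun_on A W f \<longleftrightarrow> (\<forall>U \<phi>. (U, \<phi>) \<in> A \<longrightarrow> smooth_on (\<phi> ` (U \<inter> W)) (f \<circ> inv_into U \<phi>))"
    (is "?l \<longleftrightarrow> ?r")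
proof
  assume ?l
  then show ?r using smooth_map_onD(2)[of A model_atlas W f _ _ UNIV "\<lambda>x. x"]
    by (auto simp: model_atlas_def comp_def)
next
  assume r: ?r
  show ?l
  proof (rule smooth_map_onI)
    fix U \<phi> V and \<psi> :: "'c \<Rightarrow> 'c" assume "(U, \<phi>) \<in> A" "(V, \<psi>) \<in> model_atlas"
    then show "smooth_on (\<phi> ` (U \<inter> W \<inter> f -` V)) (\<psi> \<circ> f \<circ> inv_into U \<phi>)"
      using r by (auto simp: model_atlas_def comp_def)
  next
    show "continuous_on W f"
    proof (rule continuous_at_imp_continuous_on, intro ballI)
      fix x assume x: "x \<in> W"
      obtain U \<phi> where U: "(U, \<phi>) \<in> A" "x \<in> U" using charted_cover[OF assms(1)] .
      have op: "open (U \<inter> W)" using chart_open[OF assms(1) U(1)] assms(2) by blast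
      have "continuous_on U \<phi>" using chart_homeomorphism[OF assms(1) U(1)] by (simp add: homeomorphism_def)
      then have "continuous_on (U \<inter> W) \<phi>" using continuous_on_subset by blast
      moreover have "continuous_on (\<phi> ` (U \<inter> W)) (f \<circ> inv_into U \<phi>)"
        using r U smooth_on_imp_continuous_on by blast
      ultimately have "continuous_on (U \<inter> W) (\<lambda>z. (f \<circ> inv_into U \<phi>) (\<phi> z))"
        using continuous_on_compose2 by blast
      then have "continuous_on (U \<inter> W) f"
        by (rule continuous_on_eq) (use assms(1) U(1) in auto)
      then show "isCont f x" using op x U continuous_on_eq_continuous_at by blast
    qed
  qed
qed

context
  fixes A :: "('m::t2_space, 'e::real_inner) atlas" and W :: "'m set"
  assumes A: "charted A" and W: "open W"
begin

private lemma iff: "smooth_fun_on A W f \<longleftrightarrow> (\<forall>U \<phi>. (U, \<phi>) \<in> A \<longrightarrow> smooth_on (\<phi> ` (U \<inter> W)) (\<lambda>y. f (inv_into U \<phi> y)))"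
  using smooth_fun_on_iff[OF A W, of f] by (simp add: comp_def)

lemma smooth_fun_on_const: "smooth_fun_on A W (\<lambda>x. c)"
  by (simp add: iff)

lemma smooth_fun_on_add: "smooth_fun_on A W f \<Longrightarrow> smooth_fun_on A W g \<Longrightarrow> smooth_fun_on A W (\<lambda>x. f x + g x)"
  by (simp add: iff smooth_on_add chart_open_map[OF A _ W])

lemma smooth_fun_on_sum: "(\<And>i. i \<in> I \<Longrightarrow> smooth_fun_on A W (f i)) \<Longrightarrow> smooth_fun_on A W (\<lambda>x. \<Sum>i\<in>I. f i x)"
  by (simp add: iff smooth_on_sum chart_open_map[OF A _ W])

lemma smooth_fun_on_bounded_linear: "bounded_linear h \<Longrightarrow> smooth_fun_on A W f \<Longrightarrow> smooth_fun_on A W (\<lambda>x. h (f x))"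
  unfolding iff using smooth_on_bounded_linear[OF chart_open_map[OF A _ W]] by blast

lemma smooth_fun_on_bilinear:
  "bounded_bilinear b \<Longrightarrow> smooth_fun_on A W f \<Longrightarrow> smooth_fun_on A W g \<Longrightarrow> smooth_fun_on A W (\<lambda>x. b (f x) (g x))"
  unfolding iff using smooth_on_bilinear[OF chart_open_map[OF A _ W]] by blast

lemma smooth_fun_on_mult:
  fixes f g :: "'m \<Rightarrow> 'b::real_normed_algebra"
  shows "smooth_fun_on A W f \<Longrightarrow> smooth_fun_on A W g \<Longrightarrow> smooth_fun_on A W (\<lambda>x. f x * g x)"
  by (rule smooth_fun_on_bilinear[OF bounded_bilinear_mult])

lemma smooth_fun_on_minus: "smooth_fun_on A W f \<Longrightarrow> smooth_fun_on A W (\<lambda>x. - f x)"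
  by (rule smooth_fun_on_bounded_linear[OF bounded_linear_minus[OF bounded_linear_ident]])

lemma smooth_fun_on_diff: "smooth_fun_on A W f \<Longrightarrow> smooth_fun_on A W g \<Longrightarrow> smooth_fun_on A W (\<lambda>x. f x - g x)"
  using smooth_fun_on_add[OF _ smooth_fun_on_minus] by simp

lemma smooth_fun_on_inverse:
  fixes f :: "'m \<Rightarrow> 'b::real_normed_div_algebra"
  shows "(\<And>x. x \<in> W \<Longrightarrow> f x \<noteq> 0) \<Longrightarrow> smooth_fun_on A W f \<Longrightarrow> smooth_fun_on A W (\<lambda>x. inverse (f x))"
  unfolding iff
proof (intro allI impI)
  fix U \<phi> assume nz: "\<And>x. x \<in> W \<Longrightarrow> f x \<noteq> 0"
    and s: "\<forall>U \<phi>. (U, \<phi>) \<in> A \<longrightarrow> smooth_on (\<phi> ` (U \<inter> W)) (\<lambda>y. f (inv_into U \<phi> y))" and c: "(U, \<phi>) \<in> A"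
  show "smooth_on (\<phi> ` (U \<inter> W)) (\<lambda>y. inverse (f (inv_into U \<phi> y)))"
    by (rule smooth_on_inverse[OF chart_open_map[OF A c W]]) (use nz s c A in auto)
qed

lemma smooth_fun_on_divide:
  fixes f g :: "'m \<Rightarrow> 'b::real_normed_field"
  shows "(\<And>x. x \<in> W \<Longrightarrow> g x \<noteq> 0) \<Longrightarrow> smooth_fun_on A W f \<Longrightarrow> smooth_fun_on A W g \<Longrightarrow> smooth_fun_on A W (\<lambda>x. f x / g x)"
  unfolding divide_inverse by (intro smooth_fun_on_mult smooth_fun_on_inverse)

lemma smooth_fun_on_Re: "smooth_fun_on A W f \<Longrightarrow> smooth_fun_on A W (\<lambda>x. Re (f x))"
  by (rule smooth_fun_on_bounded_linear[OF bounded_linear_Re])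

lemma smooth_fun_on_Im: "smooth_fun_on A W f \<Longrightarrow> smooth_fun_on A W (\<lambda>x. Im (f x))"
  by (rule smooth_fun_on_bounded_linear[OF bounded_linear_Im])

lemma smooth_fun_on_of_real: "smooth_fun_on A W f \<Longrightarrow> smooth_fun_on A W (\<lambda>x. complex_of_real (f x))"
  by (rule smooth_fun_on_bounded_linear[OF bounded_linear_of_real])

lemma smooth_fun_on_Complex: "smooth_fun_on A W f \<Longrightarrow> smooth_fun_on A W g \<Longrightarrow> smooth_fun_on A W (\<lambda>x. Complex (f x) (g x))"
  unfolding Complex_eq
  by (intro smooth_fun_on_add smooth_fun_on_mult smooth_fun_on_const smooth_fun_on_of_real)

lemma smooth_fun_on_compose:
  fixes f :: "'m \<Rightarrow> 'b::real_inner" and E :: "'b set"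
  assumes "orthonormal_basis E" "open T" "f ` W \<subseteq> T" "smooth_fun_on A W f" "smooth_on T g"
  shows "smooth_fun_on A W (\<lambda>x. g (f x))"
  unfolding iff
proof (intro allI impI)
  fix U \<phi> assume c: "(U, \<phi>) \<in> A"
  show "smooth_on (\<phi> ` (U \<inter> W)) (\<lambda>y. g (f (inv_into U \<phi> y)))"
    by (rule smooth_on_compose[OF chart_open_map[OF A c W] assms(2,1) _ _ assms(5)])
      (use assms(3,4) c A in \<open>auto simp: iff\<close>)
qed

lemma smooth_fun_on_cong:
  assumes "smooth_fun_on A W f" "\<And>x. x \<in> W \<Longrightarrow> f x = g x"
  shows "smooth_fun_on A W g"
  unfolding iff
proof (intro allI impI)
  fix U \<phi> assume c: "(U, \<phi>) \<in> A"
  show "smooth_on (\<phi> ` (U \<inter> W)) (\<lambda>y. g (inv_into U \<phi> y))"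
    by (rule smooth_on_cong[OF chart_open_map[OF A c W], of "\<lambda>y. f (inv_into U \<phi> y)"])
      (use assms c A in \<open>auto simp: iff\<close>)
qed

end

lemma smooth_fun_on_local:
  assumes "charted A" "\<And>p. p \<in> W \<Longrightarrow> \<exists>W'. open W' \<and> p \<in> W' \<and> smooth_fun_on A W' f" "open W"
  shows "smooth_fun_on A W f"
  unfolding smooth_fun_on_iff[OF assms(1,3)]
proof (intro allI impI, rule smooth_on_local)
  fix U \<phi> y assume c: "(U, \<phi>) \<in> A" and "y \<in> \<phi> ` (U \<inter> W)"
  then obtain x where x: "y = \<phi> x" "x \<in> U" "x \<in> W" by blast
  obtain W' where W': "open W'" "x \<in> W'" "smooth_fun_on A W' f" using assms(2) x(3) by blast
  then show "\<exists>S. open S \<and> y \<in> S \<and> smooth_on S (f \<circ> inv_into U \<phi>)"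
    using chart_open_map[OF assms(1) c W'(1)] x smooth_fun_on_iff[OF assms(1) W'(1)] c by blast
qed


text \<open>This is composition with a function whose values lie in an arbitrary normed space, where
  \<open>smooth_map_on_compose\<close> would ask for a finite-dimensional one.\<close>

lemma smooth_fun_on_pullback:
  fixes B :: "('n::t2_space, 'f::real_inner) atlas"
  assumes "charted A" "charted B" "open W" "open W'"
    "smooth_map_on A B W f" "smooth_fun_on B W' g" "f ` W \<subseteq> W'"
  shows "smooth_fun_on A W (\<lambda>x. g (f x))"
  unfolding smooth_fun_on_iff[OF assms(1,3)]
proof (intro allI impI, rule smooth_on_local)
  note cf = smooth_map_onD(1)[OF assms(5)]
  fix U \<phi> y assume c: "(U, \<phi>) \<in> A" and "y \<in> \<phi> ` (U \<inter> W)"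
  then obtain x where x: "y = \<phi> x" "x \<in> U" "x \<in> W" by blast
  obtain V \<xi> where V: "(V, \<xi>) \<in> B" "f x \<in> V" using charted_cover[OF assms(2)] by blast
  obtain E :: "'f set" where E: "orthonormal_basis E" using charted_basis[OF assms(2)] .
  define S where "S = \<phi> ` (U \<inter> W \<inter> f -` V)"
  have opS: "open S" unfolding S_def
    by (rule open_chart_vimage[OF assms(1) c assms(3) cf chart_open[OF assms(2) V(1)]])
  have opT: "open (\<xi> ` (V \<inter> W'))" by (rule chart_open_map[OF assms(2) V(1) assms(4)])
  have 1: "smooth_on S (\<xi> \<circ> f \<circ> inv_into U \<phi>)"
    unfolding S_def by (rule smooth_map_onD(2)[OF assms(5) c V(1)])
  have 2: "smooth_on (\<xi> ` (V \<inter> W')) (g \<circ> inv_into V \<xi>)"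
    using assms(6) V(1) smooth_fun_on_iff[OF assms(2,4)] by blast
  have sub: "(\<xi> \<circ> f \<circ> inv_into U \<phi>) ` S \<subseteq> \<xi> ` (V \<inter> W')"
    using assms(7,1) c by (auto simp: S_def)
  have "smooth_on S (\<lambda>z. (g \<circ> inv_into V \<xi>) ((\<xi> \<circ> f \<circ> inv_into U \<phi>) z))"
    by (rule smooth_on_compose[OF opS opT E sub 1 2])
  then have "smooth_on S ((\<lambda>x. g (f x)) \<circ> inv_into U \<phi>)"
    by (rule smooth_on_cong[OF opS, rotated]) (use assms(1,2) c(1) V(1) in \<open>auto simp: S_def\<close>)
  then show "\<exists>S. open S \<and> y \<in> S \<and> smooth_on S ((\<lambda>x. g (f x)) \<circ> inv_into U \<phi>)"
    using opS x V by (auto simp: S_def intro!: exI[of _ S])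
qed

subsection \<open>Charts, identity and products\<close>

lemma smooth_manifold_compat:
  assumes "smooth_manifold A" "(U, \<phi>) \<in> A" "(V, \<psi>) \<in> A"
  shows "smooth_on (\<phi> ` (U \<inter> V)) (\<psi> \<circ> inv_into U \<phi>)"
  using assms unfolding smooth_manifold_def by blast

lemma smooth_chart:
  assumes "smooth_manifold A" "(U, \<phi>) \<in> A"
  shows "smooth_fun_on A U \<phi>"
  unfolding smooth_fun_on_iff[OF smooth_manifold_charted[OF assms(1)] chart_open[OF smooth_manifold_charted[OF assms(1)] assms(2)]]
  using smooth_manifold_compat[OF assms(1) _ assms(2)] by blast

lemma smooth_map_id:
  assumes "smooth_manifold A"
  shows "smooth_map_on A A W (\<lambda>x. x)"
proof (rule smooth_map_onI)
  fix U \<phi> V \<psi> assume "(U, \<phi>) \<in> A" "(V, \<psi>) \<in> A"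
  from smooth_manifold_compat[OF assms this]
  show "smooth_on (\<phi> ` (U \<inter> W \<inter> (\<lambda>x. x) -` V)) (\<psi> \<circ> (\<lambda>x. x) \<circ> inv_into U \<phi>)"
    unfolding comp_def by (rule smooth_on_subset) auto
qed (rule continuous_on_id)

lemma inv_into_map_prod:
  assumes "inj_on \<phi> U" "inj_on \<psi> V" "y \<in> \<phi> ` U" "z \<in> \<psi> ` V"
  shows "inv_into (U \<times> V) (map_prod \<phi> \<psi>) (y, z) = (inv_into U \<phi> y, inv_into V \<psi> z)"
proof (rule inv_into_f_eq)
  show "inj_on (map_prod \<phi> \<psi>) (U \<times> V)" using assms(1,2) by (rule map_prod_inj_on)
qed (use assms in \<open>auto simp: inv_into_into f_inv_into_f\<close>)

lemma prod_atlasE: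
  assumes "(P, \<xi>) \<in> prod_atlas A B"
  obtains U \<phi> V \<psi> where "(U, \<phi>) \<in> A" "(V, \<psi>) \<in> B" "P = U \<times> V" "\<xi> = map_prod \<phi> \<psi>"
  using assms unfolding prod_atlas_def by auto

lemma prod_atlasI: "(U, \<phi>) \<in> A \<Longrightarrow> (V, \<psi>) \<in> B \<Longrightarrow> (U \<times> V, map_prod \<phi> \<psi>) \<in> prod_atlas A B"
  unfolding prod_atlas_def by blast

lemma charted_prod:
  fixes A :: "('m::t2_space, 'e::real_inner) atlas" and B :: "('n::t2_space, 'f::real_inner) atlas"
  assumes A: "charted A" and B: "charted B"
  shows "charted (prod_atlas A B)"
  unfolding charted_def
proof (intro conjI)
  obtain X :: "'e set" where "finite X" "span X = UNIV" using A unfolding charted_def by blast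
  moreover obtain Y :: "'f set" where "finite Y" "span Y = UNIV" using B unfolding charted_def by blast
  moreover define Z where "Z = (\<lambda>x. (x, 0)) ` X \<union> (\<lambda>y. (0, y)) ` Y"
  moreover have "(a, b) \<in> span Z" for a :: 'e and b :: 'f
  proof -
    have "(\<lambda>x. (x, 0)) ` span X \<subseteq> span Z"
      by (subst linear_span_image[symmetric]) (auto intro!: span_mono linearI simp: Z_def)
    moreover have "(\<lambda>y. (0, y)) ` span Y \<subseteq> span Z"
      by (subst linear_span_image[symmetric]) (auto intro!: span_mono linearI simp: Z_def)
    ultimately have "(a, 0) \<in> span Z" "(0, b) \<in> span Z"
      using \<open>span X = UNIV\<close> \<open>span Y = UNIV\<close> by auto
    then show ?thesis using span_add by fastforce
  qed
  ultimately show "\<exists>Z :: ('e \<times> 'f) set. finite Z \<and> span Z = UNIV"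
    by (intro exI[of _ Z]) auto
  show "(\<Union>(U, \<phi>)\<in>prod_atlas A B. U) = UNIV"
  proof (intro UNIV_eq_I[symmetric])
    fix p :: "'m \<times> 'n"
    obtain U \<phi> where 1: "(U, \<phi>) \<in> A" "fst p \<in> U" using charted_cover[OF A] .
    obtain V \<psi> where 2: "(V, \<psi>) \<in> B" "snd p \<in> V" using charted_cover[OF B] .
    show "p \<in> (\<Union>(U, \<phi>)\<in>prod_atlas A B. U)"
      using prod_atlasI[OF 1(1) 2(1)] 1(2) 2(2) by (auto intro!: bexI[of _ "(U \<times> V, map_prod \<phi> \<psi>)"] simp: mem_Times_iff)
  qed
  show "\<forall>(P, \<xi>)\<in>prod_atlas A B. open P \<and> open (\<xi> ` P) \<and> homeomorphism P (\<xi> ` P) \<xi> (inv_into P \<xi>)"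
  proof (intro ballI, clarify)
    fix P \<xi> assume "(P, \<xi>) \<in> prod_atlas A B"
    then obtain U \<phi> V \<psi> where c: "(U, \<phi>) \<in> A" "(V, \<psi>) \<in> B" and P: "P = U \<times> V" "\<xi> = map_prod \<phi> \<psi>"
      by (rule prod_atlasE)
    note inj = chart_inj[OF A c(1)] chart_inj[OF B c(2)]
    have im: "\<xi> ` P = \<phi> ` U \<times> \<psi> ` V" unfolding P by (rule map_prod_image)
    note h = chart_homeomorphism[OF A c(1)] chart_homeomorphism[OF B c(2)]
    have op: "open P" "open (\<xi> ` P)"
      using open_Times[OF chart_open[OF A c(1)] chart_open[OF B c(2)]]
        open_Times[OF chart_image_open[OF A c(1)] chart_image_open[OF B c(2)]]
      unfolding im by (simp_all add: P(1))
    have "homeomorphism P (\<xi> ` P) \<xi> (inv_into P \<xi>)"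
      unfolding homeomorphism_def
    proof (intro conjI)
      have c1: "continuous_on U \<phi>" "continuous_on (\<phi> ` U) (inv_into U \<phi>)"
        and c2: "continuous_on V \<psi>" "continuous_on (\<psi> ` V) (inv_into V \<psi>)"
        using h by (simp_all add: homeomorphism_def)
      have "continuous_on (U \<times> V) (\<lambda>p. (\<phi> (fst p), \<psi> (snd p)))"
        by (intro continuous_on_Pair continuous_on_compose2[OF c1(1) continuous_on_fst[OF continuous_on_id]]
            continuous_on_compose2[OF c2(1) continuous_on_snd[OF continuous_on_id]]) auto
      then show "continuous_on P \<xi>" by (simp add: P map_prod_def split_beta)
      have "continuous_on (\<phi> ` U \<times> \<psi> ` V) (\<lambda>p. (inv_into U \<phi> (fst p), inv_into V \<psi> (snd p)))"
        by (intro continuous_on_Pair continuous_on_compose2[OF c1(2) continuous_on_fst[OF continuous_on_id]]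
            continuous_on_compose2[OF c2(2) continuous_on_snd[OF continuous_on_id]]) auto
      then show "continuous_on (\<xi> ` P) (inv_into P \<xi>)"
        unfolding im
        by (rule continuous_on_eq) (use inv_into_map_prod[OF inj] in \<open>auto simp: P\<close>)
      have injP: "inj_on \<xi> P" unfolding P by (rule map_prod_inj_on[OF inj])
      show "\<forall>x\<in>P. inv_into P \<xi> (\<xi> x) = x" using injP by simp
      show "inv_into P \<xi> ` (\<xi> ` P) = P" using injP by (force simp: image_image)
    qed (auto simp: f_inv_into_f)
    then show "open P \<and> open (\<xi> ` P) \<and> homeomorphism P (\<xi> ` P) \<xi> (inv_into P \<xi>)" using op by blast
  qed
qed

lemma smooth_on_Pair:
  assumes "open S" "smooth_on S f" "smooth_on S g"
  shows "smooth_on S (\<lambda>x. (f x, g x))"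
proof -
  have "bounded_linear (\<lambda>x. (x, 0))" "bounded_linear (\<lambda>x. (0, x))"
    by (auto intro!: bounded_linear_intro[where K=1] simp: norm_Pair)
  then have "smooth_on S (\<lambda>x. (f x, 0) + (0, g x))"
    by (intro smooth_on_add assms smooth_on_bounded_linear[where h="\<lambda>x. (x, 0)"] smooth_on_bounded_linear[where h="\<lambda>x. (0, x)"])
  then show ?thesis by simp
qed

lemma smooth_map_on_Pair:
  assumes "charted C" "charted A" "charted B" "open W" "smooth_map_on C A W f" "smooth_map_on C B W g"
  shows "smooth_map_on C (prod_atlas A B) W (\<lambda>x. (f x, g x))"
proof (rule smooth_map_onI)
  show cfg: "continuous_on W (\<lambda>x. (f x, g x))"
    using smooth_map_onD(1)[OF assms(5)] smooth_map_onD(1)[OF assms(6)] by (rule continuous_on_Pair)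
  fix U \<phi> P \<xi> assume c: "(U, \<phi>) \<in> C" and p: "(P, \<xi>) \<in> prod_atlas A B"
  obtain V \<psi> V' \<psi>' where v: "(V, \<psi>) \<in> A" "(V', \<psi>') \<in> B" and P: "P = V \<times> V'" "\<xi> = map_prod \<psi> \<psi>'"
    using p by (rule prod_atlasE)
  have "smooth_on (\<phi> ` (U \<inter> W \<inter> (\<lambda>x. (f x, g x)) -` P))
    (\<lambda>y. ((\<psi> \<circ> f \<circ> inv_into U \<phi>) y, (\<psi>' \<circ> g \<circ> inv_into U \<phi>) y))"
  proof (rule smooth_on_Pair)
    show "open (\<phi> ` (U \<inter> W \<inter> (\<lambda>x. (f x, g x)) -` P))"
      by (rule open_chart_vimage[OF assms(1) c assms(4) cfg chart_open[OF charted_prod[OF assms(2,3)] p]])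
    show "smooth_on (\<phi> ` (U \<inter> W \<inter> (\<lambda>x. (f x, g x)) -` P)) (\<psi> \<circ> f \<circ> inv_into U \<phi>)"
      by (rule smooth_on_subset[OF smooth_map_onD(2)[OF assms(5) c v(1)]]) (auto simp: P)
    show "smooth_on (\<phi> ` (U \<inter> W \<inter> (\<lambda>x. (f x, g x)) -` P)) (\<psi>' \<circ> g \<circ> inv_into U \<phi>)"
      by (rule smooth_on_subset[OF smooth_map_onD(2)[OF assms(6) c v(2)]]) (auto simp: P)
  qed
  then show "smooth_on (\<phi> ` (U \<inter> W \<inter> (\<lambda>x. (f x, g x)) -` P)) (\<xi> \<circ> (\<lambda>x. (f x, g x)) \<circ> inv_into U \<phi>)"
    by (simp add: P comp_def)
qed

lemma smooth_map_fst_snd: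
  fixes A :: "('m::{t2_space,second_countable_topology}, 'e::real_inner) atlas" and B :: "('n::{t2_space,second_countable_topology}, 'f::real_inner) atlas"
  assumes A: "smooth_manifold A" and B: "smooth_manifold B"
  shows "smooth_map (prod_atlas A B) A fst" "smooth_map (prod_atlas A B) B snd"
proof -
  note cA = smooth_manifold_charted[OF A] and cB = smooth_manifold_charted[OF B]
  obtain E :: "'e set" where E: "orthonormal_basis E" using charted_basis[OF cA] .
  obtain E' :: "'f set" where E': "orthonormal_basis E'" using charted_basis[OF cB] .
  note oc = chart_open[OF charted_prod[OF cA cB]] 
  have key: "smooth_on (\<xi> ` (P \<inter> UNIV \<inter> fst -` U')) (\<phi>' \<circ> fst \<circ> inv_into P \<xi>)"
    if p: "(P, \<xi>) \<in> prod_atlas A B" and c: "(U', \<phi>') \<in> A" for P \<xi> U' \<phi>'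
  proof -
    obtain U \<phi> V \<psi> where v: "(U, \<phi>) \<in> A" "(V, \<psi>) \<in> B" and P: "P = U \<times> V" "\<xi> = map_prod \<phi> \<psi>"
      using p by (rule prod_atlasE)
    have op: "open (\<xi> ` (P \<inter> UNIV \<inter> fst -` U'))"
      by (rule open_chart_vimage[OF charted_prod[OF cA cB] p open_UNIV continuous_on_fst[OF continuous_on_id] chart_open[OF cA c]])
    have "smooth_on (\<xi> ` (P \<inter> UNIV \<inter> fst -` U')) (\<lambda>y. (\<phi>' \<circ> inv_into U \<phi>) (fst y))"
      by (rule smooth_on_compose[OF op chart_open_map[OF cA v(1) chart_open[OF cA c]] E _ smooth_on_linear[OF op bounded_linear_fst] smooth_manifold_compat[OF A v(1) c]])
        (auto simp: P)
    then show ?thesis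
      by (rule smooth_on_cong[OF op, rotated])
        (use inv_into_map_prod[OF chart_inj[OF cA v(1)] chart_inj[OF cB v(2)]] in \<open>auto simp: P\<close>)
  qed
  show "smooth_map (prod_atlas A B) A fst"
    by (rule smooth_map_onI[OF continuous_on_fst[OF continuous_on_id] key])
  have key: "smooth_on (\<xi> ` (P \<inter> UNIV \<inter> snd -` U')) (\<phi>' \<circ> snd \<circ> inv_into P \<xi>)"
    if p: "(P, \<xi>) \<in> prod_atlas A B" and c: "(U', \<phi>') \<in> B" for P \<xi> U' \<phi>'
  proof -
    obtain U \<phi> V \<psi> where v: "(U, \<phi>) \<in> A" "(V, \<psi>) \<in> B" and P: "P = U \<times> V" "\<xi> = map_prod \<phi> \<psi>"
      using p by (rule prod_atlasE)
    have op: "open (\<xi> ` (P \<inter> UNIV \<inter> snd -` U'))"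
      by (rule open_chart_vimage[OF charted_prod[OF cA cB] p open_UNIV continuous_on_snd[OF continuous_on_id] chart_open[OF cB c]])
    have "smooth_on (\<xi> ` (P \<inter> UNIV \<inter> snd -` U')) (\<lambda>y. (\<phi>' \<circ> inv_into V \<psi>) (snd y))"
      by (rule smooth_on_compose[OF op chart_open_map[OF cB v(2) chart_open[OF cB c]] E' _ smooth_on_linear[OF op bounded_linear_snd] smooth_manifold_compat[OF B v(2) c]])
        (auto simp: P)
    then show ?thesis
      by (rule smooth_on_cong[OF op, rotated])
        (use inv_into_map_prod[OF chart_inj[OF cA v(1)] chart_inj[OF cB v(2)]] in \<open>auto simp: P\<close>)
  qed
  show "smooth_map (prod_atlas A B) B snd"
    by (rule smooth_map_onI[OF continuous_on_snd[OF continuous_on_id] key])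
qed

section \<open>Hadamard's lemma\<close>

text \<open>The ball has bounded coordinates and so lies in a finite sum of compact segments.\<close>

lemma compact_cball_orthonormal:
  fixes E :: "'a::real_inner set"
  assumes E: "orthonormal_basis E"
  shows "compact (cball (x::'a) r)"
proof -
  define R where "R = norm x + r"
  have "\<exists>K. compact K \<and> (\<forall>c. (\<forall>e\<in>F. \<bar>c e\<bar> \<le> R) \<longrightarrow> (\<Sum>e\<in>F. c e *\<^sub>R e) \<in> K)" if "finite F" for F :: "'a set"
    using that
  proof (induction F rule: finite_induct)
    case empty
    show ?case by (rule exI[of _ "{0}"]) simp
  next
    case (insert a F)
    then obtain K where K: "compact K" "\<And>c. (\<forall>e\<in>F. \<bar>c e\<bar> \<le> R) \<Longrightarrow> (\<Sum>e\<in>F. c e *\<^sub>R e) \<in> K" by auto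
    have "compact ((\<lambda>t. t *\<^sub>R a) ` {-R..R})"
      by (intro compact_continuous_image continuous_intros) simp
    note cK = compact_sums[OF this K(1)]
    have "\<exists>u v. (\<Sum>e\<in>insert a F. c e *\<^sub>R e) = u + v \<and> u \<in> (\<lambda>t. t *\<^sub>R a) ` {-R..R} \<and> v \<in> K"
      if c: "\<forall>e\<in>insert a F. \<bar>c e\<bar> \<le> R" for c
      using insert(1,2) c K(2)[of c]
      by (intro exI[of _ "c a *\<^sub>R a"] exI[of _ "\<Sum>e\<in>F. c e *\<^sub>R e"]) (auto simp: abs_le_iff)
    then show ?case by (intro exI[of _ "{u + v |u v. u \<in> (\<lambda>t. t *\<^sub>R a) ` {-R..R} \<and> v \<in> K}"] conjI[OF cK]) blast
  qed
  from this[of E] obtain K where K: "compact K" "\<And>c. (\<forall>e\<in>E. \<bar>c e\<bar> \<le> R) \<Longrightarrow> (\<Sum>e\<in>E. c e *\<^sub>R e) \<in> K"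
    using E by (auto simp: orthonormal_basis_def)
  have "cball x r \<subseteq> K"
  proof
    fix y assume y: "y \<in> cball x r"
    have n: "norm y \<le> R"
      using y norm_triangle_ineq2[of y x] by (simp add: R_def dist_norm norm_minus_commute)
    have "\<bar>y \<bullet> e\<bar> \<le> R" if "e \<in> E" for e
    proof -
      have "norm e = 1" using that E by (auto simp: orthonormal_basis_def norm_eq_1)
      then show ?thesis using Cauchy_Schwarz_ineq2[of y e] n by simp
    qed
    then show "y \<in> K" using K(2)[of "\<lambda>e. y \<bullet> e"] E by (simp add: orthonormal_basis_def)
  qed
  then have "cball x r = K \<inter> cball x r" by blast
  then show ?thesis using K(1) by (metis compact_Int_closed closed_cball)
qed

lemma segment_in_ball:
  fixes c y :: "'a::real_normed_vector"
  assumes y: "y \<in> ball c r" and t: "0 \<le> t" "t \<le> 1"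
  shows "c + t *\<^sub>R (y - c) \<in> ball c r"
proof -
  have "t * norm (y - c) \<le> norm (y - c)" using t by (simp add: mult_left_le_one_le)
  then show ?thesis using y t by (simp add: dist_norm norm_minus_commute)
qed

text \<open>The weights \<open>t ^ m\<close> make this family closed under differentiation: each derivative of the argument
  along the ray contributes one factor \<open>t\<close>.\<close>

definition ray_integral :: "nat \<Rightarrow> 'a::real_inner \<Rightarrow> ('a \<Rightarrow> real) \<Rightarrow> 'a \<Rightarrow> real" where
  "ray_integral m c F y = integral {0..1} (\<lambda>t. t ^ m * F (c + t *\<^sub>R (y - c)))"

lemma continuous_ray:
  fixes F :: "'a::real_inner \<Rightarrow> real"
  assumes "continuous_on (ball c r) F" "y \<in> ball c r"
  shows "continuous_on {0..1} (\<lambda>t. t ^ m * F (c + t *\<^sub>R (y - c)))"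
proof -
  have "continuous_on {0..1} (\<lambda>t. c + t *\<^sub>R (y - c))" by (intro continuous_intros)
  then have "continuous_on {0..1} (\<lambda>t. F (c + t *\<^sub>R (y - c)))"
    by (rule continuous_on_compose2[OF assms(1)]) (use segment_in_ball[OF assms(2)] in auto)
  then show ?thesis by (intro continuous_intros)
qed

text \<open>Differentiation under the integral sign. The difference quotients converge uniformly along the ray,
  because the partial derivatives are uniformly continuous on a compact ball.\<close>

lemma ray_integral_has_derivative:
  fixes E :: "'a::real_inner set" and F :: "'a \<Rightarrow> real"
  assumes E: "orthonormal_basis E" and F: "smooth_on (ball c r) F" and y: "y \<in> ball c r"
  shows "(ray_integral m c F has_derivative
     (\<lambda>v. ray_integral (Suc m) c (\<lambda>x. frechet_derivative F (at x) v) y)) (at y)"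
proof -
  define D where "D v x = frechet_derivative F (at x) v" for v x
  have DF: "(F has_derivative (\<lambda>v. D v x)) (at x)" if "x \<in> ball c r" for x
    using smooth_on_has_derivative[OF F that] by (simp add: D_def)
  have Dlin: "D v x = (\<Sum>e\<in>E. (v \<bullet> e) *\<^sub>R D e x)" if "x \<in> ball c r" for v x
    using linear_orthonormal_basis[OF E, of "\<lambda>v. D v x"] has_derivative_linear[OF DF[OF that]] by blast
  have contD: "continuous_on (ball c r) (D v)" for v
    using smooth_on_imp_continuous_on[OF smooth_on_directional[OF F, of v]] by (simp add: D_def[abs_def])
  have contF: "continuous_on (ball c r) F" by (rule smooth_on_imp_continuous_on[OF F])
  have intD: "(\<lambda>t. t ^ k * D v (c + t *\<^sub>R (y - c))) integrable_on {0..1}" for k v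
    by (rule integrable_continuous_real[OF continuous_ray[OF contD y]])
  have intF: "(\<lambda>t. t ^ k * F (c + t *\<^sub>R (z - c))) integrable_on {0..1}" if "z \<in> ball c r" for k z
    by (rule integrable_continuous_real[OF continuous_ray[OF contF that]])
  have lin: "ray_integral (Suc m) c (D v) y = (\<Sum>e\<in>E. (v \<bullet> e) * ray_integral (Suc m) c (D e) y)" for v
  proof -
    have "integral {0..1} (\<lambda>t. t ^ Suc m * D v (c + t *\<^sub>R (y - c)))
      = integral {0..1} (\<lambda>t. \<Sum>e\<in>E. (v \<bullet> e) * (t ^ Suc m * D e (c + t *\<^sub>R (y - c))))"
    proof (rule integral_cong)
      fix t :: real assume "t \<in> {0..1}"
      then have "c + t *\<^sub>R (y - c) \<in> ball c r" using segment_in_ball[OF y] by simp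
      from Dlin[OF this, of v] show "t ^ Suc m * D v (c + t *\<^sub>R (y - c)) = (\<Sum>e\<in>E. (v \<bullet> e) * (t ^ Suc m * D e (c + t *\<^sub>R (y - c))))"
        by (simp add: sum_distrib_left mult_ac)
    qed
    also have "\<dots> = (\<Sum>e\<in>E. integral {0..1} (\<lambda>t. (v \<bullet> e) * (t ^ Suc m * D e (c + t *\<^sub>R (y - c)))))"
      using E intD by (intro integral_sum integrable_on_mult_right) (auto simp: orthonormal_basis_def simp del: power_Suc)
    finally show ?thesis by (simp add: ray_integral_def del: power_Suc)
  qed
  have "bounded_linear (\<lambda>v. \<Sum>e\<in>E. (v \<bullet> e) * ray_integral (Suc m) c (D e) y)"
    by (intro bounded_linear_sum bounded_linear_compose[OF bounded_linear_mult_left bounded_linear_inner_left])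
  then have bl: "bounded_linear (\<lambda>v. ray_integral (Suc m) c (D v) y)"
    by (simp only: lin[symmetric])
  have "\<exists>d>0. \<forall>z. norm (z - y) < d \<longrightarrow>
     norm (ray_integral m c F z - ray_integral m c F y - ray_integral (Suc m) c (D (z - y)) y) \<le> \<epsilon> * norm (z - y)"
    if eps: "\<epsilon> > 0" for \<epsilon>
  proof -
    \<comment> \<open>a radius strictly between that of \<open>y\<close> and \<open>r\<close>, so that the ray to \<open>y\<close> has room inside a compact ball\<close>
    define s where "s = (norm (y - c) + r) / 2"
    have s: "norm (y - c) < s" "s < r" using y by (auto simp: s_def dist_norm norm_minus_commute)
    \<comment> \<open>the error of each of the \<open>card E\<close> partial derivatives; the 1 covers the empty basis\<close>
    define \<eta> where "\<eta> = \<epsilon> / (card E + 1)"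
    have eta: "\<eta> > 0" "card E * \<eta> \<le> \<epsilon>" using eps by (auto simp: \<eta>_def field_simps)
    have "\<exists>d>0. \<forall>x\<in>cball c s. \<forall>x'\<in>cball c s. dist x' x < d \<longrightarrow> dist (D e x') (D e x) < \<eta>" for e
    proof -
      have "continuous_on (cball c s) (D e)" by (rule continuous_on_subset[OF contD]) (use s in auto)
      then have "uniformly_continuous_on (cball c s) (D e)"
        using compact_uniformly_continuous compact_cball_orthonormal[OF E] by blast
      then show ?thesis using eta(1) unfolding uniformly_continuous_on_def by blast
    qed
    then obtain d where d: "\<And>e. d e > 0"
      "\<And>e x x'. x \<in> cball c s \<Longrightarrow> x' \<in> cball c s \<Longrightarrow> dist x' x < d e \<Longrightarrow> dist (D e x') (D e x) < \<eta>"
      by metis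
    define \<delta> where "\<delta> = Min (insert (s - norm (y - c)) (d ` E))"
    have finE: "finite E" using E by (simp add: orthonormal_basis_def)
    have del: "\<delta> > 0" "\<delta> \<le> s - norm (y - c)" "\<And>e. e \<in> E \<Longrightarrow> \<delta> \<le> d e"
      using finE d(1) s by (auto simp: \<delta>_def)
    show ?thesis
    proof (intro exI[of _ \<delta>] conjI allI impI)
      fix z assume z: "norm (z - y) < \<delta>"
      have zb: "z \<in> ball c r"
        using z del(2) s norm_triangle_ineq[of "z - y" "y - c"] by (simp add: dist_norm norm_minus_commute)
      have pt: "norm (t ^ m * F (c + t *\<^sub>R (z - c)) - t ^ m * F (c + t *\<^sub>R (y - c))
           - t ^ Suc m * D (z - y) (c + t *\<^sub>R (y - c))) \<le> \<epsilon> * norm (z - y)" if t: "t \<in> {0..1}" for t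
      proof -
        define a where "a = c + t *\<^sub>R (y - c)"
        define b where "b = c + t *\<^sub>R (z - c)"
        define T where "T = ball a \<delta> \<inter> cball c s"
        have ac: "norm (a - c) \<le> norm (y - c)" using t by (simp add: a_def mult_left_le_one_le)
        have ba: "b - a = t *\<^sub>R (z - y)" by (simp add: a_def b_def algebra_simps)
        have nba: "norm (b - a) \<le> norm (z - y)" using t by (simp add: ba mult_left_le_one_le)
        have aT: "a \<in> T" using del(1) ac s by (simp add: T_def dist_norm norm_minus_commute)
        have "norm (F b - F a - D (b - a) a) \<le> norm (b - a) * \<epsilon>"
        proof (rule differentiable_bound_linearization[where S=T and f'="\<lambda>x v. D v x"])
          show "a + u *\<^sub>R (b - a) \<in> T" if u: "u \<in> {0..1}" for u
          proof -
            have un: "norm (u *\<^sub>R (b - a)) \<le> norm (b - a)" using u by (simp add: mult_left_le_one_le)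
            have "dist c (a + u *\<^sub>R (b - a)) \<le> norm (a - c) + norm (u *\<^sub>R (b - a))"
              using norm_triangle_ineq[of "a - c" "u *\<^sub>R (b - a)"] by (simp add: dist_norm norm_minus_commute algebra_simps)
            moreover have "dist a (a + u *\<^sub>R (b - a)) = norm (u *\<^sub>R (b - a))" by (simp add: dist_norm)
            ultimately show ?thesis using un nba z ac del(2) unfolding T_def by auto
          qed
          show "(F has_derivative (\<lambda>v. D v x)) (at x within T)" if "x \<in> T" for x
            by (rule has_derivative_at_withinI[OF DF]) (use that s(2) in \<open>simp add: T_def\<close>)
          show "onorm ((\<lambda>v. D v x) - (\<lambda>v. D v a)) \<le> \<epsilon>" if x: "x \<in> T" for x
          proof (rule onorm_bound)
            fix v
            have in_b: "x \<in> ball c r" "a \<in> ball c r" using x aT s by (auto simp: T_def)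
            have "D v x - D v a = (\<Sum>e\<in>E. (v \<bullet> e) * (D e x - D e a))"
              unfolding Dlin[OF in_b(1), of v] Dlin[OF in_b(2), of v]
              by (simp only: sum_subtractf right_diff_distrib real_scaleR_def)
            also have "\<bar>\<dots>\<bar> \<le> (\<Sum>e\<in>E. \<eta> * norm v)"
            proof (rule order_trans[OF sum_abs sum_mono])
              fix e assume e: "e \<in> E"
              have "norm e = 1" using e E by (auto simp: orthonormal_basis_def norm_eq_1)
              then have 1: "\<bar>v \<bullet> e\<bar> \<le> norm v" using Cauchy_Schwarz_ineq2[of v e] by simp
              have "\<bar>D e x - D e a\<bar> \<le> \<eta>"
                using d(2)[of a x e] x aT del(3)[OF e] by (auto simp: T_def dist_real_def dist_commute)
              then show "\<bar>(v \<bullet> e) * (D e x - D e a)\<bar> \<le> \<eta> * norm v"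
                using mult_mono[OF 1, of "\<bar>D e x - D e a\<bar>" \<eta>] by (simp add: abs_mult mult.commute)
            qed
            also have "\<dots> = (card E * \<eta>) * norm v" by simp
            also have "\<dots> \<le> \<epsilon> * norm v" by (rule mult_right_mono[OF eta(2)]) simp
            finally show "norm (((\<lambda>v. D v x) - (\<lambda>v. D v a)) v) \<le> \<epsilon> * norm v" by simp
          qed (use eps in simp)
        qed (rule aT)
        also have "norm (b - a) * \<epsilon> \<le> \<epsilon> * norm (z - y)" using nba eps by (simp add: mult.commute)
        finally have le: "norm (F b - F a - D (b - a) a) \<le> \<epsilon> * norm (z - y)" .
        have "D (b - a) a = t * D (z - y) a"
          unfolding ba using linear_cmul[OF has_derivative_linear[OF DF]] aT s by (auto simp: T_def)
        then have "t ^ m * F b - t ^ m * F a - t ^ Suc m * D (z - y) a = t ^ m * (F b - F a - D (b - a) a)"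
          by (simp add: algebra_simps)
        moreover have "norm (t ^ m * (F b - F a - D (b - a) a)) \<le> norm (F b - F a - D (b - a) a)"
          using t by (simp add: abs_mult mult_left_le_one_le power_le_one)
        ultimately show ?thesis using le by (simp add: a_def b_def del: power_Suc)
      qed
      have "ray_integral m c F z - ray_integral m c F y - ray_integral (Suc m) c (D (z - y)) y
        = integral {0..1} (\<lambda>t. t ^ m * F (c + t *\<^sub>R (z - c)) - t ^ m * F (c + t *\<^sub>R (y - c))
           - t ^ Suc m * D (z - y) (c + t *\<^sub>R (y - c)))"
        unfolding ray_integral_def
        using integral_diff[OF integrable_diff[OF intF[OF zb, of m] intF[OF y, of m]] intD[of "Suc m" "z - y"]]
          integral_diff[OF intF[OF zb, of m] intF[OF y, of m]]
        by (simp del: power_Suc)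
      also have "norm \<dots> \<le> \<epsilon> * norm (z - y) * (1 - 0)"
        by (rule integral_bound)
          (use pt in \<open>auto intro!: continuous_on_diff continuous_ray[OF contF zb] continuous_ray[OF contF y] continuous_ray[OF contD y] simp del: power_Suc\<close>)
      finally show "norm (ray_integral m c F z - ray_integral m c F y - ray_integral (Suc m) c (D (z - y)) y) \<le> \<epsilon> * norm (z - y)"
        by simp
    qed (rule del(1))
  qed
  then show ?thesis using bl unfolding has_derivative_at_alt D_def[abs_def] by blast
qed

lemma smooth_on_ray_integral:
  fixes E :: "'a::real_inner set" and F :: "'a \<Rightarrow> real"
  assumes E: "orthonormal_basis E" and F: "smooth_on (ball c r) F"
  shows "smooth_on (ball c r) (ray_integral m c F)"
proof -
  have "Ck_on k (ball c r) (ray_integral m c F)" for k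
    using F
  proof (induction k arbitrary: m F)
    case 0
    have "\<forall>y\<in>ball c r. isCont (ray_integral m c F) y"
      using ray_integral_has_derivative[OF E 0] has_derivative_continuous by blast
    then show ?case by (simp add: continuous_at_imp_continuous_on)
  next
    case (Suc k)
    show ?case
      by (rule Ck_on_SucI[OF open_ball ray_integral_has_derivative[OF E Suc.prems]])
        (use Suc.IH smooth_on_directional[OF Suc.prems] in auto)
  qed
  then show ?thesis by (simp add: smooth_on_def)
qed

text \<open>By the fundamental theorem of calculus along the ray from \<open>c\<close> to \<open>y\<close>, with \<open>g e\<close> the mean of the
  partial derivative in direction \<open>e\<close> over that ray.\<close>

lemma hadamard:
  fixes E :: "'a::real_inner set" and F :: "'a \<Rightarrow> real"
  assumes E: "orthonormal_basis E" and F: "smooth_on (ball c r) F" and r: "0 < r"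
  obtains g where "\<And>e. smooth_on (ball c r) (g e)" "\<And>e. g e c = frechet_derivative F (at c) e"
    "\<And>y. y \<in> ball c r \<Longrightarrow> F y = F c + (\<Sum>e\<in>E. ((y - c) \<bullet> e) * g e y)"
proof
  let ?D = "\<lambda>e x. frechet_derivative F (at x) e"
  show "smooth_on (ball c r) (ray_integral 0 c (?D e))" for e
    by (rule smooth_on_ray_integral[OF E smooth_on_directional[OF F]])
  show "ray_integral 0 c (?D e) c = ?D e c" for e
    by (simp add: ray_integral_def)
  fix y assume y: "y \<in> ball c r"
  have "((\<lambda>t. ?D (y - c) (c + t *\<^sub>R (y - c))) has_integral F (c + 1 *\<^sub>R (y - c)) - F (c + 0 *\<^sub>R (y - c))) {0..1}"
  proof (rule fundamental_theorem_of_calculus)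
    fix t :: real assume "t \<in> {0..1}"
    then have tb: "c + t *\<^sub>R (y - c) \<in> ball c r" using segment_in_ball[OF y] by simp
    note dF = smooth_on_has_derivative[OF F tb]
    have "((\<lambda>t. c + t *\<^sub>R (y - c)) has_derivative (\<lambda>u. u *\<^sub>R (y - c))) (at t)"
      by (auto intro!: derivative_eq_intros)
    from has_derivative_compose[OF this dF]
    have "((\<lambda>t. F (c + t *\<^sub>R (y - c))) has_derivative (\<lambda>u. u *\<^sub>R ?D (y - c) (c + t *\<^sub>R (y - c)))) (at t)"
      using linear_cmul[OF has_derivative_linear[OF dF]] by simp
    then show "((\<lambda>t. F (c + t *\<^sub>R (y - c))) has_vector_derivative ?D (y - c) (c + t *\<^sub>R (y - c))) (at t within {0..1})"
      unfolding has_vector_derivative_def by (rule has_derivative_at_withinI)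
  qed simp
  then have "F y - F c = integral {0..1} (\<lambda>t. ?D (y - c) (c + t *\<^sub>R (y - c)))"
    by (simp add: integral_unique)
  also have "\<dots> = integral {0..1} (\<lambda>t. \<Sum>e\<in>E. ((y - c) \<bullet> e) * (t ^ 0 * ?D e (c + t *\<^sub>R (y - c))))"
  proof (rule integral_cong)
    fix t :: real assume "t \<in> {0..1}"
    then have tb: "c + t *\<^sub>R (y - c) \<in> ball c r" using segment_in_ball[OF y] by simp
    show "?D (y - c) (c + t *\<^sub>R (y - c)) = (\<Sum>e\<in>E. ((y - c) \<bullet> e) * (t ^ 0 * ?D e (c + t *\<^sub>R (y - c))))"
      using linear_orthonormal_basis[OF E has_derivative_linear[OF smooth_on_has_derivative[OF F tb]], of "y - c"] by simp
  qed
  also have "\<dots> = (\<Sum>e\<in>E. integral {0..1} (\<lambda>t. ((y - c) \<bullet> e) * (t ^ 0 * ?D e (c + t *\<^sub>R (y - c)))))"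
    using E by (intro integral_sum integrable_on_mult_right integrable_continuous_real
        continuous_ray[OF smooth_on_imp_continuous_on[OF smooth_on_directional[OF F]] y]) (auto simp: orthonormal_basis_def)
  finally show "F y = F c + (\<Sum>e\<in>E. ((y - c) \<bullet> e) * ray_integral 0 c (?D e) y)"
    by (simp add: ray_integral_def)
qed

section \<open>Bump functions\<close>

text \<open>The closed set \<open>C\<close> contains the support of \<open>\<rho>\<close>; that it lies in \<open>W\<close> is what allows products with \<open>\<rho>\<close>
  to be extended by zero from \<open>W\<close> to the whole manifold.\<close>

lemma bump_function:
  fixes A :: "('m::{t2_space,second_countable_topology}, 'e::real_inner) atlas"
  assumes M: "smooth_manifold A"
    and W: "open W" "p \<in> W"
  obtains \<rho> :: "'m \<Rightarrow> real" and C W' where "smooth_fun A \<rho>" "closed C" "C \<subseteq> W" "\<And>x. x \<notin> C \<Longrightarrow> \<rho> x = 0"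
    "open W'" "p \<in> W'" "W' \<subseteq> C" "\<And>x. x \<in> W' \<Longrightarrow> \<rho> x = 1"
proof -
  note cA = smooth_manifold_charted[OF M]
  obtain E :: "'e set" where E: "orthonormal_basis E" using charted_basis[OF cA] .
  obtain U \<phi> where U: "(U, \<phi>) \<in> A" "p \<in> U" using charted_cover[OF cA] .
  note oU = chart_open[OF cA U(1)] and hom = chart_homeomorphism[OF cA U(1)]
  have c\<phi>: "continuous_on U \<phi>" "continuous_on (\<phi> ` U) (inv_into U \<phi>)" using hom by (simp_all add: homeomorphism_def)
  have "open (\<phi> ` (U \<inter> W))" by (rule chart_open_map[OF cA U(1) W(1)])
  then obtain r where r: "0 < r" "cball (\<phi> p) r \<subseteq> \<phi> ` (U \<inter> W)"
    using U(2) W(2) by (metis IntI image_eqI open_contains_cball)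
  define K where "K = cball (\<phi> p) r"
  define C where "C = inv_into U \<phi> ` K"
  have KU: "K \<subseteq> \<phi> ` U" using r(2) by (auto simp: K_def)
  have "compact C" unfolding C_def
    by (intro compact_continuous_image continuous_on_subset[OF c\<phi>(2) KU]) (simp add: K_def compact_cball_orthonormal[OF E])
  then have clC: "closed C" by (rule compact_imp_closed)
  have CUW: "C \<subseteq> U \<inter> W"
  proof
    fix x assume "x \<in> C"
    then obtain y where y: "y \<in> K" "x = inv_into U \<phi> y" by (auto simp: C_def)
    then obtain z where "z \<in> U \<inter> W" "y = \<phi> z" using r(2) by (auto simp: K_def)
    then show "x \<in> U \<inter> W" using y chart_inv[OF cA U(1)] by simp
  qed
  have inC: "x \<in> C" if "x \<in> U" "\<phi> x \<in> K" for x
    using that chart_inv[OF cA U(1) that(1)] unfolding C_def by (metis image_eqI)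
  obtain f :: "real \<Rightarrow> real" where f: "smooth_on UNIV f" "\<And>t. t \<le> (r/2)\<^sup>2 \<Longrightarrow> f t = 1" "\<And>t. r\<^sup>2 \<le> t \<Longrightarrow> f t = 0"
    using smooth_cutoff[of "(r/2)\<^sup>2" "r\<^sup>2"] r(1) by (auto simp: power_divide)
  define q where "q x = (\<phi> x - \<phi> p) \<bullet> (\<phi> x - \<phi> p)" for x
  define \<rho> where "\<rho> x = (if x \<in> U then f (q x) else 0)" for x
  have q_out: "r\<^sup>2 \<le> q x" if "x \<in> U" "x \<notin> C" for x
  proof -
    have "\<not> dist (\<phi> p) (\<phi> x) \<le> r" using inC[OF that(1)] that(2) by (auto simp: K_def)
    then have "r\<^sup>2 \<le> (norm (\<phi> x - \<phi> p))\<^sup>2" using r(1) by (intro power_mono) (auto simp: dist_norm norm_minus_commute)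
    then show ?thesis by (simp add: q_def dot_square_norm)
  qed
  have out: "\<rho> x = 0" if "x \<notin> C" for x using q_out f(3) that by (auto simp: \<rho>_def)
  have sq: "smooth_fun_on A U q" unfolding q_def
    by (intro smooth_fun_on_bilinear[OF cA oU bounded_bilinear_inner] smooth_fun_on_diff[OF cA oU] smooth_chart[OF M U(1)]
        smooth_fun_on_const[OF cA oU])
  have s1: "smooth_fun_on A U \<rho>"
    by (rule smooth_fun_on_cong[OF cA oU smooth_fun_on_compose[OF cA oU orthonormal_basis_real open_UNIV _ sq f(1)]])
      (auto simp: \<rho>_def)
  have oC: "open (- C)" using clC by (simp add: open_Compl)
  have s2: "smooth_fun_on A (- C) \<rho>"
    by (rule smooth_fun_on_cong[OF cA oC smooth_fun_on_const[OF cA oC, of 0]]) (simp add: out)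
  have s: "smooth_fun A \<rho>"
    by (rule smooth_fun_on_local[OF cA _ open_UNIV])
      (use s1 s2 oU oC CUW in blast)
  define W' where "W' = U \<inter> \<phi> -` ball (\<phi> p) (r/2)"
  show ?thesis
  proof (rule that[of \<rho> C W'])
    show "open W'" unfolding W'_def by (rule open_vimage_Int[OF oU c\<phi>(1) open_ball])
    show "p \<in> W'" using U(2) r(1) by (simp add: W'_def)
    show "W' \<subseteq> C" using inC r(1) by (auto simp: W'_def K_def)
    show "\<rho> x = 1" if "x \<in> W'" for x
    proof -
      have "(norm (\<phi> x - \<phi> p))\<^sup>2 \<le> (r/2)\<^sup>2"
        using that by (intro power_mono) (auto simp: W'_def dist_norm norm_minus_commute)
      then show ?thesis using that f(2) by (simp add: W'_def \<rho>_def q_def dot_square_norm)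
    qed
  qed (use s clC CUW out in auto)
qed

lemma smooth_extend_by_zero:
  assumes cA: "charted A" and "smooth_fun A \<rho>" "closed C" "C \<subseteq> W" "\<And>x. x \<notin> C \<Longrightarrow> \<rho> x = 0" "open W"
    "smooth_fun_on A W f"
  shows "smooth_fun A (\<lambda>x. if x \<in> W then \<rho> x *\<^sub>R f x else 0)" (is "smooth_fun A ?g")
proof (rule smooth_fun_on_local[OF cA _ open_UNIV])
  fix p
  have oC: "open (- C)" using assms(3) by (simp add: open_Compl)
  have "smooth_fun_on A W (\<lambda>x. \<rho> x *\<^sub>R f x)"
    by (rule smooth_fun_on_bilinear[OF cA assms(6) bounded_bilinear_scaleR smooth_map_on_subset[OF assms(2)] assms(7)]) simp
  then have 1: "smooth_fun_on A W ?g" by (rule smooth_fun_on_cong[OF cA assms(6)]) simp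
  have 2: "smooth_fun_on A (- C) ?g"
    by (rule smooth_fun_on_cong[OF cA oC smooth_fun_on_const[OF cA oC, of 0]]) (simp add: assms(5))
  show "\<exists>W'. open W' \<and> p \<in> W' \<and> smooth_fun_on A W' ?g"
    using 1 2 oC assms(4,6) by (cases "p \<in> C") blast+
qed

section \<open>Tangent vectors and vector fields\<close>

context
  fixes A :: "('m::{t2_space,second_countable_topology}, 'e::real_inner) atlas" and v p
  assumes M: "smooth_manifold A" and v: "v \<in> tangent_space A p"
begin

private lemma cA: "charted A" by (rule smooth_manifold_charted[OF M])

lemma tangent_add: "smooth_fun A f \<Longrightarrow> smooth_fun A g \<Longrightarrow> v (\<lambda>x. f x + g x) = v f + v g"
  and tangent_mult: "smooth_fun A f \<Longrightarrow> smooth_fun A g \<Longrightarrow> v (\<lambda>x. f x * g x) = v f * g p + f p * v g"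
  and tangent_scale: "smooth_fun A f \<Longrightarrow> v (\<lambda>x. c * f x) = c * v f"
  and tangent_nonsmooth: "\<not> smooth_fun A f \<Longrightarrow> v f = 0"
  using v by (simp_all add: tangent_space_def)

lemma tangent_const: "v (\<lambda>x. c) = 0"
proof -
  have "smooth_fun A (\<lambda>x. 1::real)" by (rule smooth_fun_on_const[OF cA open_UNIV])
  from tangent_mult[OF this this] tangent_scale[OF this, of c] show ?thesis by simp
qed

lemma tangent_minus: "smooth_fun A f \<Longrightarrow> v (\<lambda>x. - f x) = - v f"
  using tangent_scale[of f "-1"] by simp

lemma tangent_diff: "smooth_fun A f \<Longrightarrow> smooth_fun A g \<Longrightarrow> v (\<lambda>x. f x - g x) = v f - v g"
  using tangent_add[of f "\<lambda>x. - g x"] tangent_minus[of g] smooth_fun_on_minus[OF cA open_UNIV, of g] by simp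

lemma tangent_sum: "(\<And>i. i \<in> I \<Longrightarrow> smooth_fun A (f i)) \<Longrightarrow> v (\<lambda>x. \<Sum>i\<in>I. f i x) = (\<Sum>i\<in>I. v (f i))"
proof (induction I rule: infinite_finite_induct)
  case (insert i I)
  then show ?case using tangent_add[of "f i" "\<lambda>x. \<Sum>i\<in>I. f i x"] smooth_fun_on_sum[OF cA open_UNIV, of I f] by simp
qed (simp_all add: tangent_const)

text \<open>Where \<open>f\<close> and \<open>g\<close> agree near \<open>p\<close>, their difference \<open>d\<close> equals \<open>d (1 - \<rho>)\<close> for a bump function \<open>\<rho>\<close>,
  and both factors vanish at \<open>p\<close>.\<close>

lemma tangent_local:
  assumes "smooth_fun A f" "smooth_fun A g" "open W" "p \<in> W" "\<And>x. x \<in> W \<Longrightarrow> f x = g x"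
  shows "v f = v g"
proof -
  obtain \<rho> :: "'m \<Rightarrow> real" and C W' where r: "smooth_fun A \<rho>" "C \<subseteq> W" "\<And>x. x \<notin> C \<Longrightarrow> \<rho> x = 0"
    "p \<in> W'" "\<And>x. x \<in> W' \<Longrightarrow> \<rho> x = 1"
    using bump_function[OF M assms(3,4)] by metis
  let ?h = "\<lambda>x. f x - g x"
  have h: "smooth_fun A ?h" by (rule smooth_fun_on_diff[OF cA open_UNIV assms(1,2)])
  have r1: "smooth_fun A (\<lambda>x. 1 - \<rho> x)"
    by (intro smooth_fun_on_diff[OF cA open_UNIV] smooth_fun_on_const[OF cA open_UNIV] r(1))
  have "?h x = ?h x * (1 - \<rho> x)" for x using r(2) r(3)[of x] assms(5)[of x] by (cases "x \<in> C") auto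
  then have "?h = (\<lambda>x. ?h x * (1 - \<rho> x))" by (rule ext)
  then have "v ?h = v (\<lambda>x. ?h x * (1 - \<rho> x))" by (rule arg_cong)
  also have "\<dots> = 0" using tangent_mult[OF h r1] r(4,5) assms(4,5) by simp
  finally show ?thesis using tangent_diff[OF assms(1,2)] by simp
qed

subsection \<open>Complex-valued functions\<close>

lemma cderiv_of_real: "cderiv v (\<lambda>x. complex_of_real (f x)) = complex_of_real (v f)"
  by (simp add: cderiv_def tangent_const complex_eq_iff)

lemma cderiv_const: "cderiv v (\<lambda>x. c) = 0"
  by (simp add: cderiv_def tangent_const complex_eq_iff)

context
  fixes f g :: "'m \<Rightarrow> complex"
  assumes f: "smooth_fun A f" and g: "smooth_fun A g"
begin

private lemmas ri = smooth_fun_on_Re[OF cA open_UNIV f] smooth_fun_on_Im[OF cA open_UNIV f]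
  smooth_fun_on_Re[OF cA open_UNIV g] smooth_fun_on_Im[OF cA open_UNIV g]

lemma cderiv_add: "cderiv v (\<lambda>x. f x + g x) = cderiv v f + cderiv v g"
  by (simp add: cderiv_def tangent_add ri complex_eq_iff)

lemma cderiv_mult: "cderiv v (\<lambda>x. f x * g x) = cderiv v f * g p + f p * cderiv v g"
  by (simp add: cderiv_def tangent_add tangent_diff tangent_mult ri complex_eq_iff
      smooth_fun_on_mult[OF cA open_UNIV] algebra_simps)

end

lemma cderiv_scale: 
  assumes "smooth_fun A f"
  shows "cderiv v (\<lambda>x. c * f x) = c * cderiv v f"
  using cderiv_mult[OF smooth_fun_on_const[OF cA open_UNIV, of c] assms] by (simp add: cderiv_const)

lemma cderiv_sum:
  "(\<And>i. i \<in> I \<Longrightarrow> smooth_fun A (f i)) \<Longrightarrow> cderiv v (\<lambda>x. \<Sum>i\<in>I. f i x) = (\<Sum>i\<in>I. cderiv v (f i))"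
proof (induction I rule: infinite_finite_induct)
  case (insert i I)
  then show ?case using cderiv_add[of "f i" "\<lambda>x. \<Sum>i\<in>I. f i x"] smooth_fun_on_sum[OF cA open_UNIV, of I f] by simp
qed (simp_all add: cderiv_const)

text \<open>Every derivation is a directional derivative in a chart. By Hadamard's lemma \<open>f\<close> agrees near \<open>p\<close> with
  \<open>f(p) + (\<Sum>e\<in>E. (x\<^sub>e - x\<^sub>e(p)) G\<^sub>e)\<close> for global functions \<open>x\<^sub>e\<close> and \<open>G\<^sub>e\<close>, and the product rule leaves only
  \<open>v(x\<^sub>e) G\<^sub>e(p)\<close>.\<close>

lemma tangent_chart:
  fixes E :: "'e set"
  assumes E: "orthonormal_basis E" and U: "(U, \<phi>) \<in> A" "p \<in> U"
  obtains c where "\<And>f. smooth_fun A f \<Longrightarrow> v f = (\<Sum>e\<in>E. c e * frechet_derivative (f \<circ> inv_into U \<phi>) (at (\<phi> p)) e)"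
proof -
  note oU = chart_open[OF cA U(1)] and hom = chart_homeomorphism[OF cA U(1)]
  have c\<phi>: "continuous_on U \<phi>" using hom by (simp add: homeomorphism_def)
  obtain \<rho> :: "'m \<Rightarrow> real" and C W' where r: "smooth_fun A \<rho>" "closed C" "C \<subseteq> U" "\<And>x. x \<notin> C \<Longrightarrow> \<rho> x = 0"
    "open W'" "p \<in> W'" "W' \<subseteq> C" "\<And>x. x \<in> W' \<Longrightarrow> \<rho> x = 1"
    using bump_function[OF M oU U(2)] by metis
  define x where "x e q = (if q \<in> U then \<rho> q *\<^sub>R (\<phi> q \<bullet> e) else 0)" for e q
  have sx: "smooth_fun A (x e)" for e unfolding x_def
    using r(4) by (intro smooth_extend_by_zero[OF cA r(1-3) _ oU]
        smooth_fun_on_bounded_linear[OF cA oU bounded_linear_inner_left smooth_chart[OF M U(1)]]) auto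
  show ?thesis
  proof (rule that[of "\<lambda>e. v (x e)"])
    fix f :: "'m \<Rightarrow> real" assume f: "smooth_fun A f"
    define F where "F = f \<circ> inv_into U \<phi>"
    have sF: "smooth_on (\<phi> ` U) F"
      using f U(1) unfolding smooth_fun_on_iff[OF cA open_UNIV] F_def by force
    obtain s where s: "0 < s" "ball (\<phi> p) s \<subseteq> \<phi> ` U"
      using chart_image_open[OF cA U(1)] U(2) by (meson imageI open_contains_ball)
    obtain g where g: "\<And>e. smooth_on (ball (\<phi> p) s) (g e)" "\<And>e. g e (\<phi> p) = frechet_derivative F (at (\<phi> p)) e"
      "\<And>y. y \<in> ball (\<phi> p) s \<Longrightarrow> F y = F (\<phi> p) + (\<Sum>e\<in>E. ((y - \<phi> p) \<bullet> e) * g e y)"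
      using hadamard[OF E smooth_on_subset[OF sF s(2)] s(1)] by metis
    define B where "B = U \<inter> \<phi> -` ball (\<phi> p) s"
    have oB: "open B" unfolding B_def by (rule open_vimage_Int[OF oU c\<phi> open_ball])
    have pB: "p \<in> B" using U(2) s(1) by (simp add: B_def)
    obtain \<rho>' :: "'m \<Rightarrow> real" and C' W'' where r': "smooth_fun A \<rho>'" "closed C'" "C' \<subseteq> B" "\<And>x. x \<notin> C' \<Longrightarrow> \<rho>' x = 0"
      "open W''" "p \<in> W''" "W'' \<subseteq> C'" "\<And>x. x \<in> W'' \<Longrightarrow> \<rho>' x = 1"
      using bump_function[OF M oB pB] by metis
    define G where "G e q = (if q \<in> B then \<rho>' q *\<^sub>R g e (\<phi> q) else 0)" for e q
    have sG: "smooth_fun A (G e)" for e unfolding G_def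
    proof (rule smooth_extend_by_zero[OF cA r'(1-4) oB])
      show "smooth_fun_on A B (\<lambda>q. g e (\<phi> q))"
        by (rule smooth_fun_on_compose[OF cA oB E open_ball _ _ g(1)])
          (auto simp: B_def intro: smooth_map_on_subset[OF smooth_chart[OF M U(1)]])
    qed
    define h where "h q = f p + (\<Sum>e\<in>E. (x e q - x e p) * G e q)" for q
    have sxm: "smooth_fun A (\<lambda>q. x e q - x e p)" for e
      by (intro smooth_fun_on_diff[OF cA open_UNIV] sx smooth_fun_on_const[OF cA open_UNIV])
    have st: "smooth_fun A (\<lambda>q. (x e q - x e p) * G e q)" for e
      by (rule smooth_fun_on_mult[OF cA open_UNIV sxm sG])
    have ss: "smooth_fun A (\<lambda>q. \<Sum>e\<in>E. (x e q - x e p) * G e q)"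
      by (rule smooth_fun_on_sum[OF cA open_UNIV st])
    have sh: "smooth_fun A h" unfolding h_def
      by (rule smooth_fun_on_add[OF cA open_UNIV smooth_fun_on_const[OF cA open_UNIV] ss])
    have "v f = v h"
    proof (rule tangent_local[OF f sh, of "W' \<inter> W''"])
      fix q assume q: "q \<in> W' \<inter> W''"
      then have qU: "q \<in> U" "\<phi> q \<in> ball (\<phi> p) s" "q \<in> B" using r'(3,7) by (auto simp: B_def)
      have "f q = F (\<phi> q)" "f p = F (\<phi> p)" using qU(1) U(2) chart_inv[OF cA U(1)] by (simp_all add: F_def)
      then show "f q = h q"
        using g(3)[OF qU(2)] q qU U(2) r(6,8) r'(8) by (simp add: h_def x_def G_def inner_diff_left)
    qed (use r r' in auto)
    also have "\<dots> = (\<Sum>e\<in>E. v (\<lambda>q. (x e q - x e p) * G e q))"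
      unfolding h_def
      using tangent_add[OF smooth_fun_on_const[OF cA open_UNIV] ss, of "f p"] tangent_sum[OF st, where I=E] tangent_const[of "f p"]
      by simp
    also have "\<dots> = (\<Sum>e\<in>E. v (x e) * frechet_derivative F (at (\<phi> p)) e)"
    proof (rule sum.cong[OF refl])
      fix e
      have "v (\<lambda>q. x e q - x e p) = v (x e)"
        using tangent_diff[OF sx[of e] smooth_fun_on_const[OF cA open_UNIV, of "x e p"]] tangent_const by simp
      then show "v (\<lambda>q. (x e q - x e p) * G e q) = v (x e) * frechet_derivative F (at (\<phi> p)) e"
        using tangent_mult[OF sxm[of e] sG[of e]] pB r'(6,8) g(2) by (simp add: G_def)
    qed
    finally show "v f = (\<Sum>e\<in>E. v (x e) * frechet_derivative (f \<circ> inv_into U \<phi>) (at (\<phi> p)) e)"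
      by (simp add: F_def)
  qed
qed

end

lemma tangent_space_plus: "v \<in> tangent_space A p \<Longrightarrow> w \<in> tangent_space A p \<Longrightarrow> v + w \<in> tangent_space A p"
  by (auto simp: tangent_space_def algebra_simps)

lemma tangent_space_scale: "v \<in> tangent_space A p \<Longrightarrow> (\<lambda>f. c * v f) \<in> tangent_space A p"
  by (auto simp: tangent_space_def algebra_simps)

lemma tangent_space_zero: "0 \<in> tangent_space A p"
  by (simp add: tangent_space_def)

lemma tangent_space_sum:
  "(\<And>i. i \<in> I \<Longrightarrow> v i \<in> tangent_space A p) \<Longrightarrow> (\<lambda>f. \<Sum>i\<in>I. c i * v i f) \<in> tangent_space A p"
proof (induction I rule: infinite_finite_induct)
  case (insert i I)
  then show ?case using tangent_space_plus[OF tangent_space_scale[of "v i" A p "c i"]] by (simp add: plus_fun_def)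
qed (use tangent_space_zero[of A p] in \<open>simp_all add: zero_fun_def\<close>)

lemma cderiv_plus: "cderiv (v + w) f = cderiv v f + cderiv w f"
  by (simp add: cderiv_def complex_eq_iff)

lemma cderiv_times: "cderiv (\<lambda>f. c * v f) g = complex_of_real c * cderiv v g"
  by (simp add: cderiv_def complex_eq_iff)

lemma vector_fieldD:
  assumes "vector_field A X"
  shows "X p \<in> tangent_space A p" "smooth_fun A f \<Longrightarrow> smooth_fun A (\<lambda>p. X p f)"
  using assms by (simp_all add: vector_field_def)

text \<open>Coordinate functions \<open>x\<close> and coordinate fields \<open>V\<close> of a chart at \<open>p\<close>, cut off so as to be
  global. Only the fields carry the cut-off \<open>\<rho>\<close>, so that the expansion of a tangent vector in the last
  clause holds at every point of the manifold and not only near \<open>p\<close>.\<close>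

definition coordinate_frame ::
  "('m::{t2_space,second_countable_topology}, 'e::real_inner) atlas \<Rightarrow> 'm \<Rightarrow> nat \<Rightarrow> (nat \<Rightarrow> 'm \<Rightarrow> real) \<Rightarrow>
    (nat \<Rightarrow> 'm vfield) \<Rightarrow> ('m \<Rightarrow> real) \<Rightarrow> 'm set \<Rightarrow> bool" where
  "coordinate_frame A p n x V \<rho> W \<longleftrightarrow>
     (\<forall>i<n. smooth_fun A (x i)) \<and> (\<forall>i<n. vector_field A (V i)) \<and> smooth_fun A \<rho> \<and>
     open W \<and> p \<in> W \<and> (\<forall>q\<in>W. \<rho> q = 1) \<and>
     (\<forall>q\<in>W. \<forall>i<n. \<forall>j<n. V i q (x j) = (if i = j then 1 else 0)) \<and>
     (\<forall>q. \<forall>v\<in>tangent_space A q. \<forall>f. smooth_fun A f \<longrightarrow> \<rho> q * v f = (\<Sum>i<n. v (x i) * V i q f))"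

lemma coordinate_frameD:
  assumes "coordinate_frame A p n x V \<rho> W"
  shows "\<And>i. i < n \<Longrightarrow> smooth_fun A (x i)" "\<And>i. i < n \<Longrightarrow> vector_field A (V i)" "smooth_fun A \<rho>"
    "open W" "p \<in> W" "\<And>q. q \<in> W \<Longrightarrow> \<rho> q = 1"
    "\<And>q i j. q \<in> W \<Longrightarrow> i < n \<Longrightarrow> j < n \<Longrightarrow> V i q (x j) = (if i = j then 1 else 0)"
    "\<And>q v f. v \<in> tangent_space A q \<Longrightarrow> smooth_fun A f \<Longrightarrow> \<rho> q * v f = (\<Sum>i<n. v (x i) * V i q f)"
  using assms unfolding coordinate_frame_def by blast+

context
  fixes A :: "('m::{t2_space,second_countable_topology}, 'e::real_inner) atlas"
  assumes M: "smooth_manifold A"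
begin

private lemma ch: "charted A" by (rule smooth_manifold_charted[OF M])

lemma vector_field_plus: "vector_field A X \<Longrightarrow> vector_field A Y \<Longrightarrow> vector_field A (X + Y)"
  by (simp add: vector_field_def tangent_space_plus smooth_fun_on_add[OF ch open_UNIV])

lemma vector_field_scale: "smooth_fun A f \<Longrightarrow> vector_field A X \<Longrightarrow> vector_field A (\<lambda>q \<phi>. f q * X q \<phi>)"
  by (simp add: vector_field_def tangent_space_scale smooth_fun_on_mult[OF ch open_UNIV])

lemma vector_field_zero: "vector_field A (\<lambda>q \<phi>. 0)"
  using tangent_space_zero[of A] by (simp add: vector_field_def zero_fun_def smooth_fun_on_const[OF ch open_UNIV])

lemma vector_field_sum:
  "(\<And>i. i \<in> I \<Longrightarrow> vector_field A (X i)) \<Longrightarrow> (\<And>i. i \<in> I \<Longrightarrow> smooth_fun A (a i)) \<Longrightarrow>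
    vector_field A (\<lambda>q \<phi>. \<Sum>i\<in>I. a i q * X i q \<phi>)"
  unfolding vector_field_def
  by (auto intro!: tangent_space_sum smooth_fun_on_sum[OF ch open_UNIV] smooth_fun_on_mult[OF ch open_UNIV])

lemma vector_field_lie_bracket:
  assumes X: "vector_field A X" and Y: "vector_field A Y"
  shows "vector_field A (lie_bracket X Y)"
  unfolding vector_field_def
proof (intro conjI allI impI)
  note XT = vector_fieldD(1)[OF X] and YT = vector_fieldD(1)[OF Y]
  note Xs = vector_fieldD(2)[OF X] and Ys = vector_fieldD(2)[OF Y]
  note s = smooth_fun_on_add[OF ch open_UNIV] smooth_fun_on_mult[OF ch open_UNIV]
  fix p
  show "lie_bracket X Y p \<in> tangent_space A p"
    unfolding tangent_space_def mem_Collect_eq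
  proof (intro conjI allI impI)
    fix f g :: "'m \<Rightarrow> real" and c assume f: "smooth_fun A f"
    show "lie_bracket X Y p (\<lambda>x. c * f x) = c * lie_bracket X Y p f"
      by (simp add: lie_bracket_def tangent_scale[OF M XT] tangent_scale[OF M YT] Xs Ys f algebra_simps)
    assume g: "smooth_fun A g"
    show "lie_bracket X Y p (\<lambda>x. f x + g x) = lie_bracket X Y p f + lie_bracket X Y p g"
      by (simp add: lie_bracket_def tangent_add[OF M XT] tangent_add[OF M YT] Xs Ys f g)
    show "lie_bracket X Y p (\<lambda>x. f x * g x) = lie_bracket X Y p f * g p + f p * lie_bracket X Y p g"
      by (simp add: lie_bracket_def tangent_add[OF M XT] tangent_add[OF M YT] tangent_mult[OF M XT] tangent_mult[OF M YT]
          Xs Ys f g s algebra_simps)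
  next
    fix f :: "'m \<Rightarrow> real" assume "\<not> smooth_fun A f"
    then show "lie_bracket X Y p f = 0"
      by (simp add: lie_bracket_def tangent_nonsmooth[OF M XT] tangent_nonsmooth[OF M YT] tangent_const[OF M XT] tangent_const[OF M YT])
  qed
next
  fix f :: "'m \<Rightarrow> real" assume "smooth_fun A f"
  then show "smooth_fun A (\<lambda>p. lie_bracket X Y p f)"
    by (simp add: lie_bracket_def smooth_fun_on_diff[OF ch open_UNIV] vector_fieldD(2)[OF X] vector_fieldD(2)[OF Y])
qed

text \<open>Two nested cut-offs: \<open>\<rho>2\<close> makes the coordinates global, and \<open>\<rho>\<close>, which makes the fields global, is
  supported where \<open>\<rho>2\<close> is 1, so that the cut-off coordinates are true ones wherever a field is non-zero.\<close>

lemma coordinate_frame_exists: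
  obtains n x V \<rho> W where "coordinate_frame A p n x V \<rho> W"
proof -
  obtain E :: "'e set" where E: "orthonormal_basis E" using charted_basis[OF ch] .
  obtain U \<phi> where U: "(U, \<phi>) \<in> A" "p \<in> U" using charted_cover[OF ch] .
  note oU = chart_open[OF ch U(1)]
  obtain \<rho>2 :: "'m \<Rightarrow> real" and C2 W2 where r2: "smooth_fun A \<rho>2" "closed C2" "C2 \<subseteq> U" "\<And>x. x \<notin> C2 \<Longrightarrow> \<rho>2 x = 0"
    "open W2" "p \<in> W2" "W2 \<subseteq> C2" "\<And>x. x \<in> W2 \<Longrightarrow> \<rho>2 x = 1"
    using bump_function[OF M oU U(2)] by metis
  obtain \<rho> :: "'m \<Rightarrow> real" and C W1 where r: "smooth_fun A \<rho>" "closed C" "C \<subseteq> W2" "\<And>x. x \<notin> C \<Longrightarrow> \<rho> x = 0"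
    "open W1" "p \<in> W1" "W1 \<subseteq> C" "\<And>x. x \<in> W1 \<Longrightarrow> \<rho> x = 1"
    using bump_function[OF M r2(5,6)] by metis
  have W2U: "W2 \<subseteq> U" using r2 by blast
  define X where "X e q = (if q \<in> U then \<rho>2 q *\<^sub>R (\<phi> q \<bullet> e) else 0)" for e q
  define D where "D e q f = frechet_derivative (f \<circ> inv_into U \<phi>) (at (\<phi> q)) e" for e q and f :: "'m \<Rightarrow> real"
  define V where "V e q f = (if smooth_fun A f then (if q \<in> W2 then \<rho> q *\<^sub>R D e q f else 0) else 0)" for e q f
  have sX: "smooth_fun A (X e)" for e unfolding X_def
    using r2(4) by (intro smooth_extend_by_zero[OF ch r2(1-3) _ oU]
        smooth_fun_on_bounded_linear[OF ch oU bounded_linear_inner_left smooth_chart[OF M U(1)]]) auto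
  have sF: "smooth_on (\<phi> ` U) (f \<circ> inv_into U \<phi>)" if "smooth_fun A f" for f :: "'m \<Rightarrow> real"
    using that U(1) unfolding smooth_fun_on_iff[OF ch open_UNIV] by force
  have dF: "(f \<circ> inv_into U \<phi> has_derivative (\<lambda>e. D e q f)) (at (\<phi> q))" if "smooth_fun A f" "q \<in> U" for f q
    using smooth_on_has_derivative[OF sF[OF that(1)]] that(2) by (simp add: D_def)
  have Duniq: "D e q f = f' e" if "(f \<circ> inv_into U \<phi> has_derivative f') (at (\<phi> q))" for e q f f'
    using frechet_derivative_at[OF that] by (simp add: D_def)
  have VT: "V e q \<in> tangent_space A q" for e q
  proof -
    have add: "D e q (\<lambda>x. f x + g x) = D e q f + D e q g" if "smooth_fun A f" "smooth_fun A g" "q \<in> U" for f g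
      by (rule Duniq) (use has_derivative_add[OF dF[OF that(1,3)] dF[OF that(2,3)]] in \<open>simp add: comp_def\<close>)
    have mult: "D e q (\<lambda>x. f x * g x) = D e q f * g q + f q * D e q g" if "smooth_fun A f" "smooth_fun A g" "q \<in> U" for f g
    proof -
      have "((\<lambda>x. f x * g x) \<circ> inv_into U \<phi> has_derivative (\<lambda>h. f q * D h q g + D h q f * g q)) (at (\<phi> q))"
        using has_derivative_mult[OF dF[OF that(1,3)] dF[OF that(2,3)]] chart_inv[OF ch U(1) that(3)] by (simp add: comp_def)
      from Duniq[OF this] show ?thesis by simp
    qed
    have const: "D e q (\<lambda>x. c) = 0" for c
      using Duniq[of "\<lambda>x. c" "\<lambda>_. 0" q e] by (simp add: comp_def)
    show ?thesis
      unfolding tangent_space_def mem_Collect_eq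
    proof (intro conjI allI impI)
      fix f g :: "'m \<Rightarrow> real" and c assume f: "smooth_fun A f"
      have sc: "smooth_fun A (\<lambda>x. c :: real)" by (rule smooth_fun_on_const[OF ch open_UNIV])
      show "V e q (\<lambda>x. c * f x) = c * V e q f"
        using f smooth_fun_on_mult[OF ch open_UNIV sc f] mult[OF sc f] const W2U by (auto simp: V_def)
      assume g: "smooth_fun A g"
      show "V e q (\<lambda>x. f x + g x) = V e q f + V e q g"
        using f g smooth_fun_on_add[OF ch open_UNIV f g] add[OF f g] W2U by (auto simp: V_def algebra_simps)
      show "V e q (\<lambda>x. f x * g x) = V e q f * g q + f q * V e q g"
        using f g smooth_fun_on_mult[OF ch open_UNIV f g] mult[OF f g] W2U by (auto simp: V_def algebra_simps)
    qed (simp add: V_def)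
  qed
  have Vs: "smooth_fun A (\<lambda>q. V e q f)" if f: "smooth_fun A f" for e f
  proof -
    have "smooth_fun_on A W2 (\<lambda>q. D e q f)"
      unfolding D_def
      by (rule smooth_fun_on_compose[OF ch r2(5) E chart_image_open[OF ch U(1)] _ smooth_map_on_subset[OF smooth_chart[OF M U(1)]] smooth_on_directional[OF sF[OF f]]])
        (use W2U in auto)
    from smooth_extend_by_zero[OF ch r(1-4) r2(5) this]
    show ?thesis using f by (simp add: V_def)
  qed
  have Vvf: "vector_field A (V e)" for e using VT Vs by (simp add: vector_field_def)
  have DX: "D e q (X e') = e \<bullet> e'" if "q \<in> W2" for e e' q
  proof -
    have "((\<lambda>y. y \<bullet> e') has_derivative (\<lambda>v. v \<bullet> e')) (at (\<phi> q))"
      by (auto intro!: derivative_eq_intros)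
    then have "(X e' \<circ> inv_into U \<phi> has_derivative (\<lambda>v. v \<bullet> e')) (at (\<phi> q))"
      by (rule has_derivative_transform_within_open[OF _ chart_open_map[OF ch U(1) r2(5)]])
        (use that W2U r2(8) ch U(1) in \<open>auto simp: X_def\<close>)
    from Duniq[OF this] show ?thesis .
  qed
  have exp: "\<rho> q * v f = (\<Sum>e\<in>E. v (X e) * V e q f)" if v: "v \<in> tangent_space A q" and f: "smooth_fun A f" for q v f
  proof (cases "q \<in> W2")
    case True
    then have qU: "q \<in> U" using W2U by blast
    obtain c where c: "\<And>f. smooth_fun A f \<Longrightarrow> v f = (\<Sum>e\<in>E. c e * D e q f)"
      using tangent_chart[OF M v E U(1) qU] unfolding D_def by metis
    have "v (X e) = c e" if "e \<in> E" for e
    proof -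
      have "v (X e) = (\<Sum>e'\<in>E. c e' * (if e' = e then 1 else 0))"
        unfolding c[OF sX] by (rule sum.cong) (use DX[OF True] E that in \<open>auto simp: orthonormal_basis_def\<close>)
      then show ?thesis using that E by (simp add: orthonormal_basis_def if_distrib[of "\<lambda>x. _ * x"] cong: if_cong)
    qed
    then show ?thesis using True f c[OF f] by (simp add: V_def sum_distrib_left mult_ac)
  next
    case False
    then have "\<rho> q = 0" using r(3,4) by blast
    moreover have "V e q f = 0" for e using False by (simp add: V_def)
    ultimately show ?thesis by simp
  qed
  have finE: "finite E" using E by (simp add: orthonormal_basis_def)
  obtain b where b: "bij_betw b {0..<card E} E" using ex_bij_betw_nat_finite[OF finE] by blast
  then have b': "bij_betw b {..<card E} E" by (simp add: atLeast0LessThan)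
  have bE: "b i \<in> E" if "i < card E" for i using b' that by (auto simp: bij_betw_def)
  have binj: "b i = b j \<longleftrightarrow> i = j" if "i < card E" "j < card E" for i j
    using b' that by (auto simp: bij_betw_def inj_on_def)
  have "coordinate_frame A p (card E) (\<lambda>i. X (b i)) (\<lambda>i. V (b i)) \<rho> W1"
    unfolding coordinate_frame_def
  proof (intro conjI allI impI ballI)
    show "V (b i) q (X (b j)) = (if i = j then 1 else 0)" if "q \<in> W1" "i < card E" "j < card E" for q i j
      using that sX DX[of q] r(3,7,8) bE[OF that(2)] bE[OF that(3)] binj[OF that(2,3)] E
      by (auto simp: V_def orthonormal_basis_def subset_iff)
    show "\<rho> q * v f = (\<Sum>i<card E. v (X (b i)) * V (b i) q f)" if "v \<in> tangent_space A q" "smooth_fun A f" for q v f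
      using exp[OF that] sum.reindex_bij_betw[OF b', of "\<lambda>e. v (X e) * V e q f"] by simp
  qed (use sX Vvf r in auto)
  then show ?thesis using that by blast
qed

text \<open>A combination of the frame fields with constant coefficients extends the vector.\<close>

lemma tangent_vector_extends:
  assumes v: "v \<in> tangent_space A p"
  obtains X where "vector_field A X" "X p = v"
proof -
  obtain n x V \<rho> W where fr: "coordinate_frame A p n x V \<rho> W" using coordinate_frame_exists .
  note f = coordinate_frameD(2,5,6,8)[OF fr]
  let ?X = "\<lambda>q \<phi>. \<Sum>i<n. v (x i) * V i q \<phi>"
  have vf: "vector_field A ?X"
    by (rule vector_field_sum) (use f(1) smooth_fun_on_const[OF ch open_UNIV] in auto)
  have "?X p \<phi> = v \<phi>" for \<phi>
  proof (cases "smooth_fun A \<phi>")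
    case True
    then show ?thesis using f(4)[OF v True] f(2,3) by simp
  next
    case False
    then show ?thesis using tangent_nonsmooth[OF M v False] tangent_nonsmooth[OF M vector_fieldD(1)[OF f(1)] False] by simp
  qed
  then have "?X p = v" by (rule ext)
  with vf show ?thesis using that by blast
qed

text \<open>An operation on vector fields that is linear over the smooth functions is pointwise: multiplied by a
  cut-off that is 1 at \<open>p\<close>, a field is a global combination of frame fields whose coefficients at \<open>p\<close>
  depend on its value there only.\<close>

lemma tensorial:
  fixes T :: "'m vfield \<Rightarrow> complex"
  assumes add: "\<And>X Y. vector_field A X \<Longrightarrow> vector_field A Y \<Longrightarrow> T (X + Y) = T X + T Y"
    and scale: "\<And>f X. smooth_fun A f \<Longrightarrow> vector_field A X \<Longrightarrow> T (\<lambda>q \<phi>. f q * X q \<phi>) = complex_of_real (f p) * T X"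
    and X: "vector_field A X" and Y: "vector_field A Y" and eq: "X p = Y p"
  shows "T X = T Y"
proof -
  obtain n x V \<rho> W where fr: "coordinate_frame A p n x V \<rho> W" using coordinate_frame_exists .
  note f = coordinate_frameD(1-3,5,6,8)[OF fr]
  have sum: "T (\<lambda>q \<phi>. \<Sum>i<k. a i q * V i q \<phi>) = (\<Sum>i<k. complex_of_real (a i p) * T (V i))"
    if "k \<le> n" "\<And>i. i < n \<Longrightarrow> smooth_fun A (a i)" for k a
    using that(1)
  proof (induction k)
    case 0
    show ?case using scale[OF smooth_fun_on_const[OF ch open_UNIV, of 0] X] by simp
  next
    case (Suc k)
    let ?S = "\<lambda>q \<phi>. \<Sum>i<k. a i q * V i q \<phi>" and ?a = "\<lambda>q \<phi>. a k q * V k q \<phi>"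
    have "vector_field A ?S" "vector_field A ?a"
      using Suc.prems by (auto intro!: vector_field_sum vector_field_scale f(2) that(2))
    from add[OF this] have "T (?S + ?a) = T ?S + T ?a" .
    moreover have "?S + ?a = (\<lambda>q \<phi>. \<Sum>i<Suc k. a i q * V i q \<phi>)" by (simp add: fun_eq_iff)
    ultimately show ?case using Suc scale[OF that(2) f(2), of k k] by simp
  qed
  have ex: "T Z = (\<Sum>i<n. complex_of_real (Z p (x i)) * T (V i))" if Z: "vector_field A Z" for Z
  proof -
    have "(\<lambda>q \<phi>. \<rho> q * Z q \<phi>) = (\<lambda>q \<phi>. \<Sum>i<n. Z q (x i) * V i q \<phi>)"
    proof (intro ext)
      fix q \<phi>
      show "\<rho> q * Z q \<phi> = (\<Sum>i<n. Z q (x i) * V i q \<phi>)"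
      proof (cases "smooth_fun A \<phi>")
        case True
        then show ?thesis by (rule f(6)[OF vector_fieldD(1)[OF Z]])
      next
        case False
        then show ?thesis
          using tangent_nonsmooth[OF M vector_fieldD(1)[OF Z] False] tangent_nonsmooth[OF M vector_fieldD(1)[OF f(2)] False] by simp
      qed
    qed
    moreover have "T (\<lambda>q \<phi>. \<rho> q * Z q \<phi>) = T Z" using scale[OF f(3) Z] f(4,5) by simp
    ultimately show ?thesis using sum[of n "\<lambda>i q. Z q (x i)"] vector_fieldD(2)[OF Z] f(1) by simp
  qed
  show ?thesis using ex[OF X] ex[OF Y] eq by simp
qed

end

section \<open>Hamiltonian vector fields\<close>

lemma smooth_fun_on_prod:
  fixes f :: "'i \<Rightarrow> 'm::t2_space \<Rightarrow> real"
  assumes "charted A" "open W" "\<And>i. i \<in> I \<Longrightarrow> smooth_fun_on A W (f i)"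
  shows "smooth_fun_on A W (\<lambda>x. \<Prod>i\<in>I. f i x)"
  using assms(3) by (induction I rule: infinite_finite_induct)
    (auto intro!: smooth_fun_on_mult[OF assms(1,2)] smooth_fun_on_const[OF assms(1,2)])

lemma smooth_fun_on_det:
  fixes N :: "nat \<Rightarrow> nat \<Rightarrow> 'm::t2_space \<Rightarrow> real"
  assumes cA: "charted A" and W: "open W" and N: "\<And>i j. i < n \<Longrightarrow> j < n \<Longrightarrow> smooth_fun_on A W (N i j)"
  shows "smooth_fun_on A W (\<lambda>q. Determinant.det (Matrix.mat n n (\<lambda>(i, j). N i j q)))"
proof -
  have "Determinant.det (Matrix.mat n n (\<lambda>(i, j). N i j q))
      = (\<Sum>p\<in>{p. p permutes {0..<n}}. signof p * (\<Prod>i=0..<n. N i (p i) q))" for q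
    unfolding Determinant.det_def by (auto intro!: sum.cong prod.cong)
  then show ?thesis
    by (auto intro!: smooth_fun_on_sum[OF cA W] smooth_fun_on_mult[OF cA W] smooth_fun_on_const[OF cA W]
        smooth_fun_on_prod[OF cA W] N)
qed

text \<open>By Cramer's rule the solution of a regular linear system depends smoothly on the coefficients.\<close>

lemma smooth_linear_system:
  fixes \<Omega> :: "nat \<Rightarrow> nat \<Rightarrow> 'm::t2_space \<Rightarrow> real"
  assumes cA: "charted A" and W: "open W"
    and \<Omega>: "\<And>i j. i < n \<Longrightarrow> j < n \<Longrightarrow> smooth_fun_on A W (\<Omega> i j)"
    and b: "\<And>j. j < n \<Longrightarrow> smooth_fun_on A W (b j)"
    and inj: "\<And>q c. q \<in> W \<Longrightarrow> (\<And>j. j < n \<Longrightarrow> (\<Sum>i<n. c i * \<Omega> i j q) = 0) \<Longrightarrow> (\<And>i. i < n \<Longrightarrow> c i = 0)"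
  obtains c where "\<And>i. i < n \<Longrightarrow> smooth_fun_on A W (c i)"
    "\<And>q j. q \<in> W \<Longrightarrow> j < n \<Longrightarrow> (\<Sum>i<n. c i q * \<Omega> i j q) = b j q"
proof -
  define M where "M q = Matrix.mat n n (\<lambda>(j, i). \<Omega> i j q)" for q
  define B where "B q = Matrix.vec n (\<lambda>j. b j q)" for q
  have cM: "M q \<in> carrier_mat n n" and cB: "B q \<in> carrier_vec n" for q by (simp_all add: M_def B_def)
  have row: "(M q *\<^sub>v v) $ j = (\<Sum>i<n. v $ i * \<Omega> i j q)" if "j < n" "v \<in> carrier_vec n" for q v j
    using that by (simp add: M_def scalar_prod_def Matrix.row_def atLeast0LessThan mult.commute)
  have det: "Determinant.det (M q) \<noteq> 0" if q: "q \<in> W" for q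
  proof
    assume "Determinant.det (M q) = 0"
    then obtain v where v: "v \<in> carrier_vec n" "v \<noteq> 0\<^sub>v n" "M q *\<^sub>v v = 0\<^sub>v n"
      using det_0_iff_vec_prod_zero_field[OF cM] by blast
    have "v $ i = 0" if "i < n" for i
      using inj[OF q, of "\<lambda>i. v $ i" i] row[OF _ v(1), of _ q] v(3) that by simp
    then show False using v(1,2) by auto
  qed
  have sol: "\<exists>v. v \<in> carrier_vec n \<and> M q *\<^sub>v v = B q" if q: "q \<in> W" for q
  proof (intro exI conjI)
    let ?d = "Determinant.det (M q)"
    let ?v = "adj_mat (M q) *\<^sub>v ((1 / ?d) \<cdot>\<^sub>v B q)"
    have ca: "adj_mat (M q) \<in> carrier_mat n n" by (rule adj_mat(1)[OF cM])
    have cb: "(1 / ?d) \<cdot>\<^sub>v B q \<in> carrier_vec n" using cB by simp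
    show "?v \<in> carrier_vec n" by (rule mult_mat_vec_carrier[OF ca cb])
    have "M q *\<^sub>v ?v = (?d \<cdot>\<^sub>m 1\<^sub>m n) *\<^sub>v ((1 / ?d) \<cdot>\<^sub>v B q)"
      using assoc_mult_mat_vec[OF cM[of q] ca cb] adj_mat(2)[OF cM[of q]] by simp
    also have "\<dots> = ?d \<cdot>\<^sub>v ((1 / ?d) \<cdot>\<^sub>v B q)"
      by (rule eq_vecI) (use cb in \<open>auto simp: scalar_prod_def if_distrib[of "\<lambda>x. x * _"] sum.delta cong: if_cong\<close>)
    also have "\<dots> = B q" using det[OF q] by (simp add: smult_smult_assoc)
    finally show "M q *\<^sub>v ?v = B q" .
  qed
  define N where "N k j i q = (if i = k then b j q else \<Omega> i j q)" for k i j q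
  define c where "c k q = Determinant.det (Matrix.mat n n (\<lambda>(j, i). N k j i q)) / Determinant.det (Matrix.mat n n (\<lambda>(j, i). \<Omega> i j q))" for k q
  have rep: "Matrix.mat n n (\<lambda>(j, i). N k j i q) = replace_col (M q) (B q) k" for k q
    by (rule eq_matI) (auto simp: replace_col_def M_def B_def N_def)
  show ?thesis
  proof (rule that[of c])
    have sN: "smooth_fun_on A W (N k j i)" if "i < n" "j < n" for k j i
      using \<Omega>[OF that] b[OF that(2)] by (cases "i = k") (simp_all add: N_def[abs_def])
    show "smooth_fun_on A W (c k)" for k unfolding c_def
      by (intro smooth_fun_on_divide[OF cA W] smooth_fun_on_det[OF cA W])
        (use det \<Omega> sN in \<open>auto simp: M_def\<close>)
    fix q j assume q: "q \<in> W" and j: "j < n"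
    obtain v where v: "v \<in> carrier_vec n" "M q *\<^sub>v v = B q" using sol[OF q] by blast
    have "c i q = v $ i" if "i < n" for i
      using cramer_lemma_mat[OF cM v(1) that, of q] det[OF q] unfolding v(2) c_def rep M_def[symmetric] by simp
    then show "(\<Sum>i<n. c i q * \<Omega> i j q) = b j q"
      using row[OF j v(1), of q] j by (simp add: v(2) B_def)
  qed
qed

locale symplectic_manifold =
  fixes A :: "('m::{t2_space,second_countable_topology}, 'e::real_inner) atlas"
    and \<omega> :: "'m \<Rightarrow> 'm tvec \<Rightarrow> 'm tvec \<Rightarrow> real"
  assumes M: "smooth_manifold A" and symplectic: "symplectic_form A \<omega>"
begin

lemma charted_A: "charted A" by (rule smooth_manifold_charted[OF M])

lemma two_form_omega: "two_form A (\<lambda>p v w. complex_of_real (\<omega> p v w))"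
  using symplectic by (simp add: symplectic_form_def closed_form2_def)

lemma omega_add: "u \<in> tangent_space A p \<Longrightarrow> v \<in> tangent_space A p \<Longrightarrow> w \<in> tangent_space A p \<Longrightarrow>
    \<omega> p (u + v) w = \<omega> p u w + \<omega> p v w"
  using two_form_omega unfolding two_form_def of_real_add[symmetric] of_real_eq_iff by blast

lemma omega_scale: "v \<in> tangent_space A p \<Longrightarrow> w \<in> tangent_space A p \<Longrightarrow> \<omega> p (\<lambda>f. c * v f) w = c * \<omega> p v w"
  using two_form_omega unfolding two_form_def of_real_mult[symmetric] of_real_eq_iff by blast

lemma omega_skew: "v \<in> tangent_space A p \<Longrightarrow> w \<in> tangent_space A p \<Longrightarrow> \<omega> p v w = - \<omega> p w v"
  using two_form_omega unfolding two_form_def of_real_minus[symmetric] of_real_eq_iff by blast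

lemma omega_smooth: "vector_field A X \<Longrightarrow> vector_field A Y \<Longrightarrow> smooth_fun A (\<lambda>p. \<omega> p (X p) (Y p))"
  using two_form_omega smooth_fun_on_Re[OF charted_A open_UNIV, of "\<lambda>p. complex_of_real (\<omega> p (X p) (Y p))"]
  unfolding two_form_def by simp

lemma omega_sum:
  assumes w: "w \<in> tangent_space A p" and v: "\<And>i. i \<in> I \<Longrightarrow> v i \<in> tangent_space A p"
  shows "\<omega> p (\<lambda>f. \<Sum>i\<in>I. c i * v i f) w = (\<Sum>i\<in>I. c i * \<omega> p (v i) w)"
  using v
proof (induction I rule: infinite_finite_induct)
  case (insert i I)
  have "(\<lambda>f. c i * v i f + (\<Sum>i\<in>I. c i * v i f)) = (\<lambda>f. c i * v i f) + (\<lambda>f. \<Sum>i\<in>I. c i * v i f)"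
    by (simp add: fun_eq_iff)
  then show ?case
    using insert omega_add[OF tangent_space_scale[of "v i" A p "c i"] tangent_space_sum[where I=I and v=v and c=c] w] omega_scale[of "v i" p w "c i"] w
    by simp
qed (use omega_scale[OF tangent_space_zero w, of 0] in simp_all)

lemma omega_sum_right:
  assumes w: "w \<in> tangent_space A p" and v: "\<And>i. i \<in> I \<Longrightarrow> v i \<in> tangent_space A p"
  shows "\<omega> p w (\<lambda>f. \<Sum>i\<in>I. c i * v i f) = (\<Sum>i\<in>I. c i * \<omega> p w (v i))"
proof -
  have "\<omega> p w (\<lambda>f. \<Sum>i\<in>I. c i * v i f) = - \<omega> p (\<lambda>f. \<Sum>i\<in>I. c i * v i f) w"
    using omega_skew[OF w tangent_space_sum[OF v, where c=c]] by simp
  also have "\<dots> = (\<Sum>i\<in>I. c i * (- \<omega> p (v i) w))"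
    by (simp add: omega_sum[OF w v] sum_negf)
  also have "\<dots> = (\<Sum>i\<in>I. c i * \<omega> p w (v i))"
    by (rule sum.cong[OF refl]) (use omega_skew[OF w v] in simp)
  finally show ?thesis .
qed

lemma omega_nondegenerate:
  assumes v: "v \<in> tangent_space A p" and v': "v' \<in> tangent_space A p"
    and eq: "\<And>w. w \<in> tangent_space A p \<Longrightarrow> \<omega> p v w = \<omega> p v' w"
  shows "v = v'"
proof -
  let ?u = "v + (\<lambda>f. - 1 * v' f)"
  have "?u \<in> tangent_space A p" by (intro tangent_space_plus tangent_space_scale v v')
  moreover have "\<omega> p ?u w = 0" if "w \<in> tangent_space A p" for w
    using omega_add[OF v tangent_space_scale[OF v', of "-1"] that] omega_scale[OF v' that, of "-1"] eq[OF that] by simp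
  ultimately have "?u = 0" using symplectic by (simp add: symplectic_form_def)
  then show ?thesis by (simp add: fun_eq_iff)
qed

lemma frame_expansion:
  assumes fr: "coordinate_frame A p n x V \<rho> W" and q: "q \<in> W" and v: "v \<in> tangent_space A q"
  shows "v = (\<lambda>f. \<Sum>i<n. v (x i) * V i q f)"
proof (rule ext)
  note f = coordinate_frameD[OF fr]
  fix g
  show "v g = (\<Sum>i<n. v (x i) * V i q g)"
  proof (cases "smooth_fun A g")
    case True
    then show ?thesis using f(8)[OF v True] f(6)[OF q] by simp
  next
    case False
    then show ?thesis using tangent_nonsmooth[OF M v False] tangent_nonsmooth[OF M vector_fieldD(1)[OF f(2)] False] by simp
  qed
qed

text \<open>Near each point the field solves a linear system in a frame. The solution is unique at every point,
  so that the local solutions fit together and inherit smoothness.\<close>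

lemma hamiltonian_vfield_exists:
  assumes f: "smooth_fun A f"
  obtains X where "vector_field A X" "\<And>p w. w \<in> tangent_space A p \<Longrightarrow> \<omega> p (X p) w = w f"
proof -
  define P where "P p n c V W \<longleftrightarrow> open W \<and> p \<in> W \<and> (\<forall>i<n. vector_field A (V i)) \<and> (\<forall>i<n. smooth_fun_on A W (c i)) \<and>
     (\<forall>q\<in>W. \<forall>w\<in>tangent_space A q. \<omega> q (\<lambda>g. \<Sum>i<n. c i q * V i q g) w = w f)"
    for p and n :: nat and c V W
  have PD: "open W" "p \<in> W" "\<And>i. i < n \<Longrightarrow> vector_field A (V i)" "\<And>i. i < n \<Longrightarrow> smooth_fun_on A W (c i)"
    "\<forall>q\<in>W. \<forall>w\<in>tangent_space A q. \<omega> q (\<lambda>g. \<Sum>i<n. c i q * V i q g) w = w f" if "P p n c V W" for p n c V W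
    using that by (simp_all add: P_def)
  have loc: "\<exists>n c V W. P p n c V W" for p
  proof -
    obtain n x V \<rho> W where fr: "coordinate_frame A p n x V \<rho> W" using coordinate_frame_exists[OF M] .
    note F = coordinate_frameD[OF fr]
    have T: "V i q \<in> tangent_space A q" if "i < n" for i q by (rule vector_fieldD(1)[OF F(2)[OF that]])
    have TS: "(\<lambda>g. \<Sum>i<n. c i * V i q g) \<in> tangent_space A q" for c q by (rule tangent_space_sum) (use T in auto)
    define \<Omega> where "\<Omega> i j q = \<omega> q (V i q) (V j q)" for i j q
    have expand: "\<omega> q u w = (\<Sum>j<n. w (x j) * \<omega> q u (V j q))"
      if "q \<in> W" "u \<in> tangent_space A q" "w \<in> tangent_space A q" for q u w
      using omega_sum_right[OF that(2), of "{..<n}" "\<lambda>i. V i q" "\<lambda>i. w (x i)"] T frame_expansion[OF fr that(1,3)] by simp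
    have sumV: "\<omega> q (\<lambda>g. \<Sum>i<n. c i * V i q g) (V j q) = (\<Sum>i<n. c i * \<Omega> i j q)" if "j < n" for c q j
      unfolding \<Omega>_def by (rule omega_sum) (use T that in auto)
    obtain c where c: "\<And>i. i < n \<Longrightarrow> smooth_fun_on A W (c i)"
      "\<And>q j. q \<in> W \<Longrightarrow> j < n \<Longrightarrow> (\<Sum>i<n. c i q * \<Omega> i j q) = V j q f"
    proof (rule smooth_linear_system[OF charted_A F(4), of n \<Omega> "\<lambda>j q. V j q f"])
      show "smooth_fun_on A W (\<Omega> i j)" if "i < n" "j < n" for i j
        unfolding \<Omega>_def by (rule smooth_map_on_subset[OF omega_smooth[OF F(2) F(2)]]) (use that in auto)
      show "smooth_fun_on A W (\<lambda>q. V j q f)" if "j < n" for j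
        by (rule smooth_map_on_subset[OF vector_fieldD(2)[OF F(2) f]]) (use that in auto)
      show "c i = 0" if q: "q \<in> W" and z: "\<And>j. j < n \<Longrightarrow> (\<Sum>i<n. c i * \<Omega> i j q) = 0" and i: "i < n" for q c i
      proof -
        let ?u = "\<lambda>g. \<Sum>i<n. c i * V i q g"
        have "\<omega> q ?u w = 0" if "w \<in> tangent_space A q" for w
          unfolding expand[OF q TS that] using z sumV by simp
        then have "?u = 0" using symplectic TS[of c q] unfolding symplectic_form_def by blast
        then have "?u (x i) = 0" using fun_cong[of ?u 0 "x i"] by (simp only: zero_fun_apply)
        moreover have "?u (x i) = (\<Sum>k<n. if k = i then c k else 0)"
          by (rule sum.cong) (use F(7)[OF q _ i] in auto)
        ultimately show ?thesis using i by simp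
      qed
    qed blast
    have "\<omega> q (\<lambda>g. \<Sum>i<n. c i q * V i q g) w = w f" if "q \<in> W" "w \<in> tangent_space A q" for q w
    proof -
      have "\<omega> q (\<lambda>g. \<Sum>i<n. c i q * V i q g) w = (\<Sum>j<n. w (x j) * V j q f)"
        unfolding expand[OF that(1) TS that(2)] using sumV c(2)[OF that(1)] by simp
      also have "\<dots> = w f" using fun_cong[OF frame_expansion[OF fr that], of f] by simp
      finally show ?thesis .
    qed
    then have "P p n c V W" using F(2,4,5) c(1) by (simp add: P_def)
    then show ?thesis by blast
  qed
  have "\<exists>v. v \<in> tangent_space A p \<and> (\<forall>w\<in>tangent_space A p. \<omega> p v w = w f)" for p
  proof -
    obtain n c V W where "P p n c V W" using loc[of p] by blast
    note l = PD(2,3,5)[OF this]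
    have "(\<lambda>g. \<Sum>i<n. c i p * V i p g) \<in> tangent_space A p"
      by (rule tangent_space_sum) (use l(2) vector_fieldD(1) in auto)
    then show ?thesis using l(1,3) by blast
  qed
  then obtain X where X: "\<And>p. X p \<in> tangent_space A p" "\<And>p w. w \<in> tangent_space A p \<Longrightarrow> \<omega> p (X p) w = w f"
    by metis
  have "smooth_fun A (\<lambda>q. X q g)" if g: "smooth_fun A g" for g
  proof (rule smooth_fun_on_local[OF charted_A _ open_UNIV])
    fix p
    obtain n c V W where "P p n c V W" using loc[of p] by blast
    note l = PD[OF this]
    have "X q = (\<lambda>g. \<Sum>i<n. c i q * V i q g)" if q: "q \<in> W" for q
    proof (rule omega_nondegenerate[OF X(1)])
      show "(\<lambda>g. \<Sum>i<n. c i q * V i q g) \<in> tangent_space A q"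
        by (rule tangent_space_sum) (use l(3) vector_fieldD(1) in auto)
      show "\<omega> q (X q) w = \<omega> q (\<lambda>g. \<Sum>i<n. c i q * V i q g) w" if "w \<in> tangent_space A q" for w
        using X(2)[OF that] l(5) q that by simp
    qed
    then have eq: "X q g = (\<Sum>i<n. c i q * V i q g)" if "q \<in> W" for q using that by simp
    have "smooth_fun_on A W (\<lambda>q. \<Sum>i<n. c i q * V i q g)"
      by (intro smooth_fun_on_sum[OF charted_A l(1)] smooth_fun_on_mult[OF charted_A l(1)] l(4) 
          smooth_map_on_subset[OF vector_fieldD(2)[OF l(3) g]]) auto
    then have "smooth_fun_on A W (\<lambda>q. X q g)" by (rule smooth_fun_on_cong[OF charted_A l(1)]) (use eq in simp)
    then show "\<exists>W'. open W' \<and> p \<in> W' \<and> smooth_fun_on A W' (\<lambda>q. X q g)" using l(1,2) by blast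
  qed
  then have "vector_field A X" using X(1) by (simp add: vector_field_def)
  then show ?thesis using that X(2) by blast
qed

abbreviation ham :: "('m \<Rightarrow> real) \<Rightarrow> 'm vfield" where
  "ham \<equiv> hamiltonian_vfield A \<omega>"

lemma ham_unique:
  assumes "vector_field A X" "\<And>p w. w \<in> tangent_space A p \<Longrightarrow> \<omega> p (X p) w = w f"
  shows "ham f = X"
  unfolding hamiltonian_vfield_def
proof (rule the_equality)
  fix Y assume Y: "vector_field A Y \<and> (\<forall>p. \<forall>w\<in>tangent_space A p. \<omega> p (Y p) w = w f)"
  show "Y = X"
  proof (rule ext)
    fix p
    show "Y p = X p"
    proof (rule omega_nondegenerate)
      show "Y p \<in> tangent_space A p" "X p \<in> tangent_space A p" using Y assms(1) vector_fieldD(1) by blast+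
      fix w assume "w \<in> tangent_space A p"
      then show "\<omega> p (Y p) w = \<omega> p (X p) w" using Y assms(2)[of w p] by metis
    qed
  qed
qed (use assms in auto)

lemma ham:
  assumes "smooth_fun A f"
  shows "vector_field A (ham f)" "\<And>p w. w \<in> tangent_space A p \<Longrightarrow> \<omega> p (ham f p) w = w f"
proof -
  obtain X where X: "vector_field A X" "\<And>p w. w \<in> tangent_space A p \<Longrightarrow> \<omega> p (X p) w = w f"
    using hamiltonian_vfield_exists[OF assms] by blast
  have "ham f = X" by (rule ham_unique[OF X])
  with X show "vector_field A (ham f)" "\<And>p w. w \<in> tangent_space A p \<Longrightarrow> \<omega> p (ham f p) w = w f" by auto
qed

text \<open>This handles the vanishing imaginary part when the Poisson bracket of complex functions is evaluated
  on real ones.\<close>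

lemma ham_zero: "ham (\<lambda>x. 0) = 0"
proof (rule ham_unique)
  show "vector_field A 0" using vector_field_zero[OF M] by (simp add: zero_fun_def)
  fix p w assume w: "w \<in> tangent_space A p"
  show "\<omega> p (0 p) w = w (\<lambda>x. 0)"
    using omega_scale[OF w w, of 0] tangent_const[OF M w, of 0] by (simp add: zero_fun_def)
qed

lemma ham_skew:
  assumes "smooth_fun A f" "smooth_fun A g"
  shows "ham g p f = - ham f p g"
proof -
  note T = vector_fieldD(1)[OF ham(1)]
  have "ham g p f = \<omega> p (ham f p) (ham g p)" using ham(2)[OF assms(1) T[OF assms(2)]] by simp
  also have "\<dots> = - \<omega> p (ham g p) (ham f p)" by (rule omega_skew[OF T T]) (rule assms)+
  also have "\<omega> p (ham g p) (ham f p) = ham f p g" using ham(2)[OF assms(2) T[OF assms(1)]] by simp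
  finally show ?thesis .
qed

lemma poisson_bracket_real:
  assumes "smooth_fun A f" "smooth_fun A g"
  shows "poisson_bracket A \<omega> (\<lambda>x. complex_of_real (f x)) g p
    = complex_of_real (ham (\<lambda>x. Re (g x)) p f) + \<i> * complex_of_real (ham (\<lambda>x. Im (g x)) p f)"
  unfolding poisson_bracket_def
  using cderiv_of_real[OF M vector_fieldD(1)[OF ham(1)], of _ p f] smooth_fun_on_Re[OF charted_A open_UNIV assms(2)]
    smooth_fun_on_Im[OF charted_A open_UNIV assms(2)] assms(1) by simp

lemma poisson_bracket_real_real:
  assumes "smooth_fun A f" "smooth_fun A g"
  shows "poisson_bracket A \<omega> (\<lambda>x. complex_of_real (f x)) (\<lambda>x. complex_of_real (g x)) p = complex_of_real (ham g p f)"
  using poisson_bracket_real[OF assms(1) smooth_fun_on_of_real[OF charted_A open_UNIV assms(2)], of p] by (simp add: ham_zero)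

text \<open>Every tangent vector is a value of a Hamiltonian field: the covector \<open>\<omega>(v, -)\<close> is the differential of
  a combination of coordinate functions.\<close>

lemma tangent_is_ham:
  assumes v: "v \<in> tangent_space A p"
  obtains f where "smooth_fun A f" "ham f p = v"
proof -
  obtain n x V \<rho> W where fr: "coordinate_frame A p n x V \<rho> W" using coordinate_frame_exists[OF M] .
  note F = coordinate_frameD[OF fr]
  define f where "f q = (\<Sum>j<n. \<omega> p v (V j p) * x j q)" for q
  have xs: "smooth_fun A (\<lambda>q. \<omega> p v (V j p) * x j q)" if "j < n" for j
    by (intro smooth_fun_on_mult[OF charted_A open_UNIV] smooth_fun_on_const[OF charted_A open_UNIV] F(1) that)
  have sf: "smooth_fun A f" unfolding f_def by (rule smooth_fun_on_sum[OF charted_A open_UNIV xs]) simp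
  have "ham f p = v"
  proof (rule omega_nondegenerate[OF vector_fieldD(1)[OF ham(1)[OF sf]] v])
    fix w assume w: "w \<in> tangent_space A p"
    have "w f = (\<Sum>j<n. \<omega> p v (V j p) * w (x j))"
      unfolding f_def using tangent_sum[OF M w xs, of "{..<n}"] tangent_scale[OF M w F(1)] by simp
    also have "\<dots> = \<omega> p v (\<lambda>f. \<Sum>j<n. w (x j) * V j p f)"
      using omega_sum_right[OF v, of "{..<n}" "\<lambda>j. V j p" "\<lambda>j. w (x j)"] vector_fieldD(1)[OF F(2)]
      by (simp add: mult.commute)
    also have "\<dots> = \<omega> p v w" using frame_expansion[OF fr F(5) w] by simp
    finally show "\<omega> p (ham f p) w = \<omega> p v w" using ham(2)[OF sf w] by simp
  qed
  then show ?thesis using sf that by blast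
qed

subsection \<open>Complex tangent vectors\<close>

text \<open>Complex tangent vectors are represented by their action on real functions. The pairing \<open>omega_c\<close> with
  a real tangent vector is the complex-linear extension of \<open>\<omega>\<close> in its second argument.\<close>

definition ctangent :: "'m \<Rightarrow> (('m \<Rightarrow> real) \<Rightarrow> complex) \<Rightarrow> bool" where
  "ctangent p E \<longleftrightarrow> (\<lambda>f. Re (E f)) \<in> tangent_space A p \<and> (\<lambda>f. Im (E f)) \<in> tangent_space A p"

definition omega_c :: "'m \<Rightarrow> 'm tvec \<Rightarrow> (('m \<Rightarrow> real) \<Rightarrow> complex) \<Rightarrow> complex" where
  "omega_c p v E = Complex (\<omega> p v (\<lambda>f. Re (E f))) (\<omega> p v (\<lambda>f. Im (E f)))"

context
  fixes p E
  assumes E: "ctangent p E"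
begin

private lemma RI: "(\<lambda>f. Re (E f)) \<in> tangent_space A p" "(\<lambda>f. Im (E f)) \<in> tangent_space A p"
  using E by (simp_all add: ctangent_def)

lemma omega_c_add: "v \<in> tangent_space A p \<Longrightarrow> w \<in> tangent_space A p \<Longrightarrow> omega_c p (v + w) E = omega_c p v E + omega_c p w E"
  by (simp add: omega_c_def omega_add RI complex_eq_iff)

lemma omega_c_scale: "v \<in> tangent_space A p \<Longrightarrow> omega_c p (\<lambda>f. c * v f) E = complex_of_real c * omega_c p v E"
  by (simp add: omega_c_def omega_scale RI complex_eq_iff)

lemma omega_c_ham: "smooth_fun A f \<Longrightarrow> omega_c p (ham f p) E = E f"
  by (simp add: omega_c_def ham(2) RI complex_eq_iff)

end

lemma omega_c_frame:
  assumes fr: "coordinate_frame A p n x V \<rho> W" and q: "q \<in> W" and E: "ctangent q E" and v: "v \<in> tangent_space A q"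
  shows "omega_c q v E = (\<Sum>i<n. complex_of_real (\<omega> q v (V i q)) * E (x i))"
proof -
  note F = coordinate_frameD[OF fr]
  have RI: "(\<lambda>f. Re (E f)) \<in> tangent_space A q" "(\<lambda>f. Im (E f)) \<in> tangent_space A q"
    using E by (simp_all add: ctangent_def)
  have *: "\<omega> q v u = (\<Sum>i<n. u (x i) * \<omega> q v (V i q))" if "u \<in> tangent_space A q" for u
    using omega_sum_right[OF v, of "{..<n}" "\<lambda>j. V j q" "\<lambda>j. u (x j)"] vector_fieldD(1)[OF F(2)]
      frame_expansion[OF fr q that] by simp
  show ?thesis
    unfolding omega_c_def *[OF RI(1)] *[OF RI(2)] by (simp add: complex_eq_iff mult.commute)
qed

end

section \<open>Linear functionals on monoid algebras\<close>

text \<open>The linear extension of a function on the monoid. These functionals separate elements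
  (\<open>pm_eqI\<close>) and turn products into iterated evaluations (\<open>pm_eval_mult\<close>), so that identities in
  monoid algebras can be proved by rewriting.\<close>

definition pm_eval :: "('k \<Rightarrow>\<^sub>0 complex) \<Rightarrow> ('k \<Rightarrow> complex) \<Rightarrow> complex" where
  "pm_eval a f = (\<Sum>k\<in>Poly_Mapping.keys a. Poly_Mapping.lookup a k * f k)"

lemma pm_eval_superset:
  assumes "finite S" "Poly_Mapping.keys a \<subseteq> S"
  shows "pm_eval a f = (\<Sum>k\<in>S. Poly_Mapping.lookup a k * f k)"
  unfolding pm_eval_def by (rule sum.mono_neutral_left[OF assms]) (simp add: in_keys_iff)

lemma pm_eval_add: "pm_eval (a + b) f = pm_eval a f + pm_eval b f"
proof -
  let ?S = "Poly_Mapping.keys a \<union> Poly_Mapping.keys b"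
  have "Poly_Mapping.keys (a + b) \<subseteq> ?S" by (rule Poly_Mapping.keys_add)
  then show ?thesis
    using pm_eval_superset[of ?S "a + b" f] pm_eval_superset[of ?S a f] pm_eval_superset[of ?S b f]
    by (simp add: lookup_add algebra_simps sum.distrib)
qed

lemma pm_eval_zero [simp]: "pm_eval 0 f = 0"
  by (simp add: pm_eval_def)

lemma pm_eval_minus: "pm_eval (- a) f = - pm_eval a f"
  using pm_eval_add[of a "- a" f] by (simp add: eq_neg_iff_add_eq_0 add.commute)

lemma pm_eval_diff: "pm_eval (a - b) f = pm_eval a f - pm_eval b f"
  using pm_eval_add[of a "- b" f] by (simp add: pm_eval_minus)

lemma pm_eval_sum: "pm_eval (\<Sum>i\<in>I. a i) f = (\<Sum>i\<in>I. pm_eval (a i) f)"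
  by (induction I rule: infinite_finite_induct) (auto simp: pm_eval_add)

lemma pm_eval_single [simp]: "pm_eval (Poly_Mapping.single k c) f = c * f k"
  by (simp add: pm_eval_def)

lemma pm_eval_cong: "(\<And>k. k \<in> Poly_Mapping.keys a \<Longrightarrow> f k = g k) \<Longrightarrow> pm_eval a f = pm_eval a g"
  by (simp add: pm_eval_def)

lemma pm_eval_fun_add: "pm_eval a (\<lambda>k. f k + g k) = pm_eval a f + pm_eval a g"
  by (simp add: pm_eval_def sum.distrib algebra_simps)

lemma pm_eval_fun_scale: "pm_eval a (\<lambda>k. c * f k) = c * pm_eval a f"
  unfolding pm_eval_def sum_distrib_left by (simp add: mult_ac)

lemma pm_eval_fun_scale_right: "pm_eval a (\<lambda>k. f k * c) = pm_eval a f * c"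
  unfolding pm_eval_def sum_distrib_right by (simp add: mult_ac)

lemma pm_eval_swap: "pm_eval a (\<lambda>k. pm_eval b (\<lambda>l. f k l)) = pm_eval b (\<lambda>l. pm_eval a (\<lambda>k. f k l))"
  unfolding pm_eval_def sum_distrib_left by (subst sum.swap) (simp add: mult_ac)

lemma poly_mapping_sum_single: "a = (\<Sum>k\<in>Poly_Mapping.keys a. Poly_Mapping.single k (Poly_Mapping.lookup a k))"
proof (rule poly_mapping_eqI)
  fix k
  show "Poly_Mapping.lookup a k = Poly_Mapping.lookup (\<Sum>k\<in>Poly_Mapping.keys a. Poly_Mapping.single k (Poly_Mapping.lookup a k)) k"
    by (simp add: lookup_sum lookup_single when_def in_keys_iff)
qed

lemma pm_eval_mult:
  fixes a b :: "'k::monoid_add \<Rightarrow>\<^sub>0 complex"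
  shows "pm_eval (a * b) f = pm_eval a (\<lambda>u. pm_eval b (\<lambda>v. f (u + v)))"
proof -
  have "a * b = (\<Sum>u\<in>Poly_Mapping.keys a. \<Sum>v\<in>Poly_Mapping.keys b.
      Poly_Mapping.single (u + v) (Poly_Mapping.lookup a u * Poly_Mapping.lookup b v))"
    by (subst poly_mapping_sum_single[of a], subst poly_mapping_sum_single[of b])
      (simp add: sum_product mult_single)
  then have "pm_eval (a * b) f = (\<Sum>u\<in>Poly_Mapping.keys a. \<Sum>v\<in>Poly_Mapping.keys b.
      Poly_Mapping.lookup a u * Poly_Mapping.lookup b v * f (u + v))"
    by (simp add: pm_eval_sum)
  then show ?thesis by (simp add: pm_eval_def sum_distrib_left mult.assoc)
qed

lemma pm_eqI:
  fixes a b :: "'k \<Rightarrow>\<^sub>0 complex"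
  assumes "\<And>f. pm_eval a f = pm_eval b f"
  shows "a = b"
proof (rule poly_mapping_eqI)
  fix k :: 'k
  have *: "pm_eval c (\<lambda>l. if l = k then 1 else 0) = Poly_Mapping.lookup c k" for c :: "'k \<Rightarrow>\<^sub>0 complex"
    by (simp add: pm_eval_def if_distrib[of "\<lambda>x. _ * x"] in_keys_iff cong: if_cong)
  show "Poly_Mapping.lookup a k = Poly_Mapping.lookup b k"
    using assms[of "\<lambda>l. if l = k then 1 else 0"] by (simp add: *)
qed

lemma pm_eval_one: "pm_eval (1 :: 'k::monoid_add \<Rightarrow>\<^sub>0 complex) f = f 0"
  using pm_eval_single[of 0 1 f] by simp

lemma pm_eval_lin_ext:
  fixes \<phi> :: "'k \<Rightarrow> 'j::monoid_add \<Rightarrow>\<^sub>0 complex"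
  shows "pm_eval (lin_ext \<phi> a) f = pm_eval a (\<lambda>u. pm_eval (\<phi> u) f)"
  by (simp add: lin_ext_def pm_eval_sum pm_eval_mult) (simp add: pm_eval_def)

lemma lin_ext_add: "lin_ext \<phi> (a + b) = lin_ext \<phi> a + lin_ext \<phi> b"
  by (rule pm_eqI) (simp add: pm_eval_lin_ext pm_eval_add)

lemma lin_ext_diff: "lin_ext \<phi> (a - b) = lin_ext \<phi> a - lin_ext \<phi> b"
  by (rule pm_eqI) (simp add: pm_eval_lin_ext pm_eval_diff)

lemma lin_ext_zero: "lin_ext \<phi> 0 = 0"
  by (simp add: lin_ext_def)

lemma lin_ext_mult:
  assumes "\<And>u v. \<phi> (u + v) = \<phi> u * \<phi> v"
  shows "lin_ext \<phi> (a * b) = lin_ext \<phi> a * lin_ext \<phi> b"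
proof (rule pm_eqI)
  fix f
  have "pm_eval (lin_ext \<phi> (a * b)) f
      = pm_eval a (\<lambda>u. pm_eval b (\<lambda>v. pm_eval (\<phi> u) (\<lambda>x. pm_eval (\<phi> v) (\<lambda>y. f (x + y)))))"
    by (simp add: pm_eval_lin_ext pm_eval_mult assms)
  also have "\<dots> = pm_eval a (\<lambda>u. pm_eval (\<phi> u) (\<lambda>x. pm_eval b (\<lambda>v. pm_eval (\<phi> v) (\<lambda>y. f (x + y)))))"
    by (simp add: pm_eval_swap[of b])
  also have "\<dots> = pm_eval (lin_ext \<phi> a * lin_ext \<phi> b) f"
    by (simp add: pm_eval_lin_ext pm_eval_mult)
  finally show "pm_eval (lin_ext \<phi> (a * b)) f = pm_eval (lin_ext \<phi> a * lin_ext \<phi> b) f" .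
qed

section \<open>Tensor powers of the free algebra\<close>

lemma plus_list_append [simp]: "(u :: 'a list) + v = u @ v"
  by (simp add: plus_list_def)

lemma pair_zero: "(0 :: 'a list \<times> 'b list) = ([], [])" "(0 :: 'a list \<times> 'b list \<times> 'c list) = ([], [], [])"
  by (simp_all add: zero_prod_def zero_list_def)

lemma plus_Nil_pair [simp]: "p + ([], []) = p" "([], []) + p = p" for p :: "'a list \<times> 'b list"
  by (cases p; simp)+

lemma plus_Nil_triple [simp]: "p + ([], [], []) = p" "([], [], []) + p = p" for p :: "'a list \<times> 'b list \<times> 'c list"
  by (cases p; simp)+

lemma tensor_one_mult: "tensor_one (a * b) = tensor_one a * tensor_one b"
  unfolding tensor_one_def by (rule lin_ext_mult) (auto simp: mult_single)

lemma one_tensor_mult: "one_tensor (a * b) = one_tensor a * one_tensor b"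
  unfolding one_tensor_def by (rule lin_ext_mult) (auto simp: mult_single)

lemma coprod_word_append: "coprod_word (u @ v) = coprod_word u * coprod_word v"
  by (simp add: coprod_word_def)

lemma tensor_one_commute: "tensor_one a * basis_elt ([], [], v) = basis_elt ([], [], v) * tensor_one a"
  by (rule pm_eqI) (simp add: tensor_one_def pm_eval_mult pm_eval_lin_ext case_prod_unfold)

lemma one_tensor_commute: "one_tensor a * basis_elt (u, [], []) = basis_elt (u, [], []) * one_tensor a"
  by (rule pm_eqI) (simp add: one_tensor_def pm_eval_mult pm_eval_lin_ext case_prod_unfold)

text \<open>Factorised forms of \<open>\<Delta> \<otimes> id\<close> and \<open>id \<otimes> \<Delta>\<close> on words, from which their multiplicativity is
  read off.\<close>

lemma coprod_tensor_id_alt: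
  "coprod_tensor_id = lin_ext (\<lambda>(u, v). tensor_one (coprod_word u) * basis_elt ([], [], v))"
proof -
  have "lin_ext (\<lambda>(u1, u2). basis_elt (u1, u2, v)) c = tensor_one c * basis_elt ([], [], v)" for c :: "'a alg2" and v
    by (rule pm_eqI) (simp add: tensor_one_def pm_eval_mult pm_eval_lin_ext case_prod_unfold)
  then show ?thesis by (simp add: coprod_tensor_id_def)
qed

lemma id_tensor_coprod_alt:
  "id_tensor_coprod = lin_ext (\<lambda>(u, v). basis_elt (u, [], []) * one_tensor (coprod_word v))"
proof -
  have "lin_ext (\<lambda>(v1, v2). basis_elt (u, v1, v2)) c = basis_elt (u, [], []) * one_tensor c" for c :: "'a alg2" and u
    by (rule pm_eqI) (simp add: one_tensor_def pm_eval_mult pm_eval_lin_ext case_prod_unfold)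
  then show ?thesis by (simp add: id_tensor_coprod_def)
qed

lemma coprod_tensor_id_mult: "coprod_tensor_id (a * b) = coprod_tensor_id a * coprod_tensor_id b"
  unfolding coprod_tensor_id_alt
proof (rule lin_ext_mult, clarify)
  fix u v u' v' :: "'a list"
  let ?T = "\<lambda>u. tensor_one (coprod_word u)" and ?B = "\<lambda>v. basis_elt ([], [], v) :: 'a alg3"
  have "?T (u @ u') * ?B (v @ v') = (?T u * ?T u') * (?B v * ?B v')"
    by (simp add: coprod_word_append tensor_one_mult mult_single)
  also have "\<dots> = ?T u * (?T u' * ?B v) * ?B v'" by (simp only: mult.assoc)
  also have "\<dots> = ?T u * (?B v * ?T u') * ?B v'" by (simp only: tensor_one_commute)
  also have "\<dots> = ?T u * ?B v * (?T u' * ?B v')" by (simp only: mult.assoc)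
  finally show "(case (u, v) + (u', v') of (u, v) \<Rightarrow> ?T u * ?B v) = ?T u * ?B v * (?T u' * ?B v')"
    by simp
qed

lemma id_tensor_coprod_mult: "id_tensor_coprod (a * b) = id_tensor_coprod a * id_tensor_coprod b"
  unfolding id_tensor_coprod_alt
proof (rule lin_ext_mult, clarify)
  fix u v u' v' :: "'a list"
  let ?T = "\<lambda>v. one_tensor (coprod_word v)" and ?B = "\<lambda>u. basis_elt (u, [], []) :: 'a alg3"
  have "?B (u @ u') * ?T (v @ v') = (?B u * ?B u') * (?T v * ?T v')"
    by (simp add: coprod_word_append one_tensor_mult mult_single)
  also have "\<dots> = ?B u * (?B u' * ?T v) * ?T v'" by (simp only: mult.assoc)
  also have "\<dots> = ?B u * (?T v * ?B u') * ?T v'" by (simp only: one_tensor_commute)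
  also have "\<dots> = ?B u * ?T v * (?B u' * ?T v')" by (simp only: mult.assoc)
  finally show "(case (u, v) + (u', v') of (u, v) \<Rightarrow> ?B u * ?T v) = ?B u * ?T v * (?B u' * ?T v')"
    by simp
qed

subsection \<open>Supports\<close>

lemma alg3_on_mult: "a \<in> alg3_on S \<Longrightarrow> b \<in> alg3_on S \<Longrightarrow> a * b \<in> alg3_on S"
  unfolding alg3_on_def using keys_mult[of a b] by fastforce

lemma alg2_on_mult: "a \<in> alg2_on S \<Longrightarrow> b \<in> alg2_on S \<Longrightarrow> a * b \<in> alg2_on S"
  unfolding alg2_on_def using keys_mult[of a b] by fastforce

lemma alg3_on_add: "a \<in> alg3_on S \<Longrightarrow> b \<in> alg3_on S \<Longrightarrow> a + b \<in> alg3_on S"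
  unfolding alg3_on_def using Poly_Mapping.keys_add[of a b] by fastforce

lemma alg2_on_add: "a \<in> alg2_on S \<Longrightarrow> b \<in> alg2_on S \<Longrightarrow> a + b \<in> alg2_on S"
  unfolding alg2_on_def using Poly_Mapping.keys_add[of a b] by fastforce

lemma alg3_on_zero: "0 \<in> alg3_on S" by (simp add: alg3_on_def)

lemma alg3_on_sum: "(\<And>i. i \<in> I \<Longrightarrow> a i \<in> alg3_on S) \<Longrightarrow> (\<Sum>i\<in>I. a i) \<in> alg3_on S"
  by (induction I rule: infinite_finite_induct) (auto simp: alg3_on_zero alg3_on_add)

lemma alg3_on_single: "p \<in> lists S \<times> lists S \<times> lists S \<Longrightarrow> Poly_Mapping.single p c \<in> alg3_on S"
  by (auto simp: alg3_on_def)

lemma alg2_on_single: "p \<in> lists S \<times> lists S \<Longrightarrow> Poly_Mapping.single p c \<in> alg2_on S"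
  by (auto simp: alg2_on_def)

lemma alg3_on_one: "1 \<in> alg3_on S"
  by (simp add: alg3_on_def pair_zero)

lemma alg2_on_one: "1 \<in> alg2_on S"
  by (simp add: alg2_on_def pair_zero)

lemma alg3_on_minus: "a \<in> alg3_on S \<Longrightarrow> - a \<in> alg3_on S"
  by (simp add: alg3_on_def)

lemma alg3_on_lin_ext: "(\<And>k. k \<in> Poly_Mapping.keys a \<Longrightarrow> \<phi> k \<in> alg3_on S) \<Longrightarrow> lin_ext \<phi> a \<in> alg3_on S"
  unfolding lin_ext_def
  by (intro alg3_on_sum alg3_on_mult alg3_on_single) (auto simp: pair_zero)

lemma coprod_word_alg2_on: "w \<in> lists S \<Longrightarrow> coprod_word w \<in> alg2_on S"
proof (induction w)
  case Nil
  show ?case by (simp add: coprod_word_def alg2_on_one)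
next
  case (Cons X w)
  then show ?case
    by (auto simp: coprod_word_def intro!: alg2_on_mult alg2_on_add alg2_on_single)
qed

lemma tensor_one_alg3_on: "a \<in> alg2_on S \<Longrightarrow> tensor_one a \<in> alg3_on S"
  unfolding tensor_one_def by (rule alg3_on_lin_ext) (auto simp: alg2_on_def intro!: alg3_on_single)

lemma one_tensor_alg3_on: "a \<in> alg2_on S \<Longrightarrow> one_tensor a \<in> alg3_on S"
  unfolding one_tensor_def by (rule alg3_on_lin_ext) (auto simp: alg2_on_def intro!: alg3_on_single)

lemma coprod_tensor_id_alg3_on: "a \<in> alg2_on S \<Longrightarrow> coprod_tensor_id a \<in> alg3_on S"
  unfolding coprod_tensor_id_alt
  by (rule alg3_on_lin_ext)
    (auto simp: alg2_on_def[of S] intro!: alg3_on_mult alg3_on_single tensor_one_alg3_on coprod_word_alg2_on)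

lemma id_tensor_coprod_alg3_on: "a \<in> alg2_on S \<Longrightarrow> id_tensor_coprod a \<in> alg3_on S"
  unfolding id_tensor_coprod_alt
  by (rule alg3_on_lin_ext)
    (auto simp: alg2_on_def[of S] intro!: alg3_on_mult alg3_on_single one_tensor_alg3_on coprod_word_alg2_on)

lemma tensor_hom_one: "tensor_one 1 = 1" "one_tensor 1 = 1" "coprod_tensor_id 1 = 1" "id_tensor_coprod 1 = 1"
proof -
  show "tensor_one 1 = 1" "one_tensor 1 = 1"
    by (rule pm_eqI, simp add: tensor_one_def one_tensor_def pm_eval_lin_ext pm_eval_one pair_zero)+
  show "coprod_tensor_id 1 = 1" "id_tensor_coprod 1 = 1"
    by (rule pm_eqI, simp add: tensor_one_def one_tensor_def coprod_tensor_id_alt id_tensor_coprod_alt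
        pm_eval_lin_ext pm_eval_mult pm_eval_one pair_zero coprod_word_def)+
qed

lemma tensor_hom_add: "tensor_one (a + b) = tensor_one a + tensor_one b" "one_tensor (a + b) = one_tensor a + one_tensor b"
  "coprod_tensor_id (a + b) = coprod_tensor_id a + coprod_tensor_id b" "id_tensor_coprod (a + b) = id_tensor_coprod a + id_tensor_coprod b"
  by (simp_all add: tensor_one_def one_tensor_def coprod_tensor_id_def id_tensor_coprod_def lin_ext_add)

lemma tensor_hom_zero: "tensor_one 0 = 0" "one_tensor 0 = 0" "coprod_tensor_id 0 = 0" "id_tensor_coprod 0 = 0"
  by (simp_all add: tensor_one_def one_tensor_def coprod_tensor_id_def id_tensor_coprod_def lin_ext_zero)

section \<open>The ideals\<close>

lemma uea_ideal3_mult_left: "x \<in> uea_ideal3 \<gg> \<Longrightarrow> a \<in> alg3_on \<gg> \<Longrightarrow> a * x \<in> uea_ideal3 \<gg>"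
  unfolding uea_ideal3_def
proof (induction rule: two_sided_ideal.induct)
  case (generator b s c)
  then show ?case using two_sided_ideal.generator[OF alg3_on_mult[of a \<gg> b]] by (simp add: mult.assoc)
qed (auto intro: two_sided_ideal.zero two_sided_ideal.sum simp: distrib_left)

lemma uea_ideal3_mult_right: "x \<in> uea_ideal3 \<gg> \<Longrightarrow> a \<in> alg3_on \<gg> \<Longrightarrow> x * a \<in> uea_ideal3 \<gg>"
  unfolding uea_ideal3_def
proof (induction rule: two_sided_ideal.induct)
  case (generator b s c)
  then show ?case using two_sided_ideal.generator[OF generator(1,2) alg3_on_mult[of c \<gg> a]] by (simp add: mult.assoc)
qed (auto intro: two_sided_ideal.zero two_sided_ideal.sum simp: distrib_right)

lemma uea_ideal2_mult_right: "x \<in> uea_ideal2 \<gg> \<Longrightarrow> a \<in> alg2_on \<gg> \<Longrightarrow> x * a \<in> uea_ideal2 \<gg>"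
  unfolding uea_ideal2_def
proof (induction rule: two_sided_ideal.induct)
  case (generator b s c)
  then show ?case using two_sided_ideal.generator[OF generator(1,2) alg2_on_mult[of c \<gg> a]] by (simp add: mult.assoc)
qed (auto intro: two_sided_ideal.zero two_sided_ideal.sum simp: distrib_right)

lemma uea_ideal3_add: "x \<in> uea_ideal3 \<gg> \<Longrightarrow> y \<in> uea_ideal3 \<gg> \<Longrightarrow> x + y \<in> uea_ideal3 \<gg>"
  unfolding uea_ideal3_def by (rule two_sided_ideal.sum)

lemma uea_ideal3_minus: "x \<in> uea_ideal3 \<gg> \<Longrightarrow> - x \<in> uea_ideal3 \<gg>"
  using uea_ideal3_mult_left[of x \<gg> "- 1"] alg3_on_minus[OF alg3_on_one] by auto

lemma uea_ideal3_diff: "x \<in> uea_ideal3 \<gg> \<Longrightarrow> y \<in> uea_ideal3 \<gg> \<Longrightarrow> x - y \<in> uea_ideal3 \<gg>"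
  using uea_ideal3_add[of x \<gg> "- y"] uea_ideal3_minus[of y \<gg>] by simp

lemma uea_ideal3_zero: "0 \<in> uea_ideal3 \<gg>"
  unfolding uea_ideal3_def by (rule two_sided_ideal.zero)

lemma uea_ideal3_sum: "(\<And>i. i \<in> I \<Longrightarrow> a i \<in> uea_ideal3 \<gg>) \<Longrightarrow> (\<Sum>i\<in>I. a i) \<in> uea_ideal3 \<gg>"
  by (induction I rule: infinite_finite_induct) (auto simp: uea_ideal3_zero uea_ideal3_add)

definition slot1 :: "'x alg \<Rightarrow> 'x alg3" where "slot1 = lin_ext (\<lambda>w. basis_elt (w, [], []))"
definition slot2 :: "'x alg \<Rightarrow> 'x alg3" where "slot2 = lin_ext (\<lambda>w. basis_elt ([], w, []))"
definition slot3 :: "'x alg \<Rightarrow> 'x alg3" where "slot3 = lin_ext (\<lambda>w. basis_elt ([], [], w))"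

lemma slot_relation:
  assumes "r \<in> uea_relations \<gg>"
  shows "slot1 r \<in> uea_ideal3 \<gg>" "slot2 r \<in> uea_ideal3 \<gg>" "slot3 r \<in> uea_ideal3 \<gg>"
proof -
  have "s \<in> uea_ideal3 \<gg>" if "s \<in> slot1 ` uea_relations \<gg> \<union> slot2 ` uea_relations \<gg> \<union> slot3 ` uea_relations \<gg>" for s
  proof -
    have "1 * s * 1 \<in> uea_ideal3 \<gg>"
      unfolding uea_ideal3_def using that
      by (intro two_sided_ideal.generator alg3_on_one) (simp add: slot1_def slot2_def slot3_def)
    then show ?thesis by simp
  qed
  then show "slot1 r \<in> uea_ideal3 \<gg>" "slot2 r \<in> uea_ideal3 \<gg>" "slot3 r \<in> uea_ideal3 \<gg>" using assms by blast+
qed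

text \<open>The relations are primitive: \<open>\<Delta>(r) = r \<otimes> 1 + 1 \<otimes> r\<close>. For a bracket relation this holds because
  the two tensor factors commute. The statement is for an algebra morphism \<open>d\<close> with values in a
  ring that contains two commuting copies of the free algebra.\<close>

lemma primitive_relation:
  fixes i j d :: "'g vfield alg \<Rightarrow> 'r::ring_1"
  assumes hom: "\<And>a b. i (a - b) = i a - i b" "\<And>a b. i (a * b) = i a * i b"
    "\<And>a b. j (a - b) = j a - j b" "\<And>a b. j (a * b) = j a * j b"
    "\<And>a b. d (a - b) = d a - d b" "\<And>a b. d (a * b) = d a * d b"
    and letter: "\<And>X c. d (Poly_Mapping.single [X] c) = i (Poly_Mapping.single [X] c) + j (Poly_Mapping.single [X] c)"
    and comm: "\<And>a b. i a * j b = j b * i a"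
    and r: "r \<in> uea_relations \<gg>"
  shows "d r = i r + j r"
proof -
  from r consider (add) X Y where "r = basis_elt [X + Y] - basis_elt [X] - basis_elt [Y]"
    | (scale) c X where "r = basis_elt [\<lambda>p f. c * X p f] - Poly_Mapping.single [X] (of_real c)"
    | (bracket) X Y where "r = basis_elt [X] * basis_elt [Y] - basis_elt [Y] * basis_elt [X] - basis_elt [lie_bracket X Y]"
    unfolding uea_relations_def by blast
  then show ?thesis
  proof cases
    case bracket
    then show ?thesis by (simp only: hom letter) (simp add: comm algebra_simps)
  qed (simp_all only: hom letter, simp_all)
qed

lemma slot_mult: "slot1 (a * b) = slot1 a * slot1 b" "slot2 (a * b) = slot2 a * slot2 b" "slot3 (a * b) = slot3 a * slot3 b"
  unfolding slot1_def slot2_def slot3_def by (rule lin_ext_mult, simp add: mult_single)+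

lemma slot_commute: "slot1 a * slot2 b = slot2 b * slot1 a" "slot2 a * slot3 b = slot3 b * slot2 a"
  by (rule pm_eqI, simp add: slot1_def slot2_def slot3_def pm_eval_mult pm_eval_lin_ext pm_eval_swap[of a])+

text \<open>An algebra morphism from two to three tensor factors descends to the universal enveloping algebras as
  soon as it sends the relations in either factor to the ideal.\<close>

lemma ideal2_image:
  assumes hom: "\<And>a b. h (a + b) = h a + h b" "\<And>a b. h (a * b) = h a * h b" "h 0 = 0"
    and on: "\<And>a. a \<in> alg2_on \<gg> \<Longrightarrow> h a \<in> alg3_on \<gg>"
    and rel: "\<And>r. r \<in> uea_relations \<gg> \<Longrightarrow> h (lin_ext (\<lambda>w. basis_elt (w, [])) r) \<in> uea_ideal3 \<gg>"
      "\<And>r. r \<in> uea_relations \<gg> \<Longrightarrow> h (lin_ext (\<lambda>w. basis_elt ([], w)) r) \<in> uea_ideal3 \<gg>"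
    and x: "x \<in> uea_ideal2 \<gg>"
  shows "h x \<in> uea_ideal3 \<gg>"
  using x unfolding uea_ideal2_def
proof (induction rule: two_sided_ideal.induct)
  case (generator a s b)
  then have "h s \<in> uea_ideal3 \<gg>" using rel by blast
  then show ?case using generator on by (simp add: hom uea_ideal3_mult_left uea_ideal3_mult_right)
qed (simp_all add: hom uea_ideal3_zero uea_ideal3_add)

lemma ideal2_tensor_one: "x \<in> uea_ideal2 \<gg> \<Longrightarrow> tensor_one x \<in> uea_ideal3 \<gg>"
proof (rule ideal2_image[of tensor_one])
  have "tensor_one (lin_ext (\<lambda>w. basis_elt (w, [])) r) = slot1 r" for r :: "'a vfield alg"
    by (rule pm_eqI) (simp add: tensor_one_def slot1_def pm_eval_lin_ext)
  then show "r \<in> uea_relations \<gg> \<Longrightarrow> tensor_one (lin_ext (\<lambda>w. basis_elt (w, [])) r) \<in> uea_ideal3 \<gg>" for r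
    by (simp add: slot_relation)
  have "tensor_one (lin_ext (\<lambda>w. basis_elt ([], w)) r) = slot2 r" for r :: "'a vfield alg"
    by (rule pm_eqI) (simp add: tensor_one_def slot2_def pm_eval_lin_ext)
  then show "r \<in> uea_relations \<gg> \<Longrightarrow> tensor_one (lin_ext (\<lambda>w. basis_elt ([], w)) r) \<in> uea_ideal3 \<gg>" for r
    by (simp add: slot_relation)
qed (simp_all add: tensor_one_mult tensor_one_alg3_on tensor_hom_add tensor_hom_zero)

lemma ideal2_one_tensor: "x \<in> uea_ideal2 \<gg> \<Longrightarrow> one_tensor x \<in> uea_ideal3 \<gg>"
proof (rule ideal2_image[of one_tensor])
  have "one_tensor (lin_ext (\<lambda>w. basis_elt (w, [])) r) = slot2 r" for r :: "'a vfield alg"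
    by (rule pm_eqI) (simp add: one_tensor_def slot2_def pm_eval_lin_ext)
  then show "r \<in> uea_relations \<gg> \<Longrightarrow> one_tensor (lin_ext (\<lambda>w. basis_elt (w, [])) r) \<in> uea_ideal3 \<gg>" for r
    by (simp add: slot_relation)
  have "one_tensor (lin_ext (\<lambda>w. basis_elt ([], w)) r) = slot3 r" for r :: "'a vfield alg"
    by (rule pm_eqI) (simp add: one_tensor_def slot3_def pm_eval_lin_ext)
  then show "r \<in> uea_relations \<gg> \<Longrightarrow> one_tensor (lin_ext (\<lambda>w. basis_elt ([], w)) r) \<in> uea_ideal3 \<gg>" for r
    by (simp add: slot_relation)
qed (simp_all add: one_tensor_mult one_tensor_alg3_on tensor_hom_add tensor_hom_zero)

lemma coprod_word_single: "coprod_word [X] = basis_elt ([X], []) + basis_elt ([], [X])"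
  by (simp add: coprod_word_def)

lemma ideal2_coprod_tensor_id: "x \<in> uea_ideal2 \<gg> \<Longrightarrow> coprod_tensor_id x \<in> uea_ideal3 \<gg>"
proof (rule ideal2_image[of coprod_tensor_id])
  define d where "d = lin_ext (\<lambda>w :: 'a vfield list. tensor_one (coprod_word w))"
  have 1: "coprod_tensor_id (lin_ext (\<lambda>w. basis_elt (w, [])) r) = d r" for r :: "'a vfield alg"
    by (rule pm_eqI) (simp add: coprod_tensor_id_alt d_def pm_eval_lin_ext pm_eval_mult)
  have "d r = slot1 r + slot2 r" if "r \<in> uea_relations \<gg>" for r
  proof (rule primitive_relation[OF _ _ _ _ _ _ _ _ that])
    show "d (a * b) = d a * d b" for a b
      unfolding d_def by (rule lin_ext_mult) (simp add: coprod_word_append tensor_one_mult)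
    show "d (Poly_Mapping.single [X] c) = slot1 (Poly_Mapping.single [X] c) + slot2 (Poly_Mapping.single [X] c)" for X c
      by (rule pm_eqI) (simp add: d_def slot1_def slot2_def tensor_one_def pm_eval_lin_ext pm_eval_add coprod_word_single algebra_simps)
  qed (simp_all add: slot_mult slot_commute, simp_all add: d_def slot1_def slot2_def lin_ext_diff)
  then show "r \<in> uea_relations \<gg> \<Longrightarrow> coprod_tensor_id (lin_ext (\<lambda>w. basis_elt (w, [])) r) \<in> uea_ideal3 \<gg>" for r
    by (simp add: 1 slot_relation uea_ideal3_add)
  have "coprod_tensor_id (lin_ext (\<lambda>w. basis_elt ([], w)) r) = slot3 r" for r :: "'a vfield alg"
    by (rule pm_eqI) (simp add: coprod_tensor_id_alt slot3_def tensor_one_def pm_eval_lin_ext pm_eval_mult coprod_word_def pm_eval_one pair_zero)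
  then show "r \<in> uea_relations \<gg> \<Longrightarrow> coprod_tensor_id (lin_ext (\<lambda>w. basis_elt ([], w)) r) \<in> uea_ideal3 \<gg>" for r
    by (simp add: slot_relation)
qed (simp_all add: coprod_tensor_id_mult coprod_tensor_id_alg3_on tensor_hom_add tensor_hom_zero)

lemma ideal2_id_tensor_coprod: "x \<in> uea_ideal2 \<gg> \<Longrightarrow> id_tensor_coprod x \<in> uea_ideal3 \<gg>"
proof (rule ideal2_image[of id_tensor_coprod])
  define d where "d = lin_ext (\<lambda>w :: 'a vfield list. one_tensor (coprod_word w))"
  have 1: "id_tensor_coprod (lin_ext (\<lambda>w. basis_elt ([], w)) r) = d r" for r :: "'a vfield alg"
    by (rule pm_eqI) (simp add: id_tensor_coprod_alt d_def pm_eval_lin_ext pm_eval_mult)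
  have "d r = slot2 r + slot3 r" if "r \<in> uea_relations \<gg>" for r
  proof (rule primitive_relation[OF _ _ _ _ _ _ _ _ that])
    show "d (a * b) = d a * d b" for a b
      unfolding d_def by (rule lin_ext_mult) (simp add: coprod_word_append one_tensor_mult)
    show "d (Poly_Mapping.single [X] c) = slot2 (Poly_Mapping.single [X] c) + slot3 (Poly_Mapping.single [X] c)" for X c
      by (rule pm_eqI) (simp add: d_def slot3_def slot2_def one_tensor_def pm_eval_lin_ext pm_eval_add coprod_word_single algebra_simps)
  qed (simp_all add: slot_mult slot_commute, simp_all add: d_def slot3_def slot2_def lin_ext_diff)
  then show "r \<in> uea_relations \<gg> \<Longrightarrow> id_tensor_coprod (lin_ext (\<lambda>w. basis_elt ([], w)) r) \<in> uea_ideal3 \<gg>" for r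
    by (simp add: 1 slot_relation uea_ideal3_add)
  have "id_tensor_coprod (lin_ext (\<lambda>w. basis_elt (w, [])) r) = slot1 r" for r :: "'a vfield alg"
    by (rule pm_eqI) (simp add: id_tensor_coprod_alt slot1_def one_tensor_def pm_eval_lin_ext pm_eval_mult coprod_word_def pm_eval_one pair_zero)
  then show "r \<in> uea_relations \<gg> \<Longrightarrow> id_tensor_coprod (lin_ext (\<lambda>w. basis_elt (w, [])) r) \<in> uea_ideal3 \<gg>" for r
    by (simp add: slot_relation)
qed (simp_all add: id_tensor_coprod_mult id_tensor_coprod_alg3_on tensor_hom_add tensor_hom_zero)

section \<open>The inverse of a twist\<close>

text \<open>Series over the free algebra, and those which vanish in the triple tensor power of the universal
  enveloping algebra.\<close>

definition series3_on :: "'x set \<Rightarrow> 'x alg3 fps set" where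
  "series3_on S = {P. \<forall>n. fps_nth P n \<in> alg3_on S}"

definition null_series3 :: "'g vfield set \<Rightarrow> 'g vfield alg3 fps set" where
  "null_series3 \<gg> = {P. \<forall>n. fps_nth P n \<in> uea_ideal3 \<gg>}"

lemma null_series3_mult_left: "P \<in> null_series3 \<gg> \<Longrightarrow> Q \<in> series3_on \<gg> \<Longrightarrow> Q * P \<in> null_series3 \<gg>"
  by (auto simp: null_series3_def series3_on_def fps_mult_nth intro!: uea_ideal3_sum uea_ideal3_mult_left)

lemma null_series3_mult_right: "P \<in> null_series3 \<gg> \<Longrightarrow> Q \<in> series3_on \<gg> \<Longrightarrow> P * Q \<in> null_series3 \<gg>"
  by (auto simp: null_series3_def series3_on_def fps_mult_nth intro!: uea_ideal3_sum uea_ideal3_mult_right)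

lemma null_series3_add: "P \<in> null_series3 \<gg> \<Longrightarrow> Q \<in> null_series3 \<gg> \<Longrightarrow> P + Q \<in> null_series3 \<gg>"
  by (simp add: null_series3_def uea_ideal3_add)

lemma null_series3_diff: "P \<in> null_series3 \<gg> \<Longrightarrow> Q \<in> null_series3 \<gg> \<Longrightarrow> P - Q \<in> null_series3 \<gg>"
  by (simp add: null_series3_def uea_ideal3_diff)

lemma series3_on_mult: "P \<in> series3_on \<gg> \<Longrightarrow> Q \<in> series3_on \<gg> \<Longrightarrow> P * Q \<in> series3_on \<gg>"
  by (auto simp: series3_on_def fps_mult_nth intro!: alg3_on_sum alg3_on_mult)

lemma coeffwise_mult:
  fixes h :: "'a::ring_1 \<Rightarrow> 'b::ring_1"
  assumes "\<And>a b. h (a + b) = h a + h b" "\<And>a b. h (a * b) = h a * h b" "h 0 = 0"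
  shows "coeffwise h (P * Q) = coeffwise h P * coeffwise h Q"
proof -
  have "h (sum f I) = (\<Sum>i\<in>I. h (f i))" for f and I :: "nat set"
    by (induction I rule: infinite_finite_induct) (auto simp: assms)
  then show ?thesis by (intro fps_ext) (simp add: coeffwise_def fps_mult_nth assms)
qed

lemma coeffwise_inverse:
  fixes h :: "'g vfield alg2 \<Rightarrow> 'g vfield alg3"
  assumes hom: "\<And>a b. h (a + b) = h a + h b" "\<And>a b. h (a * b) = h a * h b" "h 0 = 0" "h 1 = 1"
    and ideal: "\<And>x. x \<in> uea_ideal2 \<gg> \<Longrightarrow> h x \<in> uea_ideal3 \<gg>"
    and P: "series_cong (uea_ideal2 \<gg>) P 1" and "P = Q * R"
  shows "coeffwise h Q * coeffwise h R - 1 \<in> null_series3 \<gg>"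
proof -
  have hdiff: "h (a - b) = h a - h b" for a b using hom(1)[of "a - b" b] by (simp add: eq_diff_eq)
  have "coeffwise h P - 1 \<in> null_series3 \<gg>"
    unfolding null_series3_def mem_Collect_eq
  proof
    fix n
    have "h (fps_nth P n - fps_nth 1 n) \<in> uea_ideal3 \<gg>"
      using P ideal by (simp add: series_cong_def)
    then show "fps_nth (coeffwise h P - 1) n \<in> uea_ideal3 \<gg>"
      by (cases "n = 0") (simp_all add: coeffwise_def hdiff hom)
  qed
  then show ?thesis using assms(7) coeffwise_mult[OF hom(1-3)] by simp
qed

text \<open>The inverses of the two sides of the cocycle identity of \<open>F\<close>, taken modulo the ideal.\<close>

lemma inverse_twist_cocycle:
  assumes F: "twist \<gg> F" and H: "inverse_series2 \<gg> F H"
  shows "coeffwise coprod_tensor_id H * coeffwise tensor_one H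
       - coeffwise id_tensor_coprod H * coeffwise one_tensor H \<in> null_series3 \<gg>"
proof -
  let ?f1 = "coeffwise tensor_one F" and ?f2 = "coeffwise coprod_tensor_id F"
    and ?g1 = "coeffwise one_tensor F" and ?g2 = "coeffwise id_tensor_coprod F"
    and ?h1 = "coeffwise tensor_one H" and ?h2 = "coeffwise coprod_tensor_id H"
    and ?l1 = "coeffwise one_tensor H" and ?l2 = "coeffwise id_tensor_coprod H"
  have on: "coeffwise h P \<in> series3_on \<gg>" if "P \<in> {F, H}" "\<And>a. a \<in> alg2_on \<gg> \<Longrightarrow> h a \<in> alg3_on \<gg>" for h P
    using that H by (auto simp: coeffwise_def series3_on_def inverse_series2_def series2_on_def)
  note ons = on[OF _ tensor_one_alg3_on] on[OF _ one_tensor_alg3_on] on[OF _ coprod_tensor_id_alg3_on] on[OF _ id_tensor_coprod_alg3_on]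
  have FH: "series_cong (uea_ideal2 \<gg>) (F * H) 1" "series_cong (uea_ideal2 \<gg>) (H * F) 1"
    using H by (simp_all add: inverse_series2_def)
  have 1: "?f1 * ?h1 - 1 \<in> null_series3 \<gg>"
    by (rule coeffwise_inverse[OF tensor_hom_add(1) tensor_one_mult tensor_hom_zero(1) tensor_hom_one(1) ideal2_tensor_one FH(1) refl])
  have 2: "?f2 * ?h2 - 1 \<in> null_series3 \<gg>"
    by (rule coeffwise_inverse[OF tensor_hom_add(3) coprod_tensor_id_mult tensor_hom_zero(3) tensor_hom_one(3) ideal2_coprod_tensor_id FH(1) refl])
  have 3: "?l1 * ?g1 - 1 \<in> null_series3 \<gg>"
    by (rule coeffwise_inverse[OF tensor_hom_add(2) one_tensor_mult tensor_hom_zero(2) tensor_hom_one(2) ideal2_one_tensor FH(2) refl])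
  have 4: "?l2 * ?g2 - 1 \<in> null_series3 \<gg>"
    by (rule coeffwise_inverse[OF tensor_hom_add(4) id_tensor_coprod_mult tensor_hom_zero(4) tensor_hom_one(4) ideal2_id_tensor_coprod FH(2) refl])
  have 5: "?f1 * ?f2 - ?g1 * ?g2 \<in> null_series3 \<gg>"
    using F by (simp add: twist_def series_cong_def null_series3_def)
  have a: "?l2 * (?l1 * ?g1 - 1) * ?g2 + (?l2 * ?g2 - 1) \<in> null_series3 \<gg>" (is "?a \<in> _")
    by (intro null_series3_add null_series3_mult_left null_series3_mult_right 3 4 ons) auto
  have b: "?f1 * (?f2 * ?h2 - 1) * ?h1 + (?f1 * ?h1 - 1) \<in> null_series3 \<gg>" (is "?b \<in> _")
    by (intro null_series3_add null_series3_mult_left null_series3_mult_right 1 2 ons) auto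
  \<comment> \<open>modulo the null series \<open>?a\<close> makes \<open>?l2 * ?l1\<close> a left inverse of \<open>?g1 * ?g2\<close>, and \<open>?b\<close> makes \<open>?h2 * ?h1\<close> a right inverse of \<open>?f1 * ?f2\<close>\<close>
  have "(?l2 * ?l1) * ?b - ?a * (?h2 * ?h1) - (?l2 * ?l1) * (?f1 * ?f2 - ?g1 * ?g2) * (?h2 * ?h1) \<in> null_series3 \<gg>"
    by (intro null_series3_diff null_series3_mult_left null_series3_mult_right a b 5 series3_on_mult ons) auto
  also have "(?l2 * ?l1) * ?b - ?a * (?h2 * ?h1) - (?l2 * ?l1) * (?f1 * ?f2 - ?g1 * ?g2) * (?h2 * ?h1) = ?h2 * ?h1 - ?l2 * ?l1"
    by (simp add: algebra_simps)
  finally show ?thesis .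
qed

lemma inverse_twist_zeroth:
  assumes F: "twist \<gg> F" and H: "inverse_series2 \<gg> F H"
  shows "fps_nth H 0 - 1 \<in> uea_ideal2 \<gg>"
proof -
  have "\<forall>n. fps_nth (F * H) n - fps_nth 1 n \<in> uea_ideal2 \<gg>" using H unfolding inverse_series2_def series_cong_def by blast
  from this[rule_format, of 0] have 1: "fps_nth F 0 * fps_nth H 0 - 1 \<in> uea_ideal2 \<gg>" by simp
  have "fps_nth H 0 \<in> alg2_on \<gg>" using H by (simp add: inverse_series2_def series2_on_def)
  moreover have "fps_nth F 0 - 1 \<in> uea_ideal2 \<gg>" using F by (simp add: twist_def)
  ultimately have "(fps_nth F 0 - 1) * - fps_nth H 0 \<in> uea_ideal2 \<gg>"
    by (intro uea_ideal2_mult_right) (simp_all add: alg2_on_def)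
  then have "(fps_nth F 0 * fps_nth H 0 - 1) + (fps_nth F 0 - 1) * - fps_nth H 0 \<in> uea_ideal2 \<gg>"
    using 1 unfolding uea_ideal2_def by (intro two_sided_ideal.sum)
  then show ?thesis by (simp add: algebra_simps)
qed

section \<open>Words of vector fields as differential operators\<close>

definition field_op :: "'g vfield \<Rightarrow> ('g \<Rightarrow> complex) \<Rightarrow> 'g \<Rightarrow> complex" where
  "field_op X \<phi> g = cderiv (X g) \<phi>"

definition word_op :: "'g vfield list \<Rightarrow> ('g \<Rightarrow> complex) \<Rightarrow> 'g \<Rightarrow> complex" where
  "word_op w \<phi> = foldr field_op w \<phi>"

lemma word_op_Nil [simp]: "word_op [] \<phi> = \<phi>"
  and word_op_Cons: "word_op (X # w) \<phi> = field_op X (word_op w \<phi>)"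
  and word_op_append: "word_op (u @ v) \<phi> = word_op u (word_op v \<phi>)"
  by (simp_all add: word_op_def)

lemma pm_eval_zero_fun: "(\<And>k. k \<in> Poly_Mapping.keys a \<Longrightarrow> f k = 0) \<Longrightarrow> pm_eval a f = 0"
  by (simp add: pm_eval_def)

locale field_words =
  fixes AG :: "('g::{t2_space,second_countable_topology}, 'k::real_inner) atlas" and \<gg> :: "'g vfield set"
  assumes M: "smooth_manifold AG" and vf: "\<And>X. X \<in> \<gg> \<Longrightarrow> vector_field AG X"
begin

lemma charted_AG: "charted AG" by (rule smooth_manifold_charted[OF M])

text \<open>Words are taken over all vector fields here: besides the letters from \<open>\<gg>\<close>, the relations contain the
  letters \<open>X + Y\<close>, \<open>c X\<close> and \<open>[X, Y]\<close>.\<close>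

definition VF :: "'g vfield set" where "VF = Collect (vector_field AG)"

lemma subset_VF: "\<gg> \<subseteq> VF" using vf by (auto simp: VF_def)

lemma lists_VF: "w \<in> lists \<gg> \<Longrightarrow> w \<in> lists VF" using subset_VF by auto

lemma field_op_smooth:
  assumes "vector_field AG X" "smooth_fun AG \<phi>"
  shows "smooth_fun AG (field_op X \<phi>)"
  unfolding field_op_def[abs_def] cderiv_def
  by (intro smooth_fun_on_Complex[OF charted_AG open_UNIV] vector_fieldD(2)[OF assms(1)] smooth_fun_on_Re[OF charted_AG open_UNIV assms(2)]
      smooth_fun_on_Im[OF charted_AG open_UNIV assms(2)])

lemma word_op_smooth: "w \<in> lists VF \<Longrightarrow> smooth_fun AG \<phi> \<Longrightarrow> smooth_fun AG (word_op w \<phi>)"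
  by (induction w) (auto simp: word_op_Cons VF_def intro!: field_op_smooth)

lemma word_op_pm_eval:
  assumes "w \<in> lists VF" "\<And>k. k \<in> Poly_Mapping.keys a \<Longrightarrow> smooth_fun AG (f k)"
  shows "word_op w (\<lambda>g. pm_eval a (\<lambda>k. f k g)) = (\<lambda>g. pm_eval a (\<lambda>k. word_op w (f k) g))"
  using assms(1)
proof (induction w)
  case (Cons X w)
  then have X: "vector_field AG X" and w: "w \<in> lists VF" by (auto simp: VF_def)
  note T = vector_fieldD(1)[OF X]
  have s: "smooth_fun AG (word_op w (f k))" if "k \<in> Poly_Mapping.keys a" for k
    by (rule word_op_smooth[OF w assms(2)[OF that]])
  have "cderiv (X g) (\<lambda>g. \<Sum>k\<in>Poly_Mapping.keys a. Poly_Mapping.lookup a k * word_op w (f k) g)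
      = (\<Sum>k\<in>Poly_Mapping.keys a. cderiv (X g) (\<lambda>g. Poly_Mapping.lookup a k * word_op w (f k) g))" for g
    by (rule cderiv_sum[OF M T]) (intro smooth_fun_on_mult[OF charted_AG open_UNIV] smooth_fun_on_const[OF charted_AG open_UNIV] s)
  also have "\<dots> g = (\<Sum>k\<in>Poly_Mapping.keys a. Poly_Mapping.lookup a k * cderiv (X g) (word_op w (f k)))" for g
    by (rule sum.cong[OF refl]) (rule cderiv_scale[OF M T s])
  finally show ?case using Cons by (simp add: word_op_Cons pm_eval_def field_op_def[abs_def])
qed simp

lemma word_op_zero: "w \<in> lists VF \<Longrightarrow> word_op w (\<lambda>g. 0) = (\<lambda>g. 0)"
  using word_op_pm_eval[of w 0 "\<lambda>k g. 0"] by simp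

lemma word_op_add:
  assumes "w \<in> lists VF" "smooth_fun AG f" "smooth_fun AG h"
  shows "word_op w (\<lambda>g. f g + h g) = (\<lambda>g. word_op w f g + word_op w h g)"
  using assms(1)
proof (induction w)
  case (Cons X w)
  then have X: "vector_field AG X" and w: "w \<in> lists VF" by (auto simp: VF_def)
  show ?case
    using Cons cderiv_add[OF M vector_fieldD(1)[OF X] word_op_smooth[OF w assms(2)] word_op_smooth[OF w assms(3)]]
    by (simp add: word_op_Cons field_op_def[abs_def])
qed simp

lemma word_op_scale:
  assumes "w \<in> lists VF" "smooth_fun AG f"
  shows "word_op w (\<lambda>g. c * f g) = (\<lambda>g. c * word_op w f g)"
  using assms(1)
proof (induction w)
  case (Cons X w)
  then have X: "vector_field AG X" and w: "w \<in> lists VF" by (auto simp: VF_def)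
  show ?case
    using Cons cderiv_scale[OF M vector_fieldD(1)[OF X] word_op_smooth[OF w assms(2)]]
    by (simp add: word_op_Cons field_op_def[abs_def])
qed simp

text \<open>The coproduct encodes the iterated product rule.\<close>

lemma word_op_mult:
  assumes "w \<in> lists VF" "smooth_fun AG f" "smooth_fun AG h"
  shows "word_op w (\<lambda>g. f g * h g) = (\<lambda>g. pm_eval (coprod_word w) (\<lambda>p. word_op (fst p) f g * word_op (snd p) h g))"
  using assms(1)
proof (induction w)
  case Nil
  show ?case by (simp add: coprod_word_def pm_eval_one pair_zero)
next
  case (Cons X w)
  then have X: "vector_field AG X" and w: "w \<in> lists VF" and wX: "[X] \<in> lists VF" by (auto simp: VF_def)
  have keys: "fst p \<in> lists VF" "snd p \<in> lists VF" if "p \<in> Poly_Mapping.keys (coprod_word w)" for p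
    using coprod_word_alg2_on[OF w] that by (auto simp: alg2_on_def)
  have s: "smooth_fun AG (word_op (fst p) f)" "smooth_fun AG (word_op (snd p) h)"
    if "p \<in> Poly_Mapping.keys (coprod_word w)" for p
    using keys[OF that] assms(2,3) word_op_smooth by blast+
  have "word_op (X # w) (\<lambda>g. f g * h g) g
      = field_op X (\<lambda>g. pm_eval (coprod_word w) (\<lambda>p. word_op (fst p) f g * word_op (snd p) h g)) g" for g
    using Cons by (simp add: word_op_Cons)
  also have "\<dots> g = pm_eval (coprod_word w) (\<lambda>p. field_op X (\<lambda>g. word_op (fst p) f g * word_op (snd p) h g) g)" for g
    using word_op_pm_eval[OF wX, of "coprod_word w" "\<lambda>p g. word_op (fst p) f g * word_op (snd p) h g"]
      smooth_fun_on_mult[OF charted_AG open_UNIV s] by (simp add: word_op_Cons)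
  also have "\<dots> g = pm_eval (coprod_word w) (\<lambda>p. word_op (X # fst p) f g * word_op (snd p) h g + word_op (fst p) f g * word_op (X # snd p) h g)" for g
    by (rule pm_eval_cong)
      (use cderiv_mult[OF M vector_fieldD(1)[OF X] s] in \<open>simp add: word_op_Cons field_op_def\<close>)
  also have "\<dots> g = pm_eval (coprod_word (X # w)) (\<lambda>p. word_op (fst p) f g * word_op (snd p) h g)" for g
  proof -
    have "coprod_word (X # w) = (basis_elt ([X], []) + basis_elt ([], [X])) * coprod_word w"
      by (simp add: coprod_word_def)
    then show ?thesis by (simp add: pm_eval_mult pm_eval_add pm_eval_fun_add)
  qed
  finally show ?case by (rule ext)
qed

lemma relation_vanishes:
  assumes r: "r \<in> uea_relations \<gg>" and s: "smooth_fun AG \<phi>"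
  shows "pm_eval r (\<lambda>w. word_op w \<phi> g) = 0"
proof -
  from r consider (add) X Y where "X \<in> \<gg>" "Y \<in> \<gg>" "r = basis_elt [X + Y] - basis_elt [X] - basis_elt [Y]"
    | (scale) c X where "X \<in> \<gg>" "r = basis_elt [\<lambda>p f. c * X p f] - Poly_Mapping.single [X] (of_real c)"
    | (bracket) X Y where "X \<in> \<gg>" "Y \<in> \<gg>" "r = basis_elt [X] * basis_elt [Y] - basis_elt [Y] * basis_elt [X] - basis_elt [lie_bracket X Y]"
    unfolding uea_relations_def by blast
  then show ?thesis
  proof cases
    case add
    then show ?thesis by (simp add: pm_eval_diff word_op_Cons field_op_def cderiv_plus)
  next
    case scale
    then show ?thesis by (simp add: pm_eval_diff word_op_Cons field_op_def cderiv_times)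
  next
    case bracket
    have "cderiv (lie_bracket X Y g) \<phi> = cderiv (X g) (field_op Y \<phi>) - cderiv (Y g) (field_op X \<phi>)"
      by (simp add: lie_bracket_def cderiv_def field_op_def[abs_def] complex_eq_iff)
    then show ?thesis using bracket
      by (simp add: pm_eval_diff pm_eval_mult word_op_Cons field_op_def)
  qed
qed

lemma relation_keys:
  assumes r: "r \<in> uea_relations \<gg>"
  shows "Poly_Mapping.keys r \<subseteq> lists VF"
proof -
  have D: "Poly_Mapping.keys (a - b) \<subseteq> lists VF" if "Poly_Mapping.keys a \<subseteq> lists VF" "Poly_Mapping.keys b \<subseteq> lists VF"
    for a b :: "'g vfield alg"
    using that Poly_Mapping.keys_add[of a "- b"] by auto
  from r consider (add) X Y where "X \<in> \<gg>" "Y \<in> \<gg>" "r = basis_elt [X + Y] - basis_elt [X] - basis_elt [Y]"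
    | (scale) c X where "X \<in> \<gg>" "r = basis_elt [\<lambda>p f. c * X p f] - Poly_Mapping.single [X] (of_real c)"
    | (bracket) X Y where "X \<in> \<gg>" "Y \<in> \<gg>" "r = basis_elt [X] * basis_elt [Y] - basis_elt [Y] * basis_elt [X] - basis_elt [lie_bracket X Y]"
    unfolding uea_relations_def by blast
  then show ?thesis
  proof cases
    case add
    then have "{X, Y, X + Y} \<subseteq> VF" using vf vector_field_plus[OF M] by (auto simp: VF_def)
    then show ?thesis unfolding add by (intro D) auto
  next
    case scale
    then have "{X, \<lambda>p f. c * X p f} \<subseteq> VF"
      using vf vector_field_scale[OF M smooth_fun_on_const[OF charted_AG open_UNIV]] by (auto simp: VF_def)
    then show ?thesis unfolding scale by (intro D) auto
  next
    case bracket
    then have "{X, Y, lie_bracket X Y} \<subseteq> VF" using vf vector_field_lie_bracket[OF M] by (auto simp: VF_def)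
    then show ?thesis unfolding bracket by (intro D) (auto simp: mult_single)
  qed
qed

lemma relation_vanishes_inside:
  assumes r: "r \<in> uea_relations \<gg>" and s: "smooth_fun AG \<phi>" and p: "p \<in> lists VF"
  shows "pm_eval r (\<lambda>w. word_op p (word_op w \<phi>) g) = 0"
proof -
  have "(\<lambda>g. pm_eval r (\<lambda>w. word_op p (word_op w \<phi>) g)) = word_op p (\<lambda>g. pm_eval r (\<lambda>w. word_op w \<phi> g))"
    by (rule word_op_pm_eval[OF p, symmetric]) (use relation_keys[OF r] word_op_smooth s in blast)
  also have "\<dots> = (\<lambda>g. 0)" by (simp add: relation_vanishes[OF r s] word_op_zero[OF p])
  finally show ?thesis by meson
qed

text \<open>Inside a generator of the ideal the relation stands between an outer and an inner word in one of the
  three slots; the relation kills the function produced by the inner word, and the outer word is linear.\<close>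

lemma ideal3_vanishes:
  assumes a: "a \<in> uea_ideal3 \<gg>" and s: "smooth_fun AG \<phi>" "smooth_fun AG \<psi>" "smooth_fun AG \<xi>"
  shows "pm_eval a (\<lambda>(u, v, w). word_op u \<phi> g * word_op v \<psi> g * word_op w \<xi> g) = 0" (is "pm_eval a ?k = 0")
  using a unfolding uea_ideal3_def
proof (induction rule: two_sided_ideal.induct)
  case (generator a t b)
  have "pm_eval t (\<lambda>q. ?k (p + q + r)) = 0" if pk: "p \<in> Poly_Mapping.keys a" and rk: "r \<in> Poly_Mapping.keys b" for p r
  proof -
    obtain p1 p2 p3 where p: "p = (p1, p2, p3)" by (cases p)
    obtain r1 r2 r3 where r: "r = (r1, r2, r3)" by (cases r)
    have L: "p1 \<in> lists VF" "p2 \<in> lists VF" "p3 \<in> lists VF" "r1 \<in> lists VF" "r2 \<in> lists VF" "r3 \<in> lists VF"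
      using pk rk generator(1,3) lists_VF unfolding alg3_on_def p r by blast+
    from generator(2) obtain l where l: "l \<in> uea_relations \<gg>" and "t = slot1 l \<or> t = slot2 l \<or> t = slot3 l"
      unfolding slot1_def slot2_def slot3_def by auto
    then consider "t = slot1 l" | "t = slot2 l" | "t = slot3 l" by blast
    then show ?thesis
    proof cases
      case 1
      have "pm_eval t (\<lambda>q. ?k (p + q + r)) = pm_eval l (\<lambda>w. word_op p1 (word_op w (word_op r1 \<phi>)) g
          * (word_op (p2 @ r2) \<psi> g * word_op (p3 @ r3) \<xi> g))"
        unfolding 1 slot1_def by (simp add: pm_eval_lin_ext p r word_op_append mult.assoc)
      then show ?thesis
        using relation_vanishes_inside[OF l word_op_smooth[OF L(4) s(1)] L(1)] by (simp add: pm_eval_fun_scale_right)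
    next
      case 2
      have "pm_eval t (\<lambda>q. ?k (p + q + r)) = pm_eval l (\<lambda>w. word_op p2 (word_op w (word_op r2 \<psi>)) g
          * (word_op (p1 @ r1) \<phi> g * word_op (p3 @ r3) \<xi> g))"
        unfolding 2 slot2_def by (simp add: pm_eval_lin_ext p r word_op_append mult_ac)
      then show ?thesis
        using relation_vanishes_inside[OF l word_op_smooth[OF L(5) s(2)] L(2)] by (simp add: pm_eval_fun_scale_right)
    next
      case 3
      have "pm_eval t (\<lambda>q. ?k (p + q + r)) = pm_eval l (\<lambda>w. word_op p3 (word_op w (word_op r3 \<xi>)) g
          * (word_op (p1 @ r1) \<phi> g * word_op (p2 @ r2) \<psi> g))"
        unfolding 3 slot3_def by (simp add: pm_eval_lin_ext p r word_op_append mult_ac)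
      then show ?thesis
        using relation_vanishes_inside[OF l word_op_smooth[OF L(6) s(3)] L(3)] by (simp add: pm_eval_fun_scale_right)
    qed
  qed
  then have "pm_eval b (\<lambda>r. pm_eval t (\<lambda>q. ?k (p + q + r))) = 0" if "p \<in> Poly_Mapping.keys a" for p
    using that by (simp add: pm_eval_def[of b])
  then have "pm_eval a (\<lambda>p. pm_eval b (\<lambda>r. pm_eval t (\<lambda>q. ?k (p + q + r)))) = 0"
    by (rule pm_eval_zero_fun)
  moreover have "pm_eval (a * t * b) ?k = pm_eval a (\<lambda>p. pm_eval b (\<lambda>r. pm_eval t (\<lambda>q. ?k (p + q + r))))"
    unfolding pm_eval_mult[of "a * t" b] pm_eval_mult[of a t] pm_eval_swap[of t b] by simp
  ultimately show ?case by simp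
qed (simp_all add: pm_eval_add)

end

section \<open>The Poisson bracket of a twist\<close>

locale inverse_twist = field_words AG \<gg>
  for AG :: "('g::{t2_space,second_countable_topology}, 'k::real_inner) atlas" and \<gg> +
  fixes F H
  assumes F: "twist \<gg> F" and H: "inverse_series2 \<gg> F H"
begin

text \<open>The coefficient of \<open>h ^ n\<close> in the product \<open>m(H(\<phi> \<otimes> \<psi>))\<close> of functions on the group.\<close>

definition star_coeff :: "nat \<Rightarrow> ('g \<Rightarrow> complex) \<Rightarrow> ('g \<Rightarrow> complex) \<Rightarrow> 'g \<Rightarrow> complex" where
  "star_coeff n \<phi> \<psi> g = pm_eval (fps_nth H n) (\<lambda>p. word_op (fst p) \<phi> g * word_op (snd p) \<psi> g)"

lemma H_words:
  assumes "p \<in> Poly_Mapping.keys (fps_nth H n)"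
  shows "fst p \<in> lists \<gg>" "snd p \<in> lists \<gg>"
proof -
  have "p \<in> lists \<gg> \<times> lists \<gg>"
    using assms H by (auto simp: inverse_series2_def series2_on_def alg2_on_def)
  then show "fst p \<in> lists \<gg>" "snd p \<in> lists \<gg>" by (simp_all only: mem_Times_iff)
qed

lemmas H_keys = lists_VF[OF H_words(1)] lists_VF[OF H_words(2)]

lemma star_coeff_smooth: "smooth_fun AG \<phi> \<Longrightarrow> smooth_fun AG \<psi> \<Longrightarrow> smooth_fun AG (star_coeff n \<phi> \<psi>)"
  unfolding star_coeff_def[abs_def] pm_eval_def
  by (intro smooth_fun_on_sum[OF charted_AG open_UNIV] smooth_fun_on_mult[OF charted_AG open_UNIV] smooth_fun_on_const[OF charted_AG open_UNIV]
      word_op_smooth H_keys)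

context
  fixes \<phi> \<psi> \<xi> :: "'g \<Rightarrow> complex"
  assumes s: "smooth_fun AG \<phi>" "smooth_fun AG \<psi>" "smooth_fun AG \<xi>"
begin

lemma star_coeff_add_left: "star_coeff n (\<lambda>g. \<phi> g + \<psi> g) \<xi> g = star_coeff n \<phi> \<xi> g + star_coeff n \<psi> \<xi> g"
  unfolding star_coeff_def pm_eval_fun_add[symmetric]
  by (rule pm_eval_cong) (simp add: word_op_add H_keys s algebra_simps)

lemma star_coeff_add_right: "star_coeff n \<xi> (\<lambda>g. \<phi> g + \<psi> g) g = star_coeff n \<xi> \<phi> g + star_coeff n \<xi> \<psi> g"
  unfolding star_coeff_def pm_eval_fun_add[symmetric]
  by (rule pm_eval_cong) (simp add: word_op_add H_keys s algebra_simps)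

lemma star_coeff_scale_left: "star_coeff n (\<lambda>g. c * \<phi> g) \<xi> g = c * star_coeff n \<phi> \<xi> g"
  unfolding star_coeff_def pm_eval_fun_scale[symmetric]
  by (rule pm_eval_cong) (simp add: word_op_scale H_keys s algebra_simps)

lemma star_coeff_scale_right: "star_coeff n \<xi> (\<lambda>g. c * \<phi> g) g = c * star_coeff n \<xi> \<phi> g"
  unfolding star_coeff_def pm_eval_fun_scale[symmetric]
  by (rule pm_eval_cong) (simp add: word_op_scale H_keys s algebra_simps)

text \<open>Associativity is the cocycle identity of the inverse twist, read through the product rule.\<close>

lemma star_coeff_assoc: "(\<Sum>i=0..n. star_coeff i (star_coeff (n - i) \<phi> \<psi>) \<xi> g) = (\<Sum>i=0..n. star_coeff i \<phi> (star_coeff (n - i) \<psi> \<xi>) g)"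
proof -
  let ?k = "\<lambda>(u, v, w). word_op u \<phi> g * word_op v \<psi> g * word_op w \<xi> g"
  have left: "star_coeff i (star_coeff j \<phi> \<psi>) \<xi> g = pm_eval (coprod_tensor_id (fps_nth H i) * tensor_one (fps_nth H j)) ?k" for i j
  proof -
    have "star_coeff i (star_coeff j \<phi> \<psi>) \<xi> g = pm_eval (fps_nth H i) (\<lambda>p. pm_eval (fps_nth H j) (\<lambda>q.
        pm_eval (coprod_word (fst p)) (\<lambda>c. word_op (fst c) (word_op (fst q) \<phi>) g * word_op (snd c) (word_op (snd q) \<psi>) g))
        * word_op (snd p) \<xi> g)"
      unfolding star_coeff_def[of i]
    proof (rule pm_eval_cong)
      fix p assume p: "p \<in> Poly_Mapping.keys (fps_nth H i)"
      note f = H_keys(1)[OF p]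
      have "word_op (fst p) (star_coeff j \<phi> \<psi>) g = pm_eval (fps_nth H j) (\<lambda>q. word_op (fst p) (\<lambda>g. word_op (fst q) \<phi> g * word_op (snd q) \<psi> g) g)"
        unfolding star_coeff_def[abs_def]
        by (subst word_op_pm_eval[OF f]) (auto intro!: smooth_fun_on_mult[OF charted_AG open_UNIV] word_op_smooth H_keys s)
      also have "\<dots> = pm_eval (fps_nth H j) (\<lambda>q.
        pm_eval (coprod_word (fst p)) (\<lambda>c. word_op (fst c) (word_op (fst q) \<phi>) g * word_op (snd c) (word_op (snd q) \<psi>) g))"
        by (rule pm_eval_cong) (simp add: word_op_mult[OF f] word_op_smooth H_keys s)
      finally show "word_op (fst p) (star_coeff j \<phi> \<psi>) g * word_op (snd p) \<xi> g = pm_eval (fps_nth H j) (\<lambda>q.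
        pm_eval (coprod_word (fst p)) (\<lambda>c. word_op (fst c) (word_op (fst q) \<phi>) g * word_op (snd c) (word_op (snd q) \<psi>) g))
        * word_op (snd p) \<xi> g" by simp
    qed
    also have "\<dots> = pm_eval (coprod_tensor_id (fps_nth H i) * tensor_one (fps_nth H j)) ?k"
      by (simp add: coprod_tensor_id_alt tensor_one_def pm_eval_mult pm_eval_lin_ext case_prod_unfold word_op_append
          pm_eval_fun_scale_right[symmetric] pm_eval_swap[of "fps_nth H j"])
    finally show ?thesis .
  qed
  have right: "star_coeff i \<phi> (star_coeff j \<psi> \<xi>) g = pm_eval (id_tensor_coprod (fps_nth H i) * one_tensor (fps_nth H j)) ?k" for i j
  proof -
    have "star_coeff i \<phi> (star_coeff j \<psi> \<xi>) g = pm_eval (fps_nth H i) (\<lambda>p. word_op (fst p) \<phi> g * pm_eval (fps_nth H j) (\<lambda>q.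
        pm_eval (coprod_word (snd p)) (\<lambda>c. word_op (fst c) (word_op (fst q) \<psi>) g * word_op (snd c) (word_op (snd q) \<xi>) g)))"
      unfolding star_coeff_def[of i]
    proof (rule pm_eval_cong)
      fix p assume p: "p \<in> Poly_Mapping.keys (fps_nth H i)"
      note f = H_keys(2)[OF p]
      have "word_op (snd p) (star_coeff j \<psi> \<xi>) g = pm_eval (fps_nth H j) (\<lambda>q. word_op (snd p) (\<lambda>g. word_op (fst q) \<psi> g * word_op (snd q) \<xi> g) g)"
        unfolding star_coeff_def[abs_def]
        by (subst word_op_pm_eval[OF f]) (auto intro!: smooth_fun_on_mult[OF charted_AG open_UNIV] word_op_smooth H_keys s)
      also have "\<dots> = pm_eval (fps_nth H j) (\<lambda>q.
        pm_eval (coprod_word (snd p)) (\<lambda>c. word_op (fst c) (word_op (fst q) \<psi>) g * word_op (snd c) (word_op (snd q) \<xi>) g))"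
        by (rule pm_eval_cong) (simp add: word_op_mult[OF f] word_op_smooth H_keys s)
      finally show "word_op (fst p) \<phi> g * word_op (snd p) (star_coeff j \<psi> \<xi>) g = word_op (fst p) \<phi> g * pm_eval (fps_nth H j) (\<lambda>q.
        pm_eval (coprod_word (snd p)) (\<lambda>c. word_op (fst c) (word_op (fst q) \<psi>) g * word_op (snd c) (word_op (snd q) \<xi>) g))" by simp
    qed
    also have "\<dots> = pm_eval (id_tensor_coprod (fps_nth H i) * one_tensor (fps_nth H j)) ?k"
      by (simp add: id_tensor_coprod_alt one_tensor_def pm_eval_mult pm_eval_lin_ext case_prod_unfold word_op_append
          pm_eval_fun_scale[symmetric] pm_eval_swap[of "fps_nth H j"] mult.assoc)
    finally show ?thesis .
  qed
  have "fps_nth (coeffwise coprod_tensor_id H * coeffwise tensor_one H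
       - coeffwise id_tensor_coprod H * coeffwise one_tensor H) n \<in> uea_ideal3 \<gg>"
    using inverse_twist_cocycle[OF F H] by (simp add: null_series3_def)
  from ideal3_vanishes[OF this s, of g]
  have "pm_eval (\<Sum>i=0..n. coprod_tensor_id (fps_nth H i) * tensor_one (fps_nth H (n - i))) ?k
      = pm_eval (\<Sum>i=0..n. id_tensor_coprod (fps_nth H i) * one_tensor (fps_nth H (n - i))) ?k"
    by (simp add: pm_eval_diff fps_mult_nth coeffwise_def)
  then show ?thesis by (simp add: pm_eval_sum left right)
qed

text \<open>Tensored with 1, the relation \<open>H\<^sub>0 = 1\<close> lives in the triple tensor power, where the vanishing of the
  ideal is already known.\<close>

lemma star_coeff_zero: "star_coeff 0 \<phi> \<psi> g = \<phi> g * \<psi> g"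
proof -
  have one: "smooth_fun AG (\<lambda>g. 1 :: complex)" by (rule smooth_fun_on_const[OF charted_AG open_UNIV])
  have "tensor_one (fps_nth H 0 - 1) \<in> uea_ideal3 \<gg>"
    by (rule ideal2_tensor_one[OF inverse_twist_zeroth[OF F H]])
  from ideal3_vanishes[OF this s(1,2) one, of g]
  have "pm_eval (fps_nth H 0 - 1) (\<lambda>p. word_op (fst p) \<phi> g * word_op (snd p) \<psi> g) = 0"
    by (simp add: tensor_one_def pm_eval_lin_ext case_prod_unfold)
  then show ?thesis by (simp add: pm_eval_diff star_coeff_def pm_eval_one pair_zero)
qed

end

definition group_bracket :: "('g \<Rightarrow> complex) \<Rightarrow> ('g \<Rightarrow> complex) \<Rightarrow> 'g \<Rightarrow> complex" where
  "group_bracket \<phi> \<psi> g = star_coeff 1 \<phi> \<psi> g - star_coeff 1 \<psi> \<phi> g"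

lemma group_bracket_skew: "group_bracket \<phi> \<psi> g = - group_bracket \<psi> \<phi> g"
  by (simp add: group_bracket_def)

context
  fixes \<phi> \<psi> \<xi> :: "'g \<Rightarrow> complex"
  assumes s: "smooth_fun AG \<phi>" "smooth_fun AG \<psi>" "smooth_fun AG \<xi>"
begin

lemma group_bracket_add: "group_bracket \<xi> (\<lambda>g. \<phi> g + \<psi> g) g = group_bracket \<xi> \<phi> g + group_bracket \<xi> \<psi> g"
  by (simp add: group_bracket_def star_coeff_add_left star_coeff_add_right s)

lemma group_bracket_scale: "group_bracket \<xi> (\<lambda>g. c * \<phi> g) g = c * group_bracket \<xi> \<phi> g"
  using star_coeff_scale_left[OF s] star_coeff_scale_right[OF s] by (simp add: group_bracket_def algebra_simps)

text \<open>The product rule is the first-order part of \<open>[a * b, c] = a * [b, c] + [a, c] * b\<close>.\<close>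

lemma group_bracket_mult: "group_bracket \<xi> (\<lambda>g. \<phi> g * \<psi> g) g = \<phi> g * group_bracket \<xi> \<psi> g + group_bracket \<xi> \<phi> g * \<psi> g"
proof -
  have B0: "star_coeff 0 a b = (\<lambda>g. a g * b g)" if "smooth_fun AG a" "smooth_fun AG b" for a b
    using star_coeff_zero[OF that that(1)] by (rule ext)
  have a: "star_coeff 1 a b g * c g + star_coeff 1 (\<lambda>g. a g * b g) c g = a g * star_coeff 1 b c g + star_coeff 1 a (\<lambda>g. b g * c g) g"
    if "smooth_fun AG a" "smooth_fun AG b" "smooth_fun AG c" for a b c
    using star_coeff_assoc[OF that, of 1 g] by (simp add: B0 that star_coeff_smooth)
  have c: "(\<lambda>g. \<phi> g * \<xi> g) = (\<lambda>g. \<xi> g * \<phi> g)" "(\<lambda>g. \<psi> g * \<xi> g) = (\<lambda>g. \<xi> g * \<psi> g)" by (simp_all add: mult.commute)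
  note e = a[OF s(1,2,3)] a[OF s(3,1,2)] a[OF s(1,3,2)]
  have e1: "star_coeff 1 (\<lambda>g. \<phi> g * \<psi> g) \<xi> g = \<phi> g * star_coeff 1 \<psi> \<xi> g + star_coeff 1 \<phi> (\<lambda>g. \<xi> g * \<psi> g) g - star_coeff 1 \<phi> \<psi> g * \<xi> g"
    using e(1) unfolding c by (simp add: algebra_simps)
  have e2: "star_coeff 1 \<xi> (\<lambda>g. \<phi> g * \<psi> g) g = star_coeff 1 \<xi> \<phi> g * \<psi> g + star_coeff 1 (\<lambda>g. \<xi> g * \<phi> g) \<psi> g - \<xi> g * star_coeff 1 \<phi> \<psi> g"
    using e(2) by (simp add: algebra_simps)
  have e3: "star_coeff 1 \<phi> (\<lambda>g. \<xi> g * \<psi> g) g = star_coeff 1 \<phi> \<xi> g * \<psi> g + star_coeff 1 (\<lambda>g. \<xi> g * \<phi> g) \<psi> g - \<phi> g * star_coeff 1 \<xi> \<psi> g"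
    using e(3) unfolding c by (simp add: algebra_simps)
  show ?thesis unfolding group_bracket_def e1 e2 e3 by (simp add: algebra_simps)
qed

text \<open>The second-order terms cancel in the alternating sum of the associativity relations.\<close>

lemma group_bracket_jacobi: "group_bracket \<phi> (group_bracket \<psi> \<xi>) g - group_bracket \<psi> (group_bracket \<phi> \<xi>) g = group_bracket (group_bracket \<phi> \<psi>) \<xi> g"
proof -
  have B0: "star_coeff 0 a b = (\<lambda>g. a g * b g)" if "smooth_fun AG a" "smooth_fun AG b" for a b
    using star_coeff_zero[OF that that(1)] by (rule ext)
  have a: "star_coeff 1 (star_coeff 1 a b) c g - star_coeff 1 a (star_coeff 1 b c) g
      = a g * star_coeff 2 b c g + star_coeff 2 a (\<lambda>g. b g * c g) g - star_coeff 2 a b g * c g - star_coeff 2 (\<lambda>g. a g * b g) c g"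
    if "smooth_fun AG a" "smooth_fun AG b" "smooth_fun AG c" for a b c
    using star_coeff_assoc[OF that, of 2 g] by (simp add: B0 that star_coeff_smooth numeral_2_eq_2 algebra_simps)
  have ex: "group_bracket a (group_bracket b c) g = star_coeff 1 a (star_coeff 1 b c) g - star_coeff 1 a (star_coeff 1 c b) g - star_coeff 1 (star_coeff 1 b c) a g + star_coeff 1 (star_coeff 1 c b) a g"
    if "smooth_fun AG a" "smooth_fun AG b" "smooth_fun AG c" for a b c
  proof -
    have m: "smooth_fun AG (\<lambda>g. (-1) * star_coeff 1 c b g)"
      by (intro smooth_fun_on_mult[OF charted_AG open_UNIV] smooth_fun_on_const[OF charted_AG open_UNIV] star_coeff_smooth that)
    have l: "group_bracket b c = (\<lambda>g. star_coeff 1 b c g + (-1) * star_coeff 1 c b g)" by (simp add: group_bracket_def fun_eq_iff)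
    have r: "star_coeff 1 a (group_bracket b c) g = star_coeff 1 a (star_coeff 1 b c) g - star_coeff 1 a (star_coeff 1 c b) g"
      unfolding l using star_coeff_add_right[OF star_coeff_smooth[OF that(2,3)] m that(1), of 1 1 g]
        star_coeff_scale_right[OF star_coeff_smooth[OF that(3,2)] that(1) that(1), of 1 "-1" 1 g] by simp
    have "star_coeff 1 (group_bracket b c) a g = star_coeff 1 (star_coeff 1 b c) a g - star_coeff 1 (star_coeff 1 c b) a g"
      unfolding l using star_coeff_add_left[OF star_coeff_smooth[OF that(2,3)] m that(1), of 1 1 g]
        star_coeff_scale_left[OF star_coeff_smooth[OF that(3,2)] that(1) that(1), of 1 "-1" 1 g] by simp
    with r show ?thesis by (simp add: group_bracket_def)
  qed
  have c: "(\<lambda>g. \<psi> g * \<phi> g) = (\<lambda>g. \<phi> g * \<psi> g)" "(\<lambda>g. \<xi> g * \<phi> g) = (\<lambda>g. \<phi> g * \<xi> g)"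
    "(\<lambda>g. \<xi> g * \<psi> g) = (\<lambda>g. \<psi> g * \<xi> g)" by (simp_all add: mult.commute)
  have "group_bracket \<phi> (group_bracket \<psi> \<xi>) g - group_bracket \<psi> (group_bracket \<phi> \<xi>) g - group_bracket (group_bracket \<phi> \<psi>) \<xi> g =
      - (star_coeff 1 (star_coeff 1 \<phi> \<psi>) \<xi> g - star_coeff 1 \<phi> (star_coeff 1 \<psi> \<xi>) g) + (star_coeff 1 (star_coeff 1 \<phi> \<xi>) \<psi> g - star_coeff 1 \<phi> (star_coeff 1 \<xi> \<psi>) g)
      - (star_coeff 1 (star_coeff 1 \<psi> \<xi>) \<phi> g - star_coeff 1 \<psi> (star_coeff 1 \<xi> \<phi>) g) + (star_coeff 1 (star_coeff 1 \<xi> \<psi>) \<phi> g - star_coeff 1 \<xi> (star_coeff 1 \<psi> \<phi>) g)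
      + (star_coeff 1 (star_coeff 1 \<psi> \<phi>) \<xi> g - star_coeff 1 \<psi> (star_coeff 1 \<phi> \<xi>) g) - (star_coeff 1 (star_coeff 1 \<xi> \<phi>) \<psi> g - star_coeff 1 \<xi> (star_coeff 1 \<phi> \<psi>) g)"
    unfolding group_bracket_skew[of "group_bracket \<phi> \<psi>" \<xi>] ex[OF s] ex[OF s(2,1,3)] ex[OF s(3,1,2)] by simp
  also have "\<dots> = 0"
    unfolding a[OF s] a[OF s(1,3,2)] a[OF s(2,3,1)] a[OF s(3,2,1)] a[OF s(2,1,3)] a[OF s(3,1,2)] c
    by (simp add: algebra_simps)
  finally show ?thesis by simp
qed

end

end

section \<open>Infinitesimal actions\<close>

text \<open>\<open>N0\<close> is an invariant open subset; it is the whole manifold for the base and the complement of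
  the zero section for a line bundle.\<close>

locale lie_group_action =
  fixes AG :: "('g::{t2_space,second_countable_topology}, 'k::real_inner) atlas"
    and G :: "'g monoid"
    and AN :: "('n::{t2_space,second_countable_topology}, 'f::real_inner) atlas"
    and act :: "'g \<Rightarrow> 'n \<Rightarrow> 'n" and N0 :: "'n set"
  assumes G: "lie_group AG G" and N: "smooth_manifold AN" and act: "smooth_action AG G AN act"
    and N0: "open N0" and inv: "\<And>g x. x \<in> N0 \<Longrightarrow> act g x \<in> N0"
begin

lemma MG: "smooth_manifold AG" and grp: "group G" and carr: "carrier G = UNIV"
  and smooth_inv: "smooth_map AG AG (\<lambda>x. inv\<^bsub>G\<^esub> x)"
  using G by (simp_all add: lie_group_def)

lemma charted_G: "charted AG" and charted_N: "charted AN"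
  by (rule smooth_manifold_charted[OF MG], rule smooth_manifold_charted[OF N])

lemma smooth_act: "smooth_map (prod_atlas AG AN) AN (\<lambda>(g, x). act g x)"
  using act by (simp add: smooth_action_def)

lemma act_one: "act \<one>\<^bsub>G\<^esub> x = x"
proof -
  have "group_action G UNIV act" using act by (simp add: smooth_action_def)
  from group_action.id_eq_one[OF this] show ?thesis by (metis UNIV_I restrict_apply')
qed

lemma act_mult: "act (g \<otimes>\<^bsub>G\<^esub> k) x = act g (act k x)"
proof -
  have "group_action G UNIV act" using act by (simp add: smooth_action_def)
  from group_action.composition_rule[OF this, of x g k] show ?thesis by (simp add: carr)
qed

text \<open>All computations with the action take place on these functions on the group, on which the Lie algebra
  acts by differentiation (\<open>orbit_inf_action\<close>).\<close>

definition orbit :: "('n \<Rightarrow> complex) \<Rightarrow> 'n \<Rightarrow> 'g \<Rightarrow> complex" where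
  "orbit f x g = f (act (inv\<^bsub>G\<^esub> g) x)"

lemma orbit_one: "orbit f x \<one>\<^bsub>G\<^esub> = f x"
  using grp by (simp add: orbit_def act_one monoid.inv_one group.is_monoid)

lemma orbit_shift: "orbit f (act (inv\<^bsub>G\<^esub> g) x) k = orbit f x (g \<otimes>\<^bsub>G\<^esub> k)"
  using group.inv_mult_group[OF grp, of g k] by (simp add: orbit_def act_mult carr)

lemma smooth_two_variables:
  assumes f: "smooth_fun_on AN N0 f"
  shows "smooth_fun_on (prod_atlas AG AN) (UNIV \<times> N0) (\<lambda>p. f (act (inv\<^bsub>G\<^esub> (fst p)) (snd p)))"
proof -
  note cP = charted_prod[OF charted_G charted_N]
  have oP: "open (UNIV \<times> N0 :: ('g \<times> 'n) set)" using N0 by (simp add: open_Times)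
  have "smooth_map (prod_atlas AG AN) AG (\<lambda>p. inv\<^bsub>G\<^esub> (fst p))"
    by (rule smooth_map_on_compose[OF cP charted_G charted_G open_UNIV open_UNIV smooth_map_fst_snd(1)[OF MG N] smooth_inv]) simp
  from smooth_map_on_Pair[OF cP charted_G charted_N open_UNIV this smooth_map_fst_snd(2)[OF MG N]]
  have "smooth_map (prod_atlas AG AN) AN (\<lambda>p. (\<lambda>(g, x). act g x) (inv\<^bsub>G\<^esub> (fst p), snd p))"
    by (rule smooth_map_on_compose[OF cP cP charted_N open_UNIV open_UNIV _ smooth_act]) simp
  then have "smooth_map_on (prod_atlas AG AN) AN (UNIV \<times> N0) (\<lambda>p. act (inv\<^bsub>G\<^esub> (fst p)) (snd p))"
    by (auto intro: smooth_map_on_subset)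
  from smooth_fun_on_pullback[OF cP charted_N oP N0 this f]
  show ?thesis using inv by (auto simp: image_subset_iff)
qed

lemma smooth_map_const: "smooth_map_on AG AN W (\<lambda>g. x)"
  by (rule smooth_map_onI) (simp_all add: comp_def)

lemma orbit_smooth:
  assumes f: "smooth_fun_on AN N0 f" and x: "x \<in> N0"
  shows "smooth_fun AG (orbit f x)"
proof -
  note cP = charted_prod[OF charted_G charted_N]
  have oP: "open (UNIV \<times> N0 :: ('g \<times> 'n) set)" using N0 by (simp add: open_Times)
  have "smooth_map AG (prod_atlas AG AN) (\<lambda>g. (g, x))"
    by (rule smooth_map_on_Pair[OF charted_G charted_G charted_N open_UNIV smooth_map_id[OF MG] smooth_map_const])
  from smooth_fun_on_pullback[OF charted_G cP open_UNIV oP this smooth_two_variables[OF f]]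
  show ?thesis using x by (simp add: orbit_def[abs_def] image_subset_iff)
qed

text \<open>Differentiation in the group variable preserves smoothness in the other one: a derivation at
  the unit is a partial derivative in a chart of the group.\<close>

lemma partial_derivation_smooth:
  fixes \<Psi> :: "'g \<times> 'n \<Rightarrow> real"
  assumes v: "v \<in> tangent_space AG a" and \<Psi>: "smooth_fun_on (prod_atlas AG AN) (UNIV \<times> N0) \<Psi>"
  shows "smooth_fun_on AN N0 (\<lambda>x. v (\<lambda>g. \<Psi> (g, x)))"
  unfolding smooth_fun_on_iff[OF charted_N N0]
proof (intro allI impI)
  note cP = charted_prod[OF charted_G charted_N]
  have oP: "open (UNIV \<times> N0 :: ('g \<times> 'n) set)" using N0 by (simp add: open_Times)
  fix V \<psi> assume V: "(V, \<psi>) \<in> AN"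
  obtain E :: "'k set" where E: "orthonormal_basis E" using charted_basis[OF charted_G] .
  obtain E2 :: "('k \<times> 'f) set" where E2: "orthonormal_basis E2" using charted_basis[OF cP] .
  obtain U \<phi> where U: "(U, \<phi>) \<in> AG" "a \<in> U" using charted_cover[OF charted_G] .
  obtain c where c: "\<And>f. smooth_fun AG f \<Longrightarrow> v f = (\<Sum>e\<in>E. c e * frechet_derivative (f \<circ> inv_into U \<phi>) (at (\<phi> a)) e)"
    using tangent_chart[OF MG v E U(1,2)] by blast
  define S where "S = \<psi> ` (V \<inter> N0)"
  have oS: "open S" unfolding S_def by (rule chart_open_map[OF charted_N V N0])
  define K where "K p = \<Psi> (inv_into U \<phi> (fst p), inv_into V \<psi> (snd p))" for p
  have im: "map_prod \<phi> \<psi> ` ((U \<times> V) \<inter> (UNIV \<times> N0)) = \<phi> ` U \<times> S"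
    unfolding S_def by (simp add: Times_Int_Times map_prod_image)
  have oUS: "open (\<phi> ` U \<times> S)" by (rule open_Times[OF chart_image_open[OF charted_G U(1)] oS])
  have "smooth_on (\<phi> ` U \<times> S) (\<Psi> \<circ> inv_into (U \<times> V) (map_prod \<phi> \<psi>))"
    using \<Psi> prod_atlasI[OF U(1) V] unfolding smooth_fun_on_iff[OF cP oP] im[symmetric] by blast
  then have K: "smooth_on (\<phi> ` U \<times> S) K"
    by (rule smooth_on_cong[OF oUS, rotated])
      (auto simp: K_def S_def inv_into_map_prod[OF chart_inj[OF charted_G U(1)] chart_inj[OF charted_N V]])
  have eq: "v (\<lambda>g. \<Psi> (g, inv_into V \<psi> y)) = (\<Sum>e\<in>E. c e * frechet_derivative K (at (\<phi> a, y)) (e, 0))" if y: "y \<in> S" for y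
  proof -
    let ?x = "inv_into V \<psi> y"
    have x: "?x \<in> N0" using y chart_inv[OF charted_N V] by (auto simp: S_def)
    have "smooth_map AG (prod_atlas AG AN) (\<lambda>g. (g, ?x))"
      by (rule smooth_map_on_Pair[OF charted_G charted_G charted_N open_UNIV smooth_map_id[OF MG] smooth_map_const])
    from smooth_fun_on_pullback[OF charted_G cP open_UNIV oP this \<Psi>]
    have s: "smooth_fun AG (\<lambda>g. \<Psi> (g, ?x))" using x by (simp add: image_subset_iff)
    have "((\<lambda>z. (z, y)) has_derivative (\<lambda>e. (e, 0))) (at (\<phi> a))"
      by (intro has_derivative_Pair has_derivative_ident has_derivative_const)
    moreover have "(K has_derivative frechet_derivative K (at (\<phi> a, y))) (at (\<phi> a, y))"
      by (rule smooth_on_has_derivative[OF K]) (use U(2) y in simp)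
    ultimately have "((\<lambda>z. K (z, y)) has_derivative (\<lambda>e. frechet_derivative K (at (\<phi> a, y)) (e, 0))) (at (\<phi> a))"
      by (rule has_derivative_compose)
    from fun_cong[OF frechet_derivative_at[OF this]]
    have "frechet_derivative (\<lambda>z. K (z, y)) (at (\<phi> a)) e = frechet_derivative K (at (\<phi> a, y)) (e, 0)" for e
      by (rule sym)
    then show ?thesis unfolding c[OF s] by (simp add: K_def comp_def)
  qed
  have sm: "smooth_on S (\<lambda>y. \<Sum>e\<in>E. c e * frechet_derivative K (at (\<phi> a, y)) (e, 0))"
  proof (intro smooth_on_sum[OF oS] smooth_on_bilinear[OF oS bounded_bilinear_mult] smooth_on_const)
    fix e
    have lin: "smooth_on S (\<lambda>y. y)" by (rule smooth_on_linear[OF oS bounded_linear_ident])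
    have "smooth_on S (\<lambda>y. (\<phi> a, y))" by (rule smooth_on_Pair[OF oS smooth_on_const lin])
    from smooth_on_compose[OF oS oUS E2 _ this smooth_on_directional[OF K]]
    show "smooth_on S (\<lambda>y. frechet_derivative K (at (\<phi> a, y)) (e, 0))" using U(2) by auto
  qed
  have "smooth_on S (\<lambda>y. v (\<lambda>g. \<Psi> (g, inv_into V \<psi> y)))"
    by (rule smooth_on_cong[OF oS _ sm]) (rule eq[symmetric])
  then show "smooth_on (\<psi> ` (V \<inter> N0)) ((\<lambda>x. v (\<lambda>g. \<Psi> (g, x))) \<circ> inv_into V \<psi>)"
    by (simp add: S_def comp_def)
qed

lemma lie_algebra_vector_field: "X \<in> lie_algebra AG G \<Longrightarrow> vector_field AG X"
  by (simp add: lie_algebra_def)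

lemma inf_action_smooth:
  assumes X: "X \<in> lie_algebra AG G" and f: "smooth_fun_on AN N0 f"
  shows "smooth_fun_on AN N0 (inf_action G act X f)"
proof -
  note cP = charted_prod[OF charted_G charted_N]
  have oP: "open (UNIV \<times> N0 :: ('g \<times> 'n) set)" using N0 by (simp add: open_Times)
  note v = vector_fieldD(1)[OF lie_algebra_vector_field[OF X], of "\<one>\<^bsub>G\<^esub>"]
  note s = smooth_two_variables[OF f]
  show ?thesis
    unfolding inf_action_def[abs_def] cderiv_def
    using smooth_fun_on_Complex[OF charted_N N0 partial_derivation_smooth[OF v smooth_fun_on_Re[OF cP oP s]]
        partial_derivation_smooth[OF v smooth_fun_on_Im[OF cP oP s]]] by simp
qed

text \<open>By left invariance the derivative at \<open>g\<close> is that at the unit after translation by \<open>g\<close>.\<close>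

lemma orbit_inf_action:
  assumes X: "X \<in> lie_algebra AG G" and f: "smooth_fun AG (orbit f x)"
  shows "orbit (inf_action G act X f) x = field_op X (orbit f x)"
proof (rule ext)
  fix g
  have left: "X g \<psi> = X \<one>\<^bsub>G\<^esub> (\<lambda>k. \<psi> (g \<otimes>\<^bsub>G\<^esub> k))" if "smooth_fun AG \<psi>" for \<psi>
  proof -
    have "X (g \<otimes>\<^bsub>G\<^esub> \<one>\<^bsub>G\<^esub>) \<psi> = X \<one>\<^bsub>G\<^esub> (\<lambda>k. \<psi> (g \<otimes>\<^bsub>G\<^esub> k))" using X that by (simp add: lie_algebra_def)
    then show ?thesis using grp carr by (simp add: monoid.r_one group.is_monoid)
  qed
  show "orbit (inf_action G act X f) x g = field_op X (orbit f x) g"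
    unfolding field_op_def cderiv_def left[OF smooth_fun_on_Re[OF charted_G open_UNIV f]] left[OF smooth_fun_on_Im[OF charted_G open_UNIV f]]
      orbit_shift[symmetric]
    by (simp add: orbit_def inf_action_def cderiv_def)
qed

lemma word_action_Cons: "word_action G act (X # w) f = inf_action G act X (word_action G act w f)"
  and word_action_Nil: "word_action G act [] f = f"
  by (simp_all add: word_action_def)

lemma word_action_smooth:
  "w \<in> lists (lie_algebra AG G) \<Longrightarrow> smooth_fun_on AN N0 f \<Longrightarrow> smooth_fun_on AN N0 (word_action G act w f)"
  by (induction w) (auto simp: word_action_Cons word_action_Nil intro!: inf_action_smooth)

end

sublocale lie_group_action \<subseteq> field_words AG "lie_algebra AG G"
  by unfold_locales (use MG lie_algebra_vector_field in auto)

context lie_group_action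
begin

lemma orbit_word_action:
  assumes w: "w \<in> lists (lie_algebra AG G)" and f: "smooth_fun AG (orbit f x)"
  shows "orbit (word_action G act w f) x = word_op w (orbit f x)"
  using w
proof (induction w)
  case (Cons X w)
  then have "smooth_fun AG (orbit (word_action G act w f) x)"
    using word_op_smooth[OF lists_VF f] by simp
  then show ?case using Cons orbit_inf_action[of X "word_action G act w f" x]
    by (simp add: word_action_Cons word_op_Cons)
qed (simp add: word_action_Nil)

end

locale twisted_action = lie_group_action AG G AN act N0 + inverse_twist AG "lie_algebra AG G" F H
  for AG :: "('g::{t2_space,second_countable_topology}, 'k::real_inner) atlas"
    and G :: "'g monoid"
    and AN :: "('n::{t2_space,second_countable_topology}, 'f::real_inner) atlas"
    and act :: "'g \<Rightarrow> 'n \<Rightarrow> 'n" and N0 and F H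
begin

text \<open>The first-order part of the commutator of the product that the twist induces on \<open>N\<close>.\<close>

definition bracket :: "('n \<Rightarrow> complex) \<Rightarrow> ('n \<Rightarrow> complex) \<Rightarrow> 'n \<Rightarrow> complex" where
  "bracket f h x = mult_action G act (fps_nth H 1) f h x - mult_action G act (fps_nth H 1) h f x"

lemma mult_action_pm_eval:
  "mult_action G act a f h x = pm_eval a (\<lambda>p. word_action G act (fst p) f x * word_action G act (snd p) h x)"
  by (simp add: mult_action_def pm_eval_def case_prod_unfold mult.assoc)

lemma mult_action_smooth:
  assumes "smooth_fun_on AN N0 f" "smooth_fun_on AN N0 h"
  shows "smooth_fun_on AN N0 (mult_action G act (fps_nth H n) f h)"
  unfolding mult_action_pm_eval[abs_def] pm_eval_def
  by (intro smooth_fun_on_sum[OF charted_N N0] smooth_fun_on_mult[OF charted_N N0] smooth_fun_on_const[OF charted_N N0] word_action_smooth assms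
      H_words)

lemma bracket_smooth: "smooth_fun_on AN N0 f \<Longrightarrow> smooth_fun_on AN N0 h \<Longrightarrow> smooth_fun_on AN N0 (bracket f h)"
  unfolding bracket_def[abs_def] by (intro smooth_fun_on_diff[OF charted_N N0] mult_action_smooth)

lemma orbit_mult_action:
  assumes "smooth_fun AG (orbit f x)" "smooth_fun AG (orbit h x)"
  shows "orbit (mult_action G act (fps_nth H n) f h) x = star_coeff n (orbit f x) (orbit h x)"
proof (rule ext)
  fix g
  show "orbit (mult_action G act (fps_nth H n) f h) x g = star_coeff n (orbit f x) (orbit h x) g"
    unfolding star_coeff_def orbit_def[of "mult_action G act (fps_nth H n) f h"] mult_action_pm_eval
  proof (rule pm_eval_cong)
    fix p assume "p \<in> Poly_Mapping.keys (fps_nth H n)"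
    note words = H_words[OF this]
    from fun_cong[OF orbit_word_action[OF words(1) assms(1)], of g] fun_cong[OF orbit_word_action[OF words(2) assms(2)], of g]
    show "word_action G act (fst p) f (act (inv\<^bsub>G\<^esub> g) x) * word_action G act (snd p) h (act (inv\<^bsub>G\<^esub> g) x)
        = word_op (fst p) (orbit f x) g * word_op (snd p) (orbit h x) g"
      by (simp add: orbit_def)
  qed
qed

lemma mult_action_zero:
  "mult_action G act (fps_nth H n) f 0 x = 0" "mult_action G act (fps_nth H n) 0 f x = 0"
proof -
  have "word_action G act w 0 x = 0" if "w \<in> lists (lie_algebra AG G)" for w
  proof -
    have o: "orbit 0 x = (\<lambda>g. 0)" by (simp add: orbit_def fun_eq_iff)
    have "word_action G act w 0 x = orbit (word_action G act w 0) x \<one>\<^bsub>G\<^esub>" by (simp add: orbit_one)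
    also have "\<dots> = word_op w (\<lambda>g. 0) \<one>\<^bsub>G\<^esub>"
      using orbit_word_action[OF that, of 0 x] smooth_fun_on_const[OF charted_G open_UNIV, of "0::complex"] by (simp add: o)
    finally show ?thesis using word_op_zero[OF lists_VF[OF that]] by simp
  qed
  note w = this[OF H_words(1)] this[OF H_words(2)]
  show "mult_action G act (fps_nth H n) f 0 x = 0" "mult_action G act (fps_nth H n) 0 f x = 0"
    unfolding mult_action_pm_eval by (rule pm_eval_zero_fun, simp add: w)+
qed

lemma orbit_bracket:
  assumes "smooth_fun AG (orbit f x)" "smooth_fun AG (orbit h x)"
  shows "orbit (bracket f h) x = group_bracket (orbit f x) (orbit h x)"
  using orbit_mult_action[OF assms] orbit_mult_action[OF assms(2,1)]
  by (simp add: fun_eq_iff orbit_def bracket_def group_bracket_def)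

lemma bracket_orbit:
  assumes "smooth_fun_on AN N0 f" "smooth_fun_on AN N0 h" "x \<in> N0"
  shows "bracket f h x = group_bracket (orbit f x) (orbit h x) \<one>\<^bsub>G\<^esub>"
  using orbit_bracket[OF orbit_smooth[OF assms(1,3)] orbit_smooth[OF assms(2,3)]] orbit_one[of "bracket f h" x] by simp

lemma bracket_skew: "bracket f h x = - bracket h f x"
  by (simp add: bracket_def)

lemma orbit_cong: "(\<And>y. y \<in> N0 \<Longrightarrow> f y = f' y) \<Longrightarrow> x \<in> N0 \<Longrightarrow> orbit f x = orbit f' x"
  using inv by (auto simp: orbit_def)

text \<open>The action preserves \<open>N0\<close>, so that the bracket at a point of \<open>N0\<close> does not see the complement.\<close>

lemma bracket_cong:
  assumes "smooth_fun_on AN N0 f" "smooth_fun_on AN N0 h" "x \<in> N0"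
    "\<And>y. y \<in> N0 \<Longrightarrow> h y = h' y"
  shows "bracket f h x = bracket f h' x"
proof -
  have "smooth_fun_on AN N0 h'" by (rule smooth_fun_on_cong[OF charted_N N0 assms(2,4)])
  then show ?thesis using bracket_orbit[OF assms(1,2,3)] bracket_orbit[OF assms(1) _ assms(3)] orbit_cong[OF assms(4,3)] by simp
qed

context
  fixes f h k :: "'n \<Rightarrow> complex" and x
  assumes f: "smooth_fun_on AN N0 f" and h: "smooth_fun_on AN N0 h" and k: "smooth_fun_on AN N0 k" and x: "x \<in> N0"
begin

private lemmas o = orbit_smooth[OF f x] orbit_smooth[OF h x] orbit_smooth[OF k x]

lemma bracket_add: "bracket f (\<lambda>y. h y + k y) x = bracket f h x + bracket f k x"
  unfolding bracket_orbit[OF f h x] bracket_orbit[OF f k x] bracket_orbit[OF f smooth_fun_on_add[OF charted_N N0 h k] x]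
  using group_bracket_add[OF o(2,3,1)] by (simp add: orbit_def[abs_def])

lemma bracket_scale: "bracket f (\<lambda>y. c * h y) x = c * bracket f h x"
  unfolding bracket_orbit[OF f h x] bracket_orbit[OF f smooth_fun_on_mult[OF charted_N N0 smooth_fun_on_const[OF charted_N N0] h] x]
  using group_bracket_scale[OF o(2,3,1)] by (simp add: orbit_def[abs_def])

lemma bracket_mult: "bracket f (\<lambda>y. h y * k y) x = h x * bracket f k x + bracket f h x * k x"
  unfolding bracket_orbit[OF f h x] bracket_orbit[OF f k x] bracket_orbit[OF f smooth_fun_on_mult[OF charted_N N0 h k] x]
  using group_bracket_mult[OF o(2,3,1)] by (simp add: orbit_def[abs_def] orbit_one[unfolded orbit_def])

lemma bracket_jacobi: "bracket f (bracket h k) x - bracket h (bracket f k) x = bracket (bracket f h) k x"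
  unfolding bracket_orbit[OF f bracket_smooth[OF h k] x] bracket_orbit[OF h bracket_smooth[OF f k] x] bracket_orbit[OF bracket_smooth[OF f h] k x]
    orbit_bracket[OF o(1,2)] orbit_bracket[OF o(1,3)] orbit_bracket[OF o(2,3)]
  by (rule group_bracket_jacobi[OF o])

end

end

section \<open>Line bundles\<close>

lemma smooth_manifold_model_complex: "smooth_manifold (model_atlas :: (complex, complex) atlas)"
proof -
  have "charted (model_atlas :: (complex, complex) atlas)" by simp
  moreover have "inv_into UNIV (\<lambda>x::complex. x) = (\<lambda>x. x)" by (simp add: inj_imp_inv_eq)
  moreover have "smooth_on UNIV (\<lambda>x::complex. x)" by (rule smooth_on_linear[OF open_UNIV bounded_linear_ident])
  ultimately show ?thesis
    unfolding charted_def smooth_manifold_def by (simp add: model_atlas_def comp_def)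
qed

locale line_bundle_over =
  fixes A :: "('m::{t2_space,second_countable_topology}, 'e::real_inner) atlas"
    and L :: "('l::{t2_space,second_countable_topology}, 'm, 'e) line_bundle"
  assumes M: "smooth_manifold A" and L: "complex_line_bundle A L"
begin

abbreviation "T \<equiv> total_atlas L"
abbreviation "\<pi> \<equiv> proj L"

lemma manifold_T: "smooth_manifold T" and smooth_proj: "smooth_map T A \<pi>"
  and proj_fadd: "\<pi> a = \<pi> b \<Longrightarrow> \<pi> (fadd L a b) = \<pi> a" and proj_fscale: "\<pi> (fscale L c a) = \<pi> a"
  using L by (simp_all add: complex_line_bundle_def)

lemma charted_A: "charted A" and charted_T: "charted T"
  by (rule smooth_manifold_charted[OF M], rule smooth_manifold_charted[OF manifold_T])

lemma open_vimage_proj: "open U \<Longrightarrow> open (\<pi> -` U)"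
  using open_vimage_Int[OF open_UNIV smooth_map_onD(1)[OF smooth_proj]] by simp

text \<open>\<open>\<tau>\<close> is the fibre coordinate of a local trivialisation and \<open>m\<close> the inverse of the trivialisation.
  Equations between elements of a fibre are checked by applying \<open>\<tau>\<close> (\<open>triv_inj\<close>).\<close>

definition trivialization :: "'m set \<Rightarrow> ('l \<Rightarrow> complex) \<Rightarrow> ('m \<times> complex \<Rightarrow> 'l) \<Rightarrow> bool" where
  "trivialization U \<tau> m \<longleftrightarrow> open U \<and> smooth_fun_on T (\<pi> -` U) \<tau> \<and>
     smooth_map_on (prod_atlas A (model_atlas :: (complex, complex) atlas)) T (U \<times> UNIV) m \<and>
     (\<forall>q\<in>U. \<forall>c. \<pi> (m (q, c)) = q \<and> \<tau> (m (q, c)) = c) \<and>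
     (\<forall>a b. \<pi> a \<in> U \<longrightarrow> \<pi> a = \<pi> b \<longrightarrow> \<tau> a = \<tau> b \<longrightarrow> a = b) \<and>
     (\<forall>a b. \<pi> a \<in> U \<longrightarrow> \<pi> a = \<pi> b \<longrightarrow> \<tau> (fadd L a b) = \<tau> a + \<tau> b) \<and>
     (\<forall>c a. \<pi> a \<in> U \<longrightarrow> \<tau> (fscale L c a) = c * \<tau> a)"

lemma trivialization_exists:
  obtains U \<tau> m where "trivialization U \<tau> m" "p \<in> U"
proof -
  let ?C = "model_atlas :: (complex, complex) atlas"
  obtain U \<tau> where U: "open U" "p \<in> U"
    and d: "diffeo_on T (prod_atlas A ?C) (\<pi> -` U) (U \<times> UNIV) (\<lambda>a. (\<pi> a, \<tau> a))"
    and lin: "\<forall>a b. \<pi> a \<in> U \<longrightarrow> \<pi> a = \<pi> b \<longrightarrow> \<tau> (fadd L a b) = \<tau> a + \<tau> b"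
      "\<forall>c a. \<pi> a \<in> U \<longrightarrow> \<tau> (fscale L c a) = c * \<tau> a"
    using L unfolding complex_line_bundle_def by meson
  define m where "m = inv_into (\<pi> -` U) (\<lambda>a. (\<pi> a, \<tau> a))"
  have bij: "bij_betw (\<lambda>a. (\<pi> a, \<tau> a)) (\<pi> -` U) (U \<times> UNIV)"
    and s: "smooth_map_on T (prod_atlas A ?C) (\<pi> -` U) (\<lambda>a. (\<pi> a, \<tau> a))"
    and sm: "smooth_map_on (prod_atlas A ?C) T (U \<times> UNIV) m"
    using d by (simp_all add: diffeo_on_def m_def)
  have "smooth_fun_on T (\<pi> -` U) (\<lambda>a. snd (\<pi> a, \<tau> a))"
    by (rule smooth_fun_on_pullback[OF charted_T charted_prod[OF charted_A charted_model_complex] open_vimage_proj[OF U(1)] open_UNIV s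
          smooth_map_fst_snd(2)[OF M smooth_manifold_model_complex]]) simp
  moreover have "\<pi> (m (q, c)) = q \<and> \<tau> (m (q, c)) = c" if "q \<in> U" for q c
    using bij_betw_inv_into_right[OF bij, of "(q, c)"] that by (simp add: m_def)
  moreover have "a = b" if "\<pi> a \<in> U" "\<pi> a = \<pi> b" "\<tau> a = \<tau> b" for a b
    using bij that unfolding bij_betw_def inj_on_def by auto
  ultimately have "trivialization U \<tau> m"
    using U(1) sm lin unfolding trivialization_def by auto
  then show ?thesis using that U(2) by blast
qed

context
  fixes U \<tau> m
  assumes tr: "trivialization U \<tau> m"
begin

lemma triv_open: "open U" and triv_smooth: "smooth_fun_on T (\<pi> -` U) \<tau>"
  and triv_inv_smooth: "smooth_map_on (prod_atlas A (model_atlas :: (complex, complex) atlas)) T (U \<times> UNIV) m"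
  and triv_inv: "q \<in> U \<Longrightarrow> \<pi> (m (q, c)) = q" "q \<in> U \<Longrightarrow> \<tau> (m (q, c)) = c"
  and triv_add: "\<pi> a \<in> U \<Longrightarrow> \<pi> a = \<pi> b \<Longrightarrow> \<tau> (fadd L a b) = \<tau> a + \<tau> b"
  and triv_scale: "\<pi> a \<in> U \<Longrightarrow> \<tau> (fscale L c a) = c * \<tau> a"
  using tr by (simp_all add: trivialization_def)

lemma triv_inj: "\<pi> a \<in> U \<Longrightarrow> \<pi> a = \<pi> b \<Longrightarrow> \<tau> a = \<tau> b \<Longrightarrow> a = b"
  using tr unfolding trivialization_def by blast

end

text \<open>The non-zero vectors, characterised without reference to a zero section: the zero vector of a fibre is
  the one fixed by the scalar 0.\<close>

definition Nz :: "'l set" where "Nz = {a. fscale L 0 a \<noteq> a}"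

lemma Nz_triv:
  assumes "trivialization U \<tau> m" "\<pi> a \<in> U"
  shows "a \<in> Nz \<longleftrightarrow> \<tau> a \<noteq> 0"
  using triv_scale[OF assms, of 0] triv_inj[OF assms(1), of "fscale L 0 a" a] assms(2) proj_fscale[of 0 a]
  by (auto simp: Nz_def)

lemma open_Nz: "open Nz"
proof (subst open_subopen, intro ballI)
  fix a assume a: "a \<in> Nz"
  obtain U \<tau> m where t: "trivialization U \<tau> m" "\<pi> a \<in> U" using trivialization_exists .
  have "open (\<pi> -` U \<inter> \<tau> -` (- {0}))"
    by (rule open_vimage_Int[OF open_vimage_proj[OF triv_open[OF t(1)]] smooth_map_onD(1)[OF triv_smooth[OF t(1)]]]) (simp add: open_Compl)
  moreover have "a \<in> \<pi> -` U \<inter> \<tau> -` (- {0})" using a t Nz_triv[OF t] by simp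
  moreover have "\<pi> -` U \<inter> \<tau> -` (- {0}) \<subseteq> Nz" using Nz_triv[OF t(1)] by auto
  ultimately show "\<exists>T. open T \<and> a \<in> T \<and> T \<subseteq> Nz" by blast
qed

definition ratio :: "'l \<Rightarrow> 'l \<Rightarrow> complex" where
  "ratio b a = (THE c. fscale L c a = b)"

lemma ratio_triv:
  assumes t: "trivialization U \<tau> m" "\<pi> a \<in> U" and ab: "a \<in> Nz" "\<pi> b = \<pi> a"
  shows "ratio b a = \<tau> b / \<tau> a"
proof -
  have nz: "\<tau> a \<noteq> 0" using Nz_triv[OF t] ab by simp
  show ?thesis
    unfolding ratio_def
  proof (rule the_equality)
    show "fscale L (\<tau> b / \<tau> a) a = b"
      by (rule triv_inj[OF t(1)]) (use t ab nz in \<open>simp_all add: proj_fscale triv_scale[OF t(1)]\<close>)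
    fix c assume "fscale L c a = b"
    then show "c = \<tau> b / \<tau> a" using triv_scale[OF t, of c] nz by (simp add: field_simps)
  qed
qed

lemma ratio_fscale:
  assumes "a \<in> Nz" "\<pi> b = \<pi> a"
  shows "fscale L (ratio b a) a = b"
proof -
  obtain U \<tau> m where t: "trivialization U \<tau> m" "\<pi> a \<in> U" using trivialization_exists .
  have nz: "\<tau> a \<noteq> 0" using Nz_triv[OF t] assms by simp
  show ?thesis
    by (rule triv_inj[OF t(1)])
      (use t assms nz in \<open>simp_all add: proj_fscale triv_scale[OF t(1)] ratio_triv[OF t assms]\<close>)
qed

lemma section_proj: "s \<in> sections A L \<Longrightarrow> \<pi> (s p) = p"
  and section_smooth: "s \<in> sections A L \<Longrightarrow> smooth_map A T s"
  by (simp_all add: sections_def)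

lemma section_coordinate_smooth:
  assumes t: "trivialization U \<tau> m" and s: "s \<in> sections A L"
  shows "smooth_fun_on A U (\<lambda>q. \<tau> (s q))"
  by (rule smooth_fun_on_pullback[OF charted_A charted_T triv_open[OF t] open_vimage_proj[OF triv_open[OF t]]
        smooth_map_on_subset[OF section_smooth[OF s]] triv_smooth[OF t]])
    (use section_proj[OF s] in auto)

text \<open>Smoothness of a section can be tested on its coordinate in any one trivialisation around each point.\<close>

lemma sectionI:
  assumes p: "\<And>q. \<pi> (s q) = q"
    and l: "\<And>p. \<exists>U \<tau> m W. trivialization U \<tau> m \<and> open W \<and> p \<in> W \<and> W \<subseteq> U \<and> smooth_fun_on A W (\<lambda>q. \<tau> (s q))"
  shows "s \<in> sections A L"
proof -
  let ?C = "model_atlas :: (complex, complex) atlas"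
  have "smooth_map A T s"
  proof (rule smooth_map_on_local[OF charted_A charted_T])
    fix p
    obtain U \<tau> m W where t: "trivialization U \<tau> m" and W: "open W" "p \<in> W" "W \<subseteq> U" and sm: "smooth_fun_on A W (\<lambda>q. \<tau> (s q))"
      using l[of p] by - (elim exE conjE, rule that, assumption+)
    have pair: "smooth_map_on A (prod_atlas A ?C) W (\<lambda>q. (q, \<tau> (s q)))"
      by (rule smooth_map_on_Pair[OF charted_A charted_A charted_model_complex W(1) smooth_map_id[OF M] sm])
    have "smooth_map_on A T W (\<lambda>q. m (q, \<tau> (s q)))"
      by (rule smooth_map_on_compose[OF charted_A charted_prod[OF charted_A charted_model_complex] charted_T W(1) _ pair triv_inv_smooth[OF t]])
        (use W(3) triv_open[OF t] in \<open>auto intro: open_Times\<close>)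
    then have "smooth_map_on A T W s"
    proof (rule smooth_map_on_cong[OF charted_A charted_T W(1)])
      fix q assume "q \<in> W"
      then have q: "q \<in> U" using W(3) by blast
      show "m (q, \<tau> (s q)) = s q"
        by (rule triv_inj[OF t]) (use q p triv_inv[OF t q] in simp_all)
    qed
    then show "\<exists>W. open W \<and> p \<in> W \<and> smooth_map_on A T W s" using W by blast
  qed
  then show ?thesis using p by (simp add: sections_def)
qed

lemma section_fadd:
  assumes s: "s \<in> sections A L" and t: "t \<in> sections A L"
  shows "(\<lambda>q. fadd L (s q) (t q)) \<in> sections A L"
proof (rule sectionI)
  show "\<pi> (fadd L (s q) (t q)) = q" for q using proj_fadd[of "s q" "t q"] section_proj s t by simp
  fix p
  obtain U \<tau> m where tr: "trivialization U \<tau> m" "p \<in> U" using trivialization_exists .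
  have "smooth_fun_on A U (\<lambda>q. \<tau> (fadd L (s q) (t q)))"
    by (rule smooth_fun_on_cong[OF charted_A triv_open[OF tr(1)] smooth_fun_on_add[OF charted_A triv_open[OF tr(1)]
            section_coordinate_smooth[OF tr(1) s] section_coordinate_smooth[OF tr(1) t]]])
      (simp add: triv_add[OF tr(1)] section_proj s t)
  then show "\<exists>U \<tau> m W. trivialization U \<tau> m \<and> open W \<and> p \<in> W \<and> W \<subseteq> U \<and> smooth_fun_on A W (\<lambda>q. \<tau> (fadd L (s q) (t q)))"
    using tr triv_open[OF tr(1)] by blast
qed

lemma section_fscale:
  assumes f: "smooth_fun A f" and s: "s \<in> sections A L"
  shows "(\<lambda>q. fscale L (f q) (s q)) \<in> sections A L"
proof (rule sectionI)
  show "\<pi> (fscale L (f q) (s q)) = q" for q using proj_fscale section_proj s by simp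
  fix p
  obtain U \<tau> m where tr: "trivialization U \<tau> m" "p \<in> U" using trivialization_exists .
  have "smooth_fun_on A U (\<lambda>q. \<tau> (fscale L (f q) (s q)))"
    by (rule smooth_fun_on_cong[OF charted_A triv_open[OF tr(1)] smooth_fun_on_mult[OF charted_A triv_open[OF tr(1)]
            smooth_map_on_subset[OF f] section_coordinate_smooth[OF tr(1) s]]])
      (simp_all add: triv_scale[OF tr(1)] section_proj s)
  then show "\<exists>U \<tau> m W. trivialization U \<tau> m \<and> open W \<and> p \<in> W \<and> W \<subseteq> U \<and> smooth_fun_on A W (\<lambda>q. \<tau> (fscale L (f q) (s q)))"
    using tr triv_open[OF tr(1)] by blast
qed

text \<open>A cut-off multiple of the local section with coordinate 1, continued by zero vectors.\<close>

lemma nonvanishing_section: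
  obtains s where "s \<in> sections A L" "s p \<in> Nz"
proof -
  obtain U \<tau> m where tr: "trivialization U \<tau> m" "p \<in> U" using trivialization_exists .
  obtain \<rho> :: "'m \<Rightarrow> real" and C W where r: "smooth_fun A \<rho>" "closed C" "C \<subseteq> U" "\<And>x. x \<notin> C \<Longrightarrow> \<rho> x = 0"
    "p \<in> W" "\<And>x. x \<in> W \<Longrightarrow> \<rho> x = 1"
    using bump_function[OF M triv_open[OF tr(1)] tr(2)] by metis
  have "\<exists>a. \<pi> a = q \<and> fscale L 0 a = a" for q
  proof -
    obtain U' \<tau>' m' where t: "trivialization U' \<tau>' m'" "q \<in> U'" using trivialization_exists .
    have "fscale L 0 (m' (q, 0)) = m' (q, 0)"
      by (rule triv_inj[OF t(1)]) (simp_all add: proj_fscale triv_scale[OF t(1)] triv_inv[OF t(1)] t(2))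
    then show ?thesis using triv_inv(1)[OF t] by blast
  qed
  then obtain z where z: "\<And>q. \<pi> (z q) = q" "\<And>q. fscale L 0 (z q) = z q" by metis
  define s where "s q = (if q \<in> U then m (q, complex_of_real (\<rho> q)) else z q)" for q
  have ps: "\<pi> (s q) = q" for q using triv_inv(1)[OF tr(1)] z by (simp add: s_def)
  have out: "\<tau>' (s q) = 0" if q: "q \<notin> C" and t: "trivialization U' \<tau>' m'" "q \<in> U'" for q U' \<tau>' m'
  proof -
    have "s q \<notin> Nz"
      using Nz_triv[OF tr(1), of "m (q, 0)"] triv_inv[OF tr(1)] r(4)[OF q] z by (auto simp: s_def Nz_def)
    then show ?thesis using Nz_triv[OF t(1)] t(2) ps by simp
  qed
  have "s \<in> sections A L"
  proof (rule sectionI[OF ps])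
    fix p
    show "\<exists>U \<tau> m W. trivialization U \<tau> m \<and> open W \<and> p \<in> W \<and> W \<subseteq> U \<and> smooth_fun_on A W (\<lambda>q. \<tau> (s q))"
    proof (cases "p \<in> U")
      case True
      have "smooth_fun_on A U (\<lambda>q. \<tau> (s q))"
        by (rule smooth_fun_on_cong[OF charted_A triv_open[OF tr(1)] smooth_fun_on_of_real[OF charted_A triv_open[OF tr(1)] smooth_map_on_subset[OF r(1)]]])
          (simp_all add: s_def triv_inv[OF tr(1)])
      then show ?thesis using tr(1) True triv_open[OF tr(1)] by blast
    next
      case False
      obtain U' \<tau>' m' where t: "trivialization U' \<tau>' m'" "p \<in> U'" using trivialization_exists .
      have oW: "open (U' - C)" using r(2) triv_open[OF t(1)] by (rule open_Diff[rotated])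
      have "smooth_fun_on A (U' - C) (\<lambda>q. \<tau>' (s q))"
        by (rule smooth_fun_on_cong[OF charted_A oW smooth_fun_on_const[OF charted_A oW, of 0]]) (use out t(1) in auto)
      then show ?thesis using t oW False r(3) by blast
    qed
  qed
  moreover have "s p \<in> Nz" using Nz_triv[OF tr(1), of "s p"] ps tr(2) r(5,6) by (simp add: s_def triv_inv[OF tr(1)])
  ultimately show ?thesis using that by blast
qed

text \<open>A functional on sections that is linear over the smooth functions depends on the value at \<open>p\<close>
  only; scaling suffices, since the rank is one.\<close>

lemma section_tensorial:
  fixes S :: "('m \<Rightarrow> 'l) \<Rightarrow> complex"
  assumes S: "\<And>f s. smooth_fun A f \<Longrightarrow> s \<in> sections A L \<Longrightarrow> S (\<lambda>q. fscale L (f q) (s q)) = f p * S s"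
    and s: "s \<in> sections A L" and e: "e \<in> sections A L" "e p \<in> Nz"
  shows "S s = ratio (s p) (e p) * S e"
proof -
  obtain U \<tau> m where tr: "trivialization U \<tau> m" "p \<in> U" using trivialization_exists .
  define W where "W = U \<inter> (\<lambda>q. \<tau> (e q)) -` (- {0})"
  have oW: "open W" unfolding W_def
    by (rule open_vimage_Int[OF triv_open[OF tr(1)] smooth_map_onD(1)[OF section_coordinate_smooth[OF tr(1) e(1)]]]) (simp add: open_Compl)
  have pW: "p \<in> W" using e(2) Nz_triv[OF tr(1), of "e p"] section_proj[OF e(1)] tr(2) by (simp add: W_def)
  obtain \<rho> :: "'m \<Rightarrow> real" and C W' where r: "smooth_fun A \<rho>" "closed C" "C \<subseteq> W" "\<And>x. x \<notin> C \<Longrightarrow> \<rho> x = 0"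
    "p \<in> W'" "\<And>x. x \<in> W' \<Longrightarrow> \<rho> x = 1"
    using bump_function[OF M oW pW] by metis
  let ?h = "\<lambda>q. \<tau> (s q) / \<tau> (e q)"
  define g where "g q = (if q \<in> W then \<rho> q *\<^sub>R ?h q else 0)" for q
  have "smooth_fun_on A W ?h"
    by (rule smooth_fun_on_divide[OF charted_A oW])
      (auto simp: W_def intro: smooth_map_on_subset[OF section_coordinate_smooth[OF tr(1) s]]
         smooth_map_on_subset[OF section_coordinate_smooth[OF tr(1) e(1)]])
  from smooth_extend_by_zero[OF charted_A r(1-4) oW this]
  have sg: "smooth_fun A g" by (simp add: g_def[abs_def])
  have eq: "(\<lambda>q. fscale L (complex_of_real (\<rho> q)) (s q)) = (\<lambda>q. fscale L (g q) (e q))"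
  proof (rule ext)
    fix q
    obtain U' \<tau>' m' where t: "trivialization U' \<tau>' m'" "q \<in> U'" using trivialization_exists .
    show "fscale L (complex_of_real (\<rho> q)) (s q) = fscale L (g q) (e q)"
    proof (cases "q \<in> W")
      case True
      then show ?thesis
        by (intro triv_inj[OF tr(1)])
          (simp_all add: W_def g_def proj_fscale section_proj s e triv_scale[OF tr(1)] scaleR_conv_of_real)
    next
      case False
      then have "\<rho> q = 0" using r(3,4) by blast
      then show ?thesis using False t(2)
        by (intro triv_inj[OF t(1)]) (simp_all add: g_def proj_fscale section_proj s e triv_scale[OF t(1)])
    qed
  qed
  have "S s = S (\<lambda>q. fscale L (complex_of_real (\<rho> q)) (s q))"
    using S[OF smooth_fun_on_of_real[OF charted_A open_UNIV r(1)] s] r(5,6) by simp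
  also have "\<dots> = g p * S e" unfolding eq by (rule S[OF sg e(1)])
  also have "g p = ratio (s p) (e p)"
    using ratio_triv[OF tr(1), of "e p" "s p"] e section_proj[OF e(1)] section_proj[OF s] tr(2) pW r(5,6)
    by (simp add: g_def)
  finally show ?thesis .
qed

end

section \<open>Any two Chern forms are cohomologous\<close>

context line_bundle_over
begin

lemma connection_section: "connection A L D \<Longrightarrow> vector_field A X \<Longrightarrow> s \<in> sections A L \<Longrightarrow> D X s \<in> sections A L"
  by (simp add: connection_def)

context
  fixes D U \<tau> m p
  assumes D: "connection A L D" and t: "trivialization U \<tau> m" and p: "p \<in> U"
begin

private lemma pr: "vector_field A X \<Longrightarrow> s \<in> sections A L \<Longrightarrow> \<pi> (D X s q) = q"
  by (rule section_proj[OF connection_section[OF D]])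

lemma conn_add_field: "vector_field A X \<Longrightarrow> vector_field A Y \<Longrightarrow> s \<in> sections A L \<Longrightarrow>
    \<tau> (D (X + Y) s p) = \<tau> (D X s p) + \<tau> (D Y s p)"
  using D pr p triv_add[OF t, of "D X s p" "D Y s p"] by (simp add: connection_def)

lemma conn_scale_field: "smooth_fun A f \<Longrightarrow> vector_field A X \<Longrightarrow> s \<in> sections A L \<Longrightarrow>
    \<tau> (D (\<lambda>q \<phi>. f q * X q \<phi>) s p) = complex_of_real (f p) * \<tau> (D X s p)"
  using D pr p triv_scale[OF t, of "D X s p"] by (simp add: connection_def)

lemma conn_add_section: "vector_field A X \<Longrightarrow> s \<in> sections A L \<Longrightarrow> s' \<in> sections A L \<Longrightarrow>
    \<tau> (D X (\<lambda>q. fadd L (s q) (s' q)) p) = \<tau> (D X s p) + \<tau> (D X s' p)"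
  using D pr p triv_add[OF t, of "D X s p" "D X s' p"] by (simp add: connection_def)

lemma conn_scale_section:
  assumes "smooth_fun A f" "vector_field A X" "s \<in> sections A L"
  shows "\<tau> (D X (\<lambda>q. fscale L (f q) (s q)) p) = f p * \<tau> (D X s p) + cderiv (X p) f * \<tau> (s p)"
proof -
  have "D X (\<lambda>q. fscale L (f q) (s q)) p = fadd L (fscale L (f p) (D X s p)) (fscale L (cderiv (X p) f) (s p))"
    using D assms by (simp add: connection_def)
  then show ?thesis using pr[OF assms(2,3)] section_proj[OF assms(3)] p
    by (simp add: triv_add[OF t] triv_scale[OF t] proj_fscale)
qed

lemma curvature_coordinate:
  assumes \<kappa>: "is_curvature A L D \<kappa>" and X: "vector_field A X" and Y: "vector_field A Y" and s: "s \<in> sections A L"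
  shows "\<kappa> p (X p) (Y p) * \<tau> (s p) = \<tau> (D X (D Y s) p) - \<tau> (D Y (D X s) p) - \<tau> (D (lie_bracket X Y) s p)"
proof -
  note B = vector_field_lie_bracket[OF M X Y]
  have "fscale L (\<kappa> p (X p) (Y p)) (s p) = fadd L (fadd L (D X (D Y s) p) (fscale L (-1) (D Y (D X s) p)))
            (fscale L (-1) (D (lie_bracket X Y) s p))"
    using \<kappa> X Y s by (simp add: is_curvature_def)
  from arg_cong[OF this, of \<tau>] show ?thesis
    using pr[OF X connection_section[OF D Y s]] pr[OF Y connection_section[OF D X s]] pr[OF B s] section_proj[OF s] p
    by (simp add: triv_add[OF t] triv_scale[OF t] proj_fscale proj_fadd)
qed

end

text \<open>The difference of two connections is linear over the smooth functions in the field and in the section: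
  the derivative terms of the two product rules cancel. So it is the multiplication by a number that
  depends on the value of the field only.\<close>

lemma connection_difference:
  assumes D: "connection A L D" and D': "connection A L D'"
  obtains \<alpha> where "one_form A \<alpha>"
    "\<And>X s p. vector_field A X \<Longrightarrow> s \<in> sections A L \<Longrightarrow> D X s p = fadd L (D' X s p) (fscale L (\<alpha> p (X p)) (s p))"
proof -
  have "\<exists>U \<tau> m. trivialization U \<tau> m \<and> p \<in> U" for p using trivialization_exists by blast
  then obtain U0 t0 m0 where t0: "\<And>p. trivialization (U0 p) (t0 p) (m0 p)" "\<And>p. p \<in> U0 p" by metis
  have "\<exists>e. e \<in> sections A L \<and> e p \<in> Nz" for p using nonvanishing_section by blast
  then obtain e0 where e0: "\<And>p. e0 p \<in> sections A L" "\<And>p. e0 p p \<in> Nz" by metis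
  have "\<exists>X. v \<in> tangent_space A p \<longrightarrow> vector_field A X \<and> X p = v" for p v using tangent_vector_extends[OF M] by metis
  then have "\<exists>Z. \<forall>p v. v \<in> tangent_space A p \<longrightarrow> vector_field A (Z p v) \<and> Z p v p = v" by (intro choice allI)
  then obtain Z where Z: "\<And>p v. v \<in> tangent_space A p \<Longrightarrow> vector_field A (Z p v)" "\<And>p v. v \<in> tangent_space A p \<Longrightarrow> Z p v p = v"
    by blast
  define \<delta> where "\<delta> p X s = t0 p (D X s p) - t0 p (D' X s p)" for p X s
  define \<alpha> where "\<alpha> p v = \<delta> p (Z p v) (e0 p) / t0 p (e0 p p)" for p v
  have nz: "t0 p (e0 p p) \<noteq> 0" for p
    using Nz_triv[OF t0(1)[of p], of "e0 p p"] e0 t0(2)[of p] section_proj[OF e0(1)] by simp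
  have dz: "\<delta> p X s = \<alpha> p (X p) * t0 p (s p)" if X: "vector_field A X" and s: "s \<in> sections A L" for p X s
  proof -
    note v = vector_fieldD(1)[OF X, of p]
    have "\<delta> p X s = ratio (s p) (e0 p p) * \<delta> p X (e0 p)"
      by (rule section_tensorial[OF _ s e0])
        (simp add: \<delta>_def conn_scale_section[OF D t0] conn_scale_section[OF D' t0] X algebra_simps)
    also have "\<delta> p X (e0 p) = \<delta> p (Z p (X p)) (e0 p)"
    proof (rule tensorial[OF M _ _ X Z(1)[OF v]])
      show "X p = Z p (X p) p" using Z(2)[OF v] by simp
      show "\<delta> p (X + Y) (e0 p) = \<delta> p X (e0 p) + \<delta> p Y (e0 p)" if "vector_field A X" "vector_field A Y" for X Y
        by (simp add: \<delta>_def conn_add_field[OF D t0] conn_add_field[OF D' t0] that e0)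
      show "\<delta> p (\<lambda>q \<phi>. f q * X q \<phi>) (e0 p) = complex_of_real (f p) * \<delta> p X (e0 p)" if "smooth_fun A f" "vector_field A X" for f X
        by (simp add: \<delta>_def conn_scale_field[OF D t0] conn_scale_field[OF D' t0] that e0 algebra_simps)
    qed
    also have "ratio (s p) (e0 p p) = t0 p (s p) / t0 p (e0 p p)"
      by (rule ratio_triv[OF t0(1)]) (simp_all add: section_proj[OF s] section_proj[OF e0(1)] t0 e0)
    finally show ?thesis by (simp add: \<alpha>_def)
  qed
  have diff: "D X s p = fadd L (D' X s p) (fscale L (\<alpha> p (X p)) (s p))"
    if X: "vector_field A X" and s: "s \<in> sections A L" for X s p
  proof (rule triv_inj[OF t0(1)[of p]])
    note pd = section_proj[OF connection_section[OF D X s]] section_proj[OF connection_section[OF D' X s]] section_proj[OF s]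
    show "\<pi> (D X s p) \<in> U0 p" by (simp add: pd t0)
    show "\<pi> (D X s p) = \<pi> (fadd L (D' X s p) (fscale L (\<alpha> p (X p)) (s p)))" by (simp add: pd proj_fadd proj_fscale)
    show "t0 p (D X s p) = t0 p (fadd L (D' X s p) (fscale L (\<alpha> p (X p)) (s p)))"
      using dz[OF X s, of p] by (simp add: triv_add[OF t0(1)] triv_scale[OF t0(1)] pd t0 proj_fscale \<delta>_def algebra_simps)
  qed
  have coord: "\<tau> (D X s q) = \<tau> (D' X s q) + \<alpha> q (X q) * \<tau> (s q)"
    if t: "trivialization U \<tau> m" "q \<in> U" and X: "vector_field A X" and s: "s \<in> sections A L" for U \<tau> m q X s
    unfolding diff[OF X s, of q]
    by (simp add: triv_add[OF t(1)] triv_scale[OF t(1)] t(2) section_proj[OF connection_section[OF D' X s]] section_proj[OF s] proj_fscale)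
  have val: "\<alpha> p v = \<delta> p X (e0 p) / t0 p (e0 p p)" if "vector_field A X" "X p = v" for p v X
    using dz[OF that(1) e0(1), of p] nz that(2) by simp
  have "one_form A \<alpha>"
    unfolding one_form_def
  proof (intro conjI allI ballI impI)
    fix p v w assume v: "v \<in> tangent_space A p" and w: "w \<in> tangent_space A p"
    obtain X where X: "vector_field A X" "X p = v" using tangent_vector_extends[OF M v] .
    obtain Y where Y: "vector_field A Y" "Y p = w" using tangent_vector_extends[OF M w] .
    show "\<alpha> p (v + w) = \<alpha> p v + \<alpha> p w"
      using val[OF vector_field_plus[OF M X(1) Y(1)], of p "v + w"] val[OF X] val[OF Y] X(2) Y(2)
      by (simp add: \<delta>_def conn_add_field[OF D t0] conn_add_field[OF D' t0] X(1) Y(1) e0 add_divide_distrib diff_divide_distrib)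
  next
    fix p v and c :: real assume v: "v \<in> tangent_space A p"
    obtain X where X: "vector_field A X" "X p = v" using tangent_vector_extends[OF M v] .
    have sc: "smooth_fun A (\<lambda>q. c)" by (rule smooth_fun_on_const[OF charted_A open_UNIV])
    show "\<alpha> p (\<lambda>f. c * v f) = complex_of_real c * \<alpha> p v"
      using val[OF vector_field_scale[OF M sc X(1)], of p "\<lambda>f. c * v f"] val[OF X] X(2)
      by (simp add: \<delta>_def conn_scale_field[OF D t0 sc X(1) e0(1)] conn_scale_field[OF D' t0 sc X(1) e0(1)] right_diff_distrib)
  next
    fix X assume X: "vector_field A X"
    show "smooth_fun A (\<lambda>p. \<alpha> p (X p))"
    proof (rule smooth_fun_on_local[OF charted_A _ open_UNIV])
      fix p
      let ?U = "U0 p" and ?t = "t0 p" and ?e = "e0 p"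
      define W where "W = ?U \<inter> (\<lambda>q. ?t (?e q)) -` (- {0})"
      have oW: "open W" unfolding W_def
        by (rule open_vimage_Int[OF triv_open[OF t0(1)] smooth_map_onD(1)[OF section_coordinate_smooth[OF t0(1) e0(1)]]]) (simp add: open_Compl)
      have WU: "W \<subseteq> ?U" by (auto simp: W_def)
      note sc = smooth_map_on_subset[OF section_coordinate_smooth[OF t0(1)[of p]] WU]
      have "smooth_fun_on A W (\<lambda>q. (?t (D X ?e q) - ?t (D' X ?e q)) / ?t (?e q))"
        by (intro smooth_fun_on_divide[OF charted_A oW] smooth_fun_on_diff[OF charted_A oW] sc connection_section[OF D X] connection_section[OF D' X] e0)
          (auto simp: W_def)
      then have "smooth_fun_on A W (\<lambda>q. \<alpha> q (X q))"
        by (rule smooth_fun_on_cong[OF charted_A oW]) (use coord[OF t0(1)[of p] _ X e0(1)] in \<open>auto simp: W_def\<close>)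
      moreover have "p \<in> W" using nz t0(2) by (simp add: W_def)
      ultimately show "\<exists>W'. open W' \<and> p \<in> W' \<and> smooth_fun_on A W' (\<lambda>q. \<alpha> q (X q))" using oW by blast
    qed
  qed
  then show ?thesis using that diff by blast
qed

text \<open>With \<open>D = D' + \<alpha>\<close> the products \<open>\<alpha>(X) \<alpha>(Y)\<close> cancel on antisymmetrisation, since the rank is one,
  and the derivatives of \<open>\<alpha>\<close> that remain form \<open>d\<alpha>\<close>.\<close>

lemma curvature_difference:
  assumes D: "connection A L D" and D': "connection A L D'"
    and \<kappa>: "is_curvature A L D \<kappa>" and \<kappa>': "is_curvature A L D' \<kappa>'"
  obtains \<alpha> where "one_form A \<alpha>"
    "\<And>X Y p. vector_field A X \<Longrightarrow> vector_field A Y \<Longrightarrow> \<kappa> p (X p) (Y p) = \<kappa>' p (X p) (Y p) + ext_deriv1 \<alpha> X Y p"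
proof -
  obtain \<alpha> where \<alpha>: "one_form A \<alpha>"
    "\<And>X s p. vector_field A X \<Longrightarrow> s \<in> sections A L \<Longrightarrow> D X s p = fadd L (D' X s p) (fscale L (\<alpha> p (X p)) (s p))"
    using connection_difference[OF D D'] by blast
  have "\<kappa> p (X p) (Y p) = \<kappa>' p (X p) (Y p) + ext_deriv1 \<alpha> X Y p"
    if X: "vector_field A X" and Y: "vector_field A Y" for X Y p
  proof -
    obtain e where e: "e \<in> sections A L" "e p \<in> Nz" using nonvanishing_section .
    obtain U \<tau> m where t: "trivialization U \<tau> m" "p \<in> U" using trivialization_exists .
    have nz: "\<tau> (e p) \<noteq> 0" using e Nz_triv[OF t(1), of "e p"] section_proj[OF e(1)] t(2) by simp
    have coord: "\<tau> (D X s p) = \<tau> (D' X s p) + \<alpha> p (X p) * \<tau> (s p)"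
      if "vector_field A X" "s \<in> sections A L" for X s
      unfolding \<alpha>(2)[OF that]
      by (simp add: triv_add[OF t(1)] triv_scale[OF t(1)] t(2) section_proj[OF connection_section[OF D' that]]
          section_proj[OF that(2)] proj_fscale)
    have twice: "\<tau> (D X (D Y e) p) = \<tau> (D' X (D' Y e) p) + \<alpha> p (Y p) * \<tau> (D' X e p)
        + cderiv (X p) (\<lambda>q. \<alpha> q (Y q)) * \<tau> (e p) + \<alpha> p (X p) * \<tau> (D' Y e p) + \<alpha> p (X p) * \<alpha> p (Y p) * \<tau> (e p)"
      if X: "vector_field A X" and Y: "vector_field A Y" for X Y
    proof -
      have sa: "smooth_fun A (\<lambda>q. \<alpha> q (Y q))" using \<alpha>(1) Y by (simp add: one_form_def)
      have DY: "D Y e = (\<lambda>q. fadd L (D' Y e q) (fscale L (\<alpha> q (Y q)) (e q)))"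
        by (rule ext) (rule \<alpha>(2)[OF Y e(1)])
      have "\<tau> (D' X (D Y e) p) = \<tau> (D' X (D' Y e) p) + (\<alpha> p (Y p) * \<tau> (D' X e p) + cderiv (X p) (\<lambda>q. \<alpha> q (Y q)) * \<tau> (e p))"
        unfolding DY conn_add_section[OF D' t X connection_section[OF D' Y e(1)] section_fscale[OF sa e(1)]]
          conn_scale_section[OF D' t sa X e(1)] ..
      then show ?thesis
        using coord[OF X connection_section[OF D Y e(1)]] coord[OF Y e(1)] by (simp add: algebra_simps)
    qed
    have "\<kappa> p (X p) (Y p) * \<tau> (e p) = (\<kappa>' p (X p) (Y p) + ext_deriv1 \<alpha> X Y p) * \<tau> (e p)"
      unfolding distrib_right curvature_coordinate[OF D t \<kappa> X Y e(1)] curvature_coordinate[OF D' t \<kappa>' X Y e(1)]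
        twice[OF X Y] twice[OF Y X] coord[OF vector_field_lie_bracket[OF M X Y] e(1)] ext_deriv1_def
      by (simp add: algebra_simps)
    then show ?thesis using nz by simp
  qed
  then show ?thesis using that \<alpha>(1) by blast
qed

lemma exact_form_add:
  assumes "exact_form2 A \<eta>" "exact_form2 A \<eta>'"
  shows "exact_form2 A (\<eta> + \<eta>')"
proof -
  obtain \<theta> \<theta>' where t: "one_form A \<theta>" "one_form A \<theta>'"
    "\<And>X Y p. vector_field A X \<Longrightarrow> vector_field A Y \<Longrightarrow> \<eta> p (X p) (Y p) = ext_deriv1 \<theta> X Y p"
    "\<And>X Y p. vector_field A X \<Longrightarrow> vector_field A Y \<Longrightarrow> \<eta>' p (X p) (Y p) = ext_deriv1 \<theta>' X Y p"
    using assms unfolding exact_form2_def by blast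
  have "one_form A (\<theta> + \<theta>')"
    using t(1,2) by (simp add: one_form_def smooth_fun_on_add[OF charted_A open_UNIV] algebra_simps)
  moreover have "(\<eta> + \<eta>') p (X p) (Y p) = ext_deriv1 (\<theta> + \<theta>') X Y p"
    if X: "vector_field A X" and Y: "vector_field A Y" for X Y p
  proof -
    have s: "smooth_fun A (\<lambda>q. \<theta> q (X q))" "smooth_fun A (\<lambda>q. \<theta>' q (X q))"
      "smooth_fun A (\<lambda>q. \<theta> q (Y q))" "smooth_fun A (\<lambda>q. \<theta>' q (Y q))"
      using t(1,2) X Y by (simp_all add: one_form_def)
    show ?thesis
      using t(3,4)[OF X Y, of p] cderiv_add[OF M vector_fieldD(1)[OF X] s(3,4)] cderiv_add[OF M vector_fieldD(1)[OF Y] s(1,2)]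
      by (simp add: ext_deriv1_def)
  qed
  ultimately show ?thesis unfolding exact_form2_def by blast
qed

lemma exact_form_scale:
  assumes "exact_form2 A \<eta>"
  shows "exact_form2 A (\<lambda>p v w. c * \<eta> p v w)"
proof -
  obtain \<theta> where t: "one_form A \<theta>"
    "\<And>X Y p. vector_field A X \<Longrightarrow> vector_field A Y \<Longrightarrow> \<eta> p (X p) (Y p) = ext_deriv1 \<theta> X Y p"
    using assms unfolding exact_form2_def by blast
  have "one_form A (\<lambda>p v. c * \<theta> p v)"
    using t(1) by (simp add: one_form_def smooth_fun_on_mult[OF charted_A open_UNIV] smooth_fun_on_const[OF charted_A open_UNIV] algebra_simps)
  moreover have "c * \<eta> p (X p) (Y p) = ext_deriv1 (\<lambda>p v. c * \<theta> p v) X Y p"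
    if X: "vector_field A X" and Y: "vector_field A Y" for X Y p
  proof -
    have s: "smooth_fun A (\<lambda>q. \<theta> q (X q))" "smooth_fun A (\<lambda>q. \<theta> q (Y q))"
      using t(1) X Y by (simp_all add: one_form_def)
    show ?thesis
      unfolding t(2)[OF X Y] ext_deriv1_def cderiv_scale[OF M vector_fieldD(1)[OF X] s(2)] cderiv_scale[OF M vector_fieldD(1)[OF Y] s(1)]
      by (simp add: algebra_simps)
  qed
  ultimately show ?thesis unfolding exact_form2_def by blast
qed

text \<open>The Chern class is defined by some Chern form. A flat connection shows that there is one, and makes
  every one exact.\<close>

lemma flat_connection_chern_class:
  assumes D': "connection A L D'" and flat: "is_curvature A L D' 0"
  shows "chern_class A L = deRham_class A 0"
proof -
  have "chern_form A L (\<lambda>p v w. \<i> / (2 * of_real pi) * 0 p v w)"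
    using assms unfolding chern_form_def by blast
  then have "chern_form A L (SOME \<eta>. chern_form A L \<eta>)" by (rule someI[of "chern_form A L"])
  then obtain D \<kappa> where D: "connection A L D" "is_curvature A L D \<kappa>"
    and eta: "(SOME \<eta>. chern_form A L \<eta>) = (\<lambda>p v w. \<i> / (2 * of_real pi) * \<kappa> p v w)"
    unfolding chern_form_def by blast
  obtain \<alpha> where \<alpha>: "one_form A \<alpha>"
    "\<And>X Y p. vector_field A X \<Longrightarrow> vector_field A Y \<Longrightarrow> \<kappa> p (X p) (Y p) = 0 p (X p) (Y p) + ext_deriv1 \<alpha> X Y p"
    using curvature_difference[OF D(1) D' D(2) flat] by blast
  then have "exact_form2 A \<kappa>" unfolding exact_form2_def by auto
  then have ex: "exact_form2 A (SOME \<eta>. chern_form A L \<eta>)" (is "exact_form2 A ?\<eta>") unfolding eta by (rule exact_form_scale)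
  have neg: "exact_form2 A (- ?\<eta>)"
    using exact_form_scale[OF ex, of "-1"] by (simp add: fun_Compl_def)
  have "exact_form2 A (\<eta>' - ?\<eta>) \<longleftrightarrow> exact_form2 A (\<eta>' - 0)" for \<eta>'
    using exact_form_add[OF _ ex, of "\<eta>' - ?\<eta>"] exact_form_add[OF _ neg, of "\<eta>'"] by auto
  then show ?thesis by (simp add: chern_class_def deRham_class_def)
qed

end

section \<open>Sections as functions on the total space\<close>

context line_bundle_over
begin

text \<open>The correspondence between sections \<open>s\<close> and functions \<open>a \<mapsto> s/a\<close> of degree \<open>-1\<close> on the non-zero
  vectors. It turns differentiation of sections into differentiation of functions on the total space,
  where the bracket of the twist is available. The value at a zero vector is arbitrary.\<close>

definition hat :: "('m \<Rightarrow> 'l) \<Rightarrow> 'l \<Rightarrow> complex" where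
  "hat s a = ratio (s (\<pi> a)) a"

definition homogeneous :: "('l \<Rightarrow> complex) \<Rightarrow> bool" where
  "homogeneous u \<longleftrightarrow> (\<forall>a\<in>Nz. \<forall>c. c \<noteq> 0 \<longrightarrow> u (fscale L c a) = u a / c)"

definition base_vector :: "'m \<Rightarrow> 'l" where
  "base_vector p = (SOME a. a \<in> Nz \<and> \<pi> a = p)"

definition unhat :: "('l \<Rightarrow> complex) \<Rightarrow> 'm \<Rightarrow> 'l" where
  "unhat u p = fscale L (u (base_vector p)) (base_vector p)"

lemma base_vector: "base_vector p \<in> Nz" "\<pi> (base_vector p) = p"
proof -
  obtain s where "s \<in> sections A L" "s p \<in> Nz" using nonvanishing_section .
  then have "\<exists>a. a \<in> Nz \<and> \<pi> a = p" using section_proj by blast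
  from someI_ex[OF this] show "base_vector p \<in> Nz" "\<pi> (base_vector p) = p" by (simp_all add: base_vector_def)
qed

lemma fscale_Nz: "a \<in> Nz \<Longrightarrow> c \<noteq> 0 \<Longrightarrow> fscale L c a \<in> Nz"
proof -
  assume a: "a \<in> Nz" and c: "c \<noteq> 0"
  obtain U \<tau> m where t: "trivialization U \<tau> m" "\<pi> a \<in> U" using trivialization_exists .
  show ?thesis using Nz_triv[OF t] Nz_triv[OF t(1), of "fscale L c a"] t a c by (simp add: proj_fscale triv_scale[OF t(1)])
qed

lemma fscale_fscale: "fscale L c (fscale L d a) = fscale L (c * d) a"
proof -
  obtain U \<tau> m where t: "trivialization U \<tau> m" "\<pi> a \<in> U" using trivialization_exists .
  show ?thesis by (rule triv_inj[OF t(1)]) (simp_all add: proj_fscale triv_scale[OF t(1)] t(2))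
qed

lemma fscale_add: "fscale L (c + d) a = fadd L (fscale L c a) (fscale L d a)"
proof -
  obtain U \<tau> m where t: "trivialization U \<tau> m" "\<pi> a \<in> U" using trivialization_exists .
  show ?thesis
    by (rule triv_inj[OF t(1)])
      (simp_all add: proj_fscale proj_fadd triv_scale[OF t(1)] triv_add[OF t(1)] t(2) distrib_right)
qed

lemma fscale_zero: "\<pi> a = \<pi> b \<Longrightarrow> fscale L 0 a = fscale L 0 b"
proof -
  assume ab: "\<pi> a = \<pi> b"
  obtain U \<tau> m where t: "trivialization U \<tau> m" "\<pi> a \<in> U" using trivialization_exists .
  show ?thesis by (rule triv_inj[OF t(1)]) (use t(2) ab in \<open>simp_all add: proj_fscale triv_scale[OF t(1)]\<close>)
qed

lemma hat_triv:
  assumes t: "trivialization U \<tau> m" "\<pi> a \<in> U" and a: "a \<in> Nz" and s: "\<And>q. \<pi> (s q) = q"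
  shows "hat s a = \<tau> (s (\<pi> a)) / \<tau> a"
  unfolding hat_def by (rule ratio_triv[OF t a s])

lemma hat_fscale: "s \<in> sections A L \<Longrightarrow> a \<in> Nz \<Longrightarrow> fscale L (hat s a) a = s (\<pi> a)"
  unfolding hat_def by (rule ratio_fscale) (simp_all add: section_proj)

lemma hat_homogeneous:
  assumes s: "s \<in> sections A L"
  shows "homogeneous (hat s)"
  unfolding homogeneous_def
proof (intro ballI allI impI)
  fix a and c :: complex assume a: "a \<in> Nz" and c: "c \<noteq> 0"
  obtain U \<tau> m where t: "trivialization U \<tau> m" "\<pi> a \<in> U" using trivialization_exists .
  show "hat s (fscale L c a) = hat s a / c"
    using hat_triv[OF t a section_proj[OF s]] hat_triv[OF t(1) _ fscale_Nz[OF a c] section_proj[OF s]] t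
    by (simp add: proj_fscale triv_scale[OF t(1)])
qed

lemma hat_smooth:
  assumes s: "s \<in> sections A L"
  shows "smooth_fun_on T Nz (hat s)"
proof (rule smooth_fun_on_local[OF charted_T _ open_Nz])
  fix a assume a: "a \<in> Nz"
  obtain U \<tau> m where t: "trivialization U \<tau> m" "\<pi> a \<in> U" using trivialization_exists .
  let ?W = "\<pi> -` U \<inter> Nz"
  have oU: "open (\<pi> -` U)" by (rule open_vimage_proj[OF triv_open[OF t(1)]])
  have oW: "open ?W" using oU open_Nz by blast
  have n: "smooth_fun_on T (\<pi> -` U) (\<lambda>a. \<tau> (s (\<pi> a)))"
    by (rule smooth_fun_on_pullback[OF charted_T charted_A oU triv_open[OF t(1)] smooth_map_on_subset[OF smooth_proj] section_coordinate_smooth[OF t(1) s]]) auto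
  have "smooth_fun_on T ?W (\<lambda>a. \<tau> (s (\<pi> a)) / \<tau> a)"
    by (rule smooth_fun_on_divide[OF charted_T oW _ smooth_map_on_subset[OF n] smooth_map_on_subset[OF triv_smooth[OF t(1)]]])
      (use Nz_triv[OF t(1)] in auto)
  then have "smooth_fun_on T ?W (hat s)"
    by (rule smooth_fun_on_cong[OF charted_T oW]) (use hat_triv[OF t(1) _ _ section_proj[OF s]] in auto)
  then show "\<exists>W. open W \<and> a \<in> W \<and> smooth_fun_on T W (hat s)" using oW t(2) a by blast
qed

text \<open>By homogeneity the choice of the base vector does not matter.\<close>

lemma unhat_eq:
  assumes u: "homogeneous u" and a: "a \<in> Nz"
  shows "unhat u (\<pi> a) = fscale L (u a) a"
proof -
  let ?b = "base_vector (\<pi> a)"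
  define c where "c = ratio ?b a"
  have b: "?b = fscale L c a" unfolding c_def by (rule ratio_fscale[symmetric, OF a]) (simp add: base_vector)
  have c: "c \<noteq> 0"
  proof
    assume "c = 0"
    then have "?b = fscale L 0 ?b" using b fscale_zero[of ?b a] base_vector(2)[of "\<pi> a"] by simp
    then show False using base_vector(1)[of "\<pi> a"] by (simp add: Nz_def)
  qed
  have "unhat u (\<pi> a) = fscale L (u a / c) (fscale L c a)"
    using u a c by (simp add: unhat_def b homogeneous_def)
  then show ?thesis using c by (simp add: fscale_fscale)
qed

lemma unhat_proj: "\<pi> (unhat u p) = p"
  by (simp add: unhat_def proj_fscale base_vector)

lemma hat_unhat:
  assumes "homogeneous u" "a \<in> Nz"
  shows "hat (unhat u) a = u a"
proof -
  obtain U \<tau> m where t: "trivialization U \<tau> m" "\<pi> a \<in> U" using trivialization_exists .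
  show ?thesis
    using hat_triv[OF t assms(2), of "unhat u"] unhat_eq[OF assms] Nz_triv[OF t] t assms(2)
    by (simp add: unhat_proj triv_scale[OF t(1)])
qed

lemma unhat_section:
  assumes u: "homogeneous u" and s: "smooth_fun_on T Nz u"
  shows "unhat u \<in> sections A L"
proof (rule sectionI)
  show "\<pi> (unhat u q) = q" for q by (rule unhat_proj)
  let ?C = "model_atlas :: (complex, complex) atlas"
  fix p
  obtain U \<tau> m where t: "trivialization U \<tau> m" "p \<in> U" using trivialization_exists .
  note oU = triv_open[OF t(1)]
  have mNz: "m (q, 1) \<in> Nz" if "q \<in> U" for q
    using Nz_triv[OF t(1), of "m (q, 1)"] triv_inv[OF t(1)] that by simp
  have pr: "smooth_map_on A (prod_atlas A ?C) U (\<lambda>q. (q, 1))"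
    by (rule smooth_map_on_Pair[OF charted_A charted_A charted_model_complex oU smooth_map_id[OF M] smooth_fun_on_const[OF charted_A oU]])
  have sm: "smooth_map_on A T U (\<lambda>q. m (q, 1))"
    by (rule smooth_map_on_compose[OF charted_A charted_prod[OF charted_A charted_model_complex] charted_T oU open_Times[OF oU open_UNIV] pr triv_inv_smooth[OF t(1)]])
      auto
  have "smooth_fun_on A U (\<lambda>q. u (m (q, 1)))"
    by (rule smooth_fun_on_pullback[OF charted_A charted_T oU open_Nz sm s]) (use mNz in auto)
  then have "smooth_fun_on A U (\<lambda>q. \<tau> (unhat u q))"
  proof (rule smooth_fun_on_cong[OF charted_A oU])
    fix q assume q: "q \<in> U"
    show "u (m (q, 1)) = \<tau> (unhat u q)"
      using unhat_eq[OF u mNz[OF q]] triv_inv[OF t(1) q] q by (simp add: triv_scale[OF t(1)])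
  qed
  then show "\<exists>U \<tau> m W. trivialization U \<tau> m \<and> open W \<and> p \<in> W \<and> W \<subseteq> U \<and> smooth_fun_on A W (\<lambda>q. \<tau> (unhat u q))"
    using t oU by blast
qed

end

section \<open>The flat connection\<close>

locale twisted_line_bundle =
  S: symplectic_manifold A \<omega> + LB: line_bundle_over A L +
  base: twisted_action AG G A act UNIV F H +
  bun: twisted_action AG G "total_atlas L" actL "line_bundle_over.Nz L" F H
  for A :: "('m::{t2_space,second_countable_topology}, 'e::real_inner) atlas"
    and \<omega> :: "'m \<Rightarrow> 'm tvec \<Rightarrow> 'm tvec \<Rightarrow> real"
    and L :: "('l::{t2_space,second_countable_topology}, 'm, 'e) line_bundle"
    and AG :: "('g::{t2_space,second_countable_topology}, 'k::real_inner) atlas"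
    and G :: "'g monoid" and act actL F H +
  assumes proj_actL: "\<And>g a. proj L (actL g a) = act g (proj L a)"
    and actL_fscale: "\<And>g c a. actL g (fscale L c a) = fscale L c (actL g a)"
    and poisson: "\<And>f h p. smooth_fun A f \<Longrightarrow> smooth_fun A h \<Longrightarrow> base.bracket f h p = \<i> * poisson_bracket A \<omega> f h p"
begin

abbreviation smoothL :: "('l \<Rightarrow> complex) \<Rightarrow> bool" where
  "smoothL u \<equiv> smooth_fun_on (total_atlas L) LB.Nz u"

definition lift :: "('m \<Rightarrow> 'b) \<Rightarrow> 'l \<Rightarrow> 'b" where "lift f a = f (proj L a)"

abbreviation lift_real :: "('m \<Rightarrow> real) \<Rightarrow> 'l \<Rightarrow> complex" where
  "lift_real f \<equiv> lift (\<lambda>p. complex_of_real (f p))"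

lemma lift_smooth: "smooth_fun A f \<Longrightarrow> smoothL (lift f)"
  using smooth_map_on_subset[OF smooth_fun_on_pullback[OF LB.charted_T LB.charted_A open_UNIV open_UNIV LB.smooth_proj, of f], of LB.Nz]
  by (simp add: lift_def[abs_def])

lemma of_real_smooth: "smooth_fun A f \<Longrightarrow> smooth_fun A (\<lambda>p. complex_of_real (f p))"
  by (rule smooth_fun_on_of_real[OF LB.charted_A open_UNIV])

lemma lift_real_smooth: "smooth_fun A f \<Longrightarrow> smoothL (lift_real f)"
  by (intro lift_smooth of_real_smooth)

text \<open>Pullback to the total space preserves the brackets, since the projection is equivariant.\<close>

lemma bracket_lift:
  assumes "smooth_fun A f" "smooth_fun A h" "a \<in> LB.Nz"
  shows "bun.bracket (lift f) (lift h) a = base.bracket f h (proj L a)"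
proof -
  have "bun.orbit (lift f) a = base.orbit f (proj L a)" for f
    by (simp add: fun_eq_iff bun.orbit_def base.orbit_def lift_def proj_actL)
  then show ?thesis
    using bun.bracket_orbit[OF lift_smooth[OF assms(1)] lift_smooth[OF assms(2)] assms(3)] base.bracket_orbit[of f h "proj L a"] assms by simp
qed

lemma bracket_real:
  assumes "smooth_fun A f" "smooth_fun A h"
  shows "base.bracket (\<lambda>p. complex_of_real (f p)) (\<lambda>p. complex_of_real (h p)) p = \<i> * complex_of_real (S.ham h p f)"
  unfolding poisson[OF of_real_smooth[OF assms(1)] of_real_smooth[OF assms(2)]] S.poisson_bracket_real_real[OF assms] ..

text \<open>\<open>[X\<^sub>f, X\<^sub>g] = - X\<^sub>h\<close> with \<open>h = {f, g}\<close>, by the Jacobi identity of the bracket on the base.\<close>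

lemma ham_lie_bracket:
  assumes f: "smooth_fun A f" and g: "smooth_fun A g"
  shows "lie_bracket (S.ham f) (S.ham g) p = (\<lambda>h. - 1 * S.ham (\<lambda>q. S.ham g q f) p h)"
proof (rule ext)
  fix h
  note vf = S.ham(1)[OF f] S.ham(1)[OF g]
  have k: "smooth_fun A (\<lambda>q. S.ham g q f)" by (rule vector_fieldD(2)[OF vf(2) f])
  show "lie_bracket (S.ham f) (S.ham g) p h = - 1 * S.ham (\<lambda>q. S.ham g q f) p h"
  proof (cases "smooth_fun A h")
    case True
    note h = True
    let ?K = "\<lambda>a b q. S.ham b q a"
    have sK: "smooth_fun A (?K a b)" if "smooth_fun A a" "smooth_fun A b" for a b
      by (rule vector_fieldD(2)[OF S.ham(1)[OF that(2)] that(1)])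
    have br2: "base.bracket (\<lambda>p. complex_of_real (a p)) (base.bracket (\<lambda>p. complex_of_real (b p)) (\<lambda>p. complex_of_real (c p))) p
        = - complex_of_real (S.ham (?K b c) p a)" if "smooth_fun A a" "smooth_fun A b" "smooth_fun A c" for a b c
    proof -
      have "base.bracket (\<lambda>p. complex_of_real (b p)) (\<lambda>p. complex_of_real (c p)) = (\<lambda>q. \<i> * complex_of_real (?K b c q))"
        by (rule ext) (rule bracket_real[OF that(2,3)])
      then show ?thesis
        using base.bracket_scale[OF of_real_smooth[OF that(1)] of_real_smooth[OF sK[OF that(2,3)]] of_real_smooth[OF that(1)], of p \<i>]
          bracket_real[OF that(1) sK[OF that(2,3)], of p] by simp
    qed
    have "base.bracket (base.bracket (\<lambda>p. complex_of_real (f p)) (\<lambda>p. complex_of_real (g p))) (\<lambda>p. complex_of_real (h p)) p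
        = complex_of_real (S.ham (?K f g) p h)"
      using br2[OF h f g] base.bracket_skew[of "base.bracket (\<lambda>p. complex_of_real (f p)) (\<lambda>p. complex_of_real (g p))" "\<lambda>p. complex_of_real (h p)" p]
      by simp
    then have "- complex_of_real (S.ham (?K g h) p f) + complex_of_real (S.ham (?K f h) p g) = complex_of_real (S.ham (?K f g) p h)"
      using base.bracket_jacobi[OF of_real_smooth[OF f] of_real_smooth[OF g] of_real_smooth[OF h], of p]
        br2[OF f g h] br2[OF g f h] by simp
    then have J: "- S.ham (?K g h) p f + S.ham (?K f h) p g = S.ham (?K f g) p h"
      unfolding of_real_minus[symmetric] of_real_add[symmetric] of_real_eq_iff .
    have sw: "S.ham (?K a h) p b = S.ham b p (\<lambda>q. S.ham a q h)" if a: "smooth_fun A a" and b: "smooth_fun A b" for a b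
    proof -
      have "?K a h = (\<lambda>q. - S.ham a q h)" by (rule ext) (rule S.ham_skew[OF a h])
      then have "S.ham b p (?K a h) = - S.ham b p (\<lambda>q. S.ham a q h)"
        using tangent_minus[OF LB.M vector_fieldD(1)[OF S.ham(1)[OF b]] vector_fieldD(2)[OF S.ham(1)[OF a] h]] by simp
      then show ?thesis using S.ham_skew[OF b sK[OF a h], of p] by simp
    qed
    show ?thesis using J sw[OF g f] sw[OF f g] by (simp add: lie_bracket_def)
  next
    case False
    then show ?thesis
      using tangent_nonsmooth[OF LB.M vector_fieldD(1)[OF vector_field_lie_bracket[OF LB.M vf]] False]
        tangent_nonsmooth[OF LB.M vector_fieldD(1)[OF S.ham(1)[OF k]] False] by simp
  qed
qed

text \<open>As a function of \<open>f\<close> this is a complex tangent vector of the base at the foot point of \<open>a\<close>. Tangent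
  vectors have to vanish on functions that are not smooth, whence the case distinction.\<close>

definition bracket_with :: "'l \<Rightarrow> ('l \<Rightarrow> complex) \<Rightarrow> ('m \<Rightarrow> real) \<Rightarrow> complex" where
  "bracket_with a u f = (if smooth_fun A f then bun.bracket (lift_real f) u a else 0)"

text \<open>The horizontal lift of \<open>v\<close>, as a derivation of functions on the total space. It is
  characterised by being \<open>\<i>\<close> times the bracket with \<open>f\<close> for \<open>v\<close> the Hamiltonian vector of \<open>f\<close>.\<close>

definition hlift :: "'l \<Rightarrow> 'm tvec \<Rightarrow> ('l \<Rightarrow> complex) \<Rightarrow> complex" where
  "hlift a v u = \<i> * S.omega_c (proj L a) v (bracket_with a u)"

context
  fixes a u
  assumes a: "a \<in> LB.Nz" and u: "smoothL u"
begin

lemma bracket_with_add: "smooth_fun A f \<Longrightarrow> smooth_fun A g \<Longrightarrow> bracket_with a u (\<lambda>x. f x + g x) = bracket_with a u f + bracket_with a u g"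
  using bun.bracket_add[OF u lift_real_smooth lift_real_smooth a, of f g]
    bun.bracket_skew[of "lift_real f" u a] bun.bracket_skew[of "lift_real g" u a] bun.bracket_skew[of "lift_real (\<lambda>x. f x + g x)" u a]
  by (simp add: bracket_with_def smooth_fun_on_add[OF LB.charted_A open_UNIV] lift_def[abs_def])

lemma bracket_with_mult: "smooth_fun A f \<Longrightarrow> smooth_fun A g \<Longrightarrow>
    bracket_with a u (\<lambda>x. f x * g x) = bracket_with a u f * of_real (g (proj L a)) + of_real (f (proj L a)) * bracket_with a u g"
  using bun.bracket_mult[OF u lift_real_smooth lift_real_smooth a, of f g]
    bun.bracket_skew[of "lift_real f" u a] bun.bracket_skew[of "lift_real g" u a] bun.bracket_skew[of "lift_real (\<lambda>x. f x * g x)" u a]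
  by (simp add: bracket_with_def smooth_fun_on_mult[OF LB.charted_A open_UNIV] lift_def[abs_def])

lemma bracket_with_scale: "smooth_fun A f \<Longrightarrow> bracket_with a u (\<lambda>x. c * f x) = of_real c * bracket_with a u f"
  using bun.bracket_scale[OF u lift_real_smooth u a, of f "of_real c"]
    bun.bracket_skew[of "lift_real f" u a] bun.bracket_skew[of "lift_real (\<lambda>x. c * f x)" u a]
    smooth_fun_on_mult[OF LB.charted_A open_UNIV smooth_fun_on_const[OF LB.charted_A open_UNIV, of c], of f]
  by (simp add: bracket_with_def lift_def[abs_def])

lemma bracket_with_ctangent: "S.ctangent (proj L a) (bracket_with a u)"
proof -
  have "bracket_with a u f = 0" if "\<not> smooth_fun A f" for f using that by (simp add: bracket_with_def)
  then show ?thesis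
    unfolding S.ctangent_def tangent_space_def by (auto simp: bracket_with_add bracket_with_mult bracket_with_scale)
qed

lemma hlift_plus: "v \<in> tangent_space A (proj L a) \<Longrightarrow> w \<in> tangent_space A (proj L a) \<Longrightarrow> hlift a (v + w) u = hlift a v u + hlift a w u"
  by (simp add: hlift_def S.omega_c_add[OF bracket_with_ctangent] distrib_left)

lemma hlift_times: "v \<in> tangent_space A (proj L a) \<Longrightarrow> hlift a (\<lambda>f. c * v f) u = complex_of_real c * hlift a v u"
  by (simp add: hlift_def S.omega_c_scale[OF bracket_with_ctangent])

lemma hlift_ham: "smooth_fun A f \<Longrightarrow> hlift a (S.ham f (proj L a)) u = \<i> * bun.bracket (lift_real f) u a"
  by (simp add: hlift_def S.omega_c_ham[OF bracket_with_ctangent] bracket_with_def)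

end

lemma hlift_cong:
  assumes a: "a \<in> LB.Nz" and u: "smoothL u" and eq: "\<And>b. b \<in> LB.Nz \<Longrightarrow> u b = u' b"
  shows "hlift a v u = hlift a v u'"
proof -
  have "bracket_with a u = bracket_with a u'"
    using bun.bracket_cong[OF lift_real_smooth u a eq] by (auto simp: bracket_with_def fun_eq_iff)
  then show ?thesis by (simp add: hlift_def)
qed

context
  fixes a v
  assumes a: "a \<in> LB.Nz" and v: "v \<in> tangent_space A (proj L a)"
begin

lemma hlift_add: "smoothL u \<Longrightarrow> smoothL w \<Longrightarrow> hlift a v (\<lambda>b. u b + w b) = hlift a v u + hlift a v w"
proof -
  assume u: "smoothL u" and w: "smoothL w"
  obtain f where f: "smooth_fun A f" "S.ham f (proj L a) = v" using S.tangent_is_ham[OF v] .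
  show ?thesis
    using bun.bracket_add[OF lift_real_smooth[OF f(1)] u w a] hlift_ham[OF a u f(1)] hlift_ham[OF a w f(1)]
      hlift_ham[OF a smooth_fun_on_add[OF LB.charted_T LB.open_Nz u w] f(1)] f(2) by (simp add: distrib_left)
qed

text \<open>For \<open>v\<close> the Hamiltonian vector of \<open>f\<close> this is the product rule of the bracket, with
  \<open>\<i> {f \<circ> \<pi>, h \<circ> \<pi>} = \<i>\<^sup>2 {f, h} = X\<^sub>f h\<close>.\<close>

lemma hlift_mult:
  assumes h: "smooth_fun A h" and u: "smoothL u"
  shows "hlift a v (\<lambda>b. lift h b * u b) = cderiv v h * u a + h (proj L a) * hlift a v u"
proof -
  obtain f where f: "smooth_fun A f" "S.ham f (proj L a) = v" using S.tangent_is_ham[OF v] .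
  let ?p = "proj L a"
  have ri: "smooth_fun A (\<lambda>x. Re (h x))" "smooth_fun A (\<lambda>x. Im (h x))"
    by (rule smooth_fun_on_Re[OF LB.charted_A open_UNIV h], rule smooth_fun_on_Im[OF LB.charted_A open_UNIV h])
  have "bun.bracket (lift_real f) (lift h) a = \<i> * poisson_bracket A \<omega> (\<lambda>p. complex_of_real (f p)) h ?p"
    using bracket_lift[OF of_real_smooth[OF f(1)] h a] poisson[OF of_real_smooth[OF f(1)] h] by simp
  also have "poisson_bracket A \<omega> (\<lambda>p. complex_of_real (f p)) h ?p = - cderiv v h"
    using S.poisson_bracket_real[OF f(1) h, of ?p] S.ham_skew[OF f(1) ri(1), of ?p] S.ham_skew[OF f(1) ri(2), of ?p] f(2)
    by (simp add: cderiv_def complex_eq_iff)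
  finally have fh: "\<i> * bun.bracket (lift_real f) (lift h) a = cderiv v h" by simp
  have "hlift a v (\<lambda>b. lift h b * u b) = \<i> * bun.bracket (lift_real f) (\<lambda>b. lift h b * u b) a"
    using hlift_ham[OF a smooth_fun_on_mult[OF LB.charted_T LB.open_Nz lift_smooth[OF h] u] f(1)] f(2) by simp
  also have "\<dots> = lift h a * (\<i> * bun.bracket (lift_real f) u a) + (\<i> * bun.bracket (lift_real f) (lift h) a) * u a"
    unfolding bun.bracket_mult[OF lift_real_smooth[OF f(1)] lift_smooth[OF h] u a] by (simp add: algebra_simps)
  also have "\<dots> = h ?p * hlift a v u + cderiv v h * u a"
    using hlift_ham[OF a u f(1)] f(2) fh by (simp add: lift_def)
  finally show ?thesis by simp
qed

text \<open>The pulled back function and the action are insensitive to scaling in the fibre.\<close>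

lemma hlift_homogeneous:
  assumes u: "smoothL u" and hom: "LB.homogeneous u" and c: "c \<noteq> 0"
  shows "hlift (fscale L c a) v u = hlift a v u / c"
proof -
  obtain f where f: "smooth_fun A f" "S.ham f (proj L a) = v" using S.tangent_is_ham[OF v] .
  note ca = LB.fscale_Nz[OF a c]
  note lf = lift_real_smooth[OF f(1)]
  have uc: "smoothL (\<lambda>b. (1 / c) * u b)"
    by (intro smooth_fun_on_mult[OF LB.charted_T LB.open_Nz] smooth_fun_on_const[OF LB.charted_T LB.open_Nz] u)
  have 1: "bun.orbit (lift_real f) (fscale L c a) = bun.orbit (lift_real f) a"
    by (simp add: fun_eq_iff bun.orbit_def lift_def actL_fscale LB.proj_fscale)
  have 2: "bun.orbit u (fscale L c a) = bun.orbit (\<lambda>b. (1 / c) * u b) a"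
    using hom bun.inv[OF a] c by (simp add: fun_eq_iff bun.orbit_def actL_fscale LB.homogeneous_def)
  have "bun.bracket (lift_real f) u (fscale L c a) = bun.bracket (lift_real f) (\<lambda>b. (1 / c) * u b) a"
    using bun.bracket_orbit[OF lf u ca] bun.bracket_orbit[OF lf uc a] 1 2 by simp
  also have "\<dots> = (1 / c) * bun.bracket (lift_real f) u a"
    by (rule bun.bracket_scale[OF lf u u a])
  finally show ?thesis
    using hlift_ham[OF ca u f(1)] hlift_ham[OF a u f(1)] f(2) by (simp add: LB.proj_fscale)
qed

end

definition hlift_field :: "'m vfield \<Rightarrow> ('l \<Rightarrow> complex) \<Rightarrow> 'l \<Rightarrow> complex" where
  "hlift_field X u a = hlift a (X (proj L a)) u"

lemma hlift_field_homogeneous: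
  assumes "vector_field A X" "smoothL u" "LB.homogeneous u"
  shows "LB.homogeneous (hlift_field X u)"
  unfolding LB.homogeneous_def hlift_field_def LB.proj_fscale
  using hlift_homogeneous[OF _ vector_fieldD(1)[OF assms(1)] assms(2,3)] by blast

text \<open>In a frame \<open>X\<close> is a combination of Hamiltonian vectors of the coordinates, with coefficients
  \<open>\<omega>(X, V\<^sub>i)\<close>, which reduces the lift to brackets with pulled back coordinates.\<close>

lemma hlift_field_smooth:
  assumes X: "vector_field A X" and u: "smoothL u"
  shows "smoothL (hlift_field X u)"
proof (rule smooth_fun_on_local[OF LB.charted_T _ LB.open_Nz])
  fix a assume a: "a \<in> LB.Nz"
  obtain n x V \<rho> W where fr: "coordinate_frame A (proj L a) n x V \<rho> W" using coordinate_frame_exists[OF LB.M] .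
  note Fr = coordinate_frameD[OF fr]
  let ?W = "proj L -` W \<inter> LB.Nz"
  have oW: "open ?W" using LB.open_vimage_proj[OF Fr(4)] LB.open_Nz by blast
  have "smooth_fun_on (total_atlas L) ?W (\<lambda>b. \<i> * (\<Sum>i<n. lift_real (\<lambda>q. \<omega> q (X q) (V i q)) b * bun.bracket (lift_real (x i)) u b))"
    by (intro smooth_fun_on_mult[OF LB.charted_T oW] smooth_fun_on_const[OF LB.charted_T oW] smooth_fun_on_sum[OF LB.charted_T oW]
        smooth_map_on_subset[OF lift_real_smooth[OF S.omega_smooth[OF X Fr(2)]]]
        smooth_map_on_subset[OF bun.bracket_smooth[OF lift_real_smooth[OF Fr(1)] u]]) auto
  then have "smooth_fun_on (total_atlas L) ?W (hlift_field X u)"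
  proof (rule smooth_fun_on_cong[OF LB.charted_T oW])
    fix b assume b: "b \<in> ?W"
    show "\<i> * (\<Sum>i<n. lift_real (\<lambda>q. \<omega> q (X q) (V i q)) b * bun.bracket (lift_real (x i)) u b) = hlift_field X u b"
      using S.omega_c_frame[OF fr _ bracket_with_ctangent[OF _ u, of b] vector_fieldD(1)[OF X]] b Fr(1)
      by (simp add: hlift_field_def hlift_def lift_def bracket_with_def)
  qed
  then show "\<exists>W. open W \<and> a \<in> W \<and> smooth_fun_on (total_atlas L) W (hlift_field X u)"
    using oW a Fr(5) by blast
qed

text \<open>The curvature of the lifts. It is tensorial, so that it has to be computed on Hamiltonian fields only.\<close>

definition curv :: "'l \<Rightarrow> ('l \<Rightarrow> complex) \<Rightarrow> 'm vfield \<Rightarrow> 'm vfield \<Rightarrow> complex" where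
  "curv a u X Y = hlift_field X (hlift_field Y u) a - hlift_field Y (hlift_field X u) a - hlift_field (lie_bracket X Y) u a"

context
  fixes a u
  assumes a: "a \<in> LB.Nz" and u: "smoothL u"
begin

text \<open>The two iterated lifts combine to \<open>- {{f \<circ> \<pi>, g \<circ> \<pi>}, u}\<close> by the Jacobi identity on the total space;
  the inner bracket is \<open>\<i> h \<circ> \<pi>\<close> with \<open>h = {f, g}\<close>, so that this is the lift of \<open>- X\<^sub>h = [X\<^sub>f, X\<^sub>g]\<close>.\<close>

lemma curv_ham:
  assumes f: "smooth_fun A f" and g: "smooth_fun A g"
  shows "curv a u (S.ham f) (S.ham g) = 0"
proof -
  let ?f = "lift_real f" and ?g = "lift_real g"
  have sf: "smoothL ?f" and sg: "smoothL ?g" by (rule lift_real_smooth[OF f], rule lift_real_smooth[OF g])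
  have two: "hlift_field (S.ham f) (hlift_field (S.ham g) u) a = - bun.bracket (lift_real f) (bun.bracket (lift_real g) u) a"
    if f: "smooth_fun A f" and g: "smooth_fun A g" for f g
  proof -
    note lf = lift_real_smooth[OF f] and lg = lift_real_smooth[OF g]
    have "hlift_field (S.ham f) (hlift_field (S.ham g) u) a = \<i> * bun.bracket (lift_real f) (hlift_field (S.ham g) u) a"
      unfolding hlift_field_def[of "S.ham f"] by (rule hlift_ham[OF a hlift_field_smooth[OF S.ham(1)[OF g] u] f])
    also have "bun.bracket (lift_real f) (hlift_field (S.ham g) u) a = bun.bracket (lift_real f) (\<lambda>b. \<i> * bun.bracket (lift_real g) u b) a"
      by (rule bun.bracket_cong[OF lf hlift_field_smooth[OF S.ham(1)[OF g] u] a]) (simp add: hlift_field_def hlift_ham[OF _ u g])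
    also have "\<dots> = \<i> * bun.bracket (lift_real f) (bun.bracket (lift_real g) u) a"
      by (rule bun.bracket_scale[OF lf bun.bracket_smooth[OF lg u] lf a])
    finally show ?thesis by simp
  qed
  let ?k = "\<lambda>q. S.ham g q f"
  have k: "smooth_fun A ?k" by (rule vector_fieldD(2)[OF S.ham(1)[OF g] f])
  have fg: "bun.bracket ?f ?g b = \<i> * lift_real ?k b" if "b \<in> LB.Nz" for b
    using bracket_lift[OF of_real_smooth[OF f] of_real_smooth[OF g] that] bracket_real[OF f g] by (simp add: lift_def)
  have "bun.bracket (bun.bracket ?f ?g) u a = - bun.bracket u (bun.bracket ?f ?g) a" by (rule bun.bracket_skew)
  also have "bun.bracket u (bun.bracket ?f ?g) a = bun.bracket u (\<lambda>b. \<i> * lift_real ?k b) a"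
    by (rule bun.bracket_cong[OF u bun.bracket_smooth[OF sf sg] a fg])
  also have "\<dots> = \<i> * bun.bracket u (lift_real ?k) a" by (rule bun.bracket_scale[OF u lift_real_smooth[OF k] u a])
  finally have J: "bun.bracket ?f (bun.bracket ?g u) a - bun.bracket ?g (bun.bracket ?f u) a = \<i> * bun.bracket (lift_real ?k) u a"
    using bun.bracket_jacobi[OF sf sg u a] bun.bracket_skew[of u "lift_real ?k" a] by simp
  have "hlift_field (lie_bracket (S.ham f) (S.ham g)) u a = - (\<i> * bun.bracket (lift_real ?k) u a)"
    unfolding hlift_field_def ham_lie_bracket[OF f g] hlift_times[OF a u vector_fieldD(1)[OF S.ham(1)[OF k]]] hlift_ham[OF a u k] by simp
  then show ?thesis by (simp add: curv_def two[OF f g] two[OF g f] J[symmetric])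
qed

lemma curv_skew:
  assumes X: "vector_field A X" and Y: "vector_field A Y"
  shows "curv a u X Y = - curv a u Y X"
proof -
  have "lie_bracket X Y (proj L a) = (\<lambda>f. - 1 * lie_bracket Y X (proj L a) f)"
    by (simp add: lie_bracket_def fun_eq_iff)
  then have "hlift_field (lie_bracket X Y) u a = - hlift_field (lie_bracket Y X) u a"
    unfolding hlift_field_def using hlift_times[OF a u vector_fieldD(1)[OF vector_field_lie_bracket[OF LB.M Y X]], of "-1"] by simp
  then show ?thesis by (simp add: curv_def)
qed

lemma curv_tensorial:
  assumes X: "vector_field A X" and X': "vector_field A X'" and Y: "vector_field A Y" and eq: "X (proj L a) = X' (proj L a)"
  shows "curv a u X Y = curv a u X' Y"
proof (rule tensorial[OF LB.M _ _ X X' eq])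
  let ?p = "proj L a"
  note YT = vector_fieldD(1)[OF Y]
  fix X assume X: "vector_field A X"
  note XT = vector_fieldD(1)[OF X]
  note sY = hlift_field_smooth[OF Y u]
  {
    fix Z assume Z: "vector_field A Z"
    note ZT = vector_fieldD(1)[OF Z]
    have "lie_bracket (X + Z) Y ?p f = (lie_bracket X Y ?p + lie_bracket Z Y ?p) f" for f
    proof (cases "smooth_fun A f")
      case True
      then show ?thesis
        using tangent_add[OF LB.M YT vector_fieldD(2)[OF X True] vector_fieldD(2)[OF Z True]] by (simp add: lie_bracket_def)
    next
      case False
      then show ?thesis
        by (simp add: lie_bracket_def tangent_nonsmooth[OF LB.M XT False] tangent_nonsmooth[OF LB.M YT False]
            tangent_nonsmooth[OF LB.M ZT False] tangent_const[OF LB.M XT] tangent_const[OF LB.M YT] tangent_const[OF LB.M ZT])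
    qed
    then have lb: "lie_bracket (X + Z) Y ?p = lie_bracket X Y ?p + lie_bracket Z Y ?p" by (rule ext)
    have 1: "hlift_field (X + Z) (hlift_field Y u) a = hlift_field X (hlift_field Y u) a + hlift_field Z (hlift_field Y u) a"
      by (simp add: hlift_field_def[of "_ + _"] hlift_field_def[of X "hlift_field Y u"] hlift_field_def[of Z "hlift_field Y u"] hlift_plus[OF a sY XT ZT])
    have "hlift a (Y ?p) (hlift_field (X + Z) u) = hlift a (Y ?p) (\<lambda>b. hlift_field X u b + hlift_field Z u b)"
      by (rule hlift_cong[OF a hlift_field_smooth[OF vector_field_plus[OF LB.M X Z] u]])
        (simp add: hlift_field_def hlift_plus[OF _ u XT ZT])
    then have 2: "hlift_field Y (hlift_field (X + Z) u) a = hlift_field Y (hlift_field X u) a + hlift_field Y (hlift_field Z u) a"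
      using hlift_add[OF a YT hlift_field_smooth[OF X u] hlift_field_smooth[OF Z u]] by (simp add: hlift_field_def[of Y])
    have 3: "hlift_field (lie_bracket (X + Z) Y) u a = hlift_field (lie_bracket X Y) u a + hlift_field (lie_bracket Z Y) u a"
      unfolding hlift_field_def lb
      by (rule hlift_plus[OF a u vector_fieldD(1)[OF vector_field_lie_bracket[OF LB.M X Y]] vector_fieldD(1)[OF vector_field_lie_bracket[OF LB.M Z Y]]])
    show "curv a u (X + Z) Y = curv a u X Y + curv a u Z Y" by (simp add: curv_def 1 2 3)
  }
  fix f :: "'m \<Rightarrow> real" assume f: "smooth_fun A f"
  let ?fX = "\<lambda>q \<phi>. f q * X q \<phi>"
  note fX = vector_field_scale[OF LB.M f X]
  have "lie_bracket ?fX Y ?p h = ((\<lambda>\<phi>. f ?p * lie_bracket X Y ?p \<phi>) + (\<lambda>\<phi>. - Y ?p f * X ?p \<phi>)) h" for h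
  proof (cases "smooth_fun A h")
    case True
    then show ?thesis
      using tangent_mult[OF LB.M YT f vector_fieldD(2)[OF X True]] by (simp add: lie_bracket_def algebra_simps)
  next
    case False
    then show ?thesis
      by (simp add: lie_bracket_def tangent_nonsmooth[OF LB.M XT False] tangent_nonsmooth[OF LB.M YT False]
          tangent_const[OF LB.M XT] tangent_const[OF LB.M YT])
  qed
  then have lb: "lie_bracket ?fX Y ?p = (\<lambda>\<phi>. f ?p * lie_bracket X Y ?p \<phi>) + (\<lambda>\<phi>. - Y ?p f * X ?p \<phi>)" by (rule ext)
  note BT = vector_fieldD(1)[OF vector_field_lie_bracket[OF LB.M X Y]]
  have 1: "hlift_field ?fX (hlift_field Y u) a = complex_of_real (f ?p) * hlift_field X (hlift_field Y u) a"
    by (simp only: hlift_field_def[of ?fX] hlift_field_def[of X "hlift_field Y u"] hlift_times[OF a sY XT])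
  have "hlift a (Y ?p) (hlift_field ?fX u) = hlift a (Y ?p) (\<lambda>b. lift_real f b * hlift_field X u b)"
    by (rule hlift_cong[OF a hlift_field_smooth[OF fX u]]) (simp only: hlift_field_def[of ?fX] hlift_field_def[of X] hlift_times[OF _ u XT] lift_def)
  also have "\<dots> = complex_of_real (Y ?p f) * hlift_field X u a + complex_of_real (f ?p) * hlift_field Y (hlift_field X u) a"
    using hlift_mult[OF a YT of_real_smooth[OF f] hlift_field_smooth[OF X u]] cderiv_of_real[OF LB.M YT, of _ f] by (simp add: hlift_field_def[of Y])
  finally have 2: "hlift_field Y (hlift_field ?fX u) a = complex_of_real (Y ?p f) * hlift_field X u a + complex_of_real (f ?p) * hlift_field Y (hlift_field X u) a"
    by (simp only: hlift_field_def[of Y])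
  have 3: "hlift_field (lie_bracket ?fX Y) u a = complex_of_real (f ?p) * hlift_field (lie_bracket X Y) u a - complex_of_real (Y ?p f) * hlift_field X u a"
    unfolding hlift_field_def lb hlift_plus[OF a u tangent_space_scale[OF BT] tangent_space_scale[OF XT]] hlift_times[OF a u BT] hlift_times[OF a u XT]
    by simp
  show "curv a u ?fX Y = complex_of_real (f ?p) * curv a u X Y" unfolding curv_def 1 2 3 by (simp add: algebra_simps)
qed

lemma curv_zero:
  assumes X: "vector_field A X" and Y: "vector_field A Y"
  shows "curv a u X Y = 0"
proof -
  obtain f where f: "smooth_fun A f" "S.ham f (proj L a) = X (proj L a)" using S.tangent_is_ham[OF vector_fieldD(1)[OF X]] .
  obtain g where g: "smooth_fun A g" "S.ham g (proj L a) = Y (proj L a)" using S.tangent_is_ham[OF vector_fieldD(1)[OF Y]] .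
  have "curv a u X Y = curv a u (S.ham f) Y" by (rule curv_tensorial[OF X S.ham(1)[OF f(1)] Y f(2)[symmetric]])
  also have "\<dots> = - curv a u Y (S.ham f)" by (rule curv_skew[OF S.ham(1)[OF f(1)] Y])
  also have "curv a u Y (S.ham f) = curv a u (S.ham g) (S.ham f)"
    by (rule curv_tensorial[OF Y S.ham(1)[OF g(1)] S.ham(1)[OF f(1)] g(2)[symmetric]])
  also have "\<dots> = 0" by (rule curv_ham[OF g(1) f(1)])
  finally show ?thesis by simp
qed

end

definition nabla :: "'m vfield \<Rightarrow> ('m \<Rightarrow> 'l) \<Rightarrow> 'm \<Rightarrow> 'l" where
  "nabla X s = LB.unhat (hlift_field X (LB.hat s))"

lemma nabla_section: "vector_field A X \<Longrightarrow> s \<in> sections A L \<Longrightarrow> nabla X s \<in> sections A L"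
  unfolding nabla_def
  by (intro LB.unhat_section hlift_field_homogeneous hlift_field_smooth LB.hat_smooth LB.hat_homogeneous)

lemma hat_nabla: "vector_field A X \<Longrightarrow> s \<in> sections A L \<Longrightarrow> a \<in> LB.Nz \<Longrightarrow> LB.hat (nabla X s) a = hlift_field X (LB.hat s) a"
  unfolding nabla_def
  by (intro LB.hat_unhat hlift_field_homogeneous LB.hat_smooth LB.hat_homogeneous)

lemma hat_fadd:
  assumes s: "s \<in> sections A L" and s': "s' \<in> sections A L" and a: "a \<in> LB.Nz"
  shows "LB.hat (\<lambda>q. fadd L (s q) (s' q)) a = LB.hat s a + LB.hat s' a"
proof -
  obtain U \<tau> m where t: "LB.trivialization U \<tau> m" "proj L a \<in> U" using LB.trivialization_exists .
  show ?thesis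
    using LB.hat_triv[OF t a LB.section_proj[OF s]] LB.hat_triv[OF t a LB.section_proj[OF s']]
      LB.hat_triv[OF t a LB.section_proj[OF LB.section_fadd[OF s s']]] t(2)
    by (simp add: LB.triv_add[OF t(1)] LB.section_proj[OF s] LB.section_proj[OF s'] add_divide_distrib)
qed

lemma hat_scale:
  assumes f: "smooth_fun A f" and s: "s \<in> sections A L" and a: "a \<in> LB.Nz"
  shows "LB.hat (\<lambda>q. fscale L (f q) (s q)) a = lift f a * LB.hat s a"
proof -
  obtain U \<tau> m where t: "LB.trivialization U \<tau> m" "proj L a \<in> U" using LB.trivialization_exists .
  show ?thesis
    using LB.hat_triv[OF t a LB.section_proj[OF s]]
      LB.hat_triv[OF t a LB.section_proj[OF LB.section_fscale[OF f s]]] t(2)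
    by (simp add: LB.triv_scale[OF t(1)] LB.section_proj[OF s] lift_def)
qed

lemma nabla_connection: "connection A L nabla"
  unfolding connection_def
proof (intro conjI allI impI)
  fix X Y :: "'m vfield" and s s' :: "'m \<Rightarrow> 'l" and p
  assume X: "vector_field A X" and s: "s \<in> sections A L"
  show "nabla X s \<in> sections A L" by (rule nabla_section[OF X s])
  let ?b = "LB.base_vector p"
  note b = LB.base_vector[of p]
  note hs = LB.hat_smooth[OF s]
  note XT = vector_fieldD(1)[OF X]
  {
    assume Y: "vector_field A Y"
    show "nabla (X + Y) s p = fadd L (nabla X s p) (nabla Y s p)"
      unfolding nabla_def LB.unhat_def hlift_field_def LB.fscale_add[symmetric]
      using hlift_plus[OF b(1) hs XT vector_fieldD(1)[OF Y]] by simp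
  }
  {
    assume s': "s' \<in> sections A L"
    have "hlift_field X (LB.hat (\<lambda>q. fadd L (s q) (s' q))) ?b = hlift ?b (X p) (\<lambda>b. LB.hat s b + LB.hat s' b)"
      unfolding hlift_field_def b(2)
      by (rule hlift_cong[OF b(1) LB.hat_smooth[OF LB.section_fadd[OF s s']]]) (rule hat_fadd[OF s s'])
    also have "\<dots> = hlift_field X (LB.hat s) ?b + hlift_field X (LB.hat s') ?b"
      unfolding hlift_field_def b(2) by (rule hlift_add[OF b(1) _ hs LB.hat_smooth[OF s']]) (simp add: XT b(2))
    finally show "nabla X (\<lambda>q. fadd L (s q) (s' q)) p = fadd L (nabla X s p) (nabla X s' p)"
      unfolding nabla_def LB.unhat_def LB.fscale_add[symmetric] by simp
  }
next
  fix f :: "'m \<Rightarrow> real" and X :: "'m vfield" and s p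
  assume f: "smooth_fun A f" and X: "vector_field A X" and s: "s \<in> sections A L"
  show "nabla (\<lambda>q \<phi>. f q * X q \<phi>) s p = fscale L (complex_of_real (f p)) (nabla X s p)"
    unfolding nabla_def LB.unhat_def hlift_field_def LB.fscale_fscale
    using hlift_times[OF LB.base_vector(1) LB.hat_smooth[OF s] vector_fieldD(1)[OF X]] by (simp add: LB.base_vector)
next
  fix f :: "'m \<Rightarrow> complex" and X :: "'m vfield" and s p
  assume f: "smooth_fun A f" and X: "vector_field A X" and s: "s \<in> sections A L"
  let ?b = "LB.base_vector p"
  note b = LB.base_vector[of p]
  have XT: "X p \<in> tangent_space A (proj L ?b)" using vector_fieldD(1)[OF X] b(2) by simp
  have "hlift_field X (LB.hat (\<lambda>q. fscale L (f q) (s q))) ?b = hlift ?b (X p) (\<lambda>b. lift f b * LB.hat s b)"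
    unfolding hlift_field_def b(2)
    by (rule hlift_cong[OF b(1) LB.hat_smooth[OF LB.section_fscale[OF f s]]]) (rule hat_scale[OF f s])
  also have "\<dots> = f p * hlift_field X (LB.hat s) ?b + cderiv (X p) f * LB.hat s ?b"
    using hlift_mult[OF b(1) XT f LB.hat_smooth[OF s]] by (simp add: hlift_field_def b(2))
  finally have "hlift_field X (LB.hat (\<lambda>q. fscale L (f q) (s q))) ?b = f p * hlift_field X (LB.hat s) ?b + cderiv (X p) f * LB.hat s ?b" .
  moreover have "fscale L (cderiv (X p) f) (s p) = fscale L (cderiv (X p) f * LB.hat s ?b) ?b"
    using LB.hat_fscale[OF s b(1)] b(2) LB.fscale_fscale[of "cderiv (X p) f" "LB.hat s ?b" ?b] by simp
  ultimately show "nabla X (\<lambda>q. fscale L (f q) (s q)) p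
      = fadd L (fscale L (f p) (nabla X s p)) (fscale L (cderiv (X p) f) (s p))"
    unfolding nabla_def LB.unhat_def LB.fscale_fscale by (simp add: LB.fscale_add)
qed

lemma nabla_flat: "is_curvature A L nabla 0"
  unfolding is_curvature_def
proof (intro conjI allI impI)
  show "two_form A (0 :: 'm form2)"
    by (simp add: two_form_def smooth_fun_on_const[OF LB.charted_A open_UNIV])
  fix X Y s p
  assume X: "vector_field A X" and Y: "vector_field A Y" and s: "s \<in> sections A L"
  let ?b = "LB.base_vector p"
  note b = LB.base_vector[of p]
  have two: "nabla X (nabla Y s) p = fscale L (hlift_field X (hlift_field Y (LB.hat s)) ?b) ?b"
    if X: "vector_field A X" and Y: "vector_field A Y" for X Y
  proof -
    have "hlift_field X (LB.hat (nabla Y s)) ?b = hlift_field X (hlift_field Y (LB.hat s)) ?b"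
      unfolding hlift_field_def[of X]
      by (rule hlift_cong[OF b(1) LB.hat_smooth[OF nabla_section[OF Y s]]]) (rule hat_nabla[OF Y s])
    then show ?thesis by (simp add: nabla_def[of X] LB.unhat_def)
  qed
  have "fadd L (fadd L (nabla X (nabla Y s) p) (fscale L (-1) (nabla Y (nabla X s) p)))
      (fscale L (-1) (nabla (lie_bracket X Y) s p)) = fscale L (curv ?b (LB.hat s) X Y) ?b"
    unfolding two[OF X Y] two[OF Y X] nabla_def[of "lie_bracket X Y"] LB.unhat_def LB.fscale_fscale LB.fscale_add[symmetric] curv_def
    by simp
  also have "\<dots> = fscale L 0 ?b" by (simp add: curv_zero[OF b(1) LB.hat_smooth[OF s] X Y])
  also have "\<dots> = fscale L 0 (s p)" by (rule LB.fscale_zero) (simp add: b LB.section_proj[OF s])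
  finally show "fscale L (0 p (X p) (Y p)) (s p) =
     fadd L (fadd L (nabla X (nabla Y s) p) (fscale L (-1) (nabla Y (nabla X s) p)))
      (fscale L (-1) (nabla (lie_bracket X Y) s p))" by simp
qed

lemma chern_class_zero: "chern_class A L = deRham_class A 0"
  by (rule LB.flat_connection_chern_class[OF nabla_connection nabla_flat])

end

theorem theorem11:
  fixes G :: "'g::{t2_space,second_countable_topology} monoid"
    and AG :: "('g, 'k::real_inner) atlas"
    and A :: "('m::{t2_space,second_countable_topology}, 'e::real_inner) atlas"
    and act :: "'g \<Rightarrow> 'm \<Rightarrow> 'm"
    and \<omega> :: "'m \<Rightarrow> 'm tvec \<Rightarrow> 'm tvec \<Rightarrow> real"
  assumes "lie_group AG G"
    and "homogeneous_space AG G A act"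
    and "symplectic_form A \<omega>"
  shows "\<not> ((\<exists>(L :: ('l::{t2_space,second_countable_topology}, 'm, 'e) line_bundle) actL.
               equivariant_line_bundle AG G A act L actL \<and>
               chern_class A L \<noteq> deRham_class A 0) \<and>
            (\<exists>star F. star_product A \<omega> star \<and> twist (lie_algebra AG G) F \<and>
               induced_by_twist AG G A act star F))"
proof
  assume "(\<exists>(L :: ('l, 'm, 'e) line_bundle) actL.
               equivariant_line_bundle AG G A act L actL \<and>
               chern_class A L \<noteq> deRham_class A 0) \<and>
            (\<exists>star F. star_product A \<omega> star \<and> twist (lie_algebra AG G) F \<and>
               induced_by_twist AG G A act star F)"
  then obtain L :: "('l, 'm, 'e) line_bundle" and actL star F H where
    eq: "equivariant_line_bundle AG G A act L actL" and nontrivial: "chern_class A L \<noteq> deRham_class A 0"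
    and star: "star_product A \<omega> star" and F: "twist (lie_algebra AG G) F"
    and H: "inverse_series2 (lie_algebra AG G) F H"
    and ind: "\<And>f g. f \<in> smooth_series A \<Longrightarrow> g \<in> smooth_series A \<Longrightarrow> star f g = mult_action_series G act H f g"
    unfolding induced_by_twist_def by blast
  have M: "smooth_manifold A" and act: "smooth_action AG G A act"
    using assms(2) by (simp_all add: homogeneous_space_def)
  have L: "complex_line_bundle A L" and actL: "smooth_action AG G (total_atlas L) actL"
    and proj_actL: "\<And>g a. proj L (actL g a) = act g (proj L a)"
    and actL_fscale: "\<And>g c a. actL g (fscale L c a) = fscale L c (actL g a)"
    using eq by (simp_all add: equivariant_line_bundle_def)
  interpret LB: line_bundle_over A L by unfold_locales (rule M L)+
  interpret base: twisted_action AG G A act UNIV F H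
    by unfold_locales (use assms(1) M act F H in \<open>auto simp: lie_group_def lie_algebra_def\<close>)
  \<comment> \<open>the action commutes with the scalar 0 and is injective, so it preserves the non-zero vectors\<close>
  have Nz_inv: "actL g a \<in> LB.Nz" if "a \<in> LB.Nz" for g a
  proof -
    have ga: "group_action G UNIV actL" using actL by (simp add: smooth_action_def)
    have "inj (actL g)" using group_action.inj_prop[OF ga, of g] assms(1) by (simp add: lie_group_def)
    then show ?thesis using that by (simp add: LB.Nz_def actL_fscale[symmetric] inj_eq)
  qed
  interpret bun: twisted_action AG G "total_atlas L" actL LB.Nz F H
    by unfold_locales (use assms(1) LB.manifold_T actL F H LB.open_Nz Nz_inv in auto)
  have poisson: "base.bracket f h p = \<i> * poisson_bracket A \<omega> f h p" if f: "smooth_fun A f" and h: "smooth_fun A h" for f h p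
  proof -
    have ss: "fps_const f \<in> smooth_series A" if "smooth_fun A f" for f :: "'m \<Rightarrow> complex"
      using that smooth_fun_on_const[OF LB.charted_A open_UNIV, of "0::complex"] by (simp add: smooth_series_def zero_fun_def)
    obtain B where B: "\<And>f g. smooth_fun A f \<Longrightarrow> smooth_fun A g \<Longrightarrow> star (fps_const f) (fps_const g) = Abs_fps (\<lambda>k. B k f g)"
      "\<And>f g. smooth_fun A f \<Longrightarrow> smooth_fun A g \<Longrightarrow> B 1 f g - B 1 g f = (\<lambda>p. \<i> * poisson_bracket A \<omega> f g p)"
      using star unfolding star_product_def by blast
    \<comment> \<open>constant series have no first-order part, so that only \<open>H\<^sub>1\<close> contributes at first order\<close>
    have first: "B 1 f g = mult_action G act (fps_nth H 1) f g" if f: "smooth_fun A f" and g: "smooth_fun A g" for f g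
    proof -
      have "B 1 f g = fps_nth (mult_action_series G act H (fps_const f) (fps_const g)) 1"
        using B(1)[OF f g] ind[OF ss[OF f] ss[OF g]] by (metis fps_nth_Abs_fps)
      also have "\<dots> = mult_action G act (fps_nth H 1) f g"
        by (simp add: mult_action_series_def fun_eq_iff base.mult_action_zero)
      finally show ?thesis .
    qed
    have "base.bracket f h p = (B 1 f h - B 1 h f) p"
      unfolding base.bracket_def first[OF f h] first[OF h f] by (simp only: minus_apply)
    also have "\<dots> = \<i> * poisson_bracket A \<omega> f h p" by (rule fun_cong[OF B(2)[OF f h]])
    finally show ?thesis .
  qed
  interpret twisted_line_bundle A \<omega> L AG G act actL F H
    by unfold_locales (use M assms(3) proj_actL actL_fscale poisson in auto)
  show False using chern_class_zero nontrivial by simp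
qed

end
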